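(* Let $M$ be a closed connected smooth Riemannian manifold and let $H=H(x,p,u):T^*M\times\mathbb{R}\to\mathbb{R}$ be continuous, convex in $p$, superlinear in $p$ ($H(x,p,u)/\|p\|_x\to+\infty$ as $\|p\|_x\to+\infty$), strictly increasing in $u$, and such that $\frac{\partial H}{\partial u}(x,p,0)$ exists and is $>0$ for every $(x,p)\in T^*M$ and, for every compact $S\subset T^*M$, there is a modulus of continuity $\eta_S$ with $\left|H(x,p,u)-H(x,p,0)-u\frac{\partial H}{\partial u}(x,p,0)\right|\le |u|\,\eta_S(|u|)$ for all $(x,p,u)\in S\times\mathbb{R}$. For each $\lambda>0$ let $V(\cdot,\lambda):M\to\mathbb{R}$ be continuous, and suppose $V(\cdot,\lambda)$ converges uniformly to $V(\cdot,0)$ as $\lambda\to0$. Let $u_0:M\to\mathbb{R}$ be the uniform limit, as $\lambda\to0^+$, of the unique continuous viscosity solutions $u_\lambda$ of $H(x,d_xu_\lambda,\lambda u_\lambda(x))+\lambda V(x,\lambda)=c(H^0)$ in $M$. Then for every $x\in M$, $$u_0(x)=\inf_{\tilde\mu\in\widetilde{\mathfrak M}(L^0)}\frac{\int_{TM}h(y,x)\frac{\partial L}{\partial u}(y,v,0)\,d\tilde\mu(y,v)+\int_M V(y,0)\,d\mu(y)}{\int_{TM}\frac{\partial L}{\partial u}(y,v,0)\,d\tilde\mu(y,v)},$$ where $h$ is the Peierls barrier of $L^0$, $\widetilde{\mathfrak M}(L^0)$ is the set of all Mather measures of $L^0$, and $\mu=\pi_\#\tilde\mu$.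
   Context: A modulus of continuity is a non-decreasing function $\eta:[0,+\infty)\to[0,+\infty)$ with $\lim_{r\to0}\eta(r)=0$. $H^0(x,p):=H(x,p,0)$. Its critical value is $c(H^0)=\inf_{f\in C^1(M)}\max_{x\in M}H^0(x,d_xf)$; it is the only constant $c$ for which $H^0(x,d_xu)=c$ admits viscosity solutions on $M$. Under the stated hypotheses, there is $\lambda_0>0$ such that $u_\lambda$ exists and is unique for $\lambda\in(0,\lambda_0]$, and $u_\lambda$ converges uniformly as $\lambda\to0^+$ to a function $u_0$, which is the largest viscosity subsolution $w$ of $H(x,d_xu,0)=c(H^0)$ satisfying $\int_{TM}w\,\frac{\partial L}{\partial u}(x,v,0)\,d\tilde\mu\ge\int_MV(x,0)\,d\mu$ for all Mather measures $\tilde\mu$ of $L^0$. The Lagrangian is $L(x,v,u)=\sup_{p\in T_x^*M}\big(\langle p,v\rangle_x-H(x,p,u)\big)$ for $(x,v,u)\in TM\times\mathbb{R}$, and $L^0(x,v):=L(x,v,0)$. Standing properties of $L$ in this setting: $L$ is continuous, convex and superlinear in $v$, strictly decreasing in $u$; $\frac{\partial L}{\partial u}(x,v,0)$ exists and is $<0$ for every $(x,v)\in TM$; and for every compact $S\subset TM$ there is a modulus of continuity $\eta_S$ with $\left|L(x,v,u)-L(x,v,0)-u\frac{\partial L}{\partial u}(x,v,0)\right|\le|u|\,\eta_S(|u|)$ for all $(x,v,u)\in S\times\mathbb{R}$. A Borel probability measure $\tilde\mu$ on $TM$ is closed if $\int_{TM}\|v\|_x\,d\tilde\mu<\infty$ and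 $\int_{TM}d_x\varphi(v)\,d\tilde\mu(x,v)=0$ for all $\varphi\in C^1(M)$. A Mather measure of $L^0$ is a closed probability measure $\tilde\mu$ with $\int_{TM}L^0\,d\tilde\mu=-c(H^0)$. $\pi:TM\to M$ is the canonical projection. The Peierls barrier of $L^0$ is $h(x,y)=\liminf_{t\to+\infty}[h_t(x,y)+c(H^0)t]$, where $h_t(x,y)=\inf\int_0^tL^0(\gamma(s),\dot\gamma(s))\,ds$ over absolutely continuous $\gamma:[0,t]\to M$ with $\gamma(0)=x$, $\gamma(t)=y$. *)

theory Defs
  imports "HOL-Probability.Probability"
begin

section \<open>Smooth manifolds\<close>

text \<open>The manifold is a whole type \<open>'m\<close>, modelled on \<open>'e\<close>. A chart is a pair (domain, coordinate map).\<close>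

type_synonym ('m, 'e) chart = "'m set \<times> ('m \<Rightarrow> 'e)"

text \<open>Differentiability of class \<open>C\<^sup>k\<close>; only meaningful on open sets.\<close>

primrec Ck_on :: "nat \<Rightarrow> 'a set \<Rightarrow> ('a::euclidean_space \<Rightarrow> 'b::real_normed_vector) \<Rightarrow> bool" where
  "Ck_on 0 S f \<longleftrightarrow> continuous_on S f"
| "Ck_on (Suc k) S f \<longleftrightarrow>
     (\<forall>x\<in>S. f differentiable (at x)) \<and> (\<forall>v. Ck_on k S (\<lambda>x. frechet_derivative f (at x) v))"

definition smooth_on :: "'a set \<Rightarrow> ('a::euclidean_space \<Rightarrow> 'b::real_normed_vector) \<Rightarrow> bool" where
  "smooth_on S f \<longleftrightarrow> (\<forall>k. Ck_on k S f)"

definition chart_inv :: "('m, 'e) chart \<Rightarrow> 'e \<Rightarrow> 'm" where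
  "chart_inv c = inv_into (fst c) (snd c)"

definition is_chart :: "('m::t2_space, 'e::euclidean_space) chart \<Rightarrow> bool" where
  "is_chart c \<longleftrightarrow> open (fst c) \<and> open (snd c ` fst c) \<and>
     homeomorphism (fst c) (snd c ` fst c) (snd c) (chart_inv c)"

definition smooth_atlas :: "('m::t2_space, 'e::euclidean_space) chart set \<Rightarrow> bool" where
  "smooth_atlas A \<longleftrightarrow> (\<forall>c\<in>A. is_chart c) \<and> (\<Union>c\<in>A. fst c) = UNIV \<and>
     (\<forall>c\<in>A. \<forall>d\<in>A. smooth_on (snd c ` (fst c \<inter> fst d)) (snd d \<circ> chart_inv c))"


section \<open>Tangent and cotangent bundle\<close>

text \<open>
  Every point \<open>x\<close> gets one chart of the atlas around it, and \<open>T\<^sub>xM\<close> is the model space \<open>'e\<close>, a vector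
  being represented by its coordinates in that chart; accordingly \<open>T\<^sub>x\<^sup>*M\<close> is the dual space
  \<open>'e \<Rightarrow>\<^sub>L real\<close>. So \<open>'m \<times> 'e\<close> and \<open>'m \<times> ('e \<Rightarrow>\<^sub>L real)\<close> are the bundles \<open>TM\<close> and \<open>T\<^sup>*M\<close> as sets, but
  their topologies are not the product topologies, since the chosen chart may jump with \<open>x\<close>.
\<close>

definition chart_at :: "('m, 'e) chart set \<Rightarrow> 'm \<Rightarrow> ('m, 'e) chart" where
  "chart_at A x = (SOME c. c \<in> A \<and> x \<in> fst c)"

lemma chart_at:
  assumes "smooth_atlas A"
  shows "chart_at A x \<in> A" "x \<in> fst (chart_at A x)"
proof -
  have "\<exists>c. c \<in> A \<and> x \<in> fst c"
    using assms unfolding smooth_atlas_def by blast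
  then have "chart_at A x \<in> A \<and> x \<in> fst (chart_at A x)"
    unfolding chart_at_def by (rule someI_ex)
  then show "chart_at A x \<in> A" "x \<in> fst (chart_at A x)" by auto
qed

definition transition_deriv ::
  "('m, 'e::euclidean_space) chart \<Rightarrow> ('m, 'e) chart \<Rightarrow> 'm \<Rightarrow> 'e \<Rightarrow> 'e" where
  "transition_deriv c d x = frechet_derivative (snd d \<circ> chart_inv c) (at (snd c x))"

text \<open>The element of \<open>T\<^sub>xM\<close>, resp. \<open>T\<^sub>x\<^sup>*M\<close>, with given coordinates in the chart \<open>c\<close>.\<close>

definition tangent_of ::
  "('m, 'e::euclidean_space) chart set \<Rightarrow> ('m, 'e) chart \<Rightarrow> 'm \<Rightarrow> 'e \<Rightarrow> 'e" where
  "tangent_of A c x = transition_deriv c (chart_at A x) x"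

definition cotangent_of ::
  "('m, 'e::euclidean_space) chart set \<Rightarrow> ('m, 'e) chart \<Rightarrow> 'm \<Rightarrow> ('e \<Rightarrow>\<^sub>L real) \<Rightarrow> ('e \<Rightarrow>\<^sub>L real)" where
  "cotangent_of A c x q = q o\<^sub>L Blinfun (transition_deriv (chart_at A x) c x)"

text \<open>
  A set in the total space is open iff it is open in all bundle charts
  \<open>(y, w) \<mapsto> (chart_inv c y, F c (chart_inv c y) w)\<close>.
\<close>

definition bundle_topology ::
  "('m, 'e::euclidean_space) chart set \<Rightarrow> (('m, 'e) chart \<Rightarrow> 'm \<Rightarrow> 'f::real_normed_vector \<Rightarrow> 'f) \<Rightarrow>
   ('m \<times> 'f) topology" where
  "bundle_topology A F = topology (\<lambda>W. \<forall>c\<in>A.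
     open {(y, w). y \<in> snd c ` fst c \<and> (chart_inv c y, F c (chart_inv c y) w) \<in> W})"

lemma openin_bundle_topology:
  "openin (bundle_topology A F) W \<longleftrightarrow> (\<forall>c\<in>A.
     open {(y, w). y \<in> snd c ` fst c \<and> (chart_inv c y, F c (chart_inv c y) w) \<in> W})"
proof -
  let ?P = "\<lambda>c W. {(y, w). y \<in> snd c ` fst c \<and> (chart_inv c y, F c (chart_inv c y) w) \<in> W}"
  have "istopology (\<lambda>W. \<forall>c\<in>A. open (?P c W))"
    unfolding istopology_def
  proof (intro conjI allI impI ballI)
    fix S T c assume "\<forall>c\<in>A. open (?P c S)" "\<forall>c\<in>A. open (?P c T)" "c \<in> A"
    then have "open (?P c S \<inter> ?P c T)" by blast
    moreover have "?P c S \<inter> ?P c T = ?P c (S \<inter> T)" by blast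
    ultimately show "open (?P c (S \<inter> T))" by simp
  next
    fix K c assume "\<forall>S\<in>K. \<forall>c\<in>A. open (?P c S)" "c \<in> A"
    then have "open (\<Union>S\<in>K. ?P c S)" by blast
    moreover have "(\<Union>S\<in>K. ?P c S) = ?P c (\<Union>K)" by blast
    ultimately show "open (?P c (\<Union>K))" by simp
  qed
  then show ?thesis
    unfolding bundle_topology_def by simp
qed

definition tangent_topology ::
  "('m, 'e::euclidean_space) chart set \<Rightarrow> ('m \<times> 'e) topology" where
  "tangent_topology A = bundle_topology A (tangent_of A)"

definition cotangent_topology ::
  "('m, 'e::euclidean_space) chart set \<Rightarrow> ('m \<times> ('e \<Rightarrow>\<^sub>L real)) topology" where
  "cotangent_topology A = bundle_topology A (cotangent_of A)"

definition riemannian_metric ::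
  "('m, 'e::euclidean_space) chart set \<Rightarrow> ('m \<Rightarrow> 'e \<Rightarrow> 'e \<Rightarrow> real) \<Rightarrow> bool" where
  "riemannian_metric A g \<longleftrightarrow>
     (\<forall>x. bilinear (g x) \<and> (\<forall>v w. g x v w = g x w v) \<and> (\<forall>v. v \<noteq> 0 \<longrightarrow> g x v v > 0)) \<and>
     (\<forall>c\<in>A. \<forall>v w. smooth_on (snd c ` fst c)
        (\<lambda>y. g (chart_inv c y) (tangent_of A c (chart_inv c y) v) (tangent_of A c (chart_inv c y) w)))"

definition closed_connected_riemannian_manifold ::
  "('m::t2_space, 'e::euclidean_space) chart set \<Rightarrow> ('m \<Rightarrow> 'e \<Rightarrow> 'e \<Rightarrow> real) \<Rightarrow> bool" where
  "closed_connected_riemannian_manifold A g \<longleftrightarrow>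
     compact (UNIV :: 'm set) \<and> connected (UNIV :: 'm set) \<and> smooth_atlas A \<and> riemannian_metric A g"

definition tangent_norm :: "('m \<Rightarrow> 'e \<Rightarrow> 'e \<Rightarrow> real) \<Rightarrow> 'm \<Rightarrow> 'e::euclidean_space \<Rightarrow> real" where
  "tangent_norm g x v = sqrt (g x v v)"

definition cotangent_norm ::
  "('m \<Rightarrow> 'e \<Rightarrow> 'e \<Rightarrow> real) \<Rightarrow> 'm \<Rightarrow> ('e::euclidean_space \<Rightarrow>\<^sub>L real) \<Rightarrow> real" where
  "cotangent_norm g x p = (SUP v\<in>{v. tangent_norm g x v \<le> 1}. blinfun_apply p v)"

definition C1_fun :: "('m, 'e::euclidean_space) chart set \<Rightarrow> ('m \<Rightarrow> real) \<Rightarrow> bool" where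
  "C1_fun A f \<longleftrightarrow> (\<forall>c\<in>A. Ck_on 1 (snd c ` fst c) (f \<circ> chart_inv c))"

definition differential ::
  "('m, 'e::euclidean_space) chart set \<Rightarrow> ('m \<Rightarrow> real) \<Rightarrow> 'm \<Rightarrow> ('e \<Rightarrow>\<^sub>L real)" where
  "differential A f x =
     Blinfun (frechet_derivative (f \<circ> chart_inv (chart_at A x)) (at (snd (chart_at A x) x)))"


section \<open>Hamiltonians and viscosity solutions\<close>

definition modulus_of_continuity :: "(real \<Rightarrow> real) \<Rightarrow> bool" where
  "modulus_of_continuity \<eta> \<longleftrightarrow>
     mono_on {0..} \<eta> \<and> (\<forall>r\<ge>0. \<eta> r \<ge> 0) \<and> (\<eta> \<longlongrightarrow> 0) (at_right 0)"

definition critical_value ::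
  "('m, 'e::euclidean_space) chart set \<Rightarrow> ('m \<Rightarrow> ('e \<Rightarrow>\<^sub>L real) \<Rightarrow> real) \<Rightarrow> real" where
  "critical_value A H0 = (INF f\<in>{f. C1_fun A f}. SUP x. H0 x (differential A f x))"

text \<open>Continuous viscosity (sub-, super-) solutions of \<open>F(x, d\<^sub>xu, u(x)) = c\<close>.\<close>

definition viscosity_subsolution ::
  "('m::t2_space, 'e::euclidean_space) chart set \<Rightarrow> ('m \<Rightarrow> ('e \<Rightarrow>\<^sub>L real) \<Rightarrow> real \<Rightarrow> real) \<Rightarrow> real \<Rightarrow>
   ('m \<Rightarrow> real) \<Rightarrow> bool" where
  "viscosity_subsolution A F c u \<longleftrightarrow> continuous_on UNIV u \<and>
     (\<forall>\<phi> x. C1_fun A \<phi> \<longrightarrow> (\<forall>\<^sub>F y in nhds x. u y - \<phi> y \<le> u x - \<phi> x) \<longrightarrow>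
        F x (differential A \<phi> x) (u x) \<le> c)"

definition viscosity_supersolution ::
  "('m::t2_space, 'e::euclidean_space) chart set \<Rightarrow> ('m \<Rightarrow> ('e \<Rightarrow>\<^sub>L real) \<Rightarrow> real \<Rightarrow> real) \<Rightarrow> real \<Rightarrow>
   ('m \<Rightarrow> real) \<Rightarrow> bool" where
  "viscosity_supersolution A F c u \<longleftrightarrow> continuous_on UNIV u \<and>
     (\<forall>\<phi> x. C1_fun A \<phi> \<longrightarrow> (\<forall>\<^sub>F y in nhds x. u y - \<phi> y \<ge> u x - \<phi> x) \<longrightarrow>
        F x (differential A \<phi> x) (u x) \<ge> c)"

definition viscosity_solution ::
  "('m::t2_space, 'e::euclidean_space) chart set \<Rightarrow> ('m \<Rightarrow> ('e \<Rightarrow>\<^sub>L real) \<Rightarrow> real \<Rightarrow> real) \<Rightarrow> real \<Rightarrow>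
   ('m \<Rightarrow> real) \<Rightarrow> bool" where
  "viscosity_solution A F c u \<longleftrightarrow> viscosity_subsolution A F c u \<and> viscosity_supersolution A F c u"

definition lagrangian ::
  "('m \<Rightarrow> ('e \<Rightarrow>\<^sub>L real) \<Rightarrow> real \<Rightarrow> real) \<Rightarrow> 'm \<Rightarrow> 'e::euclidean_space \<Rightarrow> real \<Rightarrow> real" where
  "lagrangian H x v u = (SUP p. blinfun_apply p v - H x p u)"


section \<open>Mather measures\<close>

definition closed_measure ::
  "('m, 'e::euclidean_space) chart set \<Rightarrow> ('m \<Rightarrow> 'e \<Rightarrow> 'e \<Rightarrow> real) \<Rightarrow> ('m \<times> 'e) measure \<Rightarrow> bool" where
  "closed_measure A g m \<longleftrightarrow>
     prob_space m \<and> sets m = sets (sigma UNIV {W. openin (tangent_topology A) W}) \<and>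
     integrable m (\<lambda>(x, v). tangent_norm g x v) \<and>
     (\<forall>\<phi>. C1_fun A \<phi> \<longrightarrow> (\<integral>(x, v). blinfun_apply (differential A \<phi> x) v \<partial>m) = 0)"

text \<open>
  The Bochner integral of a non-integrable function is \<open>0\<close>, hence \<open>has_bochner_integral\<close>, which
  includes integrability.
\<close>

definition mather_measures ::
  "('m, 'e::euclidean_space) chart set \<Rightarrow> ('m \<Rightarrow> 'e \<Rightarrow> 'e \<Rightarrow> real) \<Rightarrow>
   ('m \<Rightarrow> ('e \<Rightarrow>\<^sub>L real) \<Rightarrow> real \<Rightarrow> real) \<Rightarrow> ('m \<times> 'e) measure set" where
  "mather_measures A g H = {m. closed_measure A g m \<and>
     has_bochner_integral m (\<lambda>(x, v). lagrangian H x v 0) (- critical_value A (\<lambda>x p. H x p 0))}"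


section \<open>Peierls barrier\<close>

definition abs_cont_on :: "real \<Rightarrow> real \<Rightarrow> (real \<Rightarrow> 'b::metric_space) \<Rightarrow> bool" where
  "abs_cont_on a b f \<longleftrightarrow> (\<forall>\<epsilon>>0. \<exists>\<delta>>0. \<forall>D. D division_of \<Union>D \<longrightarrow> \<Union>D \<subseteq> {a..b} \<longrightarrow>
     (\<Sum>K\<in>D. Sup K - Inf K) < \<delta> \<longrightarrow> (\<Sum>K\<in>D. dist (f (Inf K)) (f (Sup K))) < \<epsilon>)"

definition abs_cont_curve ::
  "('m::t2_space, 'e::euclidean_space) chart set \<Rightarrow> real \<Rightarrow> (real \<Rightarrow> 'm) \<Rightarrow> bool" where
  "abs_cont_curve A t \<gamma> \<longleftrightarrow> continuous_on {0..t} \<gamma> \<and>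
     (\<forall>c\<in>A. \<forall>a b. 0 \<le> a \<longrightarrow> a \<le> b \<longrightarrow> b \<le> t \<longrightarrow> \<gamma> ` {a..b} \<subseteq> fst c \<longrightarrow> abs_cont_on a b (snd c \<circ> \<gamma>))"

definition velocity ::
  "('m, 'e::euclidean_space) chart set \<Rightarrow> (real \<Rightarrow> 'm) \<Rightarrow> real \<Rightarrow> 'e" where
  "velocity A \<gamma> s = vector_derivative (snd (chart_at A (\<gamma> s)) \<circ> \<gamma>) (at s)"

text \<open>
  A superlinear continuous Lagrangian is bounded below on the tangent bundle of a compact manifold,
  so the action of an absolutely continuous curve is \<open>\<infinity>\<close> whenever the integrand is not integrable.
\<close>

definition action ::
  "('m, 'e::euclidean_space) chart set \<Rightarrow> ('m \<Rightarrow> 'e \<Rightarrow> real) \<Rightarrow> real \<Rightarrow> (real \<Rightarrow> 'm) \<Rightarrow> ereal" where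
  "action A L0 t \<gamma> =
     (if integrable (lebesgue_on {0..t}) (\<lambda>s. L0 (\<gamma> s) (velocity A \<gamma> s))
      then ereal (\<integral>s. L0 (\<gamma> s) (velocity A \<gamma> s) \<partial>lebesgue_on {0..t}) else \<infinity>)"

definition minimal_action ::
  "('m::t2_space, 'e::euclidean_space) chart set \<Rightarrow> ('m \<Rightarrow> 'e \<Rightarrow> real) \<Rightarrow> real \<Rightarrow> 'm \<Rightarrow> 'm \<Rightarrow> ereal" where
  "minimal_action A L0 t x y =
     (INF \<gamma>\<in>{\<gamma>. abs_cont_curve A t \<gamma> \<and> \<gamma> 0 = x \<and> \<gamma> t = y}. action A L0 t \<gamma>)"

definition peierls_barrier ::
  "('m::t2_space, 'e::euclidean_space) chart set \<Rightarrow> ('m \<Rightarrow> ('e \<Rightarrow>\<^sub>L real) \<Rightarrow> real \<Rightarrow> real) \<Rightarrow>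
   'm \<Rightarrow> 'm \<Rightarrow> real" where
  "peierls_barrier A H x y = real_of_ereal (Liminf at_top (\<lambda>t::real.
     minimal_action A (\<lambda>x v. lagrangian H x v 0) t x y +
     ereal (critical_value A (\<lambda>x p. H x p 0) * t)))"

end

theory Submission
  imports Defs "HOL-Probability.Probability"
begin

text \<open>
  Upper bound. Mollifying \<open>u\<^sub>\<lambda>\<close> in charts and gluing yields \<open>C\<^sup>1\<close> functions whose differential is dominated by
  \<open>L(\<cdot>, \<lambda>u\<^sub>\<lambda>) - \<lambda>V + c + \<epsilon>\<close>. Integrated along curves this gives \<open>u\<^sub>0(x) - u\<^sub>0(y) \<le> h(y, x)\<close>; integrated against a
  Mather measure, which necessarily lives on a set where \<open>L\<^sup>0\<close> is bounded, it gives
  \<open>\<integral> u\<^sub>0 \<partial>L/\<partial>u \<ge> \<integral> V(\<cdot>, 0)\<close> as \<open>\<lambda> \<rightarrow> 0\<close>. Together they bound \<open>u\<^sub>0(x)\<close> by every quotient.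

  Attainment. The supersolution property provides a Hopf-Lax step: from every point a short backward segment along
  which \<open>u\<^sub>\<lambda>\<close> decreases by the discounted action up to \<open>\<epsilon>\<close>. Iterating from \<open>x\<close>, a discrete integrating factor
  turns the chain into weights; summation by parts bounds \<open>u\<^sub>\<lambda>(x)\<close> from below by the weighted sum of
  \<open>action \<times> (-\<partial>L/\<partial>u) - V\<close>, where the action is at least \<open>h - \<epsilon>\<close> for long times. The weighted point masses have a
  weak limit as \<open>\<lambda> \<rightarrow> 0\<close>, which is a Mather measure realising equality.
\<close>

text \<open>\<open>H\<close> is merely continuous, so minimising or calibrated curves would require
  lower semicontinuity of the action and regularity of minimisers. Finite chains of straight chart
  segments, minimising up to \<open>eps\<close>, take their place. Their velocities obey one bound
  \<open>R\<close>, independent of the discount: it keeps the weighted point masses in a compact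
  part of the tangent bundle and makes the expansion of \<open>L x v s\<close> to first order in
  \<open>s\<close> uniform. With \<open>a = - dL > 0\<close>, this expansion turns a step of length
  \<open>tau\<close> into an inequality in which \<open>u\<close> is multiplied by
  \<open>1 + tau * l * a\<close>; that factor is the origin of the weights. Curves in the Peierls
  barrier, by contrast, are only absolutely continuous, so comparing a \<open>C\<^sup>1\<close>
  function with the action along them needs differentiability almost everywhere, obtained here from
  Vitali coverings. Since the chart trivialising the bundles may jump from point to point, every
  uniform estimate is made on a finite family of chart balls and never on the total space.
  Differentiability of \<open>L\<close> in its last argument becomes uniform through an envelope
  argument: all maximising momenta share the same derivative of \<open>H\<close>.\<close>

abbreviation (input) LIMSEQ_ascii (infixr "---->" 60) where "X ----> a == X \<longlonglongrightarrow> a"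

lemma compact_boundE:
 fixes f :: "'a::topological_space => 'b::real_normed_vector"
 assumes "continuous_on S f" "compact S"
 obtains B where "!!x. x : S ==> norm (f x) <= B"
 using compact_imp_bounded[OF compact_continuous_image[OF assms]] unfolding bounded_iff by auto

section \<open>Absolutely continuous functions on an interval\<close>

lemma real_division_interval:
 fixes S :: "real set"
 assumes "D division_of S" "K : D"
 obtains u v where "u <= v" "K = {u..v}" "{u..v} <= S"
proof -
 obtain u v where "K = cbox u v" "K ~= {}" "K <= S" using assms division_ofD by metis
 hence "u <= v" "K = {u..v}" "{u..v} <= S" unfolding box_real by(metis atLeastatMost_empty_iff2, metis, metis)
 thus ?thesis by(rule that)
qed

lemma real_division_Inf_Sup:
 fixes S :: "real set"
 assumes D: "D division_of S" "S <= {a..b}" and K: "K : D"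
 shows "K = {Inf K..Sup K}" "Inf K <= Sup K" "a <= Inf K" "Sup K <= b"
proof -
 obtain u v where uv: "u <= v" "K = {u..v}" "{u..v} <= S" by(rule real_division_interval[OF D(1) K])
 have "{u..v} <= {a..b}" using uv(3) D(2) by(rule order_trans)
 thus "K = {Inf K..Sup K}" "Inf K <= Sup K" "a <= Inf K" "Sup K <= b" using uv(1,2) by simp_all
qed

definition ac_modulus :: "real => real => (real => 'a::metric_space) => real => real => bool" where
 "ac_modulus a b f e d \<longleftrightarrow> (ALL D. D division_of \<Union>D --> \<Union>D <= {a..b} --> (SUM K:D. Sup K - Inf K) < d
  --> (SUM K:D. dist (f (Inf K)) (f (Sup K))) < e)"

lemma abs_cont_on_modulus: "abs_cont_on a b f \<longleftrightarrow> (ALL e>0. EX d>0. ac_modulus a b f e d)"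
 unfolding abs_cont_on_def ac_modulus_def ..

lemma abs_cont_onE:
 assumes "abs_cont_on a b f" "e > 0"
 obtains d where "d > 0" "ac_modulus a b f e d"
 using assms unfolding abs_cont_on_modulus by blast

lemmas ac_modulusD = ac_modulus_def[THEN iffD1, rule_format]

text \<open>A division is a set of intervals, whereas a family may repeat or collapse them.
  Collapsed intervals contribute 0 and are dropped; on the rest the passage to sets is injective,
  because equal intervals with nonempty interior would overlap.\<close>

lemma ac_modulus_family:
 assumes ac: "ac_modulus a b f e d" and I: "finite I" "!!i. i : I ==> a <= p i & p i <= q i & q i <= b"
  "!!i j. i : I ==> j : I ==> i ~= j ==> {p i<..<q i} Int {p j<..<q j} = {}" "(SUM i:I. q i - p i) < d"
 shows "(SUM i:I. dist (f (p i)) (f (q i))) < e"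
proof -
 define J where "J = {i : I. p i < q i}"
 have JI: "J <= I" "finite J" using I(1) by(auto simp: J_def)
 define k where "k i = {p i..q i}" for i
 have inj: "inj_on k J"
 proof (rule inj_onI)
  fix i j assume ij: "i : J" "j : J" "k i = k j"
  hence "p i = p j" "q i = q j" "{p i<..<q i} ~= {}" by(auto simp: J_def k_def Icc_eq_Icc)
  thus "i = j" using I(3)[of i j] ij JI(1) by auto
 qed
 have SI: "Sup (k i) = q i" "Inf (k i) = p i" if "i : J" for i using that by(auto simp: k_def J_def)
 have "k ` J division_of \<Union>(k ` J)"
 proof (rule division_ofI)
  show "finite (k ` J)" using JI by simp
  fix K assume "K : k ` J"
  then obtain i where i: "i : J" "K = k i" by blast
  show "K <= \<Union>(k ` J)" using i by blast
  show "K ~= {}" using i by(auto simp: k_def J_def)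
  show "EX a b. K = cbox a b" using i(2) unfolding k_def by(metis box_real(2))
 next
  fix K1 K2 assume "K1 : k ` J" "K2 : k ` J" "K1 ~= K2"
  then obtain i j where ij: "i : J" "j : J" "K1 = k i" "K2 = k j" "i ~= j" by blast
  thus "interior K1 Int interior K2 = {}" using I(3)[of i j] JI(1) unfolding k_def by(simp add: subset_iff)
 qed simp
 moreover have "\<Union>(k ` J) <= {a..b}" using I(2) JI(1) by(fastforce simp: k_def)
 moreover have "(SUM K:k ` J. Sup K - Inf K) < d"
 proof -
  have "(SUM K:k ` J. Sup K - Inf K) = (SUM i:J. q i - p i)" by(simp add: sum.reindex[OF inj] SI)
  also have "... <= (SUM i:I. q i - p i)" using I(2) by(intro sum_mono2 I(1) JI(1)) auto
  finally show ?thesis using I(4) by simp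
 qed
 ultimately have "(SUM K:k ` J. dist (f (Inf K)) (f (Sup K))) < e" by(rule ac_modulusD[OF ac])
 hence "(SUM i:J. dist (f (p i)) (f (q i))) < e" by(simp add: sum.reindex[OF inj] SI)
 moreover have "(SUM i:J. dist (f (p i)) (f (q i))) = (SUM i:I. dist (f (p i)) (f (q i)))"
  using I(2) by(intro sum.mono_neutral_left I(1) JI(1)) (force simp: J_def)
 ultimately show ?thesis by simp
qed

lemma abs_cont_on_imp_continuous_on:
 assumes "abs_cont_on a b f"
 shows "continuous_on {a..b} f"
 unfolding continuous_on_iff
proof (intro ballI allI impI)
 fix x e :: real assume x: "x : {a..b}" and e: "e > 0"
 obtain d where d: "d > 0" "ac_modulus a b f e d" by(rule abs_cont_onE[OF assms e])
 have *: "dist (f u) (f v) < e" if "a <= u" "u <= v" "v <= b" "v - u < d" for u v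
  using ac_modulus_family[OF d(2), of "{()}" "%_. u" "%_. v"] that by simp
 show "EX d>0. ALL x':{a..b}. dist x' x < d --> dist (f x') (f x) < e"
 proof (intro exI[of _ d] conjI ballI impI d(1))
  fix y assume "y : {a..b}" "dist y x < d"
  thus "dist (f y) (f x) < e"
  using *[of x y] *[of y x] x by(cases "x <= y") (auto simp: dist_real_def dist_commute)
 qed
qed

text \<open>The common source of the closure properties used below: Lipschitz images, differences
  and concatenations.\<close>

lemma abs_cont_on_dominated:
 assumes "abs_cont_on a b f" "abs_cont_on a b g" and le: "!!x y. a <= x ==> x <= y ==> y <= b ==>
  dist (h x) (h y) <= C * (dist (f x) (f y) + dist (g x) (g y))"
 shows "abs_cont_on a b h"
 unfolding abs_cont_on_modulus
proof (intro allI impI)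
 fix e :: real assume "e > 0"
 \<comment> \<open>\<open>abs C + 1\<close> replaces \<open>C\<close>, which may be zero or
   negative.\<close>
 hence e: "e / (2 * (abs C + 1)) > 0" by simp
 obtain d1 where d1: "d1 > 0" "ac_modulus a b f (e / (2 * (abs C + 1))) d1" by(rule abs_cont_onE[OF assms(1) e])
 obtain d2 where d2: "d2 > 0" "ac_modulus a b g (e / (2 * (abs C + 1))) d2" by(rule abs_cont_onE[OF assms(2) e])
 have "ac_modulus a b h e (min d1 d2)" unfolding ac_modulus_def
 proof (intro allI impI)
  fix D assume D: "D division_of \<Union> D" "\<Union> D <= {a..b}" "(SUM K:D. Sup K - Inf K) < min d1 d2"
  let ?S = "%f. SUM K:D. dist (f (Inf K)) (f (Sup K))"
  have "?S h <= (SUM K:D. (abs C + 1) * (dist (f (Inf K)) (f (Sup K)) + dist (g (Inf K)) (g (Sup K))))"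
  proof (rule sum_mono)
  fix K assume K: "K : D"
  show "dist (h (Inf K)) (h (Sup K)) <= (abs C + 1) * (dist (f (Inf K)) (f (Sup K)) + dist (g (Inf K)) (g (Sup K)))"
  by(rule order_trans[OF le mult_right_mono]) (use real_division_Inf_Sup[OF D(1,2) K] in auto)
  qed
  also have "... = (abs C + 1) * (?S f + ?S g)" by(simp only: sum_distrib_left[symmetric] sum.distrib)
  also have "... < (abs C + 1) * (e / (2 * (abs C + 1)) + e / (2 * (abs C + 1)))"
  using ac_modulusD[OF d1(2) D(1,2)] ac_modulusD[OF d2(2) D(1,2)] D(3) by(intro mult_strict_left_mono add_strict_mono) auto
  also have "... = e"
  proof -
  have "c * (e / (2 * c) + e / (2 * c)) = e" if "c > 0" for c :: real using that by(simp add: field_simps)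
  thus ?thesis by(simp only: abs_add_one_gt_zero add.commute[of _ 1])
  qed
  finally show "?S h < e" .
 qed
 thus "EX d>0. ac_modulus a b h e d" using d1(1) d2(1) by(intro exI[of _ "min d1 d2"]) auto
qed

lemma abs_cont_on_Lipschitz:
 assumes "abs_cont_on a b f" "!!x y. x : {a..b} ==> y : {a..b} ==> dist (g x) (g y) <= C * dist (f x) (f y)"
 shows "abs_cont_on a b g"
 by(rule abs_cont_on_dominated[OF assms(1,1), of _ "C/2"]) (use assms(2) in simp)

lemma abs_cont_on_id: "abs_cont_on a b (%x. x)"
 unfolding abs_cont_on_modulus
proof (intro allI impI)
 fix e :: real assume "e > 0"
 have "ac_modulus a b (%x. x) e e" unfolding ac_modulus_def
 proof (intro allI impI)
  fix D assume D: "D division_of \<Union> D" "\<Union> D <= {a..b}" "(SUM K:D. Sup K - Inf K) < e"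
  thus "(SUM K:D. dist (Inf K) (Sup K)) < e" using real_division_Inf_Sup(2)[OF D(1,2)] by(simp add: dist_real_def)
 qed
 thus "EX d>0. ac_modulus a b (%x. x) e d" using \<open>e > 0\<close> by blast
qed

text \<open>A nondecreasing 1-Lipschitz change of variable does not increase lengths and keeps
  intervals nonoverlapping, but may collapse some to points; hence the estimate for families. It
  serves for the clippings \<open>min x s\<close> and \<open>max x s\<close> and for
  translations.\<close>

lemma abs_cont_on_mono_compose:
 assumes ac: "abs_cont_on a' b' f" and ab: "!!x. a <= x ==> x <= b ==> a' <= phi x & phi x <= b'"
  and mono: "!!x y. x <= y ==> phi x <= phi y & phi y - phi x <= y - x"
 shows "abs_cont_on a b (%x. f (phi x))"
 unfolding abs_cont_on_modulus
proof (intro allI impI)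
 fix e :: real assume "e > 0"
 then obtain d where d: "d > 0" "ac_modulus a' b' f e d" by(rule abs_cont_onE[OF ac])
 have "ac_modulus a b (%x. f (phi x)) e d" unfolding ac_modulus_def
 proof (intro allI impI)
  fix D assume D: "D division_of \<Union> D" "\<Union> D <= {a..b}" "(SUM K:D. Sup K - Inf K) < d"
  note K = real_division_Inf_Sup[OF D(1,2)]
  show "(SUM K:D. dist (f (phi (Inf K))) (f (phi (Sup K)))) < e"
  proof (rule ac_modulus_family[OF d(2)])
  show "finite D" using D(1) by auto
  show "a' <= phi (Inf K) & phi (Inf K) <= phi (Sup K) & phi (Sup K) <= b'" if "K : D" for K
  using K(2-4)[OF that] ab[of "Inf K"] ab[of "Sup K"] mono[of "Inf K" "Sup K"] by auto
  show "{phi (Inf K)<..<phi (Sup K)} Int {phi (Inf K')<..<phi (Sup K')} = {}" if "K : D" "K' : D" "K ~= K'" for K K'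
  proof (rule ccontr)
  have less: "x < y" if "phi x < phi y" for x y using that mono[of y x] by linarith
  assume "{phi (Inf K)<..<phi (Sup K)} Int {phi (Inf K')<..<phi (Sup K')} ~= {}"
  hence "max (phi (Inf K)) (phi (Inf K')) < min (phi (Sup K)) (phi (Sup K'))" by(simp add: not_le)
  hence "max (Inf K) (Inf K') < min (Sup K) (Sup K')"
  using less[of "Inf K" "Sup K"] less[of "Inf K" "Sup K'"] less[of "Inf K'" "Sup K"] less[of "Inf K'" "Sup K'"] by simp
  from dense[OF this] obtain z where "max (Inf K) (Inf K') < z" "z < min (Sup K) (Sup K')" by(elim exE conjE)
  hence "z : {Inf K<..<Sup K} Int {Inf K'<..<Sup K'}" by simp
  moreover have "interior {Inf K..Sup K} Int interior {Inf K'..Sup K'} = {}"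
  using division_ofD(5)[OF D(1) that] K(1)[OF that(1)] K(1)[OF that(2)] by simp
  ultimately show False by auto
  qed
  have "(SUM K:D. phi (Sup K) - phi (Inf K)) <= (SUM K:D. Sup K - Inf K)" by(rule sum_mono) (use K(2) mono in auto)
  thus "(SUM K:D. phi (Sup K) - phi (Inf K)) < d" using D(3) by linarith
  qed
 qed
 thus "EX d>0. ac_modulus a b (%x. f (phi x)) e d" using d(1) by blast
qed

text \<open>On either side of \<open>s\<close> one of the two clipped functions carries the whole
  increment; across \<open>s\<close> the triangle inequality through \<open>f s\<close>
  applies.\<close>

lemma abs_cont_on_join:
 assumes "abs_cont_on a s f" "abs_cont_on s b f" and s: "a <= s" "s <= b"
 shows "abs_cont_on a b f"
proof (rule abs_cont_on_dominated[where C = 1])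
 show "abs_cont_on a b (%x. f (min x s))" "abs_cont_on a b (%x. f (max x s))"
  by(rule abs_cont_on_mono_compose[OF assms(1)] abs_cont_on_mono_compose[OF assms(2)]; use s in auto)+
 fix x y :: real assume "x <= y"
 then consider "y <= s" | "s <= x" | "x < s" "s < y" by linarith
 thus "dist (f x) (f y) <= 1 * (dist (f (min x s)) (f (min y s)) + dist (f (max x s)) (f (max y s)))"
  using \<open>x <= y\<close> dist_triangle[of "f x" "f y" "f s"] by cases (auto simp: min_def max_def)
qed

lemma abs_cont_on_diff:
 fixes f g :: "real => 'a::real_normed_vector"
 assumes "abs_cont_on a b f" "abs_cont_on a b g"
 shows "abs_cont_on a b (%x. f x - g x)"
proof (rule abs_cont_on_dominated[OF assms, where C = 1])
 show "dist (f x - g x) (f y - g y) <= 1 * (dist (f x) (f y) + dist (g x) (g y))" for x y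
  using norm_triangle_ineq4[of "f x - f y" "g x - g y"] by(simp add: dist_norm algebra_simps)
qed

section \<open>Differentiability almost everywhere of absolutely continuous functions\<close>

text \<open>Intervals are balls of the line, so Vitali's theorem gives a countable disjoint family
  covering almost all of \<open>E\<close>. As \<open>E\<close> has finite measure, continuity from
  above lets finitely many of them leave less than \<open>e\<close> uncovered.\<close>

lemma Vitali_finite_intervals:
 fixes E :: "real set" and W :: "(real \<times> real) set"
 assumes E: "E : lmeasurable" and e: "e > 0"
  and W: "!!u v. (u, v) : W ==> u < v"
  and cov: "!!x d. x : E ==> d > 0 ==> EX (u, v):W. x : {u..v} & v - u < d"
 obtains C where "finite C" "C <= W" "pairwise (%p q. disjnt {fst p..snd p} {fst q..snd q}) C"
  "measure lebesgue (E - (UN p:C. {fst p..snd p})) < e"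
proof -
 have cb: "cball ((fst p + snd p) / 2) ((snd p - fst p) / 2) = {fst p..snd p}" for p :: "real \<times> real"
  by(auto simp: cball_eq_atLeastAtMost field_simps)
 have 1: "(0::real) < (snd p - fst p) / 2" if "p : W" for p using W[of "fst p" "snd p"] that by auto
 have 2: "EX p. p : W & x : cball ((fst p + snd p) / 2) ((snd p - fst p) / 2) & (snd p - fst p) / 2 < d"
  if xd: "x : E" "0 < d" for x d
 proof -
  obtain p where p: "p : W" "x : {fst p..snd p}" "snd p - fst p < d" using cov[OF xd] by auto
  hence "(snd p - fst p) / 2 < d" using xd(2) by auto
  thus ?thesis unfolding cb using p by blast
 qed
 obtain C where C: "countable C" "C <= W" "pairwise (%p q. disjnt {fst p..snd p} {fst q..snd q}) C"
  "negligible (E - (UN p:C. {fst p..snd p}))"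
  using Vitali_covering_theorem_cballs[of W "%p. (snd p - fst p) / 2" E "%p. (fst p + snd p) / 2", OF 1 2]
  unfolding cb by blast
 show ?thesis
 proof (cases "C = {}")
  case True
  hence "measure lebesgue E = 0" using C(4) by(simp add: negligible_imp_measure0)
  thus ?thesis using that[of "{}"] e by auto
 next
  case False
  define cn where "cn = from_nat_into C"
  have cn: "range cn = C" unfolding cn_def using False C(1) by(rule range_from_nat_into)
  let ?A = "%n. E - (UN p:cn ` {..<n}. {fst p..snd p})"
  have mA: "?A n : lmeasurable" for n
  using E by(intro fmeasurable_Diff) (auto intro!: sets.finite_UN)
  have "(%n. measure lebesgue (?A n)) ----> measure lebesgue (\<Inter>n. ?A n)"
  proof (rule Lim_measure_decseq)
  show "range ?A <= sets lebesgue" using mA by(auto simp: fmeasurable_def)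
  show "decseq ?A" by(auto simp: decseq_def)
  show "emeasure lebesgue (?A i) ~= \<infinity>" for i using mA[of i] by(auto simp: fmeasurable_def)
  qed
  moreover have "(\<Inter>n. ?A n) = E - (UN p:C. {fst p..snd p})" unfolding cn[symmetric] by blast
  ultimately have "(%n. measure lebesgue (?A n)) ----> 0"
  using C(4) by(simp add: negligible_imp_measure0)
  then obtain n where "measure lebesgue (?A n) < e"
  using eventually_happens'[OF sequentially_bot order_tendstoD(2)[OF _ e]] by blast
  moreover have sub: "cn ` {..<n} <= C" using cn by blast
  ultimately show ?thesis
  by(intro that[of "cn ` {..<n}"] pairwise_mono[OF C(3)] order_trans[OF sub C(2)]) auto
 qed
qed

lemma real_division_telescope:
 fixes f :: "real => real"
 assumes D: "D division_of {u..v}" and uv: "u <= v"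
 shows "(SUM K:D. f (Sup K) - f (Inf K)) = f v - f u"
proof -
 have mem: "Sup K : K" if K: "K : D" for K
 proof -
  obtain s t where "s <= t" "K = {s..t}" "{s..t} <= {u..v}" by(rule real_division_interval[OF D K])
  thus ?thesis by auto
 qed
 have "(%K. (Sup K, K)) ` D tagged_division_of {u..v}"
 proof (rule tagged_division_ofI)
  show "finite ((%K. (Sup K, K)) ` D)" using D by auto
  show "!!x K. (x, K) : (%K. (Sup K, K)) ` D ==> x : K" using mem by auto
  show "!!x K. (x, K) : (%K. (Sup K, K)) ` D ==> K <= {u..v}" using division_ofD(2)[OF D] by auto
  show "!!x K. (x, K) : (%K. (Sup K, K)) ` D ==> EX a b. K = cbox a b" using division_ofD(4)[OF D] by auto
  show "!!x1 k1 x2 k2. (x1, k1) : (%K. (Sup K, K)) ` D ==> (x2, k2) : (%K. (Sup K, K)) ` D ==>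
  (x1, k1) ~= (x2, k2) ==> interior k1 Int interior k2 = {}" using division_ofD(5)[OF D] by auto
  have "{K. EX x. (x, K) : (%K. (Sup K, K)) ` D} = D" by auto
  thus "\<Union>{K. EX x. (x, K) : (%K. (Sup K, K)) ` D} = {u..v}" using division_ofD(6)[OF D] by auto
 qed
 from additive_tagged_division_1[OF uv this, of f] show ?thesis
  by(subst (asm) sum.reindex) (auto simp: inj_on_def o_def)
qed

text \<open>If \<open>E\<close> had positive measure, disjoint intervals \<open>C1\<close> of slope
  at most \<open>- r\<close> would nearly cover it without covering much more, and disjoint
  intervals \<open>C2\<close> of slope at least \<open>r\<close>, inside those of \<open>C1\<close>,
  would nearly cover it again. What remains of \<open>C1\<close> after removing \<open>C2\<close>
  has tiny length, yet \<open>f\<close> must fall on it by at least \<open>r\<close> times the total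
  length of both families.\<close>

lemma abs_cont_two_slopes_negligible:
 fixes f :: "real => real"
 assumes ac: "abs_cont_on a b f" and r: "r > 0" and E: "E : lmeasurable" "E <= {a<..<b}"
  and lo: "!!x d. x : E ==> d > 0 ==> EX u v. u < x & x < v & v - u < d & f v - f u <= - r * (v - u)"
  and hi: "!!x d. x : E ==> d > 0 ==> EX u v. u < x & x < v & v - u < d & r * (v - u) <= f v - f u"
 shows "negligible E"
proof (rule ccontr)
 assume nE: "~ negligible E"
 let ?m = "measure lebesgue"
 define J where "J p = {fst p..snd p}" for p :: "real \<times> real"
 define e where "e = ?m E"
 have e: "e > 0"
  using nE E by(simp add: e_def negligible_iff_measure less_le)
 obtain dlt where d: "dlt > 0" "ac_modulus a b f (r * e / 4) dlt"
  by(rule abs_cont_onE[OF ac, of "r * e / 4"]) (use r e in auto)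
 \<comment> \<open>The cap by \<open>e\<close> guarantees that \<open>C1\<close> still has total
   length at least \<open>3 * e / 4\<close>.\<close>
 define dlt' where "dlt' = min dlt e"
 have d': "dlt' > 0" "dlt' <= dlt" "dlt' <= e" using d(1) e by(auto simp: dlt'_def)
 have "E : sets lebesgue" using E by auto
 then obtain U0 where U0: "open U0" "E <= U0" "U0 - E : lmeasurable" "emeasure lebesgue (U0 - E) < ennreal (dlt'/4)"
  by(rule sets_lebesgue_outer_open[of _ "dlt'/4"]) (use d' in auto)
 define U where "U = U0 Int {a<..<b}"
 have U: "open U" "E <= U" "U - E : lmeasurable" "?m (U - E) < dlt'/4" "U <= {a<..<b}" "U : lmeasurable"
 proof -
  show "open U" unfolding U_def by(intro open_Int U0(1) open_greaterThanLessThan)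
  show "E <= U" unfolding U_def using U0(2) E(2) by blast
  show "U <= {a<..<b}" unfolding U_def by(rule Int_lower2)
  show Ul: "U : lmeasurable" unfolding U_def
  by(intro lmeasurable_open open_Int U0(1) open_greaterThanLessThan bounded_subset[OF _ Int_lower2]) (rule bounded_Ioo)
  show UE: "U - E : lmeasurable" by(rule fmeasurable.Diff[OF Ul E(1)])
  have "?m (U - E) <= ?m (U0 - E)" by(rule measure_mono_fmeasurable) (use UE U0 in "auto simp: U_def")
  also have "... < dlt'/4" using U0(3,4) d' by(simp add: emeasure_eq_measure2 ennreal_less_iff)
  finally show "?m (U - E) < dlt'/4" .
 qed
 define W1 where "W1 = {(u, v). u < v & {u..v} <= U & f v - f u <= - r * (v - u)}"
 have cov1: "EX (u, v):W1. x : {u..v} & v - u < dd" if x: "x : E" and dd: "dd > 0" for x dd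
 proof -
  obtain d1 where d1: "d1 > 0" "ball x d1 <= U" using U(1,2) x by(meson open_contains_ball subsetD)
  obtain u v where uv: "u < x" "x < v" "v - u < min dd d1" "f v - f u <= - r * (v - u)"
  using lo[OF x, of "min dd d1"] dd d1 by auto
  have "{u..v} <= ball x d1" using uv by(auto simp: dist_real_def)
  hence "(u, v) : W1" using uv d1 by(auto simp: W1_def)
  thus ?thesis by(rule rev_bexI) (use uv in auto)
 qed
 obtain C1 where C1: "finite C1" "C1 <= W1" "pairwise (%p q. disjnt {fst p..snd p} {fst q..snd q}) C1"
  "?m (E - (UN p:C1. {fst p..snd p})) < dlt'/4"
  by(rule Vitali_finite_intervals[OF E(1) _ _ cov1, of "dlt'/4"]) (use d' in "auto simp: W1_def")
 define E2 where "E2 = E Int (UN p:C1. {fst p<..<snd p})"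
 have E2: "E2 : lmeasurable" unfolding E2_def using E(1)
  by(intro fmeasurable_Int_fmeasurable) (auto intro!: sets.finite_UN C1)
 define W2 where "W2 = {(u, v). u < v & (EX p:C1. {u..v} <= {fst p<..<snd p}) & r * (v - u) <= f v - f u}"
 have cov2: "EX (u, v):W2. x : {u..v} & v - u < dd" if x: "x : E2" and dd: "dd > 0" for x dd
 proof -
  obtain p where p: "p : C1" "x : {fst p<..<snd p}" using x by(auto simp: E2_def)
  obtain d1 where d1: "d1 > 0" "ball x d1 <= {fst p<..<snd p}" using p(2)
  by(meson open_contains_ball open_greaterThanLessThan)
  obtain u v where uv: "u < x" "x < v" "v - u < min dd d1" "r * (v - u) <= f v - f u"
  using hi[of x "min dd d1"] dd d1 x by(auto simp: E2_def)
  have "{u..v} <= ball x d1" using uv by(auto simp: dist_real_def)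
  hence "{u..v} <= {fst p<..<snd p}" using d1(2) by(rule order_trans)
  hence "(u, v) : W2" using uv p by(auto simp: W2_def)
  thus ?thesis by(rule rev_bexI) (use uv in auto)
 qed
 obtain C2 where C2: "finite C2" "C2 <= W2" "pairwise (%p q. disjnt {fst p..snd p} {fst q..snd q}) C2"
  "?m (E2 - (UN p:C2. {fst p..snd p})) < dlt'/4"
  by(rule Vitali_finite_intervals[OF E2 _ _ cov2, of "dlt'/4"]) (use d' in "auto simp: W2_def")
 have lt1: "fst p < snd p" "J p <= U" "f (snd p) - f (fst p) <= - r * (snd p - fst p)" if "p : C1" for p
  using subsetD[OF C1(2) that] by(auto simp: W1_def J_def split_beta)
 have lt2: "fst p < snd p" "r * (snd p - fst p) <= f (snd p) - f (fst p)" if "p : C2" for p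
  using C2(2) that by(auto simp: W2_def)
 have "ALL q:C2. EX p. p : C1 & J q <= J p"
 proof
  fix q assume "q : C2"
  then obtain p where "p : C1" "{fst q..snd q} <= {fst p<..<snd p}" using C2(2) by(fastforce simp: W2_def)
  thus "EX p. p : C1 & J q <= J p" unfolding J_def by(meson greaterThanLessThan_subseteq_atLeastAtMost_iff order_refl order_trans)
 qed
 then obtain pw where pi: "!!q. q : C2 ==> pw q : C1" "!!q. q : C2 ==> J q <= J (pw q)" by metis
 define P where "P p = J ` {q : C2. pw q = p}" for p
 have disj1: "J p Int J q = {}" if "p : C1" "q : C1" "p ~= q" for p q
  using C1(3) that by(auto simp: pairwise_def disjnt_def J_def)
 have disj2: "J p Int J q = {}" if "p : C2" "q : C2" "p ~= q" for p q
  using C2(3) that by(auto simp: pairwise_def disjnt_def J_def)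
 \<comment> \<open>The intervals of \<open>C2\<close> inside \<open>p\<close> are completed to a
   division of \<open>p\<close>. The added pieces, over all \<open>p\<close>, form \<open>R\<close>
   below, of total length \<open>T1 - T2 < dlt\<close>.\<close>
 have ex: "ALL p:C1. EX D. P p <= D & D division_of J p"
 proof
  fix p assume p: "p : C1"
  have "P p division_of \<Union>(P p)"
  proof (rule division_ofI)
  show "finite (P p)" using C2(1) by(auto simp: P_def)
  fix K assume "K : P p"
  then obtain q where q: "q : C2" "K = J q" by(auto simp: P_def)
  show "K <= \<Union>(P p)" using \<open>K : P p\<close> by auto
  show "K ~= {}" using q lt2(1)[of q] by(auto simp: J_def)
  show "EX a b. K = cbox a b" using q(2) unfolding J_def by(metis box_real(2))
  next
  fix K1 K2 assume "K1 : P p" "K2 : P p" "K1 ~= K2"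
  then obtain q1 q2 where "q1 : C2" "q2 : C2" "K1 = J q1" "K2 = J q2" unfolding P_def by blast
  hence "K1 Int K2 = {}" using disj2[of q1 q2] \<open>K1 ~= K2\<close> by fast
  thus "interior K1 Int interior K2 = {}" by(metis interior_Int interior_empty)
  qed simp
  moreover have "\<Union>(P p) <= cbox (fst p) (snd p)"
  unfolding P_def using pi(2) unfolding J_def box_real by blast
  ultimately obtain q where "P p <= q" "q division_of cbox (fst p) (snd p)"
  by(rule partial_division_extend_interval)
  thus "EX D. P p <= D & D division_of J p" unfolding J_def box_real by blast
 qed
 then obtain D where D: "!!p. p : C1 ==> P p <= D p" "!!p. p : C1 ==> D p division_of J p" by metis
 have finD: "finite (D p)" if "p : C1" for p using D(2)[OF that] by auto
 have injJ: "inj_on J {q : C2. pw q = p}" for p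
  using disj2 lt2(1) by(fastforce simp: inj_on_def J_def)
 have SI: "Sup (J p) = snd p" "Inf (J p) = fst p" if "fst p < snd p" for p using that by(auto simp: J_def)
 have sumP: "(SUM K:P p. g (Sup K) - g (Inf K)) = (SUM q:{q : C2. pw q = p}. g (snd q) - g (fst q))"
  for p and g :: "real => real"
  unfolding P_def by(subst sum.reindex[OF injJ]) (auto intro!: sum.cong simp: SI lt2)
 have sumD: "(SUM K:D p - P p. g (Sup K) - g (Inf K))
  = g (snd p) - g (fst p) - (SUM q:{q : C2. pw q = p}. g (snd q) - g (fst q))"
  if p: "p : C1" for p and g :: "real => real"
 proof -
  have "(SUM K:D p. g (Sup K) - g (Inf K)) = g (snd p) - g (fst p)"
  using real_division_telescope[of "D p" "fst p" "snd p" g] D(2)[OF p] lt1(1)[OF p] by(auto simp: J_def)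
  thus ?thesis using sum.subset_diff[OF D(1)[OF p] finD[OF p], of "%K. g (Sup K) - g (Inf K)"] sumP[of g p] by linarith
 qed
 have grp: "(SUM p:C1. SUM q:{q : C2. pw q = p}. g q) = (SUM q:C2. g q)" for g :: "_ => real"
  by(rule sum.group) (use C1 C2 pi in auto)
 define R where "R = (UN p:C1. D p - P p)"
 have DJ: "K <= J p" "K ~= {}" if "p : C1" "K : D p" for p K
  by(rule division_ofD(2)[OF D(2)[OF that(1)] that(2)], rule division_ofD(3)[OF D(2)[OF that(1)] that(2)])
 have sumR: "(SUM K:R. g K) = (SUM p:C1. SUM K:D p - P p. g K)" for g :: "_ => real"
  unfolding R_def
 proof (rule sum.UNION_disjoint)
  show "ALL i:C1. ALL j:C1. i ~= j --> (D i - P i) Int (D j - P j) = {}"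
  proof (intro ballI impI)
  fix i j assume ij: "i : C1" "j : C1" "i ~= j"
  show "(D i - P i) Int (D j - P j) = {}"
  proof (rule equals0I)
  fix K assume "K : (D i - P i) Int (D j - P j)"
  hence K: "K : D i" "K : D j" by simp_all
  show False using DJ(1)[OF ij(1) K(1)] DJ(1)[OF ij(2) K(2)] DJ(2)[OF ij(1) K(1)] disj1[OF ij] by blast
  qed
  qed
 qed (use C1 finD in auto)
 have Jab: "J p <= {a..b}" if "p : C1" for p
 proof -
  have "{a<..<b} <= {a..b}" by auto
  thus ?thesis using lt1(2)[OF that] U(5) by blast
 qed
 define T1 where "T1 = (SUM p:C1. snd p - fst p)"
 define T2 where "T2 = (SUM p:C2. snd p - fst p)"
 have mJ: "?m (J p) = snd p - fst p" if "fst p < snd p" for p using that by(simp add: J_def)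
 have mJ': "J p : lmeasurable" for p by(simp add: J_def)
 have T1: "T1 = ?m (UN p:C1. J p)"
  unfolding T1_def
 proof (subst measure_finite_Union)
  show "(SUM p:C1. snd p - fst p) = (SUM p:C1. ?m (J p))" using mJ[OF lt1(1)] by(intro sum.cong) auto
  show "emeasure lebesgue (J i) ~= \<infinity>" for i using fmeasurableD2[OF mJ', of i] by simp
 qed (use C1(1) disj1 mJ' in "auto simp: disjoint_family_on_def")
 have T2: "T2 = ?m (UN p:C2. J p)"
  unfolding T2_def
 proof (subst measure_finite_Union)
  show "(SUM p:C2. snd p - fst p) = (SUM p:C2. ?m (J p))" using mJ[OF lt2(1)] by(intro sum.cong) auto
  show "emeasure lebesgue (J i) ~= \<infinity>" for i using fmeasurableD2[OF mJ', of i] by simp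
 qed (use C2(1) disj2 mJ' in "auto simp: disjoint_family_on_def")
 have m1: "(UN p:C1. J p) : lmeasurable" "(UN p:C2. J p) : lmeasurable"
  using C1(1) C2(1) mJ' by(auto intro!: fmeasurable.finite_UN)
 have fin: "finite (fst ` C1 Un snd ` C1)" using C1(1) by auto
 have neg: "(fst ` C1 Un snd ` C1) : lmeasurable" "?m (fst ` C1 Un snd ` C1) = 0"
  using fin by(auto simp: negligible_finite negligible_imp_measure0 negligible_imp_measurable)
 have "?m (UN p:C1. J p) - ?m (UN p:C2. J p) <= ?m ((UN p:C1. J p) - (UN p:C2. J p))"
  using measure_Un_le[of "(UN p:C1. J p) - (UN p:C2. J p)" lebesgue "UN p:C2. J p"] m1
  measure_mono_fmeasurable[of "UN p:C1. J p" "((UN p:C1. J p) - (UN p:C2. J p)) Un (UN p:C2. J p)" lebesgue]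
  by(auto simp: fmeasurable.Diff fmeasurable.Un fmeasurableD)
 also have "... <= ?m ((U - E) Un (E2 - (UN p:C2. J p)) Un (fst ` C1 Un snd ` C1))"
 proof (rule measure_mono_fmeasurable)
  show "(UN p:C1. J p) - (UN p:C2. J p) <= (U - E) Un (E2 - (UN p:C2. J p)) Un (fst ` C1 Un snd ` C1)"
  proof
  fix x assume x: "x : (UN p:C1. J p) - (UN p:C2. J p)"
  then obtain p where p: "p : C1" "x : J p" by auto
  have "x : U" using p lt1(2)[OF p(1)] by blast
  moreover have "x : {fst p<..<snd p} | x = fst p | x = snd p" using p(2) by(auto simp: J_def)
  ultimately show "x : (U - E) Un (E2 - (UN p:C2. J p)) Un (fst ` C1 Un snd ` C1)"
  using p x by(auto simp: E2_def)
  qed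
  show "(UN p:C1. J p) - (UN p:C2. J p) : sets lebesgue" using m1 by auto
  show "(U - E) Un (E2 - (UN p:C2. J p)) Un (fst ` C1 Un snd ` C1) : lmeasurable"
  by(intro fmeasurable.Un fmeasurable.Diff U neg E2 m1)
 qed
 also have "... <= ?m (U - E) + ?m (E2 - (UN p:C2. J p)) + ?m (fst ` C1 Un snd ` C1)"
 proof -
  have s: "U - E : sets lebesgue" "E2 - (UN p:C2. J p) : sets lebesgue" "(fst ` C1 Un snd ` C1) : sets lebesgue"
  using U(3) neg(1) fmeasurable.Diff[OF E2 m1(2)] by auto
  show ?thesis using measure_Un_le[OF sets.Un[OF s(1,2)] s(3)] measure_Un_le[OF s(1,2)] by linarith
 qed
 also have "... < dlt'/4 + dlt'/4" using U(4) C2(4) neg(2) by(simp add: J_def)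
 finally have T12: "T1 - T2 < dlt" using T1 T2 d' by simp
 have "e <= ?m (E - (UN p:C1. J p)) + ?m (UN p:C1. J p)"
 proof -
  have "?m E <= ?m ((E - (UN p:C1. J p)) Un (UN p:C1. J p))"
  by(rule measure_mono_fmeasurable) (use E(1) m1 in auto)
  also have "... <= ?m (E - (UN p:C1. J p)) + ?m (UN p:C1. J p)"
  using E(1) m1 by(intro measure_Un_le) auto
  finally show ?thesis by(simp add: e_def)
 qed
 hence T1e: "T1 >= 3 * e / 4" using C1(4) T1 d'(3) by(simp add: J_def)
 have RD: "R division_of \<Union>R"
 proof (rule division_ofI)
  show "finite R" using C1(1) finD by(auto simp: R_def)
  fix K assume "K : R"
  then obtain p where p: "p : C1" "K : D p" by(auto simp: R_def)
  show "K <= \<Union>R" using \<open>K : R\<close> by auto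
  show "K ~= {}" using DJ[OF p] by auto
  show "EX a b. K = cbox a b" using division_ofD(4)[OF D(2)[OF p(1)] p(2)] by auto
 next
  fix K1 K2 assume K: "K1 : R" "K2 : R" "K1 ~= K2"
  then obtain p q where pq: "p : C1" "K1 : D p" "q : C1" "K2 : D q" by(auto simp: R_def)
  show "interior K1 Int interior K2 = {}"
  proof (cases "p = q")
  case True
  thus ?thesis using pq K division_ofD(5)[OF D(2)[OF pq(1)]] by auto
  next
  case False
  hence "K1 Int K2 = {}" using disj1[OF pq(1,3)] DJ(1)[OF pq(1,2)] DJ(1)[OF pq(3,4)] by blast
  thus ?thesis by(metis interior_Int interior_empty)
  qed
 qed simp
 have "\<Union>R <= {a..b}" using DJ(1) Jab by(fastforce simp: R_def)
 moreover have "(SUM K:R. Sup K - Inf K) < dlt"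
 proof -
  have "(SUM K:R. Sup K - Inf K) = (SUM p:C1. snd p - fst p - (SUM q:{q : C2. pw q = p}. snd q - fst q))"
  unfolding sumR using sumD[of _ "%x. x"] by(intro sum.cong refl)
  also have "... = T1 - T2" unfolding sum_subtractf grp T1_def T2_def ..
  finally show ?thesis using T12 by simp
 qed
 ultimately have small: "(SUM K:R. dist (f (Inf K)) (f (Sup K))) < r * e / 4" using ac_modulusD[OF d(2) RD] by auto
 \<comment> \<open>The increment over \<open>R\<close> is the increment over \<open>C1\<close>, at
   most \<open>- r * T1\<close>, minus the one over \<open>C2\<close>, at least
   \<open>r * T2\<close>.\<close>
 have "- (SUM K:R. dist (f (Inf K)) (f (Sup K))) <= (SUM K:R. f (Sup K) - f (Inf K))"
  unfolding sum_negf[symmetric] by(intro sum_mono) (auto simp: dist_real_def)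
 also have "... = (SUM p:C1. f (snd p) - f (fst p) - (SUM q:{q : C2. pw q = p}. f (snd q) - f (fst q)))"
  unfolding sumR using sumD[of _ f] by(intro sum.cong refl)
 also have "... = (SUM p:C1. f (snd p) - f (fst p)) - (SUM q:C2. f (snd q) - f (fst q))"
  unfolding sum_subtractf grp ..
 also have "... <= (SUM p:C1. - r * (snd p - fst p)) - (SUM q:C2. r * (snd q - fst q))"
  using lt1(3) lt2(2) by(intro diff_mono sum_mono) auto
 also have "... = - r * T1 - r * T2" by(simp add: T1_def T2_def sum_distrib_left)
 finally have "r * T1 + r * T2 < r * e / 4" using small by linarith
 moreover have "T2 >= 0" unfolding T2_def using lt2(1) by(intro sum_nonneg) (simp add: less_imp_le)
 hence "r * T2 >= 0" using r by simp
 moreover have "r * T1 >= r * (3 * e / 4)" using T1e r by(intro mult_left_mono) auto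
 moreover have "r * e > 0" using r e by simp
 ultimately show False by(simp add: algebra_simps)
qed

text \<open>Inside an interval of length \<open>dlt / 2\<close> the increments over disjoint
  intervals sum to less than 1. Intervals of slope at least \<open>4 / e\<close> covering more than
  half of a set of measure \<open>e\<close> would give a sum above 2.\<close>

lemma abs_cont_infinite_slope_negligible:
 fixes f :: "real => real"
 assumes ac: "abs_cont_on a b f" and E: "E : lmeasurable" "E <= {a<..<b}"
  and hi: "!!x d R. x : E ==> d > 0 ==> EX u v. u < x & x < v & v - u < d & R * (v - u) <= abs (f v - f u)"
 shows "negligible E"
proof -
 let ?m = "measure lebesgue"
 obtain dlt where d: "dlt > 0" "ac_modulus a b f 1 dlt" by(rule abs_cont_onE[OF ac zero_less_one])
 have loc: "negligible (E Int {x - dlt/4<..<x + dlt/4})" for x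
 proof (rule ccontr)
  define U where "U = {x - dlt/4<..<x + dlt/4} Int {a<..<b}"
  define E' where "E' = E Int {x - dlt/4<..<x + dlt/4}"
  assume "~ negligible (E Int {x - dlt/4<..<x + dlt/4})"
  hence nE: "~ negligible E'" by(simp add: E'_def)
  have E': "E' : lmeasurable" unfolding E'_def using E(1) by(intro fmeasurable_Int_fmeasurable) auto
  have E'U: "E' <= U" unfolding E'_def U_def using E(2) by blast
  have U: "open U" unfolding U_def by(intro open_Int open_greaterThanLessThan)
  define e where "e = ?m E'"
  have e: "e > 0" using nE E' by(simp add: e_def negligible_iff_measure less_le)
  define W where "W = {(u, v). u < v & {u..v} <= U & 4 / e * (v - u) <= abs (f v - f u)}"
  have cov: "EX (u, v):W. y : {u..v} & v - u < dd" if y: "y : E'" and dd: "dd > 0" for y dd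
  proof -
  obtain d1 where d1: "d1 > 0" "ball y d1 <= U" using U E'U y by(meson open_contains_ball subsetD)
  have "y : E" using y by(simp add: E'_def)
  then obtain u v where uv: "u < y" "y < v" "v - u < min dd d1" "4 / e * (v - u) <= abs (f v - f u)"
  using hi[of y "min dd d1" "4 / e"] dd d1 by auto
  have "{u..v} <= ball y d1" using uv by(auto simp: dist_real_def)
  hence "(u, v) : W" using uv d1 unfolding W_def by auto
  thus ?thesis by(rule rev_bexI) (use uv in auto)
  qed
  obtain C where C: "finite C" "C <= W" "pairwise (%p q. disjnt {fst p..snd p} {fst q..snd q}) C"
  "?m (E' - (UN p:C. {fst p..snd p})) < e/2"
  by(rule Vitali_finite_intervals[OF E' _ _ cov, of "e/2"]) (use e in "auto simp: W_def")
  define J where "J p = {fst p..snd p}" for p :: "real \<times> real"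
  have lt: "fst p < snd p" "J p <= U" "4 / e * (snd p - fst p) <= abs (f (snd p) - f (fst p))" if "p : C" for p
  using subsetD[OF C(2) that] by(auto simp: W_def J_def split_beta)
  have disj: "J p Int J q = {}" if "p : C" "q : C" "p ~= q" for p q
  using C(3) that by(auto simp: pairwise_def disjnt_def J_def)
  have mJ': "J p : lmeasurable" for p by(simp add: J_def)
  define T where "T = (SUM p:C. snd p - fst p)"
  have T: "T = ?m (UN p:C. J p)"
  unfolding T_def
  proof (subst measure_finite_Union)
  show "(SUM p:C. snd p - fst p) = (SUM p:C. ?m (J p))" using less_imp_le[OF lt(1)] by(intro sum.cong refl) (simp add: J_def)
  show "emeasure lebesgue (J i) ~= \<infinity>" for i using fmeasurableD2[OF mJ', of i] by simp
  qed (use C(1) disj mJ' in "auto simp: disjoint_family_on_def")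
  have m1: "(UN p:C. J p) : lmeasurable" using C(1) mJ' by(auto intro!: fmeasurable.finite_UN)
  have "T <= ?m {x - dlt/4<..<x + dlt/4}" unfolding T
  proof (rule measure_mono_fmeasurable)
  show "(UN p:C. J p) <= {x - dlt/4<..<x + dlt/4}" using lt(2) unfolding U_def by blast
  qed (use m1 in auto)
  hence Td: "T < dlt" using d(1) by simp
  have "?m E' <= ?m ((E' - (UN p:C. J p)) Un (UN p:C. J p))"
  by(rule measure_mono_fmeasurable) (use E' m1 in auto)
  also have "... <= ?m (E' - (UN p:C. J p)) + ?m (UN p:C. J p)"
  using E' m1 by(intro measure_Un_le) auto
  finally have Te: "T > e / 2" using C(4) T by(simp add: e_def J_def)
  have "(SUM p:C. dist (f (fst p)) (f (snd p))) < 1"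
  proof (rule ac_modulus_family[OF d(2) C(1)])
  show "a <= fst p & fst p <= snd p & snd p <= b" if "p : C" for p
  proof -
  have "fst p : J p" "snd p : J p" using lt(1)[OF that] by(auto simp: J_def)
  hence "fst p : U" "snd p : U" using lt(2)[OF that] by auto
  thus ?thesis using lt(1)[OF that] by(simp add: U_def)
  qed
  show "{fst p<..<snd p} Int {fst q<..<snd q} = {}" if "p : C" "q : C" "p ~= q" for p q
  using disj[OF that] unfolding J_def by(meson disjoint_iff greaterThanLessThan_subseteq_atLeastAtMost_iff order_refl subsetD)
  qed (use Td T_def in simp)
  hence "(SUM p:C. abs (f (snd p) - f (fst p))) < 1" by(simp add: dist_real_def abs_minus_commute)
  moreover have "(SUM p:C. abs (f (snd p) - f (fst p))) >= (SUM p:C. 4 / e * (snd p - fst p))"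
  using lt(3) by(intro sum_mono)
  moreover have "(SUM p:C. 4 / e * (snd p - fst p)) = 4 / e * T" by(simp only: T_def sum_distrib_left)
  moreover have "4 / e * T > 4 / e * (e / 2)" using Te e by(intro mult_strict_left_mono) auto
  ultimately show False using e by simp
 qed
 show ?thesis
 proof (subst locally_negligible_alt, rule ballI)
  fix x assume x: "x : E"
  show "EX U. openin (top_of_set E) U & x : U & negligible U"
  by(rule exI[of _ "E Int {x - dlt/4<..<x + dlt/4}"]) (use x d(1) loc in "auto simp: openin_open_Int")
 qed
qed

text \<open>The sets handled by Vitali coverings control only difference quotients over intervals
  with \<open>x\<close> in their interior. Continuity at \<open>x\<close> lets one endpoint tend to
  \<open>x\<close>, from either side, and so recovers the usual quotients.\<close>

lemma straddle_imp_real_derivative: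
 fixes f :: "real => real"
 assumes cont: "isCont f x"
  and str: "!!eps. eps > 0 ==> EX d>0. ALL u v. u < x & x < v & v - u < d --> abs (f v - f u - D * (v - u)) <= eps * (v - u)"
 shows "(f has_real_derivative D) (at x)"
 unfolding has_field_derivative_def has_derivative_at_alt
proof (intro conjI allI impI bounded_linear_mult_right)
 fix e :: real assume e: "e > 0"
 obtain d where d: "d > 0" "!!u v. u < x ==> x < v ==> v - u < d ==> abs (f v - f u - D * (v - u)) <= e * (v - u)"
  using str[OF e] by blast
 show "EX d>0. ALL y. norm (y - x) < d --> norm (f y - f x - D * (y - x)) <= e * norm (y - x)"
 proof (intro exI[of _ "d/2"] conjI allI impI)
  fix y assume y: "norm (y - x) < d/2"
  have lim: "(f \<longlongrightarrow> f x) (at x within S)" for S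
  using cont unfolding isCont_def by(rule tendsto_within_subset) simp
  consider "y = x" | "x < y" | "y < x" by linarith
  thus "norm (f y - f x - D * (y - x)) <= e * norm (y - x)"
  proof cases
  case 2
  have L1: "((%u. abs (f y - f u - D * (y - u))) \<longlongrightarrow> abs (f y - f x - D * (y - x))) (at_left x)"
  by(intro tendsto_intros lim)
  have L2: "((%u. e * (y - u)) \<longlongrightarrow> e * (y - x)) (at_left x)" by(intro tendsto_intros)
  have ev: "\<forall>\<^sub>F u in at_left x. abs (f y - f u - D * (y - u)) <= e * (y - u)"
  by(rule eventually_mono[OF eventually_at_left_real[of "x - d/2" x]]) (use y 2 d(1) in "auto intro!: d(2)")
  have "abs (f y - f x - D * (y - x)) <= e * (y - x)"
  by(rule tendsto_le[OF trivial_limit_at_left_real L2 L1 ev])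
  thus ?thesis using 2 by simp
  next
  case 3
  have L1: "((%v. abs (f v - f y - D * (v - y))) \<longlongrightarrow> abs (f x - f y - D * (x - y))) (at_right x)"
  by(intro tendsto_intros lim)
  have L2: "((%v. e * (v - y)) \<longlongrightarrow> e * (x - y)) (at_right x)" by(intro tendsto_intros)
  have ev: "\<forall>\<^sub>F v in at_right x. abs (f v - f y - D * (v - y)) <= e * (v - y)"
  by(rule eventually_mono[OF eventually_at_right_real[of x "x + d/2"]]) (use y 3 d(1) in "auto intro!: d(2)")
  have "abs (f x - f y - D * (x - y)) <= e * (x - y)"
  by(rule tendsto_le[OF trivial_limit_at_right_real L2 L1 ev])
  thus ?thesis using 3 by(auto simp: abs_le_iff algebra_simps)
  qed simp
 qed (use d in auto)
qed

text \<open>Where no derivative exists, either the straddling quotients are unbounded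
  (\<open>I\<close>), or rationals \<open>p < q\<close> lie strictly between their lower and upper
  limits (\<open>E p q\<close>). Subtracting the slope \<open>(p + q) / 2\<close> puts
  \<open>E p q\<close> into the two-slope situation with \<open>r = (q - p) / 2\<close>.
  Measurability is free because all sets are countable intersections of open ones.\<close>

lemma abs_cont_on_real_differentiable_AE:
 fixes f :: "real => real"
 assumes ac: "abs_cont_on a b f"
 shows "negligible {x : {a<..<b}. ~ (EX D. (f has_real_derivative D) (at x))}"
proof -
 define lo where "lo p n = (\<Union>u. UN v:{v. u < v & v - u < inverse (Suc n) & f v - f u < p * (v - u)}. {u<..<v})" for p and n :: nat
 define hi where "hi p n = (\<Union>u. UN v:{v. u < v & v - u < inverse (Suc n) & p * (v - u) < f v - f u}. {u<..<v})" for p and n :: nat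
 define un where "un R n = (\<Union>u. UN v:{v. u < v & v - u < inverse (Suc n) & real R * (v - u) < abs (f v - f u)}. {u<..<v})" for R n :: nat
 have op: "open (lo p n)" "open (hi p n)" "open (un R n)" for p n R
  unfolding lo_def hi_def un_def by(auto intro!: open_UN)
 define E where "E p q = {a<..<b} Int (\<Inter>n. lo p n) Int (\<Inter>n. hi q n)" for p q
 define I where "I = {a<..<b} Int (\<Inter>R. \<Inter>n. un R n)"
 have bor: "lo p n : sets borel" "hi p n : sets borel" "un R n : sets borel" for p n R using op by auto
 have "E p q : sets borel" "I : sets borel" for p q
  unfolding E_def I_def using bor by(auto intro!: sets.countable_INT'' sets.Int)
 hence leb: "E p q : sets lebesgue" "I : sets lebesgue" for p q
  by(simp_all add: sets_completionI_sets)
 have sub: "E p q <= {a<..<b}" "I <= {a<..<b}" for p q unfolding E_def I_def by blast+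
 have meas: "E p q : lmeasurable" "I : lmeasurable" for p q
  by(rule bounded_set_imp_lmeasurable[OF bounded_subset[OF bounded_Ioo sub(1)] leb(1)],
  rule bounded_set_imp_lmeasurable[OF bounded_subset[OF bounded_Ioo sub(2)] leb(2)])
 have small: "EX n. inverse (real (Suc n)) < d" if "d > 0" for d using reals_Archimedean[OF that] .
 have nE: "negligible (E p q)" if pq: "p < q" for p q
 proof -
  let ?c = "(p + q) / 2" and ?r = "(q - p) / 2"
  let ?g = "%x. f x - ?c * x"
  have "abs_cont_on a b ?g"
  by(intro abs_cont_on_diff ac abs_cont_on_Lipschitz[OF abs_cont_on_id, where C="abs ?c"])
  (simp only: dist_real_def abs_mult[symmetric] right_diff_distrib order_refl)
  thus ?thesis
  proof (rule abs_cont_two_slopes_negligible[where r = ?r])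
  fix x d :: real assume x: "x : E p q" "d > 0"
  obtain n where n: "inverse (real (Suc n)) < d" using small[OF x(2)] by blast
  have "x : lo p n" using x by(auto simp: E_def)
  then obtain u v where "x : {u<..<v}" "u < v" "v - u < inverse (Suc n)" "f v - f u < p * (v - u)"
  unfolding lo_def by blast
  moreover from this have "?g v - ?g u <= - ?r * (v - u)" by(simp add: field_simps)
  ultimately show "EX u v. u < x & x < v & v - u < d & ?g v - ?g u <= - ?r * (v - u)"
  using n by(intro exI[of _ u] exI[of _ v]) auto
  have "x : hi q n" using x by(auto simp: E_def)
  then obtain u v where "x : {u<..<v}" "u < v" "v - u < inverse (Suc n)" "q * (v - u) < f v - f u"
  unfolding hi_def by blast
  moreover from this have "?r * (v - u) <= ?g v - ?g u" by(simp add: field_simps)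
  ultimately show "EX u v. u < x & x < v & v - u < d & ?r * (v - u) <= ?g v - ?g u"
  using n by(intro exI[of _ u] exI[of _ v]) auto
  qed (use pq meas sub in auto)
 qed
 have nI: "negligible I"
 proof (rule abs_cont_infinite_slope_negligible[OF ac])
  fix x d R :: real assume x: "x : I" "d > 0"
  obtain n where n: "inverse (real (Suc n)) < d" using small[OF x(2)] by blast
  obtain k :: nat where k: "R <= real k" using real_arch_simple by blast
  have "x : un k n" using x by(auto simp: I_def)
  then obtain u v where uv: "x : {u<..<v}" "u < v" "v - u < inverse (Suc n)" "real k * (v - u) < abs (f v - f u)"
  unfolding un_def by blast
  have "R * (v - u) <= real k * (v - u)" using k uv by(intro mult_right_mono) auto
  hence "R * (v - u) <= abs (f v - f u)" using uv(4) by linarith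
  thus "EX u v. u < x & x < v & v - u < d & R * (v - u) <= abs (f v - f u)"
  using uv(1-3) n by(intro exI[of _ u] exI[of _ v]) auto
 qed (rule meas sub)+
 define N where "N = I Un (UN p:\<rat>. UN q:\<rat> Int {p<..}. E p q)"
 have "negligible N"
  unfolding N_def
 proof (intro negligible_Un nI negligible_countable_Union)
  show "countable ((%p. UN q:\<rat> Int {p<..}. E p q) ` \<rat>)" by(intro countable_image countable_rat)
  fix T assume "T : (%p. UN q:\<rat> Int {p<..}. E p q) ` \<rat>"
  then obtain p where T: "T = (UN q:\<rat> Int {p<..}. E p q)" by blast
  show "negligible T" unfolding T
  proof (rule negligible_countable_Union)
  show "countable (E p ` (\<rat> Int {p<..}))" by(intro countable_image countable_Int1 countable_rat)
  qed (use nE in auto)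
 qed
 moreover have "{x : {a<..<b}. ~ (EX D. (f has_real_derivative D) (at x))} <= N"
 proof (clarify, rule ccontr)
  fix x assume x: "x : {a<..<b}" and nd: "\<nexists>D. (f has_real_derivative D) (at x)" and xN: "x ~: N"
  have "x ~: I" using xN by(auto simp: N_def)
  then obtain k n where kn: "x ~: un k n" using x by(auto simp: I_def)
  have bd: "abs (f v - f u) <= real k * (v - u)" if "u < x" "x < v" "v - u < inverse (Suc n)" for u v
  proof (rule ccontr)
  assume "~ ?thesis"
  hence "x : un k n" unfolding un_def using that by(intro UN_I[of u] UN_I[of v]) auto
  with kn show False by blast
  qed
  \<comment> \<open>\<open>S\<close> collects the eventual lower bounds of the straddling quotients,
    so \<open>Sup S\<close> is their lower limit. An upper limit above it would leave room for two
    rationals that put \<open>x\<close> into some \<open>E p q\<close>.\<close>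
  define S where "S = {p. EX d>0. ALL u v. u < x & x < v & v - u < d --> p * (v - u) <= f v - f u}"
  have "- real k : S" unfolding S_def
  by(rule CollectI, rule exI[of _ "inverse (real (Suc n))"]) (use bd in "fastforce simp: abs_le_iff")
  hence Sne: "S ~= {}" by auto
  have Sb: "p <= real k" if p: "p : S" for p
  proof -
  obtain d where d: "d > 0" "!!u v. u < x ==> x < v ==> v - u < d ==> p * (v - u) <= f v - f u"
  using p by(auto simp: S_def)
  define h where "h = min d (inverse (Suc n)) / 4"
  have h: "h > 0" "4 * h <= d" "4 * h <= inverse (Suc n)" using d by(auto simp: h_def)
  have "p * (2 * h) <= f (x + h) - f (x - h)" using d(2)[of "x - h" "x + h"] h by simp
  also have "... <= real k * (2 * h)" using bd[of "x - h" "x + h"] h by(simp add: abs_le_iff)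
  finally show ?thesis using h(1) by simp
  qed
  have Sbdd: "bdd_above S" using Sb by(auto simp: bdd_above_def)
  define D where "D = Sup S"
  have "(f has_real_derivative D) (at x)"
  proof (rule straddle_imp_real_derivative)
  show "isCont f x"
  using continuous_on_interior[OF abs_cont_on_imp_continuous_on[OF ac], of x] x by simp
  fix e :: real assume e: "e > 0"
  obtain p where p: "p : S" "D - e < p" using less_cSupD[OF Sne, of "D - e"] e by(auto simp: D_def)
  obtain d1 where d1: "d1 > 0" "!!u v. u < x ==> x < v ==> v - u < d1 ==> p * (v - u) <= f v - f u"
  using p by(auto simp: S_def)
  obtain p' where p': "p' : \<rat>" "D < p'" "p' < D + e/2" using Rats_dense_in_real[of D "D + e/2"] e by auto
  obtain q' where q': "q' : \<rat>" "D + e/2 < q'" "q' < D + e" using Rats_dense_in_real[of "D + e/2" "D + e"] e by auto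
  have "p' ~: S" using cSup_upper[OF _ Sbdd, of p'] p' by(auto simp: D_def)
  hence p'2: "EX u v. u < x & x < v & v - u < d & f v - f u < p' * (v - u)" if "d > 0" for d
  using that unfolding S_def by(simp add: not_le)
  have "x : lo p' m" for m
  proof -
  obtain u v where "u < x & x < v & v - u < inverse (Suc m) & f v - f u < p' * (v - u)" using p'2[of "inverse (Suc m)"] by auto
  thus ?thesis unfolding lo_def by(intro UN_I[of u] UN_I[of v]) auto
  qed
  moreover have "x ~: E p' q'" using xN p' q' by(auto simp: N_def)
  ultimately obtain m where m: "x ~: hi q' m" using x by(auto simp: E_def)
  have up: "f v - f u <= q' * (v - u)" if "u < x" "x < v" "v - u < inverse (Suc m)" for u v
  proof (rule ccontr)
  assume "~ ?thesis"
  hence "x : hi q' m" unfolding hi_def using that by(intro UN_I[of u] UN_I[of v]) auto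
  with m show False by blast
  qed
  show "EX d>0. ALL u v. u < x & x < v & v - u < d --> abs (f v - f u - D * (v - u)) <= e * (v - u)"
  proof (intro exI[of _ "min d1 (inverse (Suc m))"] conjI allI impI)
  fix u v assume uv: "u < x & x < v & v - u < min d1 (inverse (real (Suc m)))"
  have "q' * (v - u) <= (D + e) * (v - u)" "(D - e) * (v - u) <= p * (v - u)"
  using uv q' p by(auto intro!: mult_right_mono)
  thus "abs (f v - f u - D * (v - u)) <= e * (v - u)"
  using up[of u v] d1(2)[of u v] uv by(auto simp: abs_le_iff algebra_simps)
  qed (use d1 in auto)
  qed
  with nd show False by blast
 qed
 ultimately show ?thesis by(rule negligible_subset)
qed

lemma abs_cont_on_differentiable_AE:
 fixes f :: "real => 'a::euclidean_space"
 assumes ac: "abs_cont_on a b f"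
 shows "negligible {x : {a<..<b}. ~ f differentiable (at x)}"
proof -
 have "negligible (UN i:Basis. {x : {a<..<b}. ~ (EX D. ((%x. f x \<bullet> i) has_real_derivative D) (at x))})"
 proof (rule negligible_countable_Union)
  fix T assume "T : (%i. {x : {a<..<b}. ~ (EX D. ((%x. f x \<bullet> i) has_real_derivative D) (at x))}) ` Basis"
  then obtain i where i: "i : Basis" and T: "T = {x : {a<..<b}. ~ (EX D. ((%x. f x \<bullet> i) has_real_derivative D) (at x))}"
  by blast
  show "negligible T" unfolding T
  proof (rule abs_cont_on_real_differentiable_AE)
  show "abs_cont_on a b (%x. f x \<bullet> i)"
  proof (rule abs_cont_on_Lipschitz[OF ac, where C = 1])
  fix x y
  show "dist (f x \<bullet> i) (f y \<bullet> i) <= 1 * dist (f x) (f y)"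
  using Cauchy_Schwarz_ineq2[of "f x - f y" i] i by(simp add: dist_norm inner_diff_left)
  qed
  qed
 qed (intro countable_finite finite_imageI finite_Basis)
 moreover have "{x : {a<..<b}. ~ f differentiable (at x)} <=
  (UN i:Basis. {x : {a<..<b}. ~ (EX D. ((%x. f x \<bullet> i) has_real_derivative D) (at x))})"
  using differentiable_componentwise_within[of f _ UNIV] by(auto simp: real_differentiable_def)
 ultimately show ?thesis by(rule negligible_subset)
qed

text \<open>
 The exceptional null set is handled by the gauge: its tags are confined to an open set so small
 that absolute continuity bounds their contribution.
\<close>

lemma abs_cont_on_increment_le_integral:
 fixes F l :: "real => real"
 assumes ac: "abs_cont_on a b F" and ab: "a <= b" and int: "(l has_integral I) {a..b}"
  and N: "negligible N" and der: "!!s. s : {a<..<b} - N ==> EX D<=l s. (F has_real_derivative D) (at s)"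
 shows "F b - F a <= I"
proof -
 \<comment> \<open>The endpoints join the null set because derivatives are given only inside the
   interval; with \<open>l' = 0\<close> on \<open>N'\<close> the exceptional tags add nothing to the
   Riemann sum.\<close>
 define N' where "N' = insert a (insert b N)"
 have N': "negligible N'" using N by(simp add: N'_def)
 define l' where "l' s = (if s : N' then 0 else l s)" for s
 have int': "(l' has_integral I) {a..b}"
  by(rule has_integral_spike[OF N' _ int]) (simp add: l'_def)
 have main: "F b - F a <= I + (2 + (b - a)) * e" if e: "e > 0" for e
 proof -
  obtain dlt where d: "dlt > 0" "ac_modulus a b F e dlt" by(rule abs_cont_onE[OF ac e])
  have "N' : sets lebesgue" using N' by(simp add: negligible_imp_sets)
  then obtain U where U: "open U" "N' <= U" "U - N' : lmeasurable" "emeasure lebesgue (U - N') < ennreal dlt"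
  by(rule sets_lebesgue_outer_open[OF _ d(1)])
  have Ul: "U : lmeasurable"
  proof -
  have "U = (U - N') Un N'" using U(2) by blast
  thus ?thesis using U(3) N' by(metis fmeasurable.Un negligible_imp_measurable)
  qed
  have Ud: "measure lebesgue U < dlt"
  proof -
  have "measure lebesgue (U - N') < dlt"
  using U(3,4) d(1) by(simp add: emeasure_eq_measure2 ennreal_less_iff)
  moreover have "U = (U - N') Un N'" using U(2) by blast
  moreover have "measure lebesgue ((U - N') Un N') <= measure lebesgue (U - N') + measure lebesgue N'"
  by(rule measure_Un_le[OF fmeasurableD[OF U(3)] negligible_imp_sets[OF N']])
  ultimately show ?thesis using negligible_imp_measure0[OF N'] by simp
  qed
  have "EX gm. gauge gm & (ALL D. D tagged_division_of {a..b} & gm fine D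
  --> norm (sum (%(x,k). measure lborel k *\<^sub>R l' x) D - I) < e)"
  using int' e unfolding has_integral_real by simp
  then obtain g1 where g1: "gauge g1" and g1': "ALL D. D tagged_division_of {a..b} & g1 fine D
  --> norm (sum (%(x,k). measure lborel k *\<^sub>R l' x) D - I) < e" by blast
  have "EX r>0. ALL u v. u <= x & x <= v & {u..v} <= ball x r --> F v - F u <= (l x + e) * (v - u)"
  if x: "x : {a..b} - N'" for x
  proof -
  have "x : {a<..<b} - N" using x by(auto simp: N'_def)
  then obtain D where D: "D <= l x" "(F has_real_derivative D) (at x)" using der by blast
  have "EX r>0. ALL y. norm (y - x) < r --> norm (F y - F x - D * (y - x)) <= e * norm (y - x)"
  using D(2) e unfolding has_field_derivative_def has_derivative_at_alt by simp
  then obtain r where r: "r > 0" "!!y. norm (y - x) < r ==> norm (F y - F x - D * (y - x)) <= e * norm (y - x)"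
  by blast
  show ?thesis
  proof (intro exI[of _ r] conjI r(1) allI impI)
  fix u v assume uv: "u <= x & x <= v & {u..v} <= ball x r"
  moreover from this have "u : {u..v}" "v : {u..v}" by auto
  ultimately have "u : ball x r" "v : ball x r" by blast+
  hence "abs (F u - F x - D * (u - x)) <= e * abs (u - x)" "abs (F v - F x - D * (v - x)) <= e * abs (v - x)"
  using r(2)[of u] r(2)[of v] by(auto simp: dist_real_def abs_minus_commute)
  hence "F v - F u <= (D + e) * (v - u)" using uv by(simp add: abs_le_iff algebra_simps)
  also have "... <= (l x + e) * (v - u)" using D(1) uv by(intro mult_right_mono) auto
  finally show "F v - F u <= (l x + e) * (v - u)" .
  qed
  qed
  hence "ALL x:{a..b} - N'. EX r. r > 0 & (ALL u v. u <= x & x <= v & {u..v} <= ball x r --> F v - F u <= (l x + e) * (v - u))"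
  by blast
  from bchoice[OF this] obtain r where "ALL x:{a..b} - N'. r x > 0 &
  (ALL u v. u <= x & x <= v & {u..v} <= ball x (r x) --> F v - F u <= (l x + e) * (v - u))" by blast
  hence r: "!!x. x : {a..b} - N' ==> r x > 0"
  "!!x u v. x : {a..b} - N' ==> u <= x ==> x <= v ==> {u..v} <= ball x (r x) ==> F v - F u <= (l x + e) * (v - u)"
  by blast+
  define g2 where "g2 x = (if x : N' then U else if x : {a..b} then ball x (r x) else UNIV)" for x
  have "gauge g2" unfolding gauge_def g2_def using U r(1) by auto
  hence "gauge (%x. g1 x Int g2 x)" using g1 by(rule gauge_Int[rotated])
  then obtain D where D: "D tagged_division_of {a..b}" "(%x. g1 x Int g2 x) fine D"
  using fine_division_exists_real by blast
  have f1: "g1 fine D" and f2: "g2 fine D" using D(2) by(auto simp: fine_Int)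
  have int_ivl: "EX u v. K = {u..v} & u <= x & x <= v & {u..v} <= {a..b}" if "(x, K) : D" for x K
  proof -
  have "x : K" "K <= {a..b}" "EX u v. K = cbox u v" using tagged_division_ofD(2-4)[OF D(1) that] by auto
  then obtain u v where uv: "K = {u..v}" unfolding box_real by blast
  show ?thesis using \<open>x : K\<close> \<open>K <= {a..b}\<close> unfolding uv by(intro exI[of _ u] exI[of _ v]) simp
  qed
  define D1 where "D1 = {(x, K) : D. x : N'}"
  have finD: "finite D" using D(1) by auto
  have D1D: "D1 <= D" by(auto simp: D1_def)
  have tot: "F b - F a = (SUM (x, K):D. F (Sup K) - F (Inf K))"
  using additive_tagged_division_1[OF ab D(1), of F] by simp
  also have "... = (SUM (x, K):D - D1. F (Sup K) - F (Inf K)) + (SUM (x, K):D1. F (Sup K) - F (Inf K))"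
  by(rule sum.subset_diff[OF D1D finD])
  also have "(SUM (x, K):D - D1. F (Sup K) - F (Inf K)) <= (SUM (x, K):D - D1. measure lborel K * l' x + e * measure lborel K)"
  proof (rule sum_mono, clarify)
  fix x K assume xK: "(x, K) : D" "(x, K) ~: D1"
  obtain u v where uv: "K = {u..v}" "u <= x" "x <= v" "{u..v} <= {a..b}" using int_ivl[OF xK(1)] by blast
  have xN: "x : {a..b} - N'" using xK uv by(auto simp: D1_def)
  have "K <= g2 x" using f2 xK(1) by(auto simp: fine_def)
  hence "{u..v} <= ball x (r x)" using xN uv(1) by(auto simp: g2_def)
  hence "F v - F u <= (l x + e) * (v - u)" using r(2)[OF xN uv(2,3)] by blast
  thus "F (Sup K) - F (Inf K) <= measure lborel K * l' x + e * measure lborel K"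
  using uv xN by(simp add: l'_def algebra_simps)
  qed
  also have "(SUM (x, K):D - D1. measure lborel K * l' x + e * measure lborel K) <= (SUM (x, K):D. measure lborel K * l' x + e * measure lborel K)"
  proof (rule sum_mono2[OF finD])
  fix p assume "p : D - (D - D1)"
  hence "fst p : N'" by(auto simp: D1_def)
  thus "0 <= (case p of (x, K) => measure lborel K * l' x + e * measure lborel K)" using e by(auto simp: l'_def split_beta)
  qed auto
  also have "(SUM (x, K):D. measure lborel K * l' x + e * measure lborel K) = (SUM (x, K):D. measure lborel K *\<^sub>R l' x) + e * (SUM (x, K):D. measure lborel K)"
  by(simp add: split_beta sum.distrib sum_distrib_left)
  also have "(SUM (x, K):D. measure lborel K) = b - a"
  using additive_content_tagged_division[of D a b] D(1) ab by simp
  also have "(SUM (x, K):D. measure lborel K *\<^sub>R l' x) <= I + e"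
  using g1'[rule_format, OF conjI[OF D(1) f1]] by(simp add: abs_less_iff)
  also have "(SUM (x, K):D1. F (Sup K) - F (Inf K)) <= e"
  proof -
  have part: "D1 tagged_partial_division_of {a..b}"
  using tagged_partial_division_subset[of D "{a..b}" D1] D(1) D1D by(simp add: tagged_division_of_def)
  have td: "D1 tagged_division_of \<Union>(snd ` D1)" by(rule tagged_partial_division_of_Union_self[OF part])
  have dv: "snd ` D1 division_of \<Union>(snd ` D1)" by(rule division_of_tagged_division[OF td])
  have sub: "\<Union>(snd ` D1) <= {a..b}" "\<Union>(snd ` D1) <= U"
  proof -
  have "K <= {a..b} & K <= U" if xK: "(x, K) : D1" for x K
  proof -
  have "(x, K) : D" "x : N'" using xK by(auto simp: D1_def)
  moreover from this have "K <= g2 x" using f2 by(auto simp: fine_def)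
  ultimately show ?thesis using int_ivl[of x K] by(auto simp: g2_def)
  qed
  hence "K <= {a..b}" "K <= U" if "K : snd ` D1" for K using that by(metis imageE prod.collapse)+
  thus "\<Union>(snd ` D1) <= {a..b}" "\<Union>(snd ` D1) <= U" by blast+
  qed
  have len: "Sup K - Inf K = measure lebesgue K" if K: "K : snd ` D1" for K
  proof -
  obtain u v where "u <= v" "K = {u..v}" "{u..v} <= \<Union>(snd ` D1)" by(rule real_division_interval[OF dv K])
  thus ?thesis by simp
  qed
  have "(SUM K:snd ` D1. Sup K - Inf K) = (SUM K:snd ` D1. measure lebesgue K)" using len by(rule sum.cong[OF refl])
  also have "... = measure lebesgue (\<Union>(snd ` D1))" by(rule content_division[OF dv])
  also have "... <= measure lebesgue U"
  using sub(2) Ul lmeasurable_division[OF dv] by(intro measure_mono_fmeasurable) auto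
  finally have "(SUM K:snd ` D1. Sup K - Inf K) < dlt" using Ud by simp
  hence s: "(SUM K:snd ` D1. dist (F (Inf K)) (F (Sup K))) < e" by(rule ac_modulusD[OF d(2) dv sub(1)])
  \<comment> \<open>Different tags may carry the same degenerate interval. As \<open>G\<close>
    vanishes on those, the sum over tagged intervals equals the sum over the set of
    intervals.\<close>
  define G where "G K = (if K = {} then 0 else dist (F (Inf K)) (F (Sup K)))" for K :: "real set"
  have "(SUM (x, K):D1. G K) = sum G (snd ` D1)"
  proof (rule sum.over_tagged_division_lemma[OF td])
  fix u v :: real assume "box u v = {}"
  hence "v <= u" by simp
  thus "G (cbox u v) = 0" by(cases "u = v") (auto simp: G_def)
  qed
  also have "... = (SUM K:snd ` D1. dist (F (Inf K)) (F (Sup K)))"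
  using division_ofD(3)[OF dv] by(intro sum.cong) (auto simp: G_def)
  finally have "(SUM (x, K):D1. G K) < e" using s by simp
  moreover have "(SUM (x, K):D1. F (Sup K) - F (Inf K)) <= (SUM (x, K):D1. G K)"
  proof (rule sum_mono, clarify)
  fix x K assume "(x, K) : D1"
  hence "K ~= {}" using int_ivl[of x K] subsetD[OF D1D, of "(x, K)"] by auto
  thus "F (Sup K) - F (Inf K) <= G K" by(simp add: G_def dist_real_def)
  qed
  ultimately show ?thesis by simp
  qed
  finally show ?thesis by(simp add: algebra_simps)
 qed
 show ?thesis
 proof (rule field_le_epsilon)
  fix c :: real assume "c > 0"
  thus "F b - F a <= I + c" using main[of "c / (2 + (b - a))"] ab by simp
 qed
qed

section \<open>Test functions and mollification in Euclidean space\<close>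

text \<open>Test functions only have to be \<open>C\<^sup>1\<close>, so squared positive parts
  suffice to build the one-sided penalty and the cutoffs below.\<close>

lemma pos_part_sq_has_derivative:
 "((%x::real. (max 0 x)\<^sup>2) has_real_derivative 2 * max 0 x) (at x)"
proof -
 have "norm ((max 0 y)\<^sup>2 - (max 0 x)\<^sup>2 - (2 * max 0 x) * (y - x)) <= norm (y - x) * norm (y - x)" for y :: real
 proof -
  consider "x >= 0" "y >= 0" | "x >= 0" "y < 0" | "x < 0" "y >= 0" | "x < 0" "y < 0" by linarith
  thus ?thesis
  proof cases
  case 1
  hence "(max 0 y)\<^sup>2 - (max 0 x)\<^sup>2 - (2 * max 0 x) * (y - x) = (y - x) * (y - x)"
  by(simp add: power2_eq_square algebra_simps)
  thus ?thesis by simp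
  next
  case 2
  hence "(max 0 y)\<^sup>2 - (max 0 x)\<^sup>2 - (2 * max 0 x) * (y - x) = x * x - 2 * x * y"
  by(simp add: power2_eq_square algebra_simps max_def)
  moreover have "0 <= x * x - 2 * x * y"
  proof -
  have "x * y <= 0" using 2 by(simp add: mult_nonneg_nonpos)
  moreover have "x * x >= 0" by simp
  moreover have "2 * x * y = x * y + x * y" by simp
  ultimately show ?thesis by linarith
  qed
  moreover have "x * x - 2 * x * y <= (y - x) * (y - x)" by(simp add: algebra_simps)
  ultimately show ?thesis by(simp add: abs_mult[symmetric])
  next
  case 3
  have "0 <= - (x * y)" using 3 by(simp add: mult_nonpos_nonneg)
  moreover have "x * x >= 0" by simp
  moreover have "(y - x) * (y - x) = y * y - x * y - x * y + x * x" by(simp add: algebra_simps)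
  ultimately have "y * y <= (y - x) * (y - x)" by linarith
  thus ?thesis using 3 by(simp add: power2_eq_square max_def abs_mult[symmetric])
  next
  case 4
  thus ?thesis by simp
  qed
 qed
 hence b: "norm ((max 0 y)\<^sup>2 - (max 0 x)\<^sup>2 - (2 * max 0 x) * (y - x)) <= e * norm (y - x)"
  if "norm (y - x) < e" for y e
  using that by(meson less_imp_le mult_right_mono norm_ge_zero order_trans)
 show ?thesis
  unfolding has_field_derivative_def has_derivative_at_alt
  using b by(auto intro!: bounded_linear_mult_right)
qed

text \<open>Were the increment larger than \<open>kp\<close>, the test function \<open>Phi\<close>
  of slope \<open>k > kp\<close> along the segment, with a penalty beyond its end and a steep
  quadratic penalty across, would touch \<open>u\<close> from above at an interior point of a thin
  tube. The penalty beyond the end only increases the slope in direction \<open>v\<close>, so there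
  \<open>G y \<bullet> v \<ge> k\<close>, against the hypothesis on test functions.\<close>

lemma viscosity_direction_bound:
 fixes u :: "'e::euclidean_space => real"
 assumes W: "open W" "continuous_on W u" "closed_segment a (a + v) <= W" and v: "v ~= 0"
  and test: "!!phi G y r. r > 0 ==> ball y r <= W ==> (ALL z:ball y r. (phi has_derivative (%h. G z \<bullet> h)) (at z))
  ==> continuous_on (ball y r) G ==> (ALL z:ball y r. u z - phi z <= u y - phi y) ==> G y \<bullet> v <= kp"
 shows "u (a + v) - u a <= kp"
proof (rule ccontr)
 assume "~ u (a + v) - u a <= kp"
 hence gt: "kp < u (a + v) - u a" by simp
 define k where "k = (kp + (u (a + v) - u a)) / 2"
 define gap where "gap = u (a + v) - k - u a"
 have k: "kp < k" "gap > 0" using gt by(auto simp: k_def gap_def field_simps)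
 have vv: "v \<bullet> v > 0" using v by simp
 define s where "s y = (y - a) \<bullet> v / (v \<bullet> v)" for y
 define p where "p y = y - a - s y *\<^sub>R v" for y
 have yap: "y = a + s y *\<^sub>R v + p y" for y by(simp add: p_def)
 have pv: "p y \<bullet> v = 0" for y using vv by(simp add: p_def s_def inner_diff_left)
 have sb: "s (a + v) = 1" "p (a + v) = 0" using vv by(auto simp: s_def p_def)
 have cs: "continuous_on S s" "continuous_on S p" for S
  unfolding p_def s_def using vv by(auto intro!: continuous_intros)
 obtain e where e: "e > 0" "(UN x:closed_segment a (a + v). ball x e) <= W"
  by(rule compact_subset_open_imp_ball_epsilon_subset[OF compact_segment W(1) W(3)]) blast
 define eta where "eta = e / (2 * (1 + norm v))"
 have nv: "1 + norm v > 0" using norm_ge_zero[of v] by linarith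
 have eta: "eta > 0" using e nv by(simp add: eta_def)
 have etae: "eta + eta * norm v < e"
 proof -
  have "eta + eta * norm v = eta * (1 + norm v)" by(simp add: algebra_simps)
  also have "... = e / 2" unfolding eta_def using nv by(simp add: field_simps)
  finally show ?thesis using e(1) by simp
 qed
 define C where "C = {y. 0 <= s y & s y <= 1 + eta & norm (p y) <= eta}"
 have CW: "C <= W"
 proof
  fix y assume y: "y : C"
  define s' where "s' = min (s y) 1"
  have s': "0 <= s'" "s' <= 1" "abs (s y - s') <= eta" using y eta by(auto simp: C_def s'_def)
  have "a + s' *\<^sub>R v = (1 - s') *\<^sub>R a + s' *\<^sub>R (a + v)" by(simp add: algebra_simps)
  hence seg: "a + s' *\<^sub>R v : closed_segment a (a + v)" using s' unfolding closed_segment_def by blast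
  have "y - (a + s' *\<^sub>R v) = p y + (s y - s') *\<^sub>R v" by(simp add: p_def algebra_simps)
  hence "dist y (a + s' *\<^sub>R v) <= norm (p y) + abs (s y - s') * norm v"
  unfolding dist_norm by(metis norm_triangle_ineq norm_scaleR)
  also have "... <= eta + eta * norm v" using y s' by(intro add_mono mult_right_mono) (auto simp: C_def)
  finally have "y : ball (a + s' *\<^sub>R v) e" using etae by(simp add: dist_commute)
  thus "y : W" using e(2) seg by blast
 qed
 have "closed C" unfolding C_def
  by(intro closed_Collect_conj closed_Collect_le continuous_intros cs)
 moreover have "bounded C"
 proof (rule boundedI)
  fix y assume y: "y : C"
  have "norm y <= norm (a + s y *\<^sub>R v) + norm (p y)" by(metis yap norm_triangle_ineq)
  also have "norm (a + s y *\<^sub>R v) <= norm a + abs (s y) * norm v" by(metis norm_triangle_ineq norm_scaleR)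
  also have "abs (s y) * norm v <= (1 + eta) * norm v" using y by(intro mult_right_mono) (auto simp: C_def)
  also have "norm (p y) <= eta" using y by(simp add: C_def)
  finally show "norm y <= norm a + (1 + eta) * norm v + eta" by simp
 qed
 ultimately have cC: "compact C" by(simp add: compact_eq_bounded_closed)
 have aC: "a : C" "a + v : C" using eta sb by(auto simp: C_def s_def p_def)
 have uC: "continuous_on C u" using W(2) CW by(rule continuous_on_subset)
 obtain B where B: "!!y. y : C ==> abs (u y) <= B" by(rule compact_boundE[OF uC cC]) auto
 have B0: "B >= 0" using B[OF aC(1)] by simp
 have "a : W" using CW aC by blast
 hence "isCont u a" using W(1,2) by(simp add: continuous_on_eq_continuous_at)
 then obtain tht where tht: "tht > 0" "!!y. dist y a < tht ==> dist (u y) (u a) < gap"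
  using k(2) unfolding continuous_at_eps_delta by(auto simp: dist_norm)
 \<comment> \<open>\<open>M\<close> makes the face \<open>s = 1 + eta\<close> lose against the point
   \<open>a + v\<close>. The constant \<open>n\<close> below keeps the maximiser within
   \<open>z\<close> of the axis, hence off the lateral face, and continuity at \<open>a\<close> then
   excludes the face \<open>s = 0\<close>.\<close>
 define M where "M = (2 * B + abs k * eta + 1) / eta\<^sup>2"
 have M: "M >= 0" "M * eta\<^sup>2 = 2 * B + abs k * eta + 1" using B0 eta by(auto simp: M_def)
 define Q where "Q = 2 * B + abs k * (1 + eta)"
 have Q: "Q >= 0" using B0 eta by(auto simp: Q_def)
 define z where "z = min tht eta"
 have z: "z > 0" "z <= tht" "z <= eta" using tht eta by(auto simp: z_def)
 define n where "n = Q / z\<^sup>2 + 1"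
 have n: "n >= 1" using Q by(simp add: n_def)
 define Phi where "Phi y = k * s y + M * (max 0 (s y - 1))\<^sup>2 + n * (p y \<bullet> p y)" for y
 have "continuous_on C (%y. u y - Phi y)" unfolding Phi_def by(intro continuous_intros uC cs)
 then obtain y where y: "y : C" "!!x. x : C ==> u x - Phi x <= u y - Phi y"
  using continuous_attains_sup[OF cC, of "%y. u y - Phi y"] aC by blast
 have val: "u (a + v) - k <= u y - Phi y" using y(2)[OF aC(2)] sb by(simp add: Phi_def)
 have s01: "0 <= s y" "s y <= 1 + eta" "norm (p y) <= eta" using y(1) by(auto simp: C_def)
 have ks: "k - k * s y <= abs k * (1 + eta)"
 proof -
  have "k - k * s y = k * (1 - s y)" by(simp add: algebra_simps)
  also have "... <= abs k * abs (1 - s y)" by(metis abs_ge_self abs_mult)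
  also have "... <= abs k * (1 + eta)" using s01 eta by(intro mult_left_mono) auto
  finally show ?thesis .
 qed
 have M2: "M * (max 0 (s y - 1))\<^sup>2 >= 0" using M(1) by simp
 have Bs: "u y <= B" "- B <= u (a + v)" using B[OF y(1)] B[OF aC(2)] by auto
 have "n * (p y \<bullet> p y) <= Q" unfolding Q_def
  using val[unfolded Phi_def] ks M2 Bs by linarith
 also have "Q < n * z\<^sup>2" using z(1) by(simp add: n_def field_simps)
 finally have "(norm (p y))\<^sup>2 < z\<^sup>2" using n by(simp add: dot_square_norm)
 hence pz: "norm (p y) < z" using z(1) by(simp add: power_less_imp_less_base)
 have np: "n * (p y \<bullet> p y) >= 0" using n by simp
 have s0: "s y > 0"
 proof (rule ccontr)
  assume "~ s y > 0"
  hence s0: "s y = 0" using s01 by simp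
  hence "y = a + p y" using yap[of y] by simp
  hence "dist y a < tht" using pz z by(metis add_diff_cancel_left' dist_norm less_le_trans)
  hence "u y < u a + gap" using tht(2)[of y] by(auto simp: dist_real_def)
  thus False using val s0 np by(simp add: Phi_def gap_def)
 qed
 have s1: "s y < 1 + eta"
 proof (rule ccontr)
  assume "~ s y < 1 + eta"
  hence s1: "s y = 1 + eta" using s01 by simp
  have "k * eta >= - abs k * eta" using eta by(intro mult_right_mono) auto
  thus False using val np Bs M(2) s1 eta by(simp add: Phi_def algebra_simps)
 qed
 define G where "G y = ((k + M * (2 * max 0 (s y - 1))) / (v \<bullet> v)) *\<^sub>R v + (2 * n) *\<^sub>R p y" for y
 have ds: "(s has_derivative (%h. h \<bullet> v / (v \<bullet> v))) (at y)" for y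
 proof -
  have "((%y. inverse (v \<bullet> v) * ((y - a) \<bullet> v)) has_derivative (%h. inverse (v \<bullet> v) * (h \<bullet> v))) (at y)"
  by(rule has_derivative_mult_right) (auto intro!: derivative_eq_intros)
  thus ?thesis by(simp add: s_def[abs_def] divide_inverse mult.commute)
 qed
 have dp: "(p has_derivative (%h. h - (h \<bullet> v / (v \<bullet> v)) *\<^sub>R v)) (at y)" for y
  unfolding p_def by(rule derivative_eq_intros ds refl | simp)+
 have dm: "((%y. (max 0 (s y - 1))\<^sup>2) has_derivative (%h. 2 * max 0 (s y - 1) * (h \<bullet> v / (v \<bullet> v)))) (at y)" for y
 proof -
  have "((%y. s y - 1) has_derivative (%h. h \<bullet> v / (v \<bullet> v))) (at y)"
  by(rule derivative_eq_intros ds refl | simp)+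
  from has_derivative_compose[OF this pos_part_sq_has_derivative[unfolded has_field_derivative_def]]
  show ?thesis by simp
 qed
 have dPhi: "(Phi has_derivative (%h. G y \<bullet> h)) (at y)" for y
 proof -
  have pp: "p y \<bullet> (h - (h \<bullet> v / (v \<bullet> v)) *\<^sub>R v) = p y \<bullet> h" for h using pv by(simp add: inner_diff_right)
  have "(Phi has_derivative (%h. k * (h \<bullet> v / (v \<bullet> v)) + M * (2 * max 0 (s y - 1) * (h \<bullet> v / (v \<bullet> v)))
  + n * (p y \<bullet> (h - (h \<bullet> v / (v \<bullet> v)) *\<^sub>R v) + (h - (h \<bullet> v / (v \<bullet> v)) *\<^sub>R v) \<bullet> p y))) (at y)"
  unfolding Phi_def
  by(intro has_derivative_add has_derivative_mult_right has_derivative_inner ds dp dm)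
  moreover have "k * (h \<bullet> v / (v \<bullet> v)) + M * (2 * max 0 (s y - 1) * (h \<bullet> v / (v \<bullet> v)))
  + n * (p y \<bullet> (h - (h \<bullet> v / (v \<bullet> v)) *\<^sub>R v) + (h - (h \<bullet> v / (v \<bullet> v)) *\<^sub>R v) \<bullet> p y) = G y \<bullet> h" for h
  unfolding inner_commute[of "h - (h \<bullet> v / (v \<bullet> v)) *\<^sub>R v" "p y"] pp G_def
  by(simp add: inner_add_left inner_commute[of h] algebra_simps add_divide_distrib)
  ultimately show ?thesis by(rule has_derivative_eq_rhs[OF _ ext])
 qed
 have cG: "continuous_on S G" for S unfolding G_def using vv by(intro continuous_intros cs) auto
 have "open {y. 0 < s y & s y < 1 + eta & norm (p y) < eta}"
  by(intro open_Collect_conj open_Collect_less continuous_intros cs)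
 moreover have "y : {y. 0 < s y & s y < 1 + eta & norm (p y) < eta}" using s0 s1 pz z by simp
 ultimately obtain r where r: "r > 0" "ball y r <= {y. 0 < s y & s y < 1 + eta & norm (p y) < eta}"
  by(meson open_contains_ball)
 hence rC: "ball y r <= C" by(auto simp: C_def)
 have "G y \<bullet> v <= kp"
  by(rule test[OF r(1) order_trans[OF rC CW]]) (use dPhi cG y rC in auto)
 moreover have "G y \<bullet> v = k + M * (2 * max 0 (s y - 1))"
  using vv pv by(simp add: G_def inner_add_left)
 moreover have "M * (2 * max 0 (s y - 1)) >= 0" using M(1) by simp
 ultimately show False using k by linarith
qed

definition cutoff :: "'e::euclidean_space => real => 'e => real" where
 "cutoff a r y = (max 0 (1 - (max 0 ((y - a) \<bullet> (y - a) / r\<^sup>2 - 1))\<^sup>2))\<^sup>2"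

lemma cutoff_props:
 assumes r: "r > 0"
 shows cutoff_nonneg: "cutoff a r y >= 0"
  and cutoff_1: "y : cball a r ==> cutoff a r y = 1"
  and cutoff_0: "y ~: ball a (2 * r) ==> cutoff a r y = 0"
proof -
 show "cutoff a r y >= 0" by(simp add: cutoff_def)
 have eq: "(y - a) \<bullet> (y - a) / r\<^sup>2 = (dist a y / r)\<^sup>2"
  by(simp add: dot_square_norm power_divide dist_norm norm_minus_commute)
 show "cutoff a r y = 1" if "y : cball a r"
 proof -
  have "(dist a y / r)\<^sup>2 <= 1" using that r by(simp add: power_le_one)
  thus ?thesis unfolding cutoff_def eq by(simp add: max_def)
 qed
 show "cutoff a r y = 0" if "y ~: ball a (2 * r)"
 proof -
  have "2 <= dist a y / r" using that r by(simp add: field_simps)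
  hence "2\<^sup>2 <= (dist a y / r)\<^sup>2" by(intro power_mono) auto
  hence 1: "max 0 ((dist a y / r)\<^sup>2 - 1) >= 1" by(simp add: max_def)
  have "1 <= (max 0 ((dist a y / r)\<^sup>2 - 1))\<^sup>2" using power_mono[OF 1, of 2] by simp
  thus ?thesis unfolding cutoff_def eq by(simp add: max_def)
 qed
qed

lemma cutoff_C1:
 fixes a :: "'e::euclidean_space"
 obtains G where "!!y. (cutoff a r has_derivative (%h. G y \<bullet> h)) (at y)" "continuous_on UNIV G"
proof -
 define q where "q y = (y - a) \<bullet> (y - a) / r\<^sup>2 - 1" for y
 define m where "m y = 1 - (max 0 (q y))\<^sup>2" for y
 define G where "G y = (2 * max 0 (m y) * (- (2 * max 0 (q y) * (2 / r\<^sup>2)))) *\<^sub>R (y - a)" for y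
 have dq: "(q has_derivative (%h. (2 / r\<^sup>2) * ((y - a) \<bullet> h))) (at y)" for y
 proof -
  have "((%y. (y - a) \<bullet> (y - a)) has_derivative (%h. 2 * ((y - a) \<bullet> h))) (at y)"
  by(rule has_derivative_eq_rhs[OF has_derivative_inner[where f' = "%h. h" and g' = "%h. h"]])
  (auto intro!: derivative_eq_intros simp: inner_commute)
  from has_derivative_diff[OF has_derivative_mult_right[OF this, of "inverse (r\<^sup>2)"] has_derivative_const[of 1]]
  show ?thesis by(simp add: q_def[abs_def] divide_inverse mult_ac)
 qed
 have dq2: "((%y. (max 0 (q y))\<^sup>2) has_derivative (%h. 2 * max 0 (q y) * ((2 / r\<^sup>2) * ((y - a) \<bullet> h)))) (at y)" for y
  using has_derivative_compose[OF dq pos_part_sq_has_derivative[unfolded has_field_derivative_def]] by simp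
 have dm: "(m has_derivative (%h. - (2 * max 0 (q y) * ((2 / r\<^sup>2) * ((y - a) \<bullet> h))))) (at y)" for y
  unfolding m_def by(rule derivative_eq_intros dq2 refl | simp)+
 have "((%y. (max 0 (m y))\<^sup>2) has_derivative (%h. G y \<bullet> h)) (at y)" for y
  using has_derivative_compose[OF dm pos_part_sq_has_derivative[unfolded has_field_derivative_def], of y]
  by(rule has_derivative_eq_rhs) (auto simp: G_def fun_eq_iff)
 moreover have "cutoff a r = (%y. (max 0 (m y))\<^sup>2)" by(auto simp: cutoff_def m_def q_def fun_eq_iff)
 moreover have "continuous_on UNIV G" unfolding G_def m_def q_def by(cases "r = 0") (auto intro!: continuous_intros)
 ultimately show ?thesis by(intro that[of G]) simp_all
qed

lemma mollifier_exists:
 fixes dummy :: "'e::euclidean_space"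
 assumes e: "eps > 0"
 obtains rho :: "'e => real" and g :: "'e => 'e" where
  "!!z. rho z >= 0" "!!z. z ~: cball 0 eps ==> rho z = 0" "continuous_on UNIV rho"
  "(\<integral>z. rho z \<partial>lborel) = 1" "!!z. (rho has_derivative (%h. g z \<bullet> h)) (at z)" "continuous_on UNIV g"
proof -
 define rho0 :: "'e => real" where "rho0 = cutoff 0 (eps / 2)"
 have e2: "eps / 2 > 0" using e by simp
 have r0: "rho0 z >= 0" "z : cball 0 (eps/2) ==> rho0 z = 1" for z
  unfolding rho0_def by(rule cutoff_nonneg[OF e2], rule cutoff_1[OF e2])
 have r2: "z ~: cball 0 eps ==> rho0 z = 0" for z
  unfolding rho0_def using cutoff_0[OF e2, of z 0] by auto
 obtain g0 :: "'e => 'e" where g0: "!!z. (rho0 has_derivative (%h. g0 z \<bullet> h)) (at z)" "continuous_on UNIV g0"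
  unfolding rho0_def by(rule cutoff_C1[of 0 "eps/2"]) blast
 have c0: "continuous_on UNIV rho0"
  using g0(1) by(meson continuous_at_imp_continuous_on has_derivative_continuous)
 have ind: "rho0 z = indicator (cball 0 eps) z *\<^sub>R rho0 z" for z using r2[of z] by(auto simp: indicator_def)
 have int0: "integrable lborel rho0"
 proof -
  have "integrable lborel (%z. indicator (cball 0 eps) z *\<^sub>R rho0 z)"
  by(rule borel_integrable_compact) (auto intro: continuous_on_subset[OF c0])
  thus ?thesis using ind by(metis (no_types, lifting) Bochner_Integration.integrable_cong)
 qed
 define I where "I = (\<integral>z. rho0 z \<partial>lborel)"
 have I: "I > 0"
 proof -
  have "0 < measure lborel (cball (0::'e) (eps/2))" using e by(simp add: content_cball_pos)
  also have "... = (\<integral>z. indicator (cball (0::'e) (eps/2)) z \<partial>lborel)" by simp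
  also have "... <= I" unfolding I_def
  proof (rule integral_mono[OF _ int0])
  show "integrable lborel (indicat_real (cball (0::'e) (eps/2)))"
  using emeasure_bounded_finite[OF bounded_cball, of "0::'e" "eps/2"]
  by(intro integrable_real_indicator) auto
  show "indicator (cball 0 (eps/2)) z <= rho0 z" for z using r0 by(auto simp: indicator_def)
  qed
  finally show ?thesis .
 qed
 show ?thesis
 proof (rule that[of "%z. rho0 z / I" "%z. inverse I *\<^sub>R g0 z"])
  show "rho0 z / I >= 0" for z using r0(1)[of z] I by simp
  show "z ~: cball 0 eps ==> rho0 z / I = 0" for z using r2[of z] by simp
  show "continuous_on UNIV (%z. rho0 z / I)" using I by(intro continuous_intros c0) auto
  show "(\<integral>z. rho0 z / I \<partial>lborel) = 1" using I by(simp add: I_def[symmetric])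
  show "((%z. rho0 z / I) has_derivative (%h. (inverse I *\<^sub>R g0 z) \<bullet> h)) (at z)" for z
  using has_derivative_mult_right[OF g0(1)[of z], of "inverse I"] by(simp add: divide_inverse mult.commute)
  show "continuous_on UNIV (%z. inverse I *\<^sub>R g0 z)" by(intro continuous_intros g0)
 qed
qed

text \<open>An average inherits every bound valid throughout the ball averaged over, be it on values
  or on increments in one direction. Dividing the increments by \<open>t\<close> and letting
  \<open>t\<close> tend to 0 yields the one-sided gradient bound, the form in which subsolutions
  enter.\<close>

lemma mollification:
 fixes u :: "'e::euclidean_space => real"
 assumes u: "continuous_on UNIV u" and e: "eps > 0"
 obtains w :: "'e => real" and G :: "'e => 'e" where
  "!!y. y : ball 0 R ==> (w has_derivative (%h. G y \<bullet> h)) (at y)" "continuous_on (ball 0 R) G"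
  "!!y b kp. (!!z. z : cball y eps ==> abs (u z - b) <= kp) ==> abs (w y - b) <= kp"
  "!!y v kp t0. y : ball 0 R ==> t0 > 0 ==>
  (!!t z. 0 < t ==> t < t0 ==> z : cball y eps ==> u (z + t *\<^sub>R v) - u z <= kp * t) ==> G y \<bullet> v <= kp"
proof -
 obtain rho :: "'e => real" and g :: "'e => 'e" where r: "!!z. rho z >= 0" "!!z. z ~: cball 0 eps ==> rho z = 0" "continuous_on UNIV rho"
  "(\<integral>z. rho z \<partial>lborel) = 1" and g: "!!z. (rho has_derivative (%h. g z \<bullet> h)) (at z)" "continuous_on UNIV g"
  by(rule mollifier_exists[OF e]) blast
 define w where "w y = (\<integral>z. rho z * u (y + z) \<partial>lborel)" for y
 have cu: "continuous_on S (%x. u (f x))" if "continuous_on S f" for S and f :: "'x::topological_space => 'e"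
  by(rule continuous_on_compose2[OF u that]) simp
 have cr: "continuous_on S (%x. rho (f x))" if "continuous_on S f" for S and f :: "'x::topological_space => 'e"
  by(rule continuous_on_compose2[OF r(3) that]) simp
 have cg: "continuous_on S (%x. g (f x))" if "continuous_on S f" for S and f :: "'x::topological_space => 'e"
  by(rule continuous_on_compose2[OF g(2) that]) simp
 have integ: "integrable lborel (%z. rho z * f z)" if "continuous_on UNIV f" for f :: "'e => real"
 proof -
  have "integrable lborel (%z. indicator (cball 0 eps) z *\<^sub>R (rho z * f z))"
  by(rule borel_integrable_compact) (auto intro!: continuous_intros continuous_on_subset[OF r(3)] continuous_on_subset[OF that])
  moreover have "indicator (cball 0 eps) z *\<^sub>R (rho z * f z) = rho z * f z" for z using r(2)[of z] by(auto simp: indicator_def)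
  ultimately show ?thesis by(simp only:)
 qed
 have mono: "(\<integral>z. rho z * f1 z \<partial>lborel) <= (\<integral>z. rho z * f2 z \<partial>lborel)"
  if "continuous_on UNIV f1" "continuous_on UNIV f2" "!!z. z : cball 0 eps ==> f1 z <= f2 z" for f1 f2
 proof (rule integral_mono[OF integ[OF that(1)] integ[OF that(2)]])
  fix z :: 'e
  show "rho z * f1 z <= rho z * f2 z"
  using that(3)[of z] r(1)[of z] r(2)[of z] by(cases "z : cball 0 eps") (auto intro: mult_left_mono)
 qed
 have const: "(\<integral>z. rho z * b \<partial>lborel) = b" for b using r(4) by simp
 have cuy: "continuous_on UNIV (%z. u (y + z))" for y by(intro cu continuous_intros)
 have P1: "abs (w y - b) <= kp" if *: "!!z. z : cball y eps ==> abs (u z - b) <= kp" for y b kp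
 proof -
  have **: "abs (u (y + z) - b) <= kp" if "z : cball 0 eps" for z using *[of "y + z"] that by(simp add: dist_norm)
  have "w y <= (\<integral>z. rho z * (b + kp) \<partial>lborel)" unfolding w_def
  using ** by(intro mono cuy continuous_intros) (auto simp: abs_le_iff algebra_simps)
  moreover have "(\<integral>z. rho z * (b - kp) \<partial>lborel) <= w y" unfolding w_def
  using ** by(intro mono cuy continuous_intros) (auto simp: abs_le_iff algebra_simps)
  ultimately show ?thesis unfolding const by(simp add: abs_le_iff)
 qed
 have incr: "w (y + t *\<^sub>R v) - w y <= kp * t" if *: "!!z. z : cball y eps ==> u (z + t *\<^sub>R v) - u z <= kp * t" for y t v kp
 proof -
  have "w (y + t *\<^sub>R v) <= (\<integral>z. rho z * (u (y + z) + kp * t) \<partial>lborel)" unfolding w_def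
  proof (rule mono)
  fix z :: 'e assume "z : cball 0 eps"
  thus "u (y + t *\<^sub>R v + z) <= u (y + z) + kp * t" using *[of "y + z"] by(simp add: dist_norm algebra_simps)
  qed (intro cu continuous_intros cuy)+
  also have "... = w y + (\<integral>z. rho z * (kp * t) \<partial>lborel)"
  unfolding w_def distrib_left by(rule Bochner_Integration.integral_add) (intro integ cuy continuous_intros)+
  also have "(\<integral>z. rho z * (kp * t) \<partial>lborel) = kp * t" by(rule const)
  finally show ?thesis by simp
 qed
 define Rr where "Rr = max R 0 + eps"
 obtain B :: 'e where B: "cball 0 Rr <= cbox (- B) B"
  using bounded_subset_cbox_symmetric[OF bounded_cball[of "0::'e" Rr]] by blast
 let ?Q = "cbox (- B) B"
 \<comment> \<open>A translation moves \<open>y\<close> into the kernel, the smooth factor. One box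
   contains the supports for all \<open>y\<close> in \<open>ball 0 R\<close>, so differentiation
   under the integral takes place over a fixed compact set.\<close>
 have wQ: "w y = integral ?Q (%t. rho (t - y) * u t)" if y: "y : ball 0 R" for y
 proof -
  let ?k = "%t. rho (t - y) * u t"
  have ck: "continuous_on UNIV ?k" by(intro continuous_intros cr cu)
  have z: "?k t = 0" if "t ~: ?Q" for t
  proof -
  have "t ~: cball 0 Rr" using B that by blast
  hence "norm t > Rr" by simp
  moreover have "norm t <= norm (t - y) + norm y" by(metis diff_add_cancel norm_triangle_ineq)
  ultimately have "t - y ~: cball 0 eps" using y by(auto simp: Rr_def)
  thus ?thesis using r(2) by simp
  qed
  have ind: "?k t = indicator ?Q t *\<^sub>R ?k t" for t using z[of t] by(auto simp: indicator_def)
  have si: "set_integrable lborel ?Q ?k" unfolding set_integrable_def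
  by(rule borel_integrable_compact) (auto intro: continuous_on_subset[OF ck])
  have "integral ?Q ?k = (LINT t:?Q|lborel. ?k t)"
  by(rule set_borel_integral_eq_integral(2)[OF si, symmetric])
  also have "... = (\<integral>t. ?k t \<partial>lborel)" unfolding set_lebesgue_integral_def by(simp only: ind[symmetric])
  also have "... = (\<integral>t. ?k t \<partial>(distr lborel borel ((+) y)))" by(simp only: lborel_distr_plus)
  also have "... = (\<integral>z. ?k (y + z) \<partial>lborel)"
  using borel_measurable_continuous_onI[OF ck] by(intro integral_distr) auto
  also have "... = w y" by(simp add: w_def)
  finally show ?thesis by simp
 qed
 define G where "G y = integral ?Q (%t. - (u t) *\<^sub>R g (t - y))" for y
 have cont1: "continuous_on (ball 0 R \<times> ?Q) (%(y, t). - (u t) *\<^sub>R g (t - y))"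
  unfolding split_beta by(intro continuous_intros cu cg)
 have G2: "continuous_on (ball 0 R) G" unfolding G_def by(rule integral_continuous_on_param[OF cont1])
 have G1: "(w has_derivative (%h. G y \<bullet> h)) (at y)" if y: "y : ball 0 R" for y
 proof -
  have "((%y. integral ?Q (%t. rho (t - y) * u t)) has_derivative
  blinfun_apply (integral ?Q (%t. blinfun_inner_right (- (u t) *\<^sub>R g (t - y))))) (at y within ball 0 R)"
  proof (rule leibniz_rule[OF _ _ _ y convex_ball])
  fix x t :: 'e assume "x : ball 0 R" "t : ?Q"
  have "((%x. t - x) has_derivative (%h. - h)) (at x within ball 0 R)" by(auto intro!: derivative_eq_intros)
  from has_derivative_mult_left[OF has_derivative_compose[OF this g(1)], of "u t"]
  show "((%x. rho (t - x) * u t) has_derivative blinfun_apply (blinfun_inner_right (- u t *\<^sub>R g (t - x)))) (at x within ball 0 R)"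
  by(rule has_derivative_eq_rhs) (auto simp: fun_eq_iff blinfun_inner_right.rep_eq mult.commute)
  next
  fix x :: 'e
  show "(%t. rho (t - x) * u t) integrable_on ?Q" by(intro integrable_continuous continuous_intros cr cu)
  next
  show "continuous_on (ball 0 R \<times> ?Q) (%(x, t). blinfun_inner_right (- u t *\<^sub>R g (t - x)))"
  unfolding split_beta by(intro continuous_intros cu cg bounded_linear.continuous_on[OF bounded_linear_blinfun_inner_right])
  qed
  moreover have "integral ?Q (%t. blinfun_inner_right (- (u t) *\<^sub>R g (t - y))) = blinfun_inner_right (G y)"
  unfolding G_def
  by(rule integral_linear[OF _ bounded_linear_blinfun_inner_right, unfolded o_def])
  (intro integrable_continuous continuous_intros cu cg)
  ultimately have "((%y. integral ?Q (%t. rho (t - y) * u t)) has_derivative (%h. G y \<bullet> h)) (at y within ball 0 R)"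
  by(simp add: blinfun_inner_right.rep_eq)
  hence "(w has_derivative (%h. G y \<bullet> h)) (at y within ball 0 R)"
  by(rule has_derivative_transform[OF y, rotated]) (use wQ in auto)
  thus ?thesis using y by(simp add: at_within_open[of y "ball 0 R"])
 qed
 have P2: "G y \<bullet> v <= kp" if y: "y : ball 0 R" and t0: "t0 > 0"
  and *: "!!t z. 0 < t ==> t < t0 ==> z : cball y eps ==> u (z + t *\<^sub>R v) - u z <= kp * t" for y v kp t0
 proof -
  have "((%t. y + t *\<^sub>R v) has_derivative (%t. t *\<^sub>R v)) (at 0)" by(auto intro!: derivative_eq_intros)
  moreover have "(w has_derivative (%h. G y \<bullet> h)) (at (y + 0 *\<^sub>R v))" using G1[OF y] by simp
  ultimately have "((%t. w (y + t *\<^sub>R v)) has_derivative (%t. G y \<bullet> (t *\<^sub>R v))) (at 0)"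
  by(rule has_derivative_compose)
  hence "((%t. w (y + t *\<^sub>R v)) has_real_derivative (G y \<bullet> v)) (at 0)"
  unfolding has_field_derivative_def by(rule has_derivative_eq_rhs) (auto simp: fun_eq_iff)
  hence "((%h. (w (y + h *\<^sub>R v) - w y) / h) \<longlongrightarrow> G y \<bullet> v) (at 0)"
  by(simp add: DERIV_def)
  hence lim: "((%h. (w (y + h *\<^sub>R v) - w y) / h) \<longlongrightarrow> G y \<bullet> v) (at_right 0)"
  by(rule tendsto_within_subset) simp
  show ?thesis
  proof (rule tendsto_upperbound[OF lim])
  show "\<forall>\<^sub>F h in at_right 0. (w (y + h *\<^sub>R v) - w y) / h <= kp"
  by(rule eventually_mono[OF eventually_at_right_real[OF t0]])
  (use incr * in "auto simp: divide_le_eq")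
  qed simp
 qed
 show ?thesis by(rule that[of w G]) (use G1 G2 P1 P2 in blast)+
qed

section \<open>Weak limits of discrete measures\<close>

text \<open>Schoenberg's space-filling curve: \<open>zigzag (3\<^sup>n t)\<close> reads off the \<open>n\<close>-th ternary digit of a point \<open>t\<close> of the Cantor set.\<close>

definition zigzag :: "real => real" where
 "zigzag t = max 0 (min 1 (3 * infdist t (range (%k::int. 2 * of_int k)) - 1))"

lemma zigzag_bounds: "0 <= zigzag t" "zigzag t <= 1" by(auto simp: zigzag_def)

lemma continuous_on_zigzag: "continuous_on S f ==> continuous_on S (%x. zigzag (f x))"
 unfolding zigzag_def by(intro continuous_intros)

lemma range_nonempty: "range f ~= {}" by simp

lemma infdist_even:
 fixes x :: real and k :: int
 assumes "0 <= x" "x <= 1"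
 shows "infdist (2 * of_int k + x) (range (%k::int. 2 * of_int k)) = x"
proof (rule antisym)
 have "infdist (2 * of_int k + x) (range (%k::int. 2 * of_int k)) <= dist (2 * of_int k + x) (2 * of_int k)"
  by(rule infdist_le) simp
 thus "infdist (2 * of_int k + x) (range (%k::int. 2 * of_int k)) <= x"
  using assms by(simp add: dist_real_def)
 show "x <= infdist (2 * of_int k + x) (range (%k::int. 2 * of_int k))"
  unfolding infdist_notempty[OF range_nonempty]
 proof (rule cINF_greatest)
  fix a assume "a : range (%k::int. 2 * real_of_int k)"
  then obtain j :: int where a: "a = 2 * of_int j" by blast
  have "x <= dist (2 * of_int k + x) (2 * of_int j)"
  proof (cases "j <= k")
  case True
  hence "real_of_int j <= real_of_int k" by simp
  thus ?thesis using assms by(simp add: dist_real_def)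
  next
  case False
  hence "real_of_int j >= real_of_int k + 1" by(metis add.commute int_less_real_le not_le of_int_1 of_int_add)
  thus ?thesis using assms by(simp add: dist_real_def)
  qed
  thus "x <= dist (2 * of_int k + x) a" unfolding a .
 qed simp
qed

text \<open>After multiplication by \<open>3 ^ n\<close> the earlier digits contribute an even
  integer and the later ones at most 1/3. The remainder thus lies in [0, 1/3] or [2/3, 1], on which
  \<open>zigzag\<close> is constantly 0 or 1.\<close>

lemma cantor_digit:
 fixes c :: "nat => real"
 assumes c: "!!n. c n = 0 | c n = 1"
 shows "zigzag (3 ^ n * (\<Sum>m. 2 * c m * (1/3) ^ Suc m)) = c n"
proof -
 have c01: "0 <= c m" "c m <= 1" for m using c[of m] by auto
 let ?f = "%m. 2 * c m * (1/3::real) ^ Suc m"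
 have gs: "summable (%m. 2 * (1/3::real) ^ Suc m)"
  by(intro summable_mult) (simp add: summable_Suc_iff[where f="%n. (1/3::real)^n"])
 have sm: "summable ?f"
  by(rule summable_comparison_test'[OF gs, of 0]) (use c01 in "auto intro!: mult_right_mono")
 define tail where "tail = (\<Sum>m. ?f (m + n)) * 3 ^ n"
 have split: "3 ^ n * (\<Sum>m. ?f m) = 3 ^ n * (SUM m<n. ?f m) + tail"
  using suminf_split_initial_segment[OF sm, of n] by(simp add: tail_def algebra_simps)
 have "EX k::int. 3 ^ n * (SUM m<n. ?f m) = 2 * of_int k" for n
 proof (induction n)
  case (Suc n)
  then obtain k :: int where k: "3 ^ n * (SUM m<n. ?f m) = 2 * of_int k" by blast
  have cn: "c n = of_int (if c n = 0 then 0 else 1)" using c[of n] by auto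
  have "3 ^ Suc n * (SUM m<Suc n. ?f m) = 3 * (3 ^ n * (SUM m<n. ?f m)) + 2 * c n"
  by(simp add: algebra_simps power_divide)
  also have "... = 2 * of_int (3 * k + (if c n = 0 then 0 else 1))" using k cn by simp
  finally show ?case by blast
 qed simp
 then obtain k :: int where k: "3 ^ n * (SUM m<n. ?f m) = 2 * of_int k" by blast
 have sm2: "summable (%m. ?f (m + Suc n))" using sm by(rule summable_ignore_initial_segment)
 have geo: "(%m. 2 * (1/3::real) ^ Suc (m + Suc n)) sums (2 * ((1/3) ^ (n + 2) * (1 / (1 - 1/3))))"
 proof -
  have "(%m. (1/3::real) ^ m) sums (1 / (1 - 1/3))" by(rule geometric_sums) simp
  from sums_mult[OF sums_mult[OF this, of "(1/3) ^ (n + 2)"], of 2] show ?thesis by(simp add: power_add mult_ac)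
 qed
 have b2: "(\<Sum>m. ?f (m + Suc n)) <= 2 * ((1/3) ^ (n + 2) * (1 / (1 - 1/3)))"
  unfolding sums_unique[OF geo] using c01
  by(intro suminf_le sm2 sums_summable[OF geo]) (auto intro!: mult_right_mono)
 have b1: "0 <= (\<Sum>m. ?f (m + Suc n))" using c01 by(intro suminf_nonneg sm2) auto
 have "(\<Sum>m. ?f (m + n)) = ?f n + (\<Sum>m. ?f (m + Suc n))"
  using suminf_split_head[of "%m. ?f (m + n)"] summable_ignore_initial_segment[OF sm, of n] by simp
 hence tl: "tail = 2/3 * c n + 3 ^ n * (\<Sum>m. ?f (m + Suc n))"
  by(simp add: tail_def algebra_simps power_divide)
 have "3 ^ n * (\<Sum>m. ?f (m + Suc n)) <= 3 ^ n * (2 * ((1/3) ^ (n + 2) * (1 / (1 - 1/3))))"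
  using b2 by(intro mult_left_mono) auto
 also have "... = 1/3" by(simp add: power_add power_divide)
 finally have up: "3 ^ n * (\<Sum>m. ?f (m + Suc n)) <= 1/3" .
 have lo: "0 <= 3 ^ n * (\<Sum>m. ?f (m + Suc n))" using b1 by simp
 have t01: "0 <= tail" "tail <= 1" using tl up lo c01[of n] by auto
 have "zigzag (2 * of_int k + tail) = max 0 (min 1 (3 * tail - 1))"
  unfolding zigzag_def infdist_even[OF t01] ..
 also have "... = c n"
 proof -
  have "c n = 0 ==> 0 <= tail & tail <= 1/3" "c n = 1 ==> 2/3 <= tail" using tl up lo by simp_all
  thus ?thesis using c[of n] by(auto simp: max_def min_def)
 qed
 finally show ?thesis unfolding split k .
qed

lemma binary_expansion:
 assumes "0 <= x" "x < (1::real)"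
 obtains b :: "nat => real" where "!!n. b n = 0 | b n = 1" "(%n. b n * (1/2) ^ Suc n) sums x"
proof -
 define F where "F n = \<lfloor>2 ^ n * x\<rfloor>" for n
 define b where "b n = real_of_int (F (Suc n) - 2 * F n)" for n :: nat
 have b01: "b n = 0 | b n = (1::real)" for n
 proof -
  have "of_int (F n) <= 2 ^ n * x" "2 ^ n * x < of_int (F n) + 1" unfolding F_def by linarith+
  moreover have "of_int (F (Suc n)) <= 2 * (2 ^ n * x)" "2 * (2 ^ n * x) < of_int (F (Suc n)) + 1"
  using floor_correct[of "2 ^ Suc n * x"] unfolding F_def by(simp_all add: mult.assoc)
  ultimately have "real_of_int (F (Suc n)) < of_int (2 * F n + 2)" "real_of_int (2 * F n) < of_int (F (Suc n) + 1)" by simp_all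
  hence "F (Suc n) < 2 * F n + 2" "2 * F n < F (Suc n) + 1" unfolding of_int_less_iff .
  hence "F (Suc n) - 2 * F n = 0 | F (Suc n) - 2 * F n = 1" by linarith
  thus ?thesis unfolding b_def by auto
 qed
 have F0: "F 0 = 0" using assms by(simp add: F_def floor_eq_iff)
 have part: "(SUM k<n. b k * (1/2) ^ Suc k) = of_int (F n) / 2 ^ n" for n
  by(induction n) (auto simp: F0 b_def field_simps)
 have "(%n. of_int (F n) / 2 ^ n) ----> x"
 proof (rule LIMSEQ_I)
  fix r :: real assume "r > 0"
  then obtain N where N: "(1/2::real) ^ N < r" using real_arch_pow_inv[of r "1/2"] by auto
  have "norm (of_int (F n) / 2 ^ n - x) < r" if n: "n >= N" for n
  proof -
  have "of_int (F n) <= 2 ^ n * x" "2 ^ n * x < of_int (F n) + 1" unfolding F_def by linarith+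
  hence "abs (of_int (F n) - 2 ^ n * x) / 2 ^ n <= 1 / 2 ^ n" by(intro divide_right_mono) auto
  moreover have "of_int (F n) / 2 ^ n - x = (of_int (F n) - 2 ^ n * x) / 2 ^ n" by(simp add: field_simps)
  ultimately have "abs (of_int (F n) / 2 ^ n - x) <= (1/2) ^ n" by(simp add: power_divide)
  also have "(1/2::real) ^ n <= (1/2) ^ N" using n by(intro power_decreasing) auto
  finally show ?thesis using N by simp
  qed
  thus "EX N. ALL n>=N. norm (of_int (F n) / 2 ^ n - x) < r" by blast
 qed
 hence "(%n. b n * (1/2) ^ Suc n) sums x" unfolding sums_def part .
 with b01 that show ?thesis by blast
qed

lemma space_filling_curve:
 fixes K :: "'e::euclidean_space set"
 assumes K: "bounded K"
 obtains Phi :: "real => 'e" where "continuous_on UNIV Phi" "K <= Phi ` {0..1}"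
proof -
 obtain B where B: "B > 0" "!!x. x : K ==> norm x < B"
 proof -
  obtain b where "b > 0" "ALL x:K. norm x <= b" using K unfolding bounded_pos by blast
  hence "b + 1 > 0" "!!x. x : K ==> norm x < b + 1" by fastforce+
  thus ?thesis by(rule that)
 qed
 define d where "d = DIM('e)"
 have d: "d > 0" by(simp add: d_def)
 obtain e :: "nat => 'e" where e: "bij_betw e {0..<d} Basis"
  unfolding d_def using ex_bij_betw_nat_finite[OF finite_Basis] by blast
 define P where "P i t = (\<Sum>k. zigzag (3 ^ (d * k + i) * t) * (1/2) ^ Suc k)" for i t
 have cP: "continuous_on UNIV (P i)" for i
 proof -
  have "uniform_limit UNIV (%n t. SUM k<n. zigzag (3 ^ (d * k + i) * t) * (1/2) ^ Suc k) (P i) sequentially"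
  unfolding P_def
  proof (rule Weierstrass_m_test)
  show "norm (zigzag (3 ^ (d * k + i) * t) * (1/2) ^ Suc k) <= (1/2) ^ Suc k" for k t
  using zigzag_bounds[of "3 ^ (d * k + i) * t"] by(simp add: abs_mult mult_left_le_one_le)
  show "summable (%k. (1/2::real) ^ Suc k)" by(simp add: summable_Suc_iff[where f="%n. (1/2::real)^n"])
  qed
  thus ?thesis
  by(rule uniform_limit_theorem[rotated]) (auto intro!: always_eventually continuous_intros continuous_on_zigzag)
 qed
 define Phi where "Phi t = (SUM i:{0..<d}. (2 * B * P i t - B) *\<^sub>R e i)" for t
 have c: "continuous_on UNIV Phi" unfolding Phi_def by(intro continuous_intros cP)
 have "x : Phi ` {0..1}" if x: "x : K" for x
 proof -
  define z where "z i = (x \<bullet> e i + B) / (2 * B)" for i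
  have z: "0 <= z i" "z i < 1" if i: "i < d" for i
  proof -
  have "e i : Basis" using e i by(auto simp: bij_betw_def)
  hence "abs (x \<bullet> e i) < B" using Basis_le_norm[of "e i" x] B(2)[OF x] by linarith
  thus "0 <= z i" "z i < 1" using B(1) by(auto simp: z_def field_simps abs_less_iff)
  qed
  have "ALL i. EX b. i < d --> (ALL n. b n = 0 | b n = (1::real)) & (%n. b n * (1/2) ^ Suc n) sums z i"
  proof
  fix i
  show "EX b. i < d --> (ALL n. b n = 0 | b n = (1::real)) & (%n. b n * (1/2) ^ Suc n) sums z i"
  proof (cases "i < d")
  case True
  obtain b where "!!n. b n = 0 | b n = (1::real)" "(%n. b n * (1/2) ^ Suc n) sums z i"
  by(rule binary_expansion[OF z[OF True]]) blast
  thus ?thesis by blast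
  qed simp
  qed
  from choice[OF this] obtain b where b: "ALL i. i < d --> (ALL n. b i n = 0 | b i n = (1::real)) & (%n. b i n * (1/2) ^ Suc n) sums z i"
  by blast
  \<comment> \<open>The \<open>d\<close> digit sequences are interleaved: digit
    \<open>d * k + i\<close> is the \<open>k\<close>-th digit of coordinate \<open>i\<close>,
    matching the exponent in \<open>P\<close>.\<close>
  define cc where "cc n = b (n mod d) (n div d)" for n
  have c01: "cc n = 0 | cc n = 1" for n using b d by(simp add: cc_def)
  define t where "t = (\<Sum>m. 2 * cc m * (1/3) ^ Suc m)"
  have gs: "(%m. 2 * (1/3::real) ^ Suc m) sums 1"
  proof -
  have "(%m. (1/3::real) ^ m) sums (1 / (1 - 1/3))" by(rule geometric_sums) simp
  from sums_mult[OF this, of "2/3"] show ?thesis by simp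
  qed
  have le: "0 <= 2 * cc m * (1/3) ^ Suc m" "2 * cc m * (1/3) ^ Suc m <= 2 * (1/3) ^ Suc m" for m
  using c01[of m] by auto
  have sm: "summable (%m. 2 * cc m * (1/3) ^ Suc m)"
  by(rule summable_comparison_test'[OF sums_summable[OF gs], of 0]) (use le in auto)
  have t01: "t : {0..1}"
  unfolding t_def using suminf_nonneg[OF sm le(1)] suminf_le[OF le(2) sm sums_summable[OF gs]] sums_unique[OF gs] by simp
  have P: "P i t = z i" if i: "i < d" for i
  proof -
  have "zigzag (3 ^ (d * k + i) * t) = cc (d * k + i)" for k
  unfolding t_def by(rule cantor_digit[of cc, OF c01])
  moreover have "cc (d * k + i) = b i k" for k unfolding cc_def using i d by simp
  ultimately have "zigzag (3 ^ (d * k + i) * t) = b i k" for k by(simp only:)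
  thus ?thesis unfolding P_def using b i by(simp add: sums_iff)
  qed
  have "Phi t = (SUM i:{0..<d}. (x \<bullet> e i) *\<^sub>R e i)"
  unfolding Phi_def using P B(1) by(intro sum.cong) (auto simp: z_def)
  also have "... = (SUM b:Basis. (x \<bullet> b) *\<^sub>R b)" by(rule sum.reindex_bij_betw[OF e])
  also have "... = x" by(rule euclidean_representation)
  finally show ?thesis using t01 by blast
 qed
 thus ?thesis using that[OF c] by blast
qed

text \<open>A continuous curve onto a set containing \<open>K\<close> reduces compactness of
  measures on \<open>K\<close> to the selection theorem on the real line: the points are pulled back
  to parameters in \<open>{0..1}\<close> and the limit is pushed forward again. The section
  \<open>e\<close> may be discontinuous, since it only moves point masses.\<close>

lemma weak_limit_of_discrete_measures:
 fixes K :: "'e::euclidean_space set" and X :: "nat => nat => 'e" and p :: "nat => nat => real"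
 assumes K: "compact K" and X: "!!n k. k < N n ==> X n k : K"
  and p: "!!n k. k < N n ==> p n k >= 0" "!!n. (SUM k<N n. p n k) = 1"
 obtains r M where "strict_mono (r :: nat => nat)" "prob_space M" "sets M = sets borel" "AE x in M. x : K"
  "!!f :: 'e => real. continuous_on K f ==>
  (%j. SUM k<N (r j). p (r j) k * f (X (r j) k)) ----> (\<integral>x. (if x : K then f x else 0) \<partial>M)"
proof -
 obtain Phi :: "real => 'e" where Phi: "continuous_on UNIV Phi" "K <= Phi ` {0..1}"
  by(rule space_filling_curve[OF compact_imp_bounded[OF K]]) blast
 define e where "e x = (SOME t. t : {0..1} & Phi t = x)" for x
 have e: "e x : {0..1} & Phi (e x) = x" if "x : K" for x
  unfolding e_def by(rule someI_ex) (use Phi(2) that in blast)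
 define q where "q n k = (if k < N n then p n k else 0)" for n k
 have q0: "q n k >= 0" for n k using p(1) by(simp add: q_def)
 have q1: "(\<integral>\<^sup>+ k. ennreal (q n k) \<partial>count_space UNIV) = 1" for n
 proof -
  have "(\<integral>\<^sup>+ k. ennreal (q n k) \<partial>count_space UNIV) = (\<integral>\<^sup>+ k. ennreal (q n k) \<partial>count_space {..<N n})"
  by(rule nn_integral_count_space_eq) (auto simp: q_def)
  also have "... = (SUM k<N n. ennreal (q n k))" by(simp add: nn_integral_count_space_finite)
  also have "... = ennreal (SUM k<N n. q n k)" using q0 by(intro sum_ennreal) auto
  also have "(SUM k<N n. q n k) = (SUM k<N n. p n k)" by(intro sum.cong) (auto simp: q_def)
  finally show ?thesis using p(2) by simp
 qed
 define P where "P n = embed_pmf (q n)" for n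
 have pmfP: "pmf (P n) k = q n k" for n k unfolding P_def by(rule pmf_embed_pmf[OF q0 q1])
 have setP: "set_pmf (P n) <= {..<N n}" for n by(auto simp: set_pmf_iff pmfP q_def split: if_splits)
 define nu where "nu n = distr (measure_pmf (P n)) borel (%k. e (X n k))" for n
 have rd: "real_distribution (nu n)" for n
  unfolding nu_def real_distribution_def real_distribution_axioms_def
  by(auto intro!: prob_space.prob_space_distr measure_pmf.prob_space_axioms)
 have intnu: "(\<integral>t. f t \<partial>nu n) = (SUM k<N n. p n k * f (e (X n k)))"
  if [measurable]: "f : borel_measurable borel" for f :: "real => real" and n
 proof -
  have "(\<integral>t. f t \<partial>nu n) = (\<integral>k. f (e (X n k)) \<partial>measure_pmf (P n))" unfolding nu_def by(rule integral_distr) auto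
  also have "... = (SUM k<N n. f (e (X n k)) * pmf (P n) k)"
  by(rule integral_measure_pmf_real) (use setP in auto)
  also have "... = (SUM k<N n. p n k * f (e (X n k)))" by(intro sum.cong) (auto simp: pmfP q_def)
  finally show ?thesis .
 qed
 have "tight nu"
  unfolding tight_def
 proof (intro conjI allI impI rd)
  fix eps :: real assume "eps > 0"
  \<comment> \<open>Tightness is phrased with half-open intervals, hence a left end below 0.\<close>
  have "measure (nu n) {-1<..1} = 1" for n
  proof -
  have "measure (nu n) {-1<..1} = measure (measure_pmf (P n)) ((%k. e (X n k)) -` {-1<..1})"
  unfolding nu_def by(subst measure_distr) auto
  also have "... = 1"
  proof (rule measure_pmf.prob_eq_1[THEN iffD2])
  show "AE k in measure_pmf (P n). k : (%k. e (X n k)) -` {-1<..1}"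
  proof (rule AE_pmfI)
  fix k assume "k : set_pmf (P n)"
  hence "k < N n" using setP by auto
  thus "k : (%k. e (X n k)) -` {-1<..1}" using e[OF X, of k n] by auto
  qed
  qed simp
  finally show ?thesis .
  qed
  thus "EX a b. a < b & (ALL n. 1 - eps < measure (nu n) {a<..b})"
  using \<open>eps > 0\<close> by(intro exI[of _ "-1"] exI[of _ 1]) auto
 qed
 then obtain r M' where r: "strict_mono (r :: nat => nat)" and M': "real_distribution M'" "weak_conv_m (nu o id o r) M'"
  using tight_imp_convergent_subsubsequence[of nu id] strict_mono_id by blast
 interpret M': real_distribution M' by fact
 have mP: "Phi : borel_measurable borel" using Phi(1) by(rule borel_measurable_continuous_onI)
 define M where "M = distr M' borel Phi"
 have pM: "prob_space M" unfolding M_def using mP by(intro M'.prob_space_distr) simp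
 have sM: "sets M = sets borel" by(simp add: M_def)
 have conv: "(%j. SUM k<N (r j). p (r j) k * g (X (r j) k)) ----> (\<integral>x. g x \<partial>M)"
  if g: "continuous_on UNIV g" and gb: "!!x. abs (g x) <= B" for g :: "'e => real" and B
 proof -
  have cg: "continuous_on UNIV (%t. g (Phi t))" by(rule continuous_on_compose2[OF g Phi(1)]) simp
  have "(%j. integral\<^sup>L ((nu o id o r) j) (%t. g (Phi t))) ----> integral\<^sup>L M' (%t. g (Phi t))"
  by(rule weak_conv_imp_integral_bdd_continuous_conv[OF _ M'(1,2), where B = B])
  (use rd cg gb in "auto simp: continuous_on_eq_continuous_at")
  moreover have "integral\<^sup>L M' (%t. g (Phi t)) = (\<integral>x. g x \<partial>M)"
  unfolding M_def using mP borel_measurable_continuous_onI[OF g] by(intro integral_distr[symmetric]) auto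
  moreover have "integral\<^sup>L ((nu o id o r) j) (%t. g (Phi t)) = (SUM k<N (r j). p (r j) k * g (X (r j) k))" for j
  using intnu[OF borel_measurable_continuous_onI[OF cg], of "r j"] e[OF X] by(auto intro!: sum.cong)
  ultimately show ?thesis by simp
 qed
 have ae: "AE x in M. x : K"
 proof (cases "K = {}")
  case True
  hence "N 0 = 0" using X[of 0 0] by(cases "N 0") auto
  thus ?thesis using p(2)[of 0] by simp
 next
  case False
  let ?g = "%x. min 1 (infdist x K)"
  have cg: "continuous_on UNIV ?g" by(intro continuous_intros)
  have g0: "?g (X n k) = 0" if "k < N n" for n k using X[OF that] by simp
  have "(%j. SUM k<N (r j). p (r j) k * ?g (X (r j) k)) ----> (\<integral>x. ?g x \<partial>M)"
  by(rule conv[OF cg, of 1]) (simp add: infdist_nonneg)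
  moreover have "(SUM k<N (r j). p (r j) k * ?g (X (r j) k)) = 0" for j using g0 by(intro sum.neutral) auto
  ultimately have z: "(\<integral>x. ?g x \<partial>M) = 0" by(simp add: LIMSEQ_const_iff)
  interpret M: prob_space M by fact
  have "integrable M ?g"
  proof (rule M.integrable_const_bound[where B = 1])
  show "?g : borel_measurable M" using borel_measurable_continuous_onI[OF cg] by(simp add: measurable_cong_sets[OF sM refl])
  qed (simp add: infdist_nonneg)
  hence "AE x in M. ?g x = 0"
  using z by(subst integral_nonneg_eq_0_iff_AE[symmetric]) (auto simp: infdist_nonneg)
  moreover have "x : K" if "?g x = 0" for x
  using that in_closed_iff_infdist_zero[OF compact_imp_closed[OF K] False, of x] by(simp add: min_def split: if_splits)
  ultimately show ?thesis by(rule eventually_mono)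
 qed
 show ?thesis
 proof (rule that[OF r pM sM ae])
  fix f :: "'e => real" assume f: "continuous_on K f"
  have "bounded (f ` K)" using compact_continuous_image[OF f K] by(rule compact_imp_bounded)
  then obtain B where B: "B > 0" "!!x. x : K ==> norm (f x) <= B" unfolding bounded_pos by auto
  obtain g where g: "continuous_on UNIV g" "!!x. x : K ==> g x = f x" "!!x. x : UNIV ==> norm (g x) <= B"
  by(rule Tietze[OF f _ less_imp_le[OF B(1)] B(2), of UNIV]) (use compact_imp_closed[OF K] in auto)
  have "(%j. SUM k<N (r j). p (r j) k * g (X (r j) k)) ----> (\<integral>x. g x \<partial>M)"
  by(rule conv[OF g(1), of B]) (use g(3) in auto)
  moreover have "(SUM k<N (r j). p (r j) k * g (X (r j) k)) = (SUM k<N (r j). p (r j) k * f (X (r j) k))" for j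
  using g(2) X by(intro sum.cong) auto
  moreover have "(\<integral>x. g x \<partial>M) = (\<integral>x. (if x : K then f x else 0) \<partial>M)"
  proof (rule integral_cong_AE)
  show g': "g : borel_measurable M" using borel_measurable_continuous_onI[OF g(1)] by(simp add: measurable_cong_sets[OF sM refl])
  have "K : sets M" unfolding sM using compact_imp_closed[OF K] by(rule borel_closed)
  hence "K Int space M : sets M" by(rule sets.Int[OF _ sets.top])
  hence "(%x. if x : K then g x else 0) : borel_measurable M"
  by(intro measurable_If_set g' borel_measurable_const)
  moreover have "(%x. if x : K then g x else 0) = (%x. if x : K then f x else 0)" using g(2) by auto
  ultimately show "(%x. if x : K then f x else 0) : borel_measurable M" by simp
  show "AE x in M. g x = (if x : K then f x else 0)" using ae by(rule AE_mp) (use g(2) in auto)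
  qed
  ultimately show "(%j. SUM k<N (r j). p (r j) k * f (X (r j) k)) ----> (\<integral>x. (if x : K then f x else 0) \<partial>M)" by simp
 qed
qed

section \<open>The Legendre transform in one chart\<close>

locale local_hamiltonian =
 fixes U :: "'e::euclidean_space set" and h :: "'e => 'e => real => real"
 assumes U: "open U"
  and cont: "continuous_on (U \<times> UNIV \<times> UNIV) (%(y, z, r). h y z r)"
  and conv: "!!y r. y : U ==> convex_on UNIV (%z. h y z r)"
  and superlin: "!!y r k. y : U ==> EX R. ALL z. norm z >= R --> h y z r >= k * norm z"
begin

lemma continuous_on_h:
 assumes "continuous_on S f" "continuous_on S g" "continuous_on S q" "!!x. x : S ==> f x : U"
 shows "continuous_on S (%x. h (f x) (g x) (q x))"
proof -
 have "(%x. (f x, g x, q x)) ` S <= U \<times> UNIV \<times> UNIV" using assms(4) by auto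
 from continuous_on_compose2[OF cont continuous_on_Pair[OF assms(1) continuous_on_Pair[OF assms(2,3)]] this]
 show ?thesis by simp
qed

lemma tendsto_h:
 assumes "f ----> y" "g ----> z" "q ----> r" "y : U"
 shows "(%n. h (f n) (g n) (q n)) ----> h y z r"
proof -
 have "open (U \<times> (UNIV::'e set) \<times> (UNIV::real set))" by(intro open_Times U open_UNIV)
 hence "isCont (%(y, z, r). h y z r) (y, z, r)"
  using cont assms(4) by(simp add: continuous_on_eq_continuous_at)
 moreover have "(%n. (f n, g n, q n)) ----> (y, z, r)" by(intro tendsto_intros assms)
 ultimately show ?thesis using isCont_tendsto_compose by fastforce
qed

lemma h_bounded:
 assumes "compact K" "K <= U"
 obtains B where "ALL y:K. ALL z r. norm z <= P --> abs r <= rho --> abs (h y z r) <= B"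
proof -
 have c: "compact (K \<times> cball (0::'e) P \<times> cball (0::real) rho)" using assms by(intro compact_Times) auto
 have "continuous_on (K \<times> cball (0::'e) P \<times> cball (0::real) rho) (%(y, z, r). h y z r)"
  by(rule continuous_on_subset[OF cont]) (use assms in auto)
 from compact_imp_bounded[OF compact_continuous_image[OF this c]]
 obtain B where "ALL x:(%(y, z, r). h y z r) ` (K \<times> cball 0 P \<times> cball 0 rho). norm x <= B" by(auto simp: bounded_iff)
 hence "ALL y:K. ALL z r. norm z <= P --> abs r <= rho --> abs (h y z r) <= B" by fastforce
 thus ?thesis by(rule that)
qed

text \<open>By convexity, growth on one sphere propagates outwards; compactness makes it uniform.\<close>

lemma uniform_superlinear:
 assumes K: "compact K" "K <= U"
 obtains C where "ALL y:K. ALL z r. abs r <= rho --> k * norm z - C <= h y z r"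
proof -
 have radial: "h y (t *\<^sub>R z) r <= (1 - t) * h y 0 r + t * h y z r" if "y : K" "0 <= t" "t <= 1" for y z r t
  using convex_onD[OF conv that(2,3), of y 0 z r] that(1) K by auto
 have "EX R>=1. ALL y:K. ALL z r. norm z = R --> abs r <= rho --> h y 0 r + k * R <= h y z r"
 proof (rule ccontr)
  assume no: "~ ?thesis"
  have "EX y z r. y : K & norm z = 1 & abs r <= rho & h y (real (Suc n) *\<^sub>R z) r < h y 0 r + k * real (Suc n)" for n
  proof -
  have "1 <= real (Suc n)" by simp
  then obtain y z r where "y : K" "norm z = real (Suc n)" "abs r <= rho" "~ h y 0 r + k * real (Suc n) <= h y z r"
  using no by blast
  thus ?thesis by(intro exI[of _ y] exI[of _ "(1 / real (Suc n)) *\<^sub>R z"] exI[of _ r]) (auto simp: not_le)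
  qed
  then obtain y z r where yzr: "!!n. y n : K" "!!n. norm (z n) = 1" "!!n. abs (r n) <= rho"
  "!!n. h (y n) (real (Suc n) *\<^sub>R z n) (r n) < h (y n) 0 (r n) + k * real (Suc n)" by metis
  have "compact (K \<times> sphere (0::'e) 1 \<times> cball (0::real) rho)" using K by(intro compact_Times) auto
  moreover have "(y n, z n, r n) : K \<times> sphere 0 1 \<times> cball 0 rho" for n using yzr by auto
  ultimately obtain l s where l: "l : K \<times> sphere (0::'e) 1 \<times> cball (0::real) rho" "strict_mono (s :: nat => nat)"
  "((%n. (y n, z n, r n)) o s) ----> l" unfolding compact_def by meson
  obtain y' z' r' where lr: "l = (y', z', r')" by(cases l)
  have y': "y' : U" "norm z' = 1" using l(1) lr K by auto
  have lim: "(%n. y (s n)) ----> y'" "(%n. z (s n)) ----> z'" "(%n. r (s n)) ----> r'"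
  using tendsto_fst[OF l(3)] tendsto_fst[OF tendsto_snd[OF l(3)]] tendsto_snd[OF tendsto_snd[OF l(3)]] by(auto simp: lr o_def)
  \<comment> \<open>Growth with slope \<open>k'\<close> exceeds \<open>h y' 0 r' + k * R\<close> by
    a margin of at least \<open>R\<close> as soon as \<open>R \<ge> 1\<close>.\<close>
  define k' where "k' = abs k + abs (h y' 0 r') + 1"
  obtain R0 where R0: "ALL z. norm z >= R0 --> h y' z r' >= k' * norm z" using superlin[OF y'(1)] by blast
  obtain R :: nat where "max R0 1 <= real R" using real_arch_simple by blast
  hence R: "real R >= R0" "real R >= 1" by auto
  have "h y' (real R *\<^sub>R z') r' <= h y' 0 r' + k * real R"
  proof (rule LIMSEQ_le)
  show "(%n. h (y (s n)) (real R *\<^sub>R z (s n)) (r (s n))) ----> h y' (real R *\<^sub>R z') r'"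
  "(%n. h (y (s n)) 0 (r (s n)) + k * real R) ----> h y' 0 r' + k * real R"
  by(intro tendsto_intros tendsto_h lim y')+
  show "EX N. ALL n>=N. h (y (s n)) (real R *\<^sub>R z (s n)) (r (s n)) <= h (y (s n)) 0 (r (s n)) + k * real R"
  proof (intro exI[of _ R] allI impI)
  fix n assume "R <= n"
  hence sn: "R <= s n" using seq_suble[OF l(2), of n] by linarith
  let ?t = "real R / real (Suc (s n))" and ?h = "%z. h (y (s n)) z (r (s n))"
  have "?h (?t *\<^sub>R real (Suc (s n)) *\<^sub>R z (s n)) <= (1 - ?t) * ?h 0 + ?t * ?h (real (Suc (s n)) *\<^sub>R z (s n))"
  by(rule radial[OF yzr(1)]) (use sn in auto)
  also have "... <= (1 - ?t) * ?h 0 + ?t * (?h 0 + k * real (Suc (s n)))"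
  using yzr(4)[of "s n"] by(intro add_left_mono mult_left_mono) auto
  also have "... = ?h 0 + k * (?t * real (Suc (s n)))" by(simp only: ring_distribs) simp
  finally show "?h (real R *\<^sub>R z (s n)) <= ?h 0 + k * real R" by simp
  qed
  qed
  moreover have "h y' (real R *\<^sub>R z') r' >= k' * R" using R0[rule_format, of "real R *\<^sub>R z'"] y' R by simp
  moreover have "k' * R = abs k * R + abs (h y' 0 r') * R + R" by(simp add: k'_def algebra_simps)
  moreover have "abs k * R >= k * R" by(intro mult_right_mono) auto
  moreover have "abs (h y' 0 r') * R >= abs (h y' 0 r')" using mult_left_mono[OF R(2) abs_ge_zero[of "h y' 0 r'"]] by simp
  ultimately show False using R by linarith
 qed
 then obtain R where R: "R >= 1" "!!y z r. y : K ==> norm z = R ==> abs r <= rho ==> h y 0 r + k * R <= h y z r" by blast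
 obtain B where B: "ALL y:K. ALL z r. norm z <= R --> abs r <= rho --> abs (h y z r) <= B" by(rule h_bounded[OF K])
 show ?thesis
 proof (rule that[of "B + abs k * R"], intro ballI allI impI)
  fix y z r assume y: "y : K" and r: "abs r <= rho"
  have kR: "abs k * R >= 0" using R by simp
  show "k * norm z - (B + abs k * R) <= h y z r"
  proof (cases "norm z <= R")
  case True
  hence "k * norm z <= abs k * R" by(intro mult_mono) auto
  thus ?thesis using B[rule_format, OF y True r] by linarith
  next
  case False
  hence z: "norm z > 0" using R by linarith
  let ?t = "R / norm z"
  have t: "0 < ?t" "?t <= 1" using z False R by auto
  have "h y 0 r + k * R <= (1 - ?t) * h y 0 r + ?t * h y z r"
  by(rule order_trans[OF R(2)[OF y _ r, of "?t *\<^sub>R z"] radial[OF y]]) (use t z R(1) in auto)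
  moreover have "k * R = ?t * (k * norm z)" using z by simp
  ultimately have "?t * (h y 0 r + k * norm z) <= ?t * h y z r" by(simp only: ring_distribs)
  hence "h y 0 r + k * norm z <= h y z r" using t(1) by(simp only: mult_le_cancel_left_pos)
  thus ?thesis using B[rule_format, OF y _ r, of 0] R(1) kR unfolding norm_zero by linarith
  qed
 qed
qed

definition lag :: "'e => 'e => real => real" where
 "lag y w r = (SUP z. z \<bullet> w - h y z r)"

lemma ex_argmax:
 assumes y: "y : U"
 shows "EX z. ALL z'. z' \<bullet> w - h y z' r <= z \<bullet> w - h y z r"
proof -
 obtain C where C: "ALL y:{y}. ALL z r'. abs r' <= abs r --> (norm w + 1) * norm z - C <= h y z r'"
  by(rule uniform_superlinear[of "{y}" "abs r" "norm w + 1"]) (use y in auto)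
 define P where "P = abs (C + h y 0 r) + 1"
 have "continuous_on (cball 0 P) (%z. z \<bullet> w - h y z r)"
  by(intro continuous_intros continuous_on_h) (use y in auto)
 moreover have "cball (0::'e) P ~= {}" by(simp add: P_def)
 ultimately obtain z where z: "z : cball 0 P" "!!z'. z' : cball 0 P ==> z' \<bullet> w - h y z' r <= z \<bullet> w - h y z r"
  using continuous_attains_sup[OF compact_cball[of "0::'e" P], of "%z. z \<bullet> w - h y z r"] by blast
 have "z' \<bullet> w - h y z' r <= z \<bullet> w - h y z r" for z'
 proof (cases "z' : cball 0 P")
  case False
  have "z' \<bullet> w <= norm z' * norm w" by(rule norm_cauchy_schwarz)
  moreover have "h y z' r >= (norm w + 1) * norm z' - C" using C by simp
  moreover have "(norm w + 1) * norm z' = norm z' * norm w + norm z'" by(simp add: algebra_simps)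
  ultimately have "z' \<bullet> w - h y z' r <= C - norm z'" by linarith
  also have "... <= - h y 0 r" using False by(auto simp: P_def)
  also have "... <= z \<bullet> w - h y z r" using z(2)[of 0] by(simp add: P_def)
  finally show ?thesis .
 qed (use z in auto)
 thus ?thesis by blast
qed

lemma lag_argmax:
 assumes y: "y : U"
 obtains z where "lag y w r = z \<bullet> w - h y z r" "!!z'. z' \<bullet> w - h y z' r <= lag y w r"
proof -
 obtain z where z: "ALL z'. z' \<bullet> w - h y z' r <= z \<bullet> w - h y z r" using ex_argmax[OF y] by blast
 have "lag y w r = z \<bullet> w - h y z r" unfolding lag_def
  by(rule cSup_eq_maximum) (use z in auto)
 thus ?thesis using that z by simp
qed

lemma fenchel: "y : U ==> z \<bullet> w <= lag y w r + h y z r"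
 using lag_argmax[of y w r] by(metis diff_le_eq)

lemma argmax_bound:
 assumes K: "compact K" "K <= U"
 obtains P where "ALL y:K. ALL w r z. norm w <= W --> abs r <= rho --> lag y w r = z \<bullet> w - h y z r --> norm z <= P"
proof -
 obtain C where C: "ALL y:K. ALL z r'. abs r' <= rho --> (W + 1) * norm z - C <= h y z r'" by(rule uniform_superlinear[OF K])
 obtain B where B: "ALL y:K. ALL z r. norm z <= 0 --> abs r <= rho --> abs (h y z r) <= B" by(rule h_bounded[OF K])
 have "norm z <= C + B" if y: "y : K" and w: "norm w <= W" and r: "abs r <= rho" and z: "lag y w r = z \<bullet> w - h y z r" for y w r z
 proof -
  have yU: "y : U" using y K by blast
  have "z \<bullet> w <= norm z * norm w" by(rule norm_cauchy_schwarz)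
  also have "... <= norm z * W" using w by(intro mult_left_mono) auto
  finally have "z \<bullet> w - h y z r <= C - norm z" using C[rule_format, OF y r, of z] by(simp add: algebra_simps)
  moreover have "- B <= lag y w r" using fenchel[OF yU, of 0 w r] B[rule_format, OF y _ r, of 0] by(auto simp: abs_le_iff)
  ultimately show ?thesis using z by linarith
 qed
 thus ?thesis using that by blast
qed

text \<open>All maximising momenta lie in one ball, on which the function maximised is uniformly
  continuous in all variables. Inserting the maximiser of each problem as a competitor in the other
  gives the two inequalities.\<close>

lemma lag_tendsto:
 assumes f: "f ----> y" and g: "g ----> w" and q: "q ----> r" and y: "y : U" and fU: "!!n. f n : U"
 shows "(%n. lag (f n) (g n) (q n)) ----> lag y w r"
proof (rule LIMSEQ_I)
 fix e :: real assume e: "e > 0"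
 define K where "K = insert y (range f)"
 have K: "compact K" "K <= U" using f fU y unfolding K_def by(auto intro: compact_sequence_with_limit)
 have "bounded (range g)" "bounded (range q)"
  using convergent_imp_bounded g q by blast+
 then obtain W rho where W: "!!n. norm (g n) <= W" "!!n. abs (q n) <= rho" unfolding bounded_iff by fastforce
 have W': "norm w <= W" "abs r <= rho"
  using Lim_bounded[OF tendsto_norm[OF g], of 0 W] Lim_bounded[OF tendsto_rabs[OF q], of 0 rho] W by auto
 obtain P where P: "ALL y:K. ALL w r z. norm w <= W --> abs r <= rho --> lag y w r = z \<bullet> w - h y z r --> norm z <= P"
  by(rule argmax_bound[OF K])
 let ?S = "K \<times> cball (0::'e) W \<times> cball (0::real) rho \<times> cball (0::'e) P"
 let ?F = "%x. snd (snd (snd x)) \<bullet> fst (snd x) - h (fst x) (snd (snd (snd x))) (fst (snd (snd x)))"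
 have cF: "continuous_on ?S ?F" by(intro continuous_intros continuous_on_h) (use K in auto)
 have "compact ?S" using K by(intro compact_Times) auto
 from compact_uniformly_continuous[OF cF this] obtain d where d: "d > 0"
  "ALL x:?S. ALL x':?S. dist x' x < d --> dist (?F x') (?F x) < e"
  unfolding uniformly_continuous_on_def using e by blast
 have "(%n. (f n, g n, q n)) ----> (y, w, r)" by(intro tendsto_intros assms)
 then obtain N where N: "ALL n>=N. dist (f n, g n, q n) (y, w, r) < d" using d(1) unfolding lim_sequentially by blast
 have "norm (lag (f n) (g n) (q n) - lag y w r) < e" if n: "n >= N" for n
 proof -
  have near: "dist (f n, g n, q n, z) (y, w, r, z) < d" for z :: 'e
  using N[rule_format, OF n] by(simp add: dist_prod_def)
  obtain z1 where z1: "lag (f n) (g n) (q n) = z1 \<bullet> g n - h (f n) z1 (q n)" "!!z'. z' \<bullet> g n - h (f n) z' (q n) <= lag (f n) (g n) (q n)"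
  by(rule lag_argmax[OF fU]) blast
  obtain z2 where z2: "lag y w r = z2 \<bullet> w - h y z2 r" "!!z'. z' \<bullet> w - h y z' r <= lag y w r"
  by(rule lag_argmax[OF y]) blast
  have fK: "f n : K" "y : K" by(auto simp: K_def)
  have n1: "norm z1 <= P" "norm z2 <= P" using P fK W[of n] W' z1(1) z2(1) by blast+
  have "dist (?F (f n, g n, q n, z)) (?F (y, w, r, z)) < e" if "norm z <= P" for z
  proof -
  have "(f n, g n, q n, z) : ?S" "(y, w, r, z) : ?S" using fK W[of n] W' that by auto
  thus ?thesis using d(2) near by blast
  qed
  from this[OF n1(1)] this[OF n1(2)] show ?thesis
  using z1(1) z1(2)[of z2] z2(1) z2(2)[of z1] by(auto simp: dist_real_def abs_less_iff)
 qed
 thus "EX N. ALL n>=N. norm (lag (f n) (g n) (q n) - lag y w r) < e" by blast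
qed

lemma continuous_on_lag: "continuous_on (U \<times> UNIV \<times> UNIV) (%(y, w, r). lag y w r)"
 unfolding continuous_on_sequentially
proof (intro allI impI ballI, elim conjE)
 fix x and a assume a: "a : U \<times> (UNIV::'e set) \<times> (UNIV::real set)" and x: "ALL n. x n : U \<times> (UNIV::'e set) \<times> (UNIV::real set)" "x ----> a"
 obtain y w r where ayw: "a = (y, w, r)" by(cases a) auto
 have l: "(%n. fst (x n)) ----> y" "(%n. fst (snd (x n))) ----> w" "(%n. snd (snd (x n))) ----> r"
  using tendsto_fst[OF x(2)] tendsto_fst[OF tendsto_snd[OF x(2)]] tendsto_snd[OF tendsto_snd[OF x(2)]] by(auto simp: ayw)
 have "(%n. lag (fst (x n)) (fst (snd (x n))) (snd (snd (x n)))) ----> lag y w r"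
  by(rule lag_tendsto[OF l]) (use a x(1) ayw in "auto simp: mem_Times_iff")
 thus "((%(y, w, r). lag y w r) o x) ----> (case a of (y, w, r) => lag y w r)"
  by(simp add: o_def split_beta ayw)
qed

lemma continuous_on_lag':
 assumes "continuous_on S f" "continuous_on S g" "continuous_on S q" "!!x. x : S ==> f x : U"
 shows "continuous_on S (%x. lag (f x) (g x) (q x))"
proof -
 have "(%x. (f x, g x, q x)) ` S <= U \<times> UNIV \<times> UNIV" using assms(4) by auto
 from continuous_on_compose2[OF continuous_on_lag continuous_on_Pair[OF assms(1) continuous_on_Pair[OF assms(2,3)]] this]
 show ?thesis by simp
qed

lemma lag_superlinear:
 assumes K: "compact K" "K <= U" and k: "k >= 0"
 obtains C where "ALL y:K. ALL w r. abs r <= rho --> k * norm w - C <= lag y w r"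
proof -
 obtain B where B: "ALL y:K. ALL z r. norm z <= k --> abs r <= rho --> abs (h y z r) <= B" by(rule h_bounded[OF K])
 have "k * norm w - B <= lag y w r" if y: "y : K" and r: "abs r <= rho" for y w r
 proof -
  define z where "z = (k / norm w) *\<^sub>R w"
  have "norm z <= k" using k by(simp add: z_def)
  hence "h y z r <= B" using B y r by(auto simp: abs_le_iff)
  moreover have "z \<bullet> w = k * norm w" by(cases "w = 0") (auto simp: z_def dot_square_norm power2_eq_square)
  moreover have "z \<bullet> w <= lag y w r + h y z r" using y K by(intro fenchel) auto
  ultimately show ?thesis by linarith
 qed
 thus ?thesis using that by blast
qed

text \<open>A quotient with fixed small \<open>r\<close> is continuous and uniformly close to the
  derivative \<open>E\<close>. The lemma is used twice, for the derivative of \<open>h\<close> and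
  for that of \<open>lag\<close>.\<close>

lemma uniform_quotient_tendsto:
 fixes F :: "'e => 'e => real => real"
 assumes unif: "!!K P e. compact K ==> K <= U ==> e > 0 ==> EX dlt>0. ALL y:K. ALL z r. norm z <= P --> abs r < dlt
  --> abs (F y z r - F y z 0 - r * E y z) <= e * abs r"
  and f: "f ----> y" and g: "g ----> z" and y: "y : U" and fU: "!!n. f n : U"
  and F: "!!r. (%n. F (f n) (g n) r) ----> F y z r"
 shows "(%n. E (f n) (g n)) ----> E y z"
proof (rule LIMSEQ_I)
 fix e :: real assume e: "e > 0"
 define K where "K = insert y (range f)"
 have K: "compact K" "K <= U" using f fU y unfolding K_def by(auto intro: compact_sequence_with_limit)
 have "bounded (range g)" using convergent_imp_bounded g by blast
 then obtain P where P: "!!n. norm (g n) <= P" unfolding bounded_iff by fastforce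
 have P': "norm z <= P" using Lim_bounded[OF tendsto_norm[OF g], of 0 P] P by auto
 obtain dlt where dlt: "dlt > 0" "ALL y:K. ALL z r. norm z <= P --> abs r < dlt --> abs (F y z r - F y z 0 - r * E y z) <= e/3 * abs r"
  using unif[OF K, of "e/3" P] e by auto
 define r where "r = dlt / 2"
 have r: "r > 0" "abs r < dlt" using dlt by(auto simp: r_def)
 let ?Q = "%y z. (F y z r - F y z 0) / r"
 have app: "abs (?Q y' z' - E y' z') <= e/3" if "y' : K" "norm z' <= P" for y' z'
 proof -
  have "abs (F y' z' r - F y' z' 0 - r * E y' z') <= e/3 * r" using dlt(2) that r by fastforce
  moreover have "?Q y' z' - E y' z' = (F y' z' r - F y' z' 0 - r * E y' z') / r" using r by(simp add: field_simps)
  ultimately show ?thesis using r by(simp add: abs_divide divide_le_eq)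
 qed
 have "(%n. ?Q (f n) (g n)) ----> ?Q y z" by(intro tendsto_intros F) (use r in auto)
 then obtain N where N: "ALL n>=N. abs (?Q (f n) (g n) - ?Q y z) < e/3" using e LIMSEQ_D[of _ _ "e/3"] by force
 have "norm (E (f n) (g n) - E y z) < e" if "n >= N" for n
 proof -
  have "f n : K" "y : K" by(auto simp: K_def)
  thus ?thesis using app[of "f n" "g n"] app[of y z] P[of n] P' N[rule_format, OF that]
  unfolding real_norm_def by linarith
 qed
 thus "EX N. ALL n>=N. norm (E (f n) (g n) - E y z) < e" by blast
qed

end

locale local_hamiltonian_deriv = local_hamiltonian U h
 for U :: "'e::euclidean_space set" and h :: "'e => 'e => real => real" +
 fixes D :: "'e => 'e => real" and dL :: "'e => 'e => real"
 assumes D_unif: "!!K P eps. compact K ==> K <= U ==> eps > 0 ==> EX dlt>0. ALL y:K. ALL z r. norm z <= P --> abs r < dlt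
  --> abs (h y z r - h y z 0 - r * D y z) <= eps * abs r"
  and dL: "!!y w. y : U ==> (lag y w has_real_derivative dL y w) (at 0)"
begin

lemma D_tendsto:
 assumes f: "f ----> y" and g: "g ----> z" and y: "y : U" and fU: "!!n. f n : U"
 shows "(%n. D (f n) (g n)) ----> D y z"
 by(rule uniform_quotient_tendsto[OF D_unif f g y fU]) (simp_all add: tendsto_h f g y)

text \<open>Envelope formula: by Fenchel's inequality \<open>lag y w r + h y z r\<close> is minimal
  at \<open>r = 0\<close>, so its derivative vanishes there. In particular \<open>D y z\<close> is
  the same for every maximiser \<open>z\<close>.\<close>

lemma dL_eq:
 assumes y: "y : U" and z: "lag y w 0 = z \<bullet> w - h y z 0"
 shows "dL y w = - D y z"
proof -
 have dh: "((%r. h y z r) has_real_derivative D y z) (at 0)"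
  unfolding has_field_derivative_def has_derivative_at_alt
 proof (intro conjI allI impI bounded_linear_mult_right)
  fix e :: real assume "e > 0"
  then obtain dlt where "dlt > 0" "ALL y:{y}. ALL z' r. norm z' <= norm z --> abs r < dlt --> abs (h y z' r - h y z' 0 - r * D y z') <= e * abs r"
  using D_unif[of "{y}" e "norm z"] y by auto
  thus "EX d>0. ALL r. norm (r - 0) < d --> norm (h y z r - h y z 0 - D y z * (r - 0)) <= e * norm (r - 0)"
  by(intro exI[of _ dlt]) (auto simp: mult.commute)
 qed
 let ?f = "%r. lag y w r + h y z r"
 have df: "(?f has_real_derivative dL y w + D y z) (at 0)" by(intro DERIV_add dL[OF y] dh)
 have "dL y w + D y z = 0"
 proof (rule DERIV_local_min[OF df zero_less_one], intro allI impI)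
  fix r :: real
  show "?f 0 <= ?f r" using z fenchel[OF y, of z w r] by simp
 qed
 thus ?thesis by simp
qed

text \<open>The increment of \<open>lag\<close> lies between the increments of \<open>- h\<close> at
  a maximiser for parameter 0 and at one for parameter \<open>r\<close>. Along a sequence violating
  the claim both maximisers have limits that maximise the limit problem; there \<open>D\<close>
  takes equal values by \<open>dL_eq\<close>, so the two bounds agree to first order.\<close>

lemma lag_deriv_uniform:
 assumes K: "compact K" "K <= U" and e: "eps > 0"
 shows "EX dlt>0. ALL y:K. ALL w r. norm w <= W --> abs r < dlt --> abs (lag y w r - lag y w 0 - r * dL y w) <= eps * abs r"
proof (rule ccontr)
 assume no: "~ ?thesis"
 have "EX y w r. y : K & norm w <= W & abs r < inverse (real (Suc n)) &
  ~ abs (lag y w r - lag y w 0 - r * dL y w) <= eps * abs r" for n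
  using no by(metis inverse_positive_iff_positive of_nat_0_less_iff zero_less_Suc)
 then obtain y w r where yw: "!!n. y n : K" "!!n. norm (w n) <= W" "!!n. abs (r n) < inverse (real (Suc n))"
  "!!n. ~ abs (lag (y n) (w n) (r n) - lag (y n) (w n) 0 - r n * dL (y n) (w n)) <= eps * abs (r n)" by metis
 have yU: "y n : U" for n using yw(1) K by blast
 have r1: "abs (r n) <= 1" for n
 proof -
  have "inverse (real (Suc n)) <= 1" by(simp add: inverse_le_1_iff)
  thus ?thesis using yw(3)[of n] by linarith
 qed
 have rlim: "r ----> 0"
  by(rule tendsto_rabs_zero_cancel, rule tendsto_sandwich[OF _ _ tendsto_const LIMSEQ_inverse_real_of_nat])
  (use yw(3) in "auto intro!: always_eventually less_imp_le")
 obtain P where P: "ALL y:K. ALL w r z. norm w <= W --> abs r <= 1 --> lag y w r = z \<bullet> w - h y z r --> norm z <= P"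
  by(rule argmax_bound[OF K])
 have "EX z. lag (y n) (w n) s = z \<bullet> w n - h (y n) z s" for n s
  using lag_argmax[OF yU[of n], of "w n" s] by metis
 then obtain Z where Z: "!!n s. lag (y n) (w n) s = Z n s \<bullet> w n - h (y n) (Z n s) s" by metis
 have ZP: "norm (Z n 0) <= P" "norm (Z n (r n)) <= P" for n
  using P[rule_format, OF yw(1,2)[of n] _ Z[of n 0]] P[rule_format, OF yw(1,2)[of n] r1[of n] Z[of n "r n"]] by auto
 have "compact (K \<times> cball (0::'e) W \<times> cball (0::'e) P \<times> cball (0::'e) P)" using K by(intro compact_Times) auto
 moreover have "(y n, w n, Z n 0, Z n (r n)) : K \<times> cball (0::'e) W \<times> cball (0::'e) P \<times> cball (0::'e) P" for n
  using yw(1,2)[of n] ZP[of n] by auto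
 ultimately obtain l s where l: "l : K \<times> cball (0::'e) W \<times> cball (0::'e) P \<times> cball (0::'e) P" "strict_mono (s :: nat => nat)"
  "((%n. (y n, w n, Z n 0, Z n (r n))) o s) ----> l"
  unfolding compact_def by(meson)
 obtain y' w' z1 z2 where lr: "l = (y', w', z1, z2)" by(cases l) auto
 have y'U: "y' : U" using l(1) lr K by auto
 have lim: "(%n. y (s n)) ----> y'" "(%n. w (s n)) ----> w'" "(%n. Z (s n) 0) ----> z1" "(%n. Z (s n) (r (s n))) ----> z2"
  using tendsto_fst[OF l(3)] tendsto_fst[OF tendsto_snd[OF l(3)]] tendsto_fst[OF tendsto_snd[OF tendsto_snd[OF l(3)]]]
  tendsto_snd[OF tendsto_snd[OF tendsto_snd[OF l(3)]]] by(auto simp: lr o_def)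
 have rs: "(%n. r (s n)) ----> 0" using LIMSEQ_subseq_LIMSEQ[OF rlim l(2)] by(simp add: o_def)
 have arg: "lag y' w' 0 = z \<bullet> w' - h y' z 0" if z: "(%n. Z (s n) (q n)) ----> z" and q: "q ----> 0" for z q
 proof (rule LIMSEQ_unique)
  show "(%n. lag (y (s n)) (w (s n)) (q n)) ----> lag y' w' 0" by(rule lag_tendsto[OF lim(1,2) q y'U yU])
  have "(%n. Z (s n) (q n) \<bullet> w (s n) - h (y (s n)) (Z (s n) (q n)) (q n)) ----> z \<bullet> w' - h y' z 0"
  by(intro tendsto_intros lim z tendsto_h[OF lim(1) z q y'U])
  thus "(%n. lag (y (s n)) (w (s n)) (q n)) ----> z \<bullet> w' - h y' z 0" by(simp only: Z)
 qed
 have D12: "D y' z1 = D y' z2" using dL_eq[OF y'U arg[OF lim(3) tendsto_const]] dL_eq[OF y'U arg[OF lim(4) rs]] by simp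
 have "(%n. D (y (s n)) (Z (s n) (r (s n))) - D (y (s n)) (Z (s n) 0)) ----> D y' z2 - D y' z1"
  by(intro tendsto_diff D_tendsto lim y'U yU)
 hence "(%n. D (y (s n)) (Z (s n) (r (s n))) - D (y (s n)) (Z (s n) 0)) ----> 0" using D12 by simp
 then obtain N1 where N1: "ALL n>=N1. abs (D (y (s n)) (Z (s n) (r (s n))) - D (y (s n)) (Z (s n) 0)) < eps/2"
  using LIMSEQ_D[of _ 0 "eps/2"] e by force
 obtain dlt where dlt: "dlt > 0" "ALL y:K. ALL z r. norm z <= P --> abs r < dlt --> abs (h y z r - h y z 0 - r * D y z) <= eps/2 * abs r"
  using D_unif[OF K, of "eps/2" P] e by auto
 obtain N2 where N2: "ALL n>=N2. abs (r (s n)) < dlt" using LIMSEQ_D[OF rs dlt(1)] by auto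
 define n where "n = s (max N1 N2)"
 have nr: "abs (r n) < dlt" and nD: "abs (D (y n) (Z n (r n)) - D (y n) (Z n 0)) < eps/2" using N1 N2 by(auto simp: n_def)
 have H1: "abs (h (y n) (Z n 0) (r n) - h (y n) (Z n 0) 0 - r n * D (y n) (Z n 0)) <= eps/2 * abs (r n)"
  using dlt(2) yw(1)[of n] ZP(1)[of n] nr by blast
 have H2: "abs (h (y n) (Z n (r n)) (r n) - h (y n) (Z n (r n)) 0 - r n * D (y n) (Z n (r n))) <= eps/2 * abs (r n)"
  using dlt(2) yw(1)[of n] ZP(2)[of n] nr by blast
 have dLn: "dL (y n) (w n) = - D (y n) (Z n 0)" by(rule dL_eq[OF yU Z])
 have "lag (y n) (w n) (r n) >= Z n 0 \<bullet> w n - h (y n) (Z n 0) (r n)" using fenchel[OF yU[of n], of "Z n 0" "w n" "r n"] by simp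
 hence lo: "lag (y n) (w n) (r n) - lag (y n) (w n) 0 >= h (y n) (Z n 0) 0 - h (y n) (Z n 0) (r n)" using Z[of n 0] by simp
 have "lag (y n) (w n) 0 >= Z n (r n) \<bullet> w n - h (y n) (Z n (r n)) 0" using fenchel[OF yU[of n], of "Z n (r n)" "w n" 0] by simp
 hence up: "lag (y n) (w n) (r n) - lag (y n) (w n) 0 <= h (y n) (Z n (r n)) 0 - h (y n) (Z n (r n)) (r n)" using Z[of n "r n"] by simp
 have "abs (r n * (D (y n) (Z n (r n)) - D (y n) (Z n 0))) <= abs (r n) * (eps/2)"
  unfolding abs_mult using nD by(intro mult_left_mono) auto
 hence rD: "abs (r n * D (y n) (Z n (r n)) - r n * D (y n) (Z n 0)) <= eps/2 * abs (r n)" by(simp add: algebra_simps)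
 have "eps/2 * abs (r n) >= 0" using e by simp
 hence "abs (lag (y n) (w n) (r n) - lag (y n) (w n) 0 - r n * dL (y n) (w n)) <= eps/2 * abs (r n) + eps/2 * abs (r n)"
  unfolding dLn mult_minus_right using lo up H1 H2 rD by linarith
 thus False using yw(4)[of n] by simp
qed

lemma continuous_on_dL: "continuous_on (U \<times> UNIV) (%(y, w). dL y w)"
 unfolding continuous_on_sequentially
proof (intro allI impI ballI, elim conjE)
 fix x and a assume a: "a : U \<times> (UNIV::'e set)" and x: "ALL n. x n : U \<times> (UNIV::'e set)" "x ----> a"
 obtain y w where ayw: "a = (y, w)" by(cases a) auto
 have y: "y : U" using a ayw by auto
 have fU: "fst (x n) : U" for n using x(1) by(simp add: mem_Times_iff)
 have l: "(%n. fst (x n)) ----> y" "(%n. snd (x n)) ----> w"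
  using tendsto_fst[OF x(2)] tendsto_snd[OF x(2)] by(auto simp: ayw)
 have "(%n. dL (fst (x n)) (snd (x n))) ----> dL y w"
  by(rule uniform_quotient_tendsto[OF lag_deriv_uniform l y fU]) (simp_all add: lag_tendsto l y fU)
 thus "((%(y, w). dL y w) o x) ----> (case a of (y, w) => dL y w)" by(simp add: o_def split_beta ayw)
qed

end

section \<open>The Hopf-Lax step in one chart\<close>

text \<open>The Lagrangian need not be differentiable, as \<open>f\<close> need not be strictly
  convex. Adding \<open>dlt/2 * (z \<bullet> z)\<close> makes the maximiser \<open>p w\<close>
  unique and Lipschitz in \<open>w\<close>, so the conjugate is \<open>C\<^sup>1\<close> with
  gradient \<open>p\<close> and may be used in test functions.\<close>

lemma legendre_regularized:
 fixes f :: "'e::euclidean_space => real"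
 assumes conv: "convex_on UNIV f" and cont: "continuous_on UNIV f"
  and sup: "!!k. EX C. ALL z. f z >= k * norm z - C" and d: "dlt > 0"
 obtains l p where "!!w. l w = p w \<bullet> w - f (p w) - dlt/2 * (p w \<bullet> p w)"
  "!!w z. z \<bullet> w - f z - dlt/2 * (z \<bullet> z) <= l w"
  "!!w. (l has_derivative (%h. p w \<bullet> h)) (at w)" "continuous_on UNIV p"
proof -
 define g where "g z = f z + dlt/2 * (z \<bullet> z)" for z
 have cg: "continuous_on S g" for S unfolding g_def by(intro continuous_intros continuous_on_subset[OF cont]) auto
 have gf: "g z >= f z" for z using d by(simp add: g_def)
 have "EX q. ALL z. z \<bullet> w - g z <= q \<bullet> w - g q" for w
 proof -
  obtain C where C: "ALL z. f z >= (norm w + 1) * norm z - C" using sup by blast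
  define P where "P = abs (C + g 0) + 1"
  have "continuous_on (cball 0 P) (%z. z \<bullet> w - g z)" by(intro continuous_intros cg)
  moreover have "cball (0::'e) P ~= {}" by(simp add: P_def)
  ultimately obtain z where z: "z : cball 0 P" "!!z'. z' : cball 0 P ==> z' \<bullet> w - g z' <= z \<bullet> w - g z"
  using continuous_attains_sup[OF compact_cball[of "0::'e" P], of "%z. z \<bullet> w - g z"] by blast
  have "z' \<bullet> w - g z' <= z \<bullet> w - g z" for z'
  proof (cases "z' : cball 0 P")
  case False
  have "z' \<bullet> w <= norm z' * norm w" by(rule norm_cauchy_schwarz)
  moreover have "g z' >= (norm w + 1) * norm z' - C" using C gf[of z'] by(meson order_trans)
  moreover have "(norm w + 1) * norm z' = norm z' * norm w + norm z'" by(simp add: algebra_simps)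
  ultimately have "z' \<bullet> w - g z' <= C - norm z'" by linarith
  also have "... <= - g 0" using False by(auto simp: P_def)
  also have "... <= z \<bullet> w - g z" using z(2)[of 0] by(simp add: P_def)
  finally show ?thesis .
  qed (use z in auto)
  thus ?thesis by blast
 qed
 then obtain p where p: "!!w z. z \<bullet> w - g z <= p w \<bullet> w - g (p w)" by metis
 define l where "l w = p w \<bullet> w - g (p w)" for w
 have strong: "z \<bullet> w - g z + dlt/2 * ((z - p w) \<bullet> (z - p w)) <= p w \<bullet> w - g (p w)" for z w
 proof (rule ccontr)
  define X where "X = z \<bullet> w - g z"
  define Z where "Z = p w \<bullet> w - g (p w)"
  define Q where "Q = (z - p w) \<bullet> (z - p w)"
  define Y where "Y = dlt/2 * Q"
  assume "~ ?thesis"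
  hence gt: "X + Y - Z > 0" by(simp add: X_def Y_def Z_def Q_def)
  have XZ: "X <= Z" using p by(simp add: X_def Z_def)
  have Y: "Y > 0" using gt XZ by linarith
  have key: "X + (1 - t) * Y <= Z" if t: "0 < t" "t < 1" for t
  proof -
  define zt where "zt = (1 - t) *\<^sub>R p w + t *\<^sub>R z"
  have ff: "f zt <= (1 - t) * f (p w) + t * f z"
  unfolding zt_def by(rule convex_onD[OF conv]) (use t in auto)
  have zz: "zt \<bullet> zt = (1 - t) * (p w \<bullet> p w) + t * (z \<bullet> z) - t * (1 - t) * Q"
  unfolding zt_def Q_def by(simp add: inner_add_left inner_add_right inner_diff_left inner_diff_right inner_commute[of z "p w"] algebra_simps)
  moreover note ff
  moreover have "dlt/2 * (zt \<bullet> zt) = (1 - t) * (dlt/2 * (p w \<bullet> p w)) + t * (dlt/2 * (z \<bullet> z)) - t * ((1 - t) * Y)"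
  unfolding zz Y_def by(simp add: field_simps)
  ultimately have "g zt <= (1 - t) * g (p w) + t * g z - t * ((1 - t) * Y)"
  unfolding g_def by(simp add: algebra_simps)
  moreover have "zt \<bullet> w = (1 - t) * (p w \<bullet> w) + t * (z \<bullet> w)" by(simp add: zt_def inner_add_left)
  moreover have "zt \<bullet> w - g zt <= Z" using p by(simp add: Z_def)
  ultimately have "(1 - t) * Z + t * X + t * ((1 - t) * Y) <= Z" by(simp add: Z_def X_def algebra_simps)
  hence "t * (X + (1 - t) * Y) <= t * Z" by(simp add: algebra_simps)
  thus ?thesis using t by simp
  qed
  \<comment> \<open>With this \<open>t\<close>, \<open>t * Y\<close> is half of the supposed
    violation \<open>X + Y - Z\<close>.\<close>
  define t where "t = (X + Y - Z) / (2 * Y)"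
  have t: "0 < t" "t < 1" using gt Y XZ by(auto simp: t_def field_simps)
  have "t * Y = (X + Y - Z) / 2" using Y by(simp add: t_def)
  thus False using key[OF t] gt by(simp add: algebra_simps)
 qed
 have lip: "dlt * norm (p w' - p w) <= norm (w' - w)" for w w'
 proof -
  have 1: "p w' \<bullet> w - g (p w') + dlt/2 * ((p w' - p w) \<bullet> (p w' - p w)) <= p w \<bullet> w - g (p w)" by(rule strong)
  have 2: "p w \<bullet> w' - g (p w) + dlt/2 * ((p w - p w') \<bullet> (p w - p w')) <= p w' \<bullet> w' - g (p w')" by(rule strong)
  have sq: "(p w - p w') \<bullet> (p w - p w') = (p w' - p w) \<bullet> (p w' - p w)"
  by(metis dot_square_norm norm_minus_commute)
  have "dlt * ((p w' - p w) \<bullet> (p w' - p w)) <= (p w' - p w) \<bullet> (w' - w)"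
  using 1 2 unfolding sq by(simp add: inner_diff_left inner_diff_right algebra_simps)
  also have "... <= norm (p w' - p w) * norm (w' - w)" by(rule norm_cauchy_schwarz)
  finally have "norm (p w' - p w) * (dlt * norm (p w' - p w)) <= norm (p w' - p w) * norm (w' - w)"
  by(simp add: dot_square_norm power2_eq_square algebra_simps)
  thus ?thesis by(cases "norm (p w' - p w) = 0") auto
 qed
 have lip': "norm (p w' - p w) <= norm (w' - w) / dlt" for w w' using lip[of w' w] d by(simp add: field_simps)
 have cp: "continuous_on UNIV p"
  unfolding continuous_on_iff
 proof (intro ballI allI impI)
  fix x :: 'e and e :: real assume e: "e > 0"
  show "EX d>0. ALL x':UNIV. dist x' x < d --> dist (p x') (p x) < e"
  proof (intro exI[of _ "dlt * e"] conjI ballI impI)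
  fix x' assume "dist x' x < dlt * e"
  hence "norm (x' - x) / dlt < e" using d by(simp add: dist_norm field_simps)
  thus "dist (p x') (p x) < e" using lip'[of x' x] by(simp add: dist_norm)
  qed (use d e in simp)
 qed
 have dl: "(l has_derivative (%h. p w \<bullet> h)) (at w)" for w
  unfolding has_derivative_at_alt
 proof (intro conjI allI impI bounded_linear_inner_right)
  fix e :: real assume e: "e > 0"
  show "EX d>0. ALL y. norm (y - w) < d --> norm (l y - l w - p w \<bullet> (y - w)) <= e * norm (y - w)"
  proof (intro exI[of _ "dlt * e"] conjI allI impI)
  fix y assume y: "norm (y - w) < dlt * e"
  have "l y >= p w \<bullet> y - g (p w)" "l w >= p y \<bullet> w - g (p y)" using p by(auto simp: l_def)
  hence "0 <= l y - l w - p w \<bullet> (y - w)" "l y - l w - p w \<bullet> (y - w) <= (p y - p w) \<bullet> (y - w)"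
  by(auto simp: l_def inner_diff_left inner_diff_right)
  hence "norm (l y - l w - p w \<bullet> (y - w)) <= (p y - p w) \<bullet> (y - w)" by simp
  also have "... <= norm (p y - p w) * norm (y - w)" by(rule norm_cauchy_schwarz)
  also have "... <= e * norm (y - w)"
  proof (rule mult_right_mono)
  have "norm (y - w) / dlt <= e" using y d by(simp add: field_simps)
  thus "norm (p y - p w) <= e" using lip'[of y w] by linarith
  qed simp
  finally show "norm (l y - l w - p w \<bullet> (y - w)) <= e * norm (y - w)" .
  qed (use d e in simp)
 qed
 show ?thesis
 proof (rule that[of l p])
  show "l w = p w \<bullet> w - f (p w) - dlt/2 * (p w \<bullet> p w)" for w by(simp add: l_def g_def)
  show "z \<bullet> w - f z - dlt/2 * (z \<bullet> z) <= l w" for z w using p[of z w] by(simp add: l_def g_def)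
 qed (rule dl cp)+
qed

text \<open>
 The minimum over \<open>y\<close> of \<open>u y + s l((y0 - y)/s) + (c - 2\<epsilon>) s\<close> decreases with \<open>s\<close>: at a minimizer the
 Hopf-Lax kernel is a test function for \<open>u\<close> from below, and its \<open>s\<close>-derivative is \<open>-f\<close> of its gradient.
\<close>

lemma hopf_lax_step:
 fixes u :: "'e::euclidean_space => real" and f :: "'e => real"
 assumes conv: "convex_on UNIV f" and cont: "continuous_on UNIV f"
  and sup: "!!k. EX C. ALL z. f z >= k * norm z - C" and d: "dlt > 0" and e: "eps > 0" and tau: "tau > 0"
  and u: "continuous_on (cball y0 rho) u" and k: "kp >= 0"
  and lip: "!!y. y : cball y0 rho ==> u y0 - kp * dist y y0 <= u y"
  and C: "!!z. norm z <= kp + 1 ==> f z + dlt/2 * (z \<bullet> z) <= C" and C0: "!!z. - C0 <= f z"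
  and small: "(C + C0) * tau < rho"
  and test: "!!phi G y r. r > 0 ==> ball y r <= ball y0 rho ==> (ALL z:ball y r. (phi has_derivative (%h. G z \<bullet> h)) (at z))
  ==> continuous_on (ball y r) G ==> (ALL z:ball y r. u z - phi z >= u y - phi y) ==> c - eps <= f (G y)"
 obtains y where "norm (y0 - y) <= (C + C0) * tau"
  "!!z. u y + z \<bullet> (y0 - y) - tau * (f z + dlt/2 * (z \<bullet> z)) + (c - 3 * eps) * tau <= u y0"
proof -
 obtain l p where l1: "!!w. l w = p w \<bullet> w - f (p w) - dlt/2 * (p w \<bullet> p w)"
  and l2: "!!w z. z \<bullet> w - f z - dlt/2 * (z \<bullet> z) <= l w"
  and l3: "!!w. (l has_derivative (%h. p w \<bullet> h)) (at w)" and l4: "continuous_on UNIV p"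
  by(rule legendre_regularized[OF conv cont sup d]) blast
 have cl: "continuous_on UNIV l" using l3 by(meson continuous_at_imp_continuous_on has_derivative_continuous)
 have l0: "l 0 <= C0"
 proof -
  have "l 0 = - f (p 0) - dlt/2 * (p 0 \<bullet> p 0)" using l1[of 0] by simp
  moreover have "0 <= dlt/2 * (p 0 \<bullet> p 0)" using d by simp
  ultimately show ?thesis using C0[of "p 0"] by linarith
 qed
 have lg: "l w >= (kp + 1) * norm w - C" for w
 proof -
  define z where "z = ((kp + 1) / norm w) *\<^sub>R w"
  have "norm z <= kp + 1" using k by(simp add: z_def)
  hence "f z + dlt/2 * (z \<bullet> z) <= C" by(rule C)
  moreover have "z \<bullet> w = (kp + 1) * norm w" by(cases "w = 0") (auto simp: z_def dot_square_norm power2_eq_square)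
  ultimately show ?thesis using l2[of z w] by linarith
 qed
 have CC: "C + C0 >= 0" using C[of 0] C0[of 0] k by simp
 hence rho: "rho > 0" using small tau by(smt (verit) mult_nonneg_nonneg)
 \<comment> \<open>Of the three \<open>eps\<close> in the conclusion, one is lost in the
   supersolution test, one makes the derivative in \<open>s\<close> strictly negative, and one pays
   for starting at \<open>s0\<close> instead of 0.\<close>
 define psi where "psi s y = u y + s * l ((y0 - y) /\<^sub>R s) + (c - 2 * eps) * s" for s y
 have near: "norm (y0 - y) <= (C + C0) * s" if s: "0 < s" and y: "y : cball y0 rho" and m: "psi s y <= psi s y0" for s y
 proof -
  have "s * l ((y0 - y) /\<^sub>R s) >= s * ((kp + 1) * norm ((y0 - y) /\<^sub>R s) - C)" by(rule mult_left_mono[OF lg less_imp_le[OF s]])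
  also have "s * ((kp + 1) * norm ((y0 - y) /\<^sub>R s) - C) = (kp + 1) * norm (y0 - y) - s * C"
  proof -
  have "norm ((y0 - y) /\<^sub>R s) = norm (y0 - y) / s" using s by(simp add: divide_inverse mult.commute)
  thus ?thesis using s by(simp only:) (simp add: field_simps)
  qed
  finally have "s * l ((y0 - y) /\<^sub>R s) >= (kp + 1) * norm (y0 - y) - s * C" .
  moreover have "s * l 0 <= s * C0" using l0 s by(intro mult_left_mono) auto
  moreover have "u y0 - kp * norm (y0 - y) <= u y" using lip[OF y] by(simp add: dist_norm norm_minus_commute)
  ultimately show ?thesis using m by(simp add: psi_def algebra_simps)
 qed
 have cpsi: "continuous_on (cball y0 rho) (psi s)" for s
  unfolding psi_def by(intro continuous_intros u continuous_on_compose2[OF cl]) auto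
 have y0c: "y0 : cball y0 rho" using rho by simp
 have argmin: "EX y:cball y0 rho. ALL y':cball y0 rho. psi s y <= psi s y'" for s
  by(rule continuous_attains_inf[OF compact_cball _ cpsi]) (use y0c in blast)
 \<comment> \<open>\<open>psi s y0\<close> tends to \<open>u y0\<close> as \<open>s\<close> tends to
   0; a small positive start avoids the singular kernel at \<open>s = 0\<close>.\<close>
 define s0 where "s0 = min tau (eps * tau / (abs (l 0 + (c - 2 * eps)) + 1))"
 have s0: "0 < s0" "s0 <= tau" using tau e by(auto simp: s0_def)
 have s0e: "s0 * (l 0 + (c - 2 * eps)) <= eps * tau"
 proof -
  have "s0 * (l 0 + (c - 2 * eps)) <= s0 * (abs (l 0 + (c - 2 * eps)) + 1)" using s0 by(intro mult_left_mono) auto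
  also have "... <= (eps * tau / (abs (l 0 + (c - 2 * eps)) + 1)) * (abs (l 0 + (c - 2 * eps)) + 1)"
  by(intro mult_right_mono) (auto simp: s0_def)
  also have "... = eps * tau" by simp
  finally show ?thesis .
 qed
 define alp where "alp = psi s0 y0"
 have alp: "alp <= u y0 + eps * tau" using s0e by(simp add: alp_def psi_def algebra_simps)
 let ?Q = "{s0..tau} \<times> cball y0 rho"
 \<comment> \<open>\<open>Z\<close> is the compact set of times at which the minimum of
   \<open>psi s\<close> has not risen above its initial bound. If its supremum were below
   \<open>tau\<close>, the negative derivative would carry the bound beyond it.\<close>
 define Z where "Z = fst ` (?Q Int (%x. psi (fst x) (snd x)) -` {..alp})"
 have Zmem: "s : Z \<longleftrightarrow> s : {s0..tau} & (EX y:cball y0 rho. psi s y <= alp)" for s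
  unfolding Z_def by force
 have cQ: "compact ?Q" by(intro compact_Times) auto
 have "continuous_on ?Q (%x. psi (fst x) (snd x))"
  unfolding psi_def using s0
  by(intro continuous_intros continuous_on_compose2[OF u] continuous_on_compose2[OF cl]) auto
 hence "closed (?Q Int (%x. psi (fst x) (snd x)) -` {..alp})"
  by(intro continuous_closed_preimage compact_imp_closed[OF cQ]) auto
 hence "compact (?Q Int (?Q Int (%x. psi (fst x) (snd x)) -` {..alp}))" by(intro compact_Int_closed cQ)
 moreover have "?Q Int (?Q Int (%x. psi (fst x) (snd x)) -` {..alp}) = ?Q Int (%x. psi (fst x) (snd x)) -` {..alp}" by blast
 ultimately have cZ: "compact Z" unfolding Z_def by(auto intro!: compact_continuous_image continuous_on_fst continuous_on_id)
 have s0Z: "s0 : Z" unfolding Zmem using s0 y0c by(auto simp: alp_def)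
 define s2 where "s2 = Sup Z"
 have s2Z: "s2 : Z" unfolding s2_def by(rule closed_contains_Sup) (use s0Z cZ in "auto intro: compact_imp_closed bounded_imp_bdd_above compact_imp_bounded")
 have s2up: "s <= s2" if "s : Z" for s
  unfolding s2_def using that cZ by(intro cSup_upper) (auto intro: bounded_imp_bdd_above compact_imp_bounded)
 have s2: "0 < s2" "s2 <= tau" using s2Z s0 by(auto simp: Zmem)
 have "s2 = tau"
 proof (rule ccontr)
  assume "s2 ~= tau"
  hence lt: "s2 < tau" using s2 by simp
  obtain y where y: "y : cball y0 rho" "!!y'. y' : cball y0 rho ==> psi s2 y <= psi s2 y'" using argmin[of s2] by blast
  have ya: "psi s2 y <= alp" using s2Z y(2) unfolding Zmem by(meson order_trans)
  have "norm (y0 - y) <= (C + C0) * s2" by(rule near[OF s2(1) y(1) y(2)[OF y0c]])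
  also have "... <= (C + C0) * tau" using CC s2 by(intro mult_left_mono) auto
  also have "... < rho" by(rule small)
  finally have yb: "y : ball y0 rho" by(simp add: dist_norm)
  obtain r where r: "r > 0" "ball y r <= ball y0 rho" using yb open_ball open_contains_ball by metis
  define G where "G z = p ((y0 - z) /\<^sub>R s2)" for z
  define phi where "phi z = - (s2 * l ((y0 - z) /\<^sub>R s2))" for z
  have "(phi has_derivative (%h. G z \<bullet> h)) (at z)" for z
  proof -
  have "((%z. (y0 - z) /\<^sub>R s2) has_derivative (%h. - (h /\<^sub>R s2))) (at z)" by(auto intro!: derivative_eq_intros)
  from has_derivative_compose[OF this l3]
  have "((%z. - (s2 * l ((y0 - z) /\<^sub>R s2))) has_derivative (%h. - (s2 * (p ((y0 - z) /\<^sub>R s2) \<bullet> - (h /\<^sub>R s2))))) (at z)"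
  by(intro has_derivative_minus has_derivative_mult_right)
  thus ?thesis unfolding phi_def[abs_def] by(rule has_derivative_eq_rhs) (use s2 in "auto simp: G_def fun_eq_iff")
  qed
  moreover have "continuous_on (ball y r) G" unfolding G_def by(intro continuous_on_compose2[OF l4] continuous_intros) auto
  moreover have "ALL z:ball y r. u z - phi z >= u y - phi y"
  proof
  fix z assume "z : ball y r"
  hence "z : cball y0 rho" using r(2) ball_subset_cball by blast
  thus "u z - phi z >= u y - phi y" using y(2)[of z] by(simp add: psi_def phi_def)
  qed
  ultimately have fG: "c - eps <= f (G y)" using test[OF r] by blast
  define q where "q = y0 - y"
  have dpsi: "((%s. psi s y) has_real_derivative (l (q /\<^sub>R s2) - p (q /\<^sub>R s2) \<bullet> (q /\<^sub>R s2) + (c - 2 * eps))) (at s2)"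
  proof -
  have "((%s. q /\<^sub>R s) has_derivative (%h. - (h / s2\<^sup>2) *\<^sub>R q)) (at s2)"
  proof -
  have "((%s. inverse s) has_real_derivative - (inverse s2 ^ Suc (Suc 0))) (at s2)" using s2 by(intro DERIV_inverse) auto
  hence "((%s. inverse s) has_derivative (%h. - (h / s2\<^sup>2))) (at s2)"
  unfolding has_field_derivative_def by(rule has_derivative_eq_rhs) (auto simp: fun_eq_iff power2_eq_square divide_inverse)
  from has_derivative_scaleR_left[OF this, of q] show ?thesis by simp
  qed
  from has_derivative_compose[OF this l3]
  have "((%s. l (q /\<^sub>R s)) has_derivative (%h. p (q /\<^sub>R s2) \<bullet> (- (h / s2\<^sup>2) *\<^sub>R q))) (at s2)" .
  hence "((%s. l (q /\<^sub>R s)) has_real_derivative (- (p (q /\<^sub>R s2) \<bullet> q) / s2\<^sup>2)) (at s2)"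
  unfolding has_field_derivative_def by(rule has_derivative_eq_rhs) (auto simp: fun_eq_iff)
  from DERIV_mult[OF DERIV_ident this]
  have "((%s. s * l (q /\<^sub>R s)) has_real_derivative (l (q /\<^sub>R s2) - p (q /\<^sub>R s2) \<bullet> (q /\<^sub>R s2))) (at s2)"
  by(rule DERIV_cong) (use s2 in "simp add: power2_eq_square divide_inverse")
  moreover have "((%s. (c - 2 * eps) * s) has_real_derivative (c - 2 * eps)) (at s2)" by(auto intro!: derivative_eq_intros)
  ultimately have "((%s. u y + (s * l (q /\<^sub>R s) + (c - 2 * eps) * s)) has_real_derivative
  (0 + (l (q /\<^sub>R s2) - p (q /\<^sub>R s2) \<bullet> (q /\<^sub>R s2) + (c - 2 * eps)))) (at s2)"
  by(intro DERIV_add DERIV_const)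
  thus ?thesis by(simp add: psi_def q_def algebra_simps)
  qed
  have "l (q /\<^sub>R s2) - p (q /\<^sub>R s2) \<bullet> (q /\<^sub>R s2) = - f (G y) - dlt/2 * (G y \<bullet> G y)"
  by(simp add: l1 G_def q_def)
  moreover have "dlt/2 * (G y \<bullet> G y) >= 0" using d by simp
  ultimately have "l (q /\<^sub>R s2) - p (q /\<^sub>R s2) \<bullet> (q /\<^sub>R s2) + (c - 2 * eps) < 0" using fG e by linarith
  from DERIV_neg_dec_right[OF dpsi this] obtain h where h: "h > 0" "ALL t>0. t < h --> psi (s2 + t) y < psi s2 y" by blast
  define t where "t = min (h/2) (tau - s2)"
  have t: "t > 0" "t < h" "s2 + t <= tau" using h lt by(auto simp: t_def)
  have "s2 + t : Z" unfolding Zmem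
  proof
  show "s2 + t : {s0..tau}" using t s2Z[unfolded Zmem] by auto
  have "psi (s2 + t) y <= alp" using h(2) t ya by fastforce
  thus "EX y:cball y0 rho. psi (s2 + t) y <= alp" using y(1) by blast
  qed
  thus False using s2up[of "s2 + t"] t by simp
 qed
 then obtain y1 where y1: "y1 : cball y0 rho" "psi tau y1 <= alp" using s2Z unfolding Zmem by blast
 obtain y where y: "y : cball y0 rho" "!!y'. y' : cball y0 rho ==> psi tau y <= psi tau y'" using argmin[of tau] by blast
 show ?thesis
 proof (rule that[of y])
  show "norm (y0 - y) <= (C + C0) * tau" by(rule near[OF tau y(1) y(2)[OF y0c]])
  fix z
  have "psi tau y <= u y0 + eps * tau" using y(2)[OF y1(1)] y1(2) alp by linarith
  moreover have "tau * (z \<bullet> ((y0 - y) /\<^sub>R tau) - f z - dlt/2 * (z \<bullet> z)) <= tau * l ((y0 - y) /\<^sub>R tau)"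
  using l2[of z "(y0 - y) /\<^sub>R tau"] tau by(intro mult_left_mono) auto
  moreover have "tau * (z \<bullet> ((y0 - y) /\<^sub>R tau) - f z - dlt/2 * (z \<bullet> z)) = z \<bullet> (y0 - y) - tau * (f z + dlt/2 * (z \<bullet> z))"
  proof -
  have "tau * (z \<bullet> ((y0 - y) /\<^sub>R tau)) = z \<bullet> (y0 - y)" using tau by simp
  thus ?thesis by(simp add: right_diff_distrib distrib_left)
  qed
  ultimately show "u y + z \<bullet> (y0 - y) - tau * (f z + dlt/2 * (z \<bullet> z)) + (c - 3 * eps) * tau <= u y0"
  by(simp add: psi_def algebra_simps)
 qed
qed

section \<open>Differential calculus in the charts of the manifold\<close>

text \<open>Continuous differentiability with an explicit gradient vector: covectors of the model
  space become vectors, so that bounds and uniform continuity concern a single map.\<close>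

definition C1_grad :: "'e::euclidean_space set => ('e => real) => ('e => 'e) => bool" where
 "C1_grad S f G \<longleftrightarrow> (ALL y:S. (f has_derivative (%h. G y \<bullet> h)) (at y)) & continuous_on S G"

lemma C1_gradD:
 "C1_grad S f G ==> y : S ==> (f has_derivative (%h. G y \<bullet> h)) (at y)" "C1_grad S f G ==> continuous_on S G"
 by(auto simp: C1_grad_def)

lemma linear_eq_inner_sum:
 fixes f :: "'e::euclidean_space => real"
 assumes "linear f"
 shows "f h = (SUM b:Basis. f b *\<^sub>R b) \<bullet> h"
proof -
 have "f h = f (SUM b:Basis. (h \<bullet> b) *\<^sub>R b)" by(simp add: euclidean_representation)
 also have "... = (SUM b:Basis. (h \<bullet> b) * f b)" using assms by(simp add: linear_sum linear_scale)
 finally show ?thesis by(simp add: inner_sum_left inner_commute[of h] mult.commute)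
qed

lemma Ck_on_1_iff:
 fixes f :: "'e::euclidean_space => real"
 shows "Ck_on 1 S f \<longleftrightarrow> (EX G. C1_grad S f G)"
proof
 assume "Ck_on 1 S f"
 hence d: "!!x. x : S ==> f differentiable (at x)" and c: "!!v. continuous_on S (%x. frechet_derivative f (at x) v)"
  by auto
 let ?G = "%x. SUM b:Basis. frechet_derivative f (at x) b *\<^sub>R b"
 have "C1_grad S f ?G"
  unfolding C1_grad_def
 proof (intro conjI ballI)
  fix y assume y: "y : S"
  have der: "(f has_derivative frechet_derivative f (at y)) (at y)" using d[OF y] by(simp add: frechet_derivative_works)
  have "frechet_derivative f (at y) = (%h. ?G y \<bullet> h)"
  using linear_eq_inner_sum[OF has_derivative_linear[OF der]] by blast
  thus "(f has_derivative (%h. ?G y \<bullet> h)) (at y)" using der by simp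
 qed (intro continuous_intros c)
 thus "EX G. C1_grad S f G" by blast
next
 assume "EX G. C1_grad S f G"
 then obtain G where G: "C1_grad S f G" by blast
 have fd: "frechet_derivative f (at y) = (%h. G y \<bullet> h)" if "y : S" for y
  using frechet_derivative_at[OF C1_gradD(1)[OF G that]] by simp
 have "continuous_on S (%y. G y \<bullet> v)" for v by(intro continuous_intros C1_gradD(2)[OF G])
 hence "continuous_on S (%x. frechet_derivative f (at x) v)" for v
  by(rule continuous_on_eq) (simp add: fd)
 moreover have "f differentiable (at y)" if "y : S" for y using C1_gradD(1)[OF G that] by(auto simp: differentiable_def)
 ultimately show "Ck_on 1 S f" by simp
qed

lemma C1_grad_unique:
 assumes "(f has_derivative (%h. a \<bullet> h)) (at y)" "(f has_derivative (%h. b \<bullet> h)) (at y)"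
 shows "a = (b::'e::euclidean_space)"
proof -
 have "(%h. a \<bullet> h) = (%h. b \<bullet> h)" using has_derivative_unique[OF assms] .
 thus ?thesis by(metis vector_eq_rdot inner_commute vector_eq_ldot)
qed

lemma C1_grad_continuous: "C1_grad S f G ==> continuous_on S f"
 unfolding C1_grad_def by(meson continuous_at_imp_continuous_on has_derivative_continuous)

lemma C1_grad_Un:
 assumes "C1_grad S f G" "C1_grad T f G" "open S" "open T"
 shows "C1_grad (S Un T) f G"
 using assms unfolding C1_grad_def by(auto intro: continuous_on_open_Un)

lemma C1_grad_mult:
 assumes "C1_grad S f F" "C1_grad S g G"
 shows "C1_grad S (%y. f y * g y) (%y. f y *\<^sub>R G y + g y *\<^sub>R F y)"
 unfolding C1_grad_def
proof (intro conjI ballI)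
 fix y assume y: "y : S"
 show "((%y. f y * g y) has_derivative (%h. (f y *\<^sub>R G y + g y *\<^sub>R F y) \<bullet> h)) (at y)"
  by(rule has_derivative_eq_rhs[OF has_derivative_mult[OF C1_gradD(1)[OF assms(1) y] C1_gradD(1)[OF assms(2) y]]])
  (auto simp: fun_eq_iff inner_add_left)
qed (intro continuous_intros C1_grad_continuous[OF assms(1)] C1_grad_continuous[OF assms(2)] C1_gradD(2)[OF assms(1)] C1_gradD(2)[OF assms(2)])

lemma C1_grad_add:
 assumes "C1_grad S f F" "C1_grad S g G"
 shows "C1_grad S (%y. f y + g y) (%y. F y + G y)"
 unfolding C1_grad_def
proof (intro conjI ballI)
 fix y assume y: "y : S"
 show "((%y. f y + g y) has_derivative (%h. (F y + G y) \<bullet> h)) (at y)"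
  by(rule has_derivative_eq_rhs[OF has_derivative_add[OF C1_gradD(1)[OF assms(1) y] C1_gradD(1)[OF assms(2) y]]])
  (auto simp: fun_eq_iff inner_add_left)
qed (intro continuous_intros C1_gradD(2)[OF assms(1)] C1_gradD(2)[OF assms(2)])

lemma C1_grad_inverse:
 assumes f: "C1_grad S f F" and nz: "!!y. y : S ==> f y ~= 0"
 shows "C1_grad S (%y. inverse (f y)) (%y. (- inverse (f y * f y)) *\<^sub>R F y)"
 unfolding C1_grad_def
proof (intro conjI ballI)
 fix y assume y: "y : S"
 show "((%y. inverse (f y)) has_derivative (%h. ((- inverse (f y * f y)) *\<^sub>R F y) \<bullet> h)) (at y)"
  by(rule has_derivative_eq_rhs[OF Deriv.has_derivative_inverse[OF nz[OF y] C1_gradD(1)[OF f y]]])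
  (auto simp: fun_eq_iff)
qed (use nz in "auto intro!: continuous_intros C1_grad_continuous[OF f] C1_gradD(2)[OF f]")

text \<open>The product is \<open>C\<^sup>1\<close> on the ball by the product rule and vanishes on
  the complement of \<open>cball a (rho/2)\<close>. These two open sets overlap and cover the space,
  whatever the values of \<open>psi\<close> outside the ball.\<close>

lemma C1_grad_cutoff_mult:
 fixes psi :: "'e::euclidean_space => real"
 assumes rho: "rho > 0" and psi: "C1_grad (ball a rho) psi F"
 obtains G where "C1_grad UNIV (%y. cutoff a (rho/4) y * psi y) G" "!!y. y : ball a (rho/4) ==> G y = F y"
proof -
 have r4: "rho/4 > 0" using rho by simp
 obtain Gc where Gc: "!!y. (cutoff a (rho/4) has_derivative (%h. Gc y \<bullet> h)) (at y)" "continuous_on UNIV Gc"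
  by(rule cutoff_C1[of a "rho/4"]) blast
 have c1: "C1_grad S (cutoff a (rho/4)) Gc" for S using Gc by(auto simp: C1_grad_def intro: continuous_on_subset)
 define G where "G y = (if y : ball a rho then cutoff a (rho/4) y *\<^sub>R F y + psi y *\<^sub>R Gc y else 0)" for y
 let ?f = "%y. cutoff a (rho/4) y * psi y"
 have B: "C1_grad (ball a rho) ?f G"
 proof -
  have m: "C1_grad (ball a rho) ?f (%y. cutoff a (rho/4) y *\<^sub>R F y + psi y *\<^sub>R Gc y)" by(rule C1_grad_mult[OF c1 psi])
  thus ?thesis unfolding C1_grad_def G_def by(auto cong: continuous_on_cong_simp)
 qed
 have z: "cutoff a (rho/4) y = 0" if "y : - cball a (rho/2)" for y by(rule cutoff_0[OF r4]) (use that in auto)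
 have op: "open (- cball a (rho/2))" by auto
 have z2: "Gc y = 0" if y: "y : - cball a (rho/2)" for y
 proof (rule C1_grad_unique[OF Gc(1)])
  show "(cutoff a (rho/4) has_derivative (%h. 0 \<bullet> h)) (at y)"
  by(rule has_derivative_transform_within_open[OF _ op y, of "%_. 0"]) (use z in auto)
 qed
 have G0: "G y = 0" if "y : - cball a (rho/2)" for y using z[OF that] z2[OF that] by(simp add: G_def)
 have Cc: "C1_grad (- cball a (rho/2)) ?f G"
  unfolding C1_grad_def
 proof (intro conjI ballI)
  fix y assume y: "y : - cball a (rho/2)"
  have "(?f has_derivative (%h. 0)) (at y)"
  by(rule has_derivative_transform_within_open[OF _ op y, of "%_. 0"]) (use z in auto)
  thus "(?f has_derivative (%h. G y \<bullet> h)) (at y)" using G0[OF y] by simp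
 next
  show "continuous_on (- cball a (rho/2)) G"
  by(rule continuous_on_eq[OF continuous_on_const[of _ 0]]) (use G0 in auto)
 qed
 have "ball a rho Un - cball a (rho/2) = UNIV" using rho by auto
 hence "C1_grad UNIV ?f G" using C1_grad_Un[OF B Cc open_ball op] by simp
 moreover have "G y = F y" if y: "y : ball a (rho/4)" for y
 proof (rule C1_grad_unique[of psi])
  have yb: "y : ball a rho" using y rho by auto
  show "(psi has_derivative (%h. F y \<bullet> h)) (at y)" by(rule C1_gradD(1)[OF psi yb])
  have "(?f has_derivative (%h. G y \<bullet> h)) (at y)" by(rule C1_gradD(1)[OF B yb])
  thus "(psi has_derivative (%h. G y \<bullet> h)) (at y)"
  by(rule has_derivative_transform_within_open[OF _ open_ball y]) (use cutoff_1[OF r4, of _ a] in "auto simp: less_imp_le")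
 qed
 ultimately show ?thesis by(rule that)
qed

abbreviation cinv :: "('m, 'e) chart => 'e => 'm" where "cinv == chart_inv"

locale riem_manifold =
 fixes A :: "('m::t2_space, 'e::euclidean_space) chart set" and g :: "'m => 'e => 'e => real"
 assumes man: "closed_connected_riemannian_manifold A g"
begin

lemma compactM: "compact (UNIV :: 'm set)" and connectedM: "connected (UNIV :: 'm set)"
 and atlas: "smooth_atlas A" and metric: "riemannian_metric A g"
 using man by(auto simp: closed_connected_riemannian_manifold_def)

abbreviation df :: "('m => real) => 'm => 'e => real" where "df f x == blinfun_apply (differential A f x)"

abbreviation img :: "('m, 'e) chart => 'e set" where "img c == snd c ` fst c"

lemma chartD:
 assumes "c : A"
 shows open_dom: "open (fst c)" and open_img: "open (img c)"
  and chart_inv_chart: "!!x. x : fst c ==> cinv c (snd c x) = x"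
  and chart_chart_inv: "!!y. y : img c ==> snd c (cinv c y) = y"
  and chart_inv_dom: "!!y. y : img c ==> cinv c y : fst c"
  and cont_chart: "continuous_on (fst c) (snd c)" and cont_chart_inv: "continuous_on (img c) (cinv c)"
proof -
 have "is_chart c" using atlas assms by(auto simp: smooth_atlas_def)
 thus "open (fst c)" "open (img c)" "!!x. x : fst c ==> cinv c (snd c x) = x"
  "!!y. y : img c ==> snd c (cinv c y) = y" "!!y. y : img c ==> cinv c y : fst c"
  "continuous_on (fst c) (snd c)" "continuous_on (img c) (cinv c)"
  by(auto simp: is_chart_def homeomorphism_def)
qed

lemma open_overlap:
 assumes "c : A" "d : A"
 shows "open (snd c ` (fst c Int fst d))"
proof -
 have "snd c ` (fst c Int fst d) = img c Int cinv c -` fst d"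
  using chart_inv_chart[OF assms(1)] by force
 moreover have "open (img c Int cinv c -` fst d)"
  by(rule continuous_open_preimage[OF cont_chart_inv[OF assms(1)] open_img[OF assms(1)] open_dom[OF assms(2)]])
 ultimately show ?thesis by simp
qed

lemma open_chart_inv_image:
 assumes c: "c : A" and S: "open S" "S <= img c"
 shows "open (cinv c ` S)"
proof -
 have "cinv c ` S = fst c Int snd c -` S"
  using S(2) chart_inv_chart[OF c] chart_chart_inv[OF c] chart_inv_dom[OF c] by force
 moreover have "open (fst c Int snd c -` S)" by(rule continuous_open_preimage[OF cont_chart[OF c] open_dom[OF c] S(1)])
 ultimately show ?thesis by simp
qed

lemma transition_has_derivative:
 assumes c: "c : A" "d : A" and x: "x : fst c" "x : fst d"
 shows "((snd d o cinv c) has_derivative transition_deriv c d x) (at (snd c x))"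
  and "bounded_linear (transition_deriv c d x)"
proof -
 have "smooth_on (snd c ` (fst c Int fst d)) (snd d o cinv c)" using atlas c by(auto simp: smooth_atlas_def)
 hence "Ck_on (Suc 0) (snd c ` (fst c Int fst d)) (snd d o cinv c)" by(simp only: smooth_on_def)
 hence "(snd d o cinv c) differentiable (at (snd c x))" using x by auto
 thus *: "((snd d o cinv c) has_derivative transition_deriv c d x) (at (snd c x))"
  unfolding transition_deriv_def by(simp add: frechet_derivative_works)
 thus "bounded_linear (transition_deriv c d x)" by(rule has_derivative_bounded_linear)
qed

lemma transition_deriv_continuous:
 assumes c: "c : A" "d : A"
 shows "continuous_on (snd c ` (fst c Int fst d)) (%y. transition_deriv c d (cinv c y) v)"
proof -
 have "smooth_on (snd c ` (fst c Int fst d)) (snd d o cinv c)" using atlas c by(auto simp: smooth_atlas_def)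
 hence "Ck_on (Suc 0) (snd c ` (fst c Int fst d)) (snd d o cinv c)" by(simp only: smooth_on_def)
 hence "continuous_on (snd c ` (fst c Int fst d)) (%y. frechet_derivative (snd d o cinv c) (at y) v)" by simp
 moreover have "frechet_derivative (snd d o cinv c) (at y) v = transition_deriv c d (cinv c y) v"
  if "y : snd c ` (fst c Int fst d)" for y
  using that chart_chart_inv[OF c(1), of y] unfolding transition_deriv_def by auto
 ultimately show ?thesis by(rule continuous_on_eq)
qed

lemma transition_chain:
 assumes c: "c : A" "d : A" "e : A" and x: "x : fst c" "x : fst d" "x : fst e"
 shows "transition_deriv d e x (transition_deriv c d x v) = transition_deriv c e x v"
proof -
 have "(snd d o cinv c) (snd c x) = snd d x" using chart_inv_chart[OF c(1) x(1)] by simp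
 hence "((snd e o cinv d) has_derivative transition_deriv d e x) (at ((snd d o cinv c) (snd c x)))"
  using transition_has_derivative(1)[OF c(2,3) x(2,3)] by simp
 from diff_chain_at[OF transition_has_derivative(1)[OF c(1,2) x(1,2)] this]
 have "(((snd e o cinv d) o (snd d o cinv c)) has_derivative (transition_deriv d e x o transition_deriv c d x)) (at (snd c x))" .
 hence "((snd e o cinv c) has_derivative (transition_deriv d e x o transition_deriv c d x)) (at (snd c x))"
  by(rule has_derivative_transform_within_open[OF _ open_overlap[OF c(1,2)]])
  (use x chart_inv_chart[OF c(1)] chart_inv_chart[OF c(2)] in auto)
 from has_derivative_unique[OF this transition_has_derivative(1)[OF c(1,3) x(1,3)]]
 show ?thesis by(metis comp_apply)
qed

lemma transition_self:
 assumes c: "c : A" and x: "x : fst c"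
 shows "transition_deriv c c x v = v"
proof -
 have "((snd c o cinv c) has_derivative (%h. h)) (at (snd c x))"
  by(rule has_derivative_transform_within_open[OF has_derivative_ident open_img[OF c]])
  (use x chart_chart_inv[OF c] in auto)
 from has_derivative_unique[OF this transition_has_derivative(1)[OF c c x x]] show ?thesis by metis
qed

lemmas chart_atD = chart_at[OF atlas]

lemma transition_inverse:
 assumes "c : A" "d : A" "x : fst c" "x : fst d"
 shows "transition_deriv d c x (transition_deriv c d x v) = v"
 using transition_chain[OF assms(1,2,1,3,4,3)] transition_self[OF assms(1,3)] by simp

text \<open>Covectors are transported by the transpose of the inverse of the map that transports
  vectors.\<close>

lemma pairing:
 assumes c: "c : A" "x : fst c"
 shows "blinfun_apply (cotangent_of A c x q) (tangent_of A c x w) = blinfun_apply q w"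
proof -
 have "blinfun_apply (Blinfun (transition_deriv (chart_at A x) c x)) v = transition_deriv (chart_at A x) c x v" for v
  using transition_has_derivative(2)[OF chart_atD(1) c(1) chart_atD(2) c(2)] by(simp add: bounded_linear_Blinfun_apply)
 thus ?thesis unfolding cotangent_of_def tangent_of_def
  using transition_inverse[OF c(1) chart_atD(1) c(2) chart_atD(2)] by simp
qed

lemma tangent_of_surj:
 assumes c: "c : A" "x : fst c"
 obtains w where "tangent_of A c x w = v"
 using transition_inverse[OF chart_atD(1) c(1) chart_atD(2) c(2), of v] that unfolding tangent_of_def by blast

lemma cotangent_of_surj:
 assumes c: "c : A" "x : fst c"
 obtains z where "cotangent_of A c x (blinfun_inner_right z) = p"
proof -
 have bl: "bounded_linear (tangent_of A c x)" unfolding tangent_of_def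
  by(rule transition_has_derivative(2)[OF c(1) chart_atD(1) c(2) chart_atD(2)])
 have lin: "linear (%w. blinfun_apply p (tangent_of A c x w))"
  by(intro bounded_linear.linear bounded_linear_compose[OF blinfun.bounded_linear_right bl])
 define z where "z = (SUM b:Basis. blinfun_apply p (tangent_of A c x b) *\<^sub>R b)"
 have z: "blinfun_apply p (tangent_of A c x w) = z \<bullet> w" for w
  unfolding z_def by(rule linear_eq_inner_sum[OF lin])
 have "cotangent_of A c x (blinfun_inner_right z) = p"
 proof (rule blinfun_eqI)
  fix v
  obtain w where w: "tangent_of A c x w = v" by(rule tangent_of_surj[OF c])
  show "blinfun_apply (cotangent_of A c x (blinfun_inner_right z)) v = blinfun_apply p v"
  unfolding w[symmetric] pairing[OF c] z by(simp add: blinfun_inner_right.rep_eq)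
 qed
 thus ?thesis by(rule that)
qed

lemma differential_chart:
 assumes c: "c : A" "x : fst c" and f: "((f o cinv c) has_derivative (%h. G \<bullet> h)) (at (snd c x))"
 shows "differential A f x = cotangent_of A c x (blinfun_inner_right G)"
  and "df f x (tangent_of A c x w) = G \<bullet> w"
proof -
 let ?d = "chart_at A x"
 note d = chart_atD(1)[of x] chart_atD(2)[of x]
 have "(snd c o cinv ?d) (snd ?d x) = snd c x" using chart_inv_chart[OF d] by simp
 hence "((f o cinv c) has_derivative (%h. G \<bullet> h)) (at ((snd c o cinv ?d) (snd ?d x)))" using f by simp
 from diff_chain_at[OF transition_has_derivative(1)[OF d(1) c(1) d(2) c(2)] this]
 have "(((f o cinv c) o (snd c o cinv ?d)) has_derivative ((%h. G \<bullet> h) o transition_deriv ?d c x)) (at (snd ?d x))" .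
 hence der: "((f o cinv ?d) has_derivative ((%h. G \<bullet> h) o transition_deriv ?d c x)) (at (snd ?d x))"
  by(rule has_derivative_transform_within_open[OF _ open_overlap[OF d(1) c(1)]])
  (use c d chart_inv_chart[OF d(1)] chart_inv_chart[OF c(1)] in auto)
 have bl: "bounded_linear (transition_deriv ?d c x)" by(rule transition_has_derivative(2)[OF d(1) c(1) d(2) c(2)])
 show 1: "differential A f x = cotangent_of A c x (blinfun_inner_right G)"
 proof (rule blinfun_eqI)
  fix v
  have "df f x v = G \<bullet> transition_deriv ?d c x v"
  unfolding differential_def frechet_derivative_at[OF der, symmetric]
  using has_derivative_bounded_linear[OF der] by(simp add: bounded_linear_Blinfun_apply)
  thus "df f x v = blinfun_apply (cotangent_of A c x (blinfun_inner_right G)) v"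
  using bl by(simp add: cotangent_of_def bounded_linear_Blinfun_apply blinfun_inner_right.rep_eq)
 qed
 show "df f x (tangent_of A c x w) = G \<bullet> w"
  unfolding 1 pairing[OF c] by(simp add: blinfun_inner_right.rep_eq)
qed

lemma C1_fun_iff: "C1_fun A f \<longleftrightarrow> (ALL c:A. EX G. C1_grad (img c) (f o cinv c) G)"
 unfolding C1_fun_def Ck_on_1_iff ..

definition grad :: "('m, 'e) chart => ('m => real) => 'e => 'e" where
 "grad c f = (SOME G. C1_grad (img c) (f o cinv c) G)"

lemma C1_fun_grad: "C1_fun A f ==> c : A ==> C1_grad (img c) (f o cinv c) (grad c f)"
 unfolding grad_def C1_fun_iff by(rule someI_ex[where P = "C1_grad (img c) (f o cinv c)"]) blast

lemma differential_grad:
 assumes f: "C1_fun A f" and c: "c : A" "y : img c"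
 shows "df f (cinv c y) (tangent_of A c (cinv c y) w) = grad c f y \<bullet> w"
  and "differential A f (cinv c y) = cotangent_of A c (cinv c y) (blinfun_inner_right (grad c f y))"
 using differential_chart[OF c(1) chart_inv_dom[OF c], of f "grad c f y"] C1_gradD(1)[OF C1_fun_grad[OF f c(1)] c(2)]
  chart_chart_inv[OF c] by auto

lemma C1_fun_continuous:
 assumes "C1_fun A f" shows "continuous_on UNIV f"
proof -
 have "isCont f x" for x
 proof -
  let ?d = "chart_at A x"
  note d = chart_atD(1)[of x] chart_atD(2)[of x]
  have "continuous_on (fst ?d) (%x. (f o cinv ?d) (snd ?d x))"
  by(rule continuous_on_compose2[OF C1_grad_continuous[OF C1_fun_grad[OF assms d(1)]] cont_chart[OF d(1)]]) auto
  hence "continuous_on (fst ?d) f" using chart_inv_chart[OF d(1)] by(auto cong: continuous_on_cong_simp)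
  thus ?thesis using open_dom[OF d(1)] d(2) by(simp add: continuous_on_eq_continuous_at)
 qed
 thus ?thesis by(simp add: continuous_on_eq_continuous_at)
qed

text \<open>Functions with compact support in a chart extend by zero.\<close>

lemma C1_fun_extend:
 assumes c: "c : A" and K: "compact K" "K <= img c" and xi: "C1_grad UNIV xi G" and z: "!!y. y ~: K ==> xi y = 0"
 shows "C1_fun A (%x. if x : fst c then xi (snd c x) else 0)" (is "C1_fun A ?f")
 unfolding C1_fun_def
proof
 fix d assume d: "d : A"
 let ?K = "cinv c ` K"
 have "compact ?K" by(rule compact_continuous_image[OF continuous_on_subset[OF cont_chart_inv[OF c] K(2)] K(1)])
 hence clK: "closed ?K" by(rule compact_imp_closed)
 have f0: "?f x = 0" if "x ~: ?K" for x
 proof (cases "x : fst c")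
  case True
  hence "snd c x ~: K" using that chart_inv_chart[OF c True] by(metis imageI)
  thus ?thesis using z by simp
 qed simp
 let ?O1 = "snd d ` (fst d Int fst c)" and ?O2 = "img d Int cinv d -` (- ?K)"
 have o1: "open ?O1" by(rule open_overlap[OF d c])
 have o2: "open ?O2" by(rule continuous_open_preimage[OF cont_chart_inv[OF d] open_img[OF d]]) (use clK in auto)
 have cov: "img d = ?O1 Un ?O2"
 proof -
  have "?K <= fst c" using chart_inv_dom[OF c] K(2) by auto
  hence "y : ?O1" if "y : img d" "cinv d y : ?K" for y
  using that chart_inv_dom[OF d that(1)] chart_chart_inv[OF d that(1)] by(metis IntI imageI subsetD)
  thus ?thesis by auto
 qed
 let ?h = "?f o cinv d"
 have d1: "(?h has_derivative (%v. G (snd c (cinv d y)) \<bullet> transition_deriv d c (cinv d y) v)) (at y)" if y: "y : ?O1" for y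
 proof -
  have yd: "cinv d y : fst d" "cinv d y : fst c" "snd d (cinv d y) = y"
  using y chart_inv_chart[OF d] by auto
  have "((snd c o cinv d) has_derivative transition_deriv d c (cinv d y)) (at y)"
  using transition_has_derivative(1)[OF d c yd(1,2)] yd(3) by simp
  from diff_chain_at[OF this C1_gradD(1)[OF xi]]
  have "((xi o (snd c o cinv d)) has_derivative (%v. G (snd c (cinv d y)) \<bullet> transition_deriv d c (cinv d y) v)) (at y)"
  by(simp add: o_def)
  thus ?thesis
  by(rule has_derivative_transform_within_open[OF _ o1 y]) (use chart_inv_chart[OF d] in auto)
 qed
 have d2: "(?h has_derivative (%v. 0)) (at y)" if y: "y : ?O2" for y
  by(rule has_derivative_transform_within_open[OF has_derivative_const o2 y]) (use f0 in auto)
 have c1: "continuous_on ?O1 (%y. frechet_derivative ?h (at y) v)" for v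
 proof -
  have "continuous_on ?O1 (%y. snd c (cinv d y))"
  by(rule continuous_on_compose2[OF cont_chart[OF c] continuous_on_subset[OF cont_chart_inv[OF d]]])
  (use chart_inv_chart[OF d] in auto)
  hence "continuous_on ?O1 (%y. G (snd c (cinv d y)))"
  by(rule continuous_on_compose2[OF C1_gradD(2)[OF xi]]) auto
  hence cc: "continuous_on ?O1 (%y. G (snd c (cinv d y)) \<bullet> transition_deriv d c (cinv d y) v)"
  by(intro continuous_intros transition_deriv_continuous[OF d c])
  have ff: "frechet_derivative ?h (at y) v = G (snd c (cinv d y)) \<bullet> transition_deriv d c (cinv d y) v" if "y : ?O1" for y
  using fun_cong[OF frechet_derivative_at[OF d1[OF that]], of v] by simp
  show ?thesis by(rule continuous_on_eq[OF cc]) (rule ff[symmetric])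
 qed
 have c2: "continuous_on ?O2 (%y. frechet_derivative ?h (at y) v)" for v
 proof -
  have ff: "frechet_derivative ?h (at y) v = 0" if "y : ?O2" for y
  using fun_cong[OF frechet_derivative_at[OF d2[OF that]], of v] by simp
  show ?thesis by(rule continuous_on_eq[OF continuous_on_const[of ?O2 0]]) (rule ff[symmetric])
 qed
 have "continuous_on (img d) (%y. frechet_derivative ?h (at y) v)" for v
  using continuous_on_open_Un[OF o1 o2 c1 c2] by(simp only: cov[symmetric])
 moreover have "?h differentiable (at y)" if "y : img d" for y
 proof -
  have "y : ?O1 | y : ?O2" using that cov by blast
  thus ?thesis using d1 d2 unfolding differentiable_def by blast
 qed
 ultimately show "Ck_on 1 (img d) ?h" by simp
qed

text \<open>The viscosity inequalities are tested with \<open>C\<^sup>1\<close> functions on the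
  whole manifold, while the constructions in charts yield functions on a ball only; near the
  touching point the cutoff changes nothing.\<close>

lemma local_test_function:
 assumes c: "c : A" and rho: "rho > 0" "ball y0 rho <= img c" and psi: "C1_grad (ball y0 rho) psi F"
 obtains phi where "C1_fun A phi" "!!y. y : ball y0 (rho/4) ==> phi (cinv c y) = psi y"
  "differential A phi (cinv c y0) = cotangent_of A c (cinv c y0) (blinfun_inner_right (F y0))"
proof -
 have r4: "rho/4 > 0" using rho by simp
 obtain G where G: "C1_grad UNIV (%y. cutoff y0 (rho/4) y * psi y) G" "!!y. y : ball y0 (rho/4) ==> G y = F y"
  by(rule C1_grad_cutoff_mult[OF rho(1) psi]) blast
 let ?xi = "%y. cutoff y0 (rho/4) y * psi y"
 define phi where "phi x = (if x : fst c then ?xi (snd c x) else 0)" for x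
 have K: "cball y0 (rho/2) <= img c" using rho by(intro order_trans[OF _ rho(2)]) auto
 have C1: "C1_fun A phi" unfolding phi_def
 proof (rule C1_fun_extend[OF c compact_cball K G(1)])
  fix y assume "y ~: cball y0 (rho/2)"
  hence "cutoff y0 (rho/4) y = 0" by(intro cutoff_0[OF r4]) auto
  thus "?xi y = 0" by simp
 qed
 have in_img: "y : img c" if "y : ball y0 (rho/4)" for y using that rho by(intro subsetD[OF rho(2)]) auto
 have eq: "phi (cinv c y) = psi y" if y: "y : ball y0 (rho/4)" for y
  using cutoff_1[OF r4, of y y0] y chart_inv_dom[OF c in_img[OF y]] chart_chart_inv[OF c in_img[OF y]] by(auto simp: phi_def)
 have y0: "y0 : ball y0 (rho/4)" "y0 : ball y0 rho" using rho by auto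
 have "(psi has_derivative (%h. F y0 \<bullet> h)) (at y0)" by(rule C1_gradD(1)[OF psi y0(2)])
 hence "((phi o cinv c) has_derivative (%h. F y0 \<bullet> h)) (at y0)"
  by(rule has_derivative_transform_within_open[OF _ open_ball y0(1)]) (use eq in auto)
 hence "differential A phi (cinv c y0) = cotangent_of A c (cinv c y0) (blinfun_inner_right (F y0))"
  using chart_inv_dom[OF c in_img[OF y0(1)]] chart_chart_inv[OF c in_img[OF y0(1)]] by(intro differential_chart(1)[OF c]) auto
 with C1 eq show ?thesis by(rule that)
qed

end

lemma abs_cont_on_cong:
 assumes "abs_cont_on a b f" "!!x. x : {a..b} ==> f x = g x"
 shows "abs_cont_on a b g"
 by(rule abs_cont_on_Lipschitz[OF assms(1), of g 1]) (use assms(2) in simp)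

lemma C1_on_compact_interval_abs_cont:
 fixes f :: "real => 'a::euclidean_space"
 assumes d: "!!x. x : {a..b} ==> (f has_vector_derivative f' x) (at x)" and c: "continuous_on {a..b} f'"
 shows "abs_cont_on a b f"
proof -
 obtain B where B: "!!x. x : {a..b} ==> norm (f' x) <= B" by(rule compact_boundE[OF c compact_Icc]) blast
 show ?thesis
 proof (rule abs_cont_on_Lipschitz[OF abs_cont_on_id, where C = B])
  fix x y assume xy: "x : {a..b}" "y : {a..b}"
  have "norm (f x - f y) <= B * norm (x - y)"
  proof (rule differentiable_bound[OF convex_real_interval(5)[of a b] _ _ xy])
  fix z assume z: "z : {a..b}"
  show "(f has_derivative (%t. t *\<^sub>R f' z)) (at z within {a..b})"
  using d[OF z] unfolding has_vector_derivative_def by(rule has_derivative_at_withinI)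
  show "onorm (%t. t *\<^sub>R f' z) <= B"
  by(rule onorm_le) (use mult_left_mono[OF B[OF z] abs_ge_zero] in "simp add: mult.commute")
  qed
  thus "dist (f x) (f y) <= B * dist x y" by(simp add: dist_norm)
 qed
qed

section \<open>The tangent bundle, a finite cover, curves and their action\<close>

context riem_manifold
begin

lemma topspace_bundle [simp]: "topspace (bundle_topology A F) = UNIV"
proof -
 have "openin (bundle_topology A F) UNIV"
  unfolding openin_bundle_topology
 proof
  fix c assume c: "c : A"
  have "{(y, w). y : img c & (cinv c y, F c (cinv c y) w) : UNIV} = img c \<times> UNIV" by auto
  thus "open {(y, w). y : img c & (cinv c y, F c (cinv c y) w) : UNIV}"
  using open_img[OF c] by(simp only: open_Times open_UNIV)
 qed
 thus ?thesis using openin_subset by blast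
qed

lemma bundle_chart_continuous:
 assumes c: "c : A"
 shows "continuous_map (top_of_set (img c \<times> UNIV)) (bundle_topology A F) (%(y, w). (cinv c y, F c (cinv c y) w))"
 unfolding continuous_map_def
proof (intro conjI allI impI)
 fix W assume "openin (bundle_topology A F) W"
 hence "open {(y, w). y : img c & (cinv c y, F c (cinv c y) w) : W}" using c by(simp add: openin_bundle_topology)
 moreover have "{x : topspace (top_of_set (img c \<times> UNIV)). (case x of (y, w) => (cinv c y, F c (cinv c y) w)) : W}
  = {(y, w). y : img c & (cinv c y, F c (cinv c y) w) : W}" by auto
 ultimately show "openin (top_of_set (img c \<times> UNIV)) {x : topspace (top_of_set (img c \<times> UNIV)).
  (case x of (y, w) => (cinv c y, F c (cinv c y) w)) : W}"
  unfolding openin_open_eq[OF open_Times[OF open_img[OF c] open_UNIV]] by auto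
qed simp

text \<open>Continuity for the bundle topology, read off in bundle charts. The product topology on
  \<open>'m \<times> 'e\<close> would be wrong because the chosen chart jumps.\<close>

definition tm_cont :: "('m => 'e => real) => bool" where
 "tm_cont F \<longleftrightarrow> (ALL c:A. continuous_on (img c \<times> UNIV) (%x. F (cinv c (fst x)) (tangent_of A c (cinv c (fst x)) (snd x))))"

abbreviation TM :: "('m \<times> 'e) measure" where "TM == sigma UNIV {W. openin (tangent_topology A) W}"

lemma tm_cont_measurable:
 assumes F: "tm_cont F" and m: "sets m = sets TM"
 shows "(%(x, v). F x v) : borel_measurable m"
proof (rule borel_measurableI)
 fix S :: "real set" assume S: "open S"
 have sp: "space m = UNIV" using sets_eq_imp_space_eq[OF m] by simp
 let ?W = "(%(x, v). F x v) -` S"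
 have "openin (tangent_topology A) ?W"
  unfolding tangent_topology_def openin_bundle_topology
 proof
  fix c assume c: "c : A"
  have "open ((img c \<times> UNIV) Int (%x. F (cinv c (fst x)) (tangent_of A c (cinv c (fst x)) (snd x))) -` S)"
  by(rule continuous_open_preimage[OF _ _ S]) (use F c open_img[OF c] in "auto simp: tm_cont_def intro!: open_Times")
  moreover have "(img c \<times> UNIV) Int (%x. F (cinv c (fst x)) (tangent_of A c (cinv c (fst x)) (snd x))) -` S
  = {(y, w). y : img c & (cinv c y, tangent_of A c (cinv c y) w) : ?W}" by auto
  ultimately show "open {(y, w). y : img c & (cinv c y, tangent_of A c (cinv c y) w) : ?W}" by simp
 qed
 hence "?W : sets TM" by(intro in_measure_of) auto
 thus "?W Int space m : sets m" using m sp by simp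
qed

lemma fst_measurable:
 assumes m: "sets m = sets TM"
 shows "fst : measurable m (borel :: 'm measure)"
proof (rule borel_measurableI)
 fix S :: "'m set" assume S: "open S"
 have sp: "space m = UNIV" using sets_eq_imp_space_eq[OF m] by simp
 have "openin (tangent_topology A) (fst -` S)"
  unfolding tangent_topology_def openin_bundle_topology
 proof
  fix c assume c: "c : A"
  have "open (img c Int cinv c -` S)" by(rule continuous_open_preimage[OF cont_chart_inv[OF c] open_img[OF c] S])
  moreover have "{(y, w). y : img c & (cinv c y, tangent_of A c (cinv c y) w) : fst -` S} = (img c Int cinv c -` S) \<times> UNIV" by auto
  ultimately show "open {(y, w). y : img c & (cinv c y, tangent_of A c (cinv c y) w) : fst -` S}" by(simp add: open_Times)
 qed
 hence "fst -` S : sets TM" by(intro in_measure_of) auto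
 thus "fst -` S Int space m : sets m" using m sp by simp
qed

lemma tm_cont_base:
 assumes "continuous_on UNIV f" shows "tm_cont (%x v. f x)"
 unfolding tm_cont_def
proof
 fix c assume c: "c : A"
 have "continuous_on (img c) (%y. f (cinv c y))" by(rule continuous_on_compose2[OF assms cont_chart_inv[OF c]]) auto
 thus "continuous_on (img c \<times> UNIV) (%x. f (cinv c (fst x)))"
  by(rule continuous_on_compose2) (auto intro!: continuous_intros)
qed

lemma tm_cont_mult: "tm_cont F ==> tm_cont G ==> tm_cont (%x v. F x v * G x v)"
 unfolding tm_cont_def by(auto intro!: continuous_intros)

lemma tm_cont_differential:
 assumes f: "C1_fun A f" shows "tm_cont (%x v. df f x v)"
 unfolding tm_cont_def
proof
 fix c assume c: "c : A"
 have "continuous_on (img c \<times> UNIV) (%x. grad c f (fst x) \<bullet> snd x)"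
  by(intro continuous_intros continuous_on_compose2[OF C1_gradD(2)[OF C1_fun_grad[OF f c]]]) auto
 thus "continuous_on (img c \<times> UNIV)
  (%x. df f (cinv c (fst x)) (tangent_of A c (cinv c (fst x)) (snd x)))"
  by(rule continuous_on_eq) (use differential_grad(1)[OF f c] in auto)
qed

text \<open>Smoothness of the metric is given for fixed coordinate vectors only; expansion in the
  basis exhibits its joint dependence on point and vector.\<close>

lemma tm_cont_metric: "tm_cont (tangent_norm g)"
 unfolding tm_cont_def tangent_norm_def
proof
 fix c assume c: "c : A"
 let ?T = "%y w. tangent_of A c (cinv c y) w"
 let ?q = "%b b' y. g (cinv c y) (?T y b) (?T y b')"
 have bil: "bilinear (g x)" for x using metric by(auto simp: riemannian_metric_def)
 have cq: "continuous_on (img c) (?q b b')" for b b'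
 proof -
  have "smooth_on (img c) (?q b b')" using metric c by(auto simp: riemannian_metric_def)
  hence "Ck_on 0 (img c) (?q b b')" by(simp only: smooth_on_def)
  thus ?thesis by simp
 qed
 have eq: "g (cinv c y) (?T y w) (?T y w) = (SUM b:Basis. SUM b':Basis. (w \<bullet> b) * (w \<bullet> b') * ?q b b' y)" if y: "y : img c" for y w
 proof -
  have lin: "linear (?T y)" unfolding tangent_of_def
  by(rule bounded_linear.linear[OF transition_has_derivative(2)[OF c chart_atD(1) chart_inv_dom[OF c y] chart_atD(2)]])
  have "?T y w = ?T y (SUM b:Basis. (w \<bullet> b) *\<^sub>R b)" by(simp add: euclidean_representation)
  also have "... = (SUM b:Basis. (w \<bullet> b) *\<^sub>R ?T y b)" using lin by(simp add: linear_sum linear_scale)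
  finally have Tw: "?T y w = (SUM b:Basis. (w \<bullet> b) *\<^sub>R ?T y b)" .
  have l1: "linear (g (cinv c y) v)" and l2: "linear (%v. g (cinv c y) v v')" for v v'
  using bil by(auto simp: bilinear_def)
  have "g (cinv c y) (SUM b:Basis. (w \<bullet> b) *\<^sub>R ?T y b) (SUM b:Basis. (w \<bullet> b) *\<^sub>R ?T y b)
  = (SUM b:Basis. (w \<bullet> b) * g (cinv c y) (?T y b) (SUM b:Basis. (w \<bullet> b) *\<^sub>R ?T y b))"
  using linear_sum[OF l2, of "%b. (w \<bullet> b) *\<^sub>R ?T y b" Basis] linear_scale[OF l2] by simp
  also have "... = (SUM b:Basis. (w \<bullet> b) * (SUM b':Basis. (w \<bullet> b') * ?q b b' y))"
  using linear_sum[OF l1, of _ "%b. (w \<bullet> b) *\<^sub>R ?T y b" Basis] linear_scale[OF l1] by simp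
  finally show ?thesis using Tw by(simp add: sum_distrib_left mult.assoc)
 qed
 have "continuous_on (img c \<times> UNIV) (%x. sqrt (SUM b:Basis. SUM b':Basis. (snd x \<bullet> b) * (snd x \<bullet> b') * ?q b b' (fst x)))"
  by(intro continuous_intros continuous_on_compose2[OF cq]) auto
 thus "continuous_on (img c \<times> UNIV) (%x. sqrt (g (cinv c (fst x)) (?T (fst x) (snd x)) (?T (fst x) (snd x))))"
  by(rule continuous_on_eq) (use eq in auto)
qed

text \<open>Balls of radius \<open>r\<close> cover the manifold, bump functions live in radius
  \<open>2 * r\<close>, uniform bounds and short segments in radius \<open>3 * r\<close>, and the
  compact supports of mollified functions in radius \<open>4 * r\<close>.\<close>

definition is_cover :: "(('m, 'e) chart \<times> 'e \<times> real) set => bool" where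
 "is_cover I \<longleftrightarrow> finite I & (ALL (c, a, r):I. c : A & r > 0 & cball a (4 * r) <= img c) &
  (ALL x. EX (c, a, r):I. EX y:ball a r. x = cinv c y)"

lemma ex_cover: "EX I. is_cover I"
proof -
 define \<I> where "\<I> = {(c, a, r). c : A & r > 0 & cball a (4 * r) <= img c}"
 define N where "N = (%(c :: ('m, 'e) chart, a, r). cinv c ` ball a r)"
 have op: "open (N i)" if "i : \<I>" for i
 proof -
  obtain c a r where i: "i = (c, a, r)" by(cases i)
  have c: "c : A" "r > 0" "cball a (4 * r) <= img c" using that i by(auto simp: \<I>_def)
  have "ball a r <= img c" using c(2) by(intro order_trans[OF _ c(3)]) auto
  thus ?thesis using open_chart_inv_image[OF c(1) open_ball] by(simp add: N_def i)
 qed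
 have cov: "UNIV <= (UN i:\<I>. N i)"
 proof
  fix x :: 'm
  let ?c = "chart_at A x"
  note c = chart_atD(1)[of x] chart_atD(2)[of x]
  obtain e where e: "e > 0" "cball (snd ?c x) e <= img ?c"
  using open_img[OF c(1)] c(2) by(meson imageI open_contains_cball)
  hence "(?c, snd ?c x, e/4) : \<I>" using c by(simp add: \<I>_def)
  moreover have "x : N (?c, snd ?c x, e/4)" using e(1) chart_inv_chart[OF c] by(auto simp: N_def intro!: image_eqI[of _ _ "snd ?c x"])
  ultimately show "x : (UN i:\<I>. N i)" by blast
 qed
 obtain I where I: "I <= \<I>" "finite I" "UNIV <= (UN i:I. N i)"
  by(rule compactE_image[OF compactM, of \<I> N]) (use op cov in auto)
 have "is_cover I" unfolding is_cover_def
 proof (intro conjI allI I(2))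
  show "ALL (c, a, r):I. c : A & r > 0 & cball a (4 * r) <= img c" using I(1) by(auto simp: \<I>_def)
  fix x
  obtain i where i: "i : I" "x : N i" using I(3) by blast
  show "EX (c, a, r):I. EX y:ball a r. x = cinv c y" by(rule bexI[OF _ i(1)]) (use i(2) in "auto simp: N_def")
 qed
 thus ?thesis by blast
qed

definition cover :: "(('m, 'e) chart \<times> 'e \<times> real) set" where "cover = (SOME I. is_cover I)"

lemma cover: "is_cover cover" unfolding cover_def by(rule someI_ex[OF ex_cover])

lemma finite_cover: "finite cover" using cover by(simp add: is_cover_def)

lemma coverD:
 assumes "(c, a, r) : cover" shows "c : A" "r > 0" "cball a (4 * r) <= img c"
 using cover assms unfolding is_cover_def by fast+

lemma coverE:
 obtains c a r y where "(c, a, r) : cover" "y : ball a r" "x = cinv c y"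
proof -
 have "EX (c, a, r):cover. EX y:ball a r. x = cinv c y" using cover by(simp add: is_cover_def)
 then obtain i where i: "i : cover" "case i of (c, a, r) => EX y:ball a r. x = cinv c y" by blast
 obtain c a r where car: "i = (c, a, r)" by(cases i)
 obtain y where "y : ball a r" "x = cinv c y" using i(2) unfolding car by auto
 thus ?thesis using that[of c a r y] i(1) car by simp
qed

lemma velocity_chart:
 assumes c: "c : A" and x: "gm s : fst c" and cont: "isCont gm s"
  and d: "((snd c o gm) has_vector_derivative w) (at s)"
 shows "velocity A gm s = tangent_of A c (gm s) w"
proof -
 let ?d = "chart_at A (gm s)"
 note dd = chart_atD(1)[of "gm s"] chart_atD(2)[of "gm s"]
 have "((snd c o gm) has_derivative (%h. h *\<^sub>R w)) (at s)" using d by(simp add: has_vector_derivative_def)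
 moreover have "((snd ?d o cinv c) has_derivative transition_deriv c ?d (gm s)) (at ((snd c o gm) s))"
  using transition_has_derivative(1)[OF c dd(1) x dd(2)] by simp
 ultimately have der: "(((snd ?d o cinv c) o (snd c o gm)) has_derivative (transition_deriv c ?d (gm s) o (%h. h *\<^sub>R w))) (at s)"
  by(rule diff_chain_at)
 obtain T where T: "open T" "s : T" "ALL t:T. gm t : fst c"
  using cont open_dom[OF c] x unfolding continuous_at_open by blast
 have "((snd ?d o gm) has_derivative (transition_deriv c ?d (gm s) o (%h. h *\<^sub>R w))) (at s)"
  by(rule has_derivative_transform_within_open[OF der T(1,2)]) (use T(3) chart_inv_chart[OF c] in auto)
 moreover have "transition_deriv c ?d (gm s) o (%h. h *\<^sub>R w) = (%h. h *\<^sub>R tangent_of A c (gm s) w)"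
  using linear_scale[OF bounded_linear.linear[OF transition_has_derivative(2)[OF c dd(1) x dd(2)]]] by(simp add: fun_eq_iff tangent_of_def)
 ultimately have "((snd ?d o gm) has_vector_derivative tangent_of A c (gm s) w) (at s)" by(simp add: has_vector_derivative_def)
 thus ?thesis unfolding velocity_def by(rule vector_derivative_at)
qed

end

lemma has_vector_derivative_shift_iff:
 "((%r. f (r - s)) has_vector_derivative D) (at r) \<longleftrightarrow> (f has_vector_derivative D) (at (r - s))"
proof -
 have 1: "((%r. f (r - s)) has_vector_derivative D) (at r)" if "(f has_vector_derivative D) (at (r - s))" for f s r
 proof -
  have "((%r. r - s) has_derivative (%h. h)) (at r)" by(auto intro!: derivative_eq_intros)
  from has_derivative_compose[OF this that[unfolded has_vector_derivative_def]]
  show ?thesis by(simp add: has_vector_derivative_def)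
 qed
 show ?thesis using 1[of f r s] 1[of "%r. f (r - s)" "r - s" "- s"] by auto
qed

lemma has_vector_derivative_local_iff:
 assumes "open T" "r : T" "!!x. x : T ==> f x = g x"
 shows "(f has_vector_derivative D) (at r) \<longleftrightarrow> (g has_vector_derivative D) (at r)"
 using has_vector_derivative_transform_within_open[of f D r T g] has_vector_derivative_transform_within_open[of g D r T f] assms
 by auto

context riem_manifold
begin

lemma velocity_local:
 assumes "open T" "r : T" "!!x. x : T ==> gm x = gm' x"
 shows "velocity A gm r = velocity A gm' r"
proof -
 have "((snd c o gm) has_vector_derivative D) (at r) \<longleftrightarrow> ((snd c o gm') has_vector_derivative D) (at r)" for c :: "('m, 'e) chart" and D
  by(rule has_vector_derivative_local_iff[OF assms(1,2)]) (use assms(3) in simp)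
 thus ?thesis unfolding velocity_def vector_derivative_def using assms(2,3) by simp
qed

lemma velocity_shift: "velocity A (%r. gm (r - s)) r = velocity A gm (r - s)"
proof -
 have "((snd c o (%r. gm (r - s))) has_vector_derivative D) (at r) \<longleftrightarrow> ((snd c o gm) has_vector_derivative D) (at (r - s))" for c :: "('m, 'e) chart" and D
  using has_vector_derivative_shift_iff[of "snd c o gm" s D r] by(simp add: o_def)
 thus ?thesis unfolding velocity_def vector_derivative_def by simp
qed

text \<open>Inside one chart ball \<open>f\<close> is Lipschitz in coordinates, so \<open>f\<close>
  along the curve is absolutely continuous; at almost every time its derivative is the differential
  applied to the velocity.\<close>

lemma C1_increment_local:
 assumes f: "C1_fun A f" and ac: "abs_cont_curve A t gm" and int: "l integrable_on {u..v}"
  and uv: "0 <= u" "u <= v" "v <= t" and c: "c : A" "cball a r <= img c" "gm ` {u..v} <= cinv c ` ball a r"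
  and le: "!!s. s : {u<..<v} ==> df f (gm s) (velocity A gm s) <= l s"
 shows "f (gm v) - f (gm u) <= integral {u..v} l"
proof -
 define eta where "eta = snd c o gm"
 have b: "eta s : ball a r" "gm s : fst c" "cinv c (eta s) = gm s" if s: "s : {u..v}" for s
 proof -
  obtain y where y: "y : ball a r" "gm s = cinv c y" using c(3) s by blast
  have yi: "y : img c" using y(1) c(2) by(meson ball_subset_cball subsetD)
  thus "eta s : ball a r" "gm s : fst c" "cinv c (eta s) = gm s"
  using y chart_chart_inv[OF c(1) yi] chart_inv_dom[OF c(1) yi] by(auto simp: eta_def)
 qed
 have sub: "gm ` {u..v} <= fst c" using b(2) by blast
 have aceta: "abs_cont_on u v eta" unfolding eta_def
  using ac[unfolded abs_cont_curve_def, THEN conjunct2, rule_format, OF c(1) uv sub] .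
 have G: "C1_grad (img c) (f o cinv c) (grad c f)" by(rule C1_fun_grad[OF f c(1)])
 obtain B where B: "!!y. y : cball a r ==> norm (grad c f y) <= B"
  by(rule compact_boundE[OF continuous_on_subset[OF C1_gradD(2)[OF G] c(2)] compact_cball]) blast
 have lip: "norm ((f o cinv c) x - (f o cinv c) y) <= B * norm (x - y)" if xy: "x : cball a r" "y : cball a r" for x y
 proof (rule differentiable_bound[OF convex_cball _ _ xy])
  fix z assume z: "z : cball a r"
  show "((f o cinv c) has_derivative (%h. grad c f z \<bullet> h)) (at z within cball a r)"
  by(rule has_derivative_at_withinI[OF C1_gradD(1)[OF G]]) (use z c(2) in blast)
  show "onorm (%h. grad c f z \<bullet> h) <= B"
  proof (rule onorm_le)
  fix h
  have "norm (grad c f z \<bullet> h) <= norm (grad c f z) * norm h" by(simp add: Cauchy_Schwarz_ineq2)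
  also have "... <= B * norm h" by(rule mult_right_mono[OF B[OF z]]) simp
  finally show "norm (grad c f z \<bullet> h) <= B * norm h" .
  qed
 qed
 have acF: "abs_cont_on u v (%s. f (gm s))"
 proof (rule abs_cont_on_Lipschitz[OF aceta, where C = B])
  fix x y assume xy: "x : {u..v}" "y : {u..v}"
  have "eta x : cball a r" "eta y : cball a r" using b(1)[OF xy(1)] b(1)[OF xy(2)] by auto
  from lip[OF this] show "dist (f (gm x)) (f (gm y)) <= B * dist (eta x) (eta y)"
  using b(3)[OF xy(1)] b(3)[OF xy(2)] by(simp add: dist_norm)
 qed
 show ?thesis
 proof (rule abs_cont_on_increment_le_integral[OF acF uv(2) integrable_integral[OF int] abs_cont_on_differentiable_AE[OF aceta]])
  fix s assume s: "s : {u<..<v} - {x : {u<..<v}. ~ eta differentiable (at x)}"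
  hence suv: "s : {u<..<v}" "s : {u..v}" and "eta differentiable (at s)" by auto
  then obtain w where w: "(eta has_vector_derivative w) (at s)" using vector_derivative_works by blast
  have "continuous_on {0..t} gm" using ac by(simp add: abs_cont_curve_def)
  hence "continuous_on {u<..<v} gm" by(rule continuous_on_subset) (use uv in auto)
  hence cont: "isCont gm s" using suv(1) by(simp add: continuous_on_eq_continuous_at)
  have vel: "velocity A gm s = tangent_of A c (gm s) w"
  by(rule velocity_chart[where c = c, OF c(1) b(2)[OF suv(2)] cont]) (use w in "simp add: eta_def")
  have eimg: "eta s : img c" using b(1)[OF suv(2)] c(2) by(meson ball_subset_cball subsetD)
  have "((%s. (f o cinv c) (eta s)) has_derivative (%h. grad c f (eta s) \<bullet> (h *\<^sub>R w))) (at s)"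
  by(rule has_derivative_compose[OF w[unfolded has_vector_derivative_def] C1_gradD(1)[OF G eimg]])
  hence "((%s. f (gm s)) has_derivative (%h. grad c f (eta s) \<bullet> (h *\<^sub>R w))) (at s)"
  by(rule has_derivative_transform_within_open[OF _ open_greaterThanLessThan suv(1)]) (use b(3) in auto)
  hence "((%s. f (gm s)) has_real_derivative (grad c f (eta s) \<bullet> w)) (at s)"
  unfolding has_field_derivative_def by(rule has_derivative_eq_rhs) (auto simp: fun_eq_iff)
  moreover have "grad c f (eta s) \<bullet> w <= l s"
  using le[OF suv(1)] differential_grad(1)[OF f c(1) eimg, of w] b(3)[OF suv(2)] vel by simp
  ultimately show "EX D<=l s. ((%s. f (gm s)) has_real_derivative D) (at s)" by blast
 qed
qed

text \<open>Each chart controls only short pieces of the curve. The inequality is additive over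
  adjacent intervals and holds on all short ones, so Bolzano's bisection principle propagates
  it.\<close>

lemma C1_increment_le:
 assumes f: "C1_fun A f" and ac: "abs_cont_curve A t gm" and t: "0 <= t" and int: "(l has_integral I) {0..t}"
  and le: "!!s. s : {0<..<t} ==> df f (gm s) (velocity A gm s) <= l s"
 shows "f (gm t) - f (gm 0) <= I"
proof -
 have io: "l integrable_on {0..t}" using int by blast
 have io': "l integrable_on {u..v}" if "0 <= u" "v <= t" for u v
  by(rule integrable_on_subinterval[OF io]) (use that in auto)
 have cont: "continuous_on {0..t} gm" using ac by(simp add: abs_cont_curve_def)
 let ?P = "%u v. 0 <= u --> u <= v --> v <= t --> f (gm v) - f (gm u) <= integral {u..v} l"
 have "?P 0 t"
  using t
 proof (rule Bolzano[where P = ?P])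
  fix a b c assume "?P a b" "?P b c" "a <= b" "b <= c"
  show "?P a c"
  proof (intro impI)
  assume ac: "0 <= a" "a <= c" "c <= t"
  have "integral {a..b} l + integral {b..c} l = integral {a..c} l"
  by(rule Henstock_Kurzweil_Integration.integral_combine[OF \<open>a <= b\<close> \<open>b <= c\<close> io'[OF ac(1,3)]])
  moreover have "f (gm b) - f (gm a) <= integral {a..b} l" using \<open>?P a b\<close> \<open>a <= b\<close> \<open>b <= c\<close> ac by simp
  moreover have "f (gm c) - f (gm b) <= integral {b..c} l" using \<open>?P b c\<close> \<open>a <= b\<close> \<open>b <= c\<close> ac by simp
  ultimately show "f (gm c) - f (gm a) <= integral {a..c} l" by linarith
  qed
 next
  fix x assume x: "0 <= x" "x <= t"
  obtain c a r y where c: "(c, a, r) : cover" "y : ball a r" "gm x = cinv c y" by(rule coverE[of "gm x"])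
  note cD = coverD[OF c(1)]
  have cb: "cball a r <= img c" using cD(2) by(intro order_trans[OF _ cD(3)]) auto
  let ?N = "cinv c ` ball a r"
  have oN: "open ?N" by(rule open_chart_inv_image[OF cD(1) open_ball]) (use cb ball_subset_cball in blast)
  have "gm x : ?N" using c by blast
  moreover have "x : {0..t}" using x by simp
  ultimately obtain T where T: "open T" "x : T" "ALL s:{0..t}. s : T --> gm s : ?N"
  using cont oN unfolding continuous_on_topological by meson
  then obtain d where d: "d > 0" "ball x d <= T" by(meson open_contains_ball)
  show "EX d>0. ALL a b. a <= x & x <= b & b - a < d --> ?P a b"
  proof (intro exI[of _ d] conjI allI impI d(1))
  fix u v assume uv: "u <= x & x <= v & v - u < d" and uv': "0 <= u" "u <= v" "v <= t"
  have "gm ` {u..v} <= ?N"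
  proof
  fix z assume "z : gm ` {u..v}"
  then obtain s where s: "s : {u..v}" "z = gm s" by blast
  hence "s : ball x d" using uv by(auto simp: dist_real_def)
  thus "z : ?N" using T(3) d(2) s uv' by auto
  qed
  thus "f (gm v) - f (gm u) <= integral {u..v} l"
  by(rule C1_increment_local[OF f ac io'[OF uv'(1,3)] uv' cD(1) cb]) (use le uv' in auto)
  qed
 qed
 thus ?thesis using t integral_unique[OF int] by simp
qed

lemma segment_curve:
 assumes c: "c : A" and seg: "!!s. s : {0..t} ==> y + s *\<^sub>R w : img c"
 shows "abs_cont_curve A t (%s. cinv c (y + s *\<^sub>R w))"
  and "!!s. s : {0..t} ==> velocity A (%s. cinv c (y + s *\<^sub>R w)) s = tangent_of A c (cinv c (y + s *\<^sub>R w)) w"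
proof -
 let ?gm = "%s. cinv c (y + s *\<^sub>R w)"
 have lin: "((%s. y + s *\<^sub>R w) has_vector_derivative w) (at s)" for s
  by(auto intro!: derivative_eq_intros simp: has_vector_derivative_def)
 show "abs_cont_curve A t ?gm"
  unfolding abs_cont_curve_def
 proof (intro conjI ballI allI impI)
  show "continuous_on {0..t} ?gm"
  by(rule continuous_on_compose2[OF cont_chart_inv[OF c]]) (use seg in "auto intro!: continuous_intros")
  fix d a b assume d: "d : A" and ab: "0 <= a" "a <= b" "b <= t" "?gm ` {a..b} <= fst d"
  have mem: "y + s *\<^sub>R w : snd c ` (fst c Int fst d)" "?gm s : fst c" "?gm s : fst d" "snd c (?gm s) = y + s *\<^sub>R w" if "s : {a..b}" for s
  proof -
  have s: "y + s *\<^sub>R w : img c" using seg[of s] that ab by auto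
  show 1: "?gm s : fst c" "?gm s : fst d" "snd c (?gm s) = y + s *\<^sub>R w"
  using chart_inv_dom[OF c s] chart_chart_inv[OF c s] ab(4) that by auto
  thus "y + s *\<^sub>R w : snd c ` (fst c Int fst d)" by(metis IntI imageI)
  qed
  show "abs_cont_on a b (snd d o ?gm)"
  proof (rule C1_on_compact_interval_abs_cont)
  fix s assume s: "s : {a..b}"
  have "((snd d o cinv c) has_derivative transition_deriv c d (?gm s)) (at (y + s *\<^sub>R w))"
  using transition_has_derivative(1)[OF c d mem(2,3)[OF s]] mem(4)[OF s] by simp
  from has_derivative_compose[OF lin[of s, unfolded has_vector_derivative_def] this]
  have "((%s. (snd d o cinv c) (y + s *\<^sub>R w)) has_derivative (%h. transition_deriv c d (?gm s) (h *\<^sub>R w))) (at s)" .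
  thus "((snd d o ?gm) has_vector_derivative transition_deriv c d (?gm s) w) (at s)"
  using linear_scale[OF bounded_linear.linear[OF transition_has_derivative(2)[OF c d mem(2,3)[OF s]]]]
  by(simp add: has_vector_derivative_def o_def)
  next
  show "continuous_on {a..b} (%s. transition_deriv c d (?gm s) w)"
  by(rule continuous_on_compose2[OF transition_deriv_continuous[OF c d], of "{a..b}" "%s. y + s *\<^sub>R w"])
  (use mem(1) in "auto intro!: continuous_intros")
  qed
 qed
 fix s assume "s : {0..t}"
 hence s: "y + s *\<^sub>R w : img c" by(rule seg)
 have "isCont (cinv c) (y + s *\<^sub>R w)"
  using continuous_on_eq_continuous_at[OF open_img[OF c]] cont_chart_inv[OF c] s by blast
 hence cont: "isCont ?gm s" by(rule isCont_o2[rotated]) (intro continuous_intros)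
 have op: "open ((%s. y + s *\<^sub>R w) -` img c)"
  by(rule open_vimage[OF open_img[OF c]]) (intro continuous_intros)
 have "((snd c o ?gm) has_vector_derivative w) (at s)"
  by(rule has_vector_derivative_transform_within_open[OF lin op]) (use s chart_chart_inv[OF c] in auto)
 from velocity_chart[where gm = ?gm, OF c chart_inv_dom[OF c s] cont this]
 show "velocity A ?gm s = tangent_of A c (?gm s) w" .
qed

definition concat_curve :: "real => (real => 'm) => (real => 'm) => real => 'm" where
 "concat_curve s gm1 gm2 r = (if r <= s then gm1 r else gm2 (r - s))"

lemma abs_cont_curve_concat:
 assumes 1: "abs_cont_curve A s gm1" and 2: "abs_cont_curve A t gm2" and st: "0 <= s" "0 <= t" and eq: "gm1 s = gm2 0"
 shows "abs_cont_curve A (s + t) (concat_curve s gm1 gm2)"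
proof -
 let ?gm = "concat_curve s gm1 gm2"
 have e1: "?gm r = gm1 r" if "r <= s" for r using that by(simp add: concat_curve_def)
 have e2: "?gm r = gm2 (r - s)" if "s <= r" for r using that eq by(cases "r = s") (auto simp: concat_curve_def)
 have c1: "continuous_on {0..s} ?gm"
  by(rule continuous_on_eq[of _ gm1]) (use 1 e1 in "auto simp: abs_cont_curve_def")
 have "continuous_on {s..s + t} (%r. gm2 (r - s))"
  by(rule continuous_on_compose2[of "{0..t}" gm2]) (use 2 in "auto simp: abs_cont_curve_def intro!: continuous_intros")
 hence c2: "continuous_on {s..s + t} ?gm" by(rule continuous_on_eq) (use e2 in auto)
 have "continuous_on ({0..s} Un {s..s + t}) ?gm" by(rule continuous_on_closed_Un[OF _ _ c1 c2]) auto
 moreover have "{0..s} Un {s..s + t} = {0..s + t}" using st by auto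
 ultimately have cont: "continuous_on {0..s + t} ?gm" by simp
 show ?thesis
  unfolding abs_cont_curve_def
 proof (intro conjI ballI allI impI cont)
  fix c a b assume c: "c : A" and ab: "0 <= a" "a <= b" "b <= s + t" and sub: "?gm ` {a..b} <= fst c"
  have L: "abs_cont_on a' b' (snd c o ?gm)" if "a <= a'" "a' <= b'" "b' <= b" "b' <= s" for a' b'
  proof (rule abs_cont_on_cong[where f = "snd c o gm1"])
  have "gm1 ` {a'..b'} <= fst c"
  proof
  fix z assume "z : gm1 ` {a'..b'}"
  then obtain r where r: "r : {a'..b'}" "z = gm1 r" by blast
  hence "z = ?gm r" "r : {a..b}" using e1[of r] that by auto
  thus "z : fst c" using sub by blast
  qed
  thus "abs_cont_on a' b' (snd c o gm1)" using 1[unfolded abs_cont_curve_def, THEN conjunct2, rule_format, OF c, of a' b'] that ab by auto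
  qed (use e1 that in auto)
  have R: "abs_cont_on a' b' (snd c o ?gm)" if "a <= a'" "a' <= b'" "b' <= b" "s <= a'" for a' b'
  proof (rule abs_cont_on_cong[where f = "%r. (snd c o gm2) (r - s)"])
  have "gm2 ` {a' - s..b' - s} <= fst c"
  proof
  fix z assume "z : gm2 ` {a' - s..b' - s}"
  then obtain r where r: "r : {a' - s..b' - s}" "z = gm2 r" by blast
  hence "z = ?gm (r + s)" "r + s : {a..b}" using e2[of "r + s"] that by auto
  thus "z : fst c" using sub by blast
  qed
  hence "abs_cont_on (a' - s) (b' - s) (snd c o gm2)"
  using 2[unfolded abs_cont_curve_def, THEN conjunct2, rule_format, OF c, of "a' - s" "b' - s"] that ab by auto
  thus "abs_cont_on a' b' (%r. (snd c o gm2) (r - s))" by(rule abs_cont_on_mono_compose) auto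
  qed (use e2 that in auto)
  consider "b <= s" | "s <= a" | "a <= s" "s <= b" by linarith
  thus "abs_cont_on a b (snd c o ?gm)"
  proof cases
  case 3
  thus ?thesis using abs_cont_on_join[OF L[of a s] R[of s b]] by simp
  qed (use L[of a b] R[of a b] ab in auto)
 qed
qed

text \<open>\<open>action\<close> requires Lebesgue integrability, whereas integration along curves
  is done with the gauge integral. For integrands bounded below the two agree: after adding
  \<open>B\<close> the integrand is nonnegative.\<close>

lemma action_has_integral:
 assumes B: "!!x v. - B <= L0 x v" and int: "((%s. L0 (gm s) (velocity A gm s)) has_integral I) {0..t}"
 shows "action A L0 t gm = ereal I"
proof -
 let ?f = "%s. L0 (gm s) (velocity A gm s)"
 have "(%s. ?f s + B) integrable_on {0..t}" using int by(intro integrable_add integrable_const_ivl) blast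
 hence "(%s. ?f s + B) absolutely_integrable_on {0..t}"
 proof (rule nonnegative_absolutely_integrable_1)
  show "0 <= ?f s + B" for s using B[of "gm s" "velocity A gm s"] by linarith
 qed
 hence "(%s. (?f s + B) - B) absolutely_integrable_on {0..t}"
  by(intro set_integral_diff absolutely_integrable_on_const) auto
 hence ai: "?f absolutely_integrable_on {0..t}" by simp
 hence "integrable (lebesgue_on {0..t}) ?f" by(rule absolutely_integrable_imp_integrable) simp
 moreover from this have "integral\<^sup>L (lebesgue_on {0..t}) ?f = I"
  using lebesgue_integral_eq_integral[of "{0..t}" ?f] integral_unique[OF int] by simp
 ultimately show ?thesis by(simp add: action_def)
qed

lemma action_lessE:
 assumes "action A L0 t gm < ereal a"
 obtains I where "((%s. L0 (gm s) (velocity A gm s)) has_integral I) {0..t}" "I < a"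
proof -
 let ?f = "%s. L0 (gm s) (velocity A gm s)"
 have i: "integrable (lebesgue_on {0..t}) ?f" and l: "integral\<^sup>L (lebesgue_on {0..t}) ?f < a"
  using assms by(auto simp: action_def split: if_splits)
 have "?f integrable_on {0..t}" by(rule integrable_on_lebesgue_on[OF i]) simp
 moreover have "integral {0..t} ?f < a" using l lebesgue_integral_eq_integral[OF i] by simp
 ultimately show ?thesis using that integrable_integral by blast
qed

text \<open>Minimal actions are handled only through strict real upper bounds. Such a bound is
  witnessed by an actual curve, so neither attained minima nor infinite values arise.\<close>

lemma minimal_action_lessI:
 assumes B: "!!x v. - B <= L0 x v" and "abs_cont_curve A t gm" "gm 0 = x" "gm t = y"
  "((%s. L0 (gm s) (velocity A gm s)) has_integral I) {0..t}" "I < a"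
 shows "minimal_action A L0 t x y < ereal a"
 unfolding minimal_action_def INF_less_iff
 by(rule bexI[of _ gm]) (use action_has_integral[OF B assms(5)] assms in auto)

lemma minimal_action_lessE:
 assumes "minimal_action A L0 t x y < ereal a"
 obtains gm I where "abs_cont_curve A t gm" "gm 0 = x" "gm t = y"
  "((%s. L0 (gm s) (velocity A gm s)) has_integral I) {0..t}" "I < a"
proof -
 obtain gm where g: "abs_cont_curve A t gm" "gm 0 = x" "gm t = y" "action A L0 t gm < ereal a"
  using assms unfolding minimal_action_def INF_less_iff by auto
 obtain I where "((%s. L0 (gm s) (velocity A gm s)) has_integral I) {0..t}" "I < a" by(rule action_lessE[OF g(4)])
 with g(1-3) show ?thesis by(rule that)
qed

lemma minimal_action_triangle:
 assumes B: "!!x v. - B <= L0 x v" and st: "0 <= s" "0 <= t"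
  and 1: "minimal_action A L0 s x y < ereal a" and 2: "minimal_action A L0 t y z < ereal b"
 shows "minimal_action A L0 (s + t) x z < ereal (a + b)"
proof -
 obtain gm1 I1 where g1: "abs_cont_curve A s gm1" "gm1 0 = x" "gm1 s = y"
  "((%r. L0 (gm1 r) (velocity A gm1 r)) has_integral I1) {0..s}" "I1 < a" by(rule minimal_action_lessE[OF 1])
 obtain gm2 I2 where g2: "abs_cont_curve A t gm2" "gm2 0 = y" "gm2 t = z"
  "((%r. L0 (gm2 r) (velocity A gm2 r)) has_integral I2) {0..t}" "I2 < b" by(rule minimal_action_lessE[OF 2])
 let ?gm = "concat_curve s gm1 gm2"
 let ?f = "%r. L0 (?gm r) (velocity A ?gm r)"
 have ac: "abs_cont_curve A (s + t) ?gm" by(rule abs_cont_curve_concat[OF g1(1) g2(1) st]) (use g1 g2 in simp)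
 have v1: "velocity A ?gm r = velocity A gm1 r" if "r < s" for r
  by(rule velocity_local[OF open_lessThan[of s]]) (use that in "auto simp: concat_curve_def")
 have v2: "velocity A ?gm r = velocity A gm2 (r - s)" if "s < r" for r
  unfolding velocity_shift[symmetric]
  by(rule velocity_local[OF open_greaterThan[of s]]) (use that in "auto simp: concat_curve_def")
 \<comment> \<open>At the junction the velocity may be anything; a single time does not affect the
   integrals.\<close>
 have i1: "(?f has_integral I1) {0..s}"
  by(rule has_integral_spike[OF negligible_finite[of "{s}"] _ g1(4)]) (use v1 in "auto simp: concat_curve_def")
 have "((%r. L0 (gm2 (r - s)) (velocity A gm2 (r - s))) has_integral I2) {s..s + t}"
  using has_integral_affinity'[of "%r. L0 (gm2 r) (velocity A gm2 r)" I2 0 t 1 "- s"] g2(4) by(simp add: add.commute)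
 hence i2: "(?f has_integral I2) {s..s + t}"
  by(rule has_integral_spike[OF negligible_finite[of "{s}"], rotated 2]) (use v2 in "auto simp: concat_curve_def")
 have int: "(?f has_integral (I1 + I2)) {0..s + t}" by(rule has_integral_combine[OF _ _ i1 i2]) (use st in auto)
 have "?gm 0 = x" "?gm (s + t) = z" using g1 g2 st by(auto simp: concat_curve_def)
 from minimal_action_lessI[OF B ac this int, of "a + b"] g1(5) g2(5) show ?thesis by simp
qed

end

section \<open>The Hamiltonian and the Lagrangian read in charts\<close>

locale hamiltonian = riem_manifold A g
 for A :: "('m::t2_space, 'e::euclidean_space) chart set" and g :: "'m => 'e => 'e => real" +
 fixes H :: "'m => ('e \<Rightarrow>\<^sub>L real) => real => real"
 assumes H_cont: "continuous_map (prod_topology (cotangent_topology A) euclideanreal) euclideanreal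
  (%((x, p), r). H x p r)"
  and H_convex: "!!x r. convex_on UNIV (%p. H x p r)"
  and H_superlinear: "!!x r. filterlim (%p. H x p r / cotangent_norm g x p) at_top
  (filtercomap (cotangent_norm g x) at_top)"
  and H_deriv: "!!x p. deriv (H x p) 0 > 0"
  and H_modulus: "!!S. compactin (cotangent_topology A) S ==>
  EX eta. modulus_of_continuity eta &
  (ALL (x, p):S. ALL r. abs (H x p r - H x p 0 - r * deriv (H x p) 0) <= abs r * eta (abs r))"
  and L_deriv: "!!x v. lagrangian H x v differentiable (at 0)"
begin

definition Hc :: "('m, 'e) chart => 'e => 'e => real => real" where
 "Hc c y z r = H (cinv c y) (cotangent_of A c (cinv c y) (blinfun_inner_right z)) r"

definition Dc :: "('m, 'e) chart => 'e => 'e => real" where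
 "Dc c y z = deriv (H (cinv c y) (cotangent_of A c (cinv c y) (blinfun_inner_right z))) 0"

abbreviation L :: "'m => 'e => real => real" where "L == lagrangian H"

abbreviation dL :: "'m => 'e => real" where "dL x v == deriv (lagrangian H x v) 0"

abbreviation Tg :: "('m, 'e) chart => 'e => 'e => 'e" where "Tg c y == tangent_of A c (cinv c y)"

abbreviation "Lc c y w == L (cinv c y) (Tg c y w)"

abbreviation "dLc c y w == dL (cinv c y) (Tg c y w)"

lemma bundle_chart_inner:
 assumes c: "c : A"
 shows "continuous_map (top_of_set (img c \<times> UNIV)) (cotangent_topology A)
  (%(y, z). (cinv c y, cotangent_of A c (cinv c y) (blinfun_inner_right z)))"
proof -
 have "continuous_map (top_of_set (img c \<times> UNIV)) (top_of_set (img c \<times> UNIV)) (%x. (fst x, blinfun_inner_right (snd x)))"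
  unfolding continuous_map_in_subtopology continuous_map_iff_continuous
  by(auto intro!: continuous_intros bounded_linear.continuous_on[OF bounded_linear_blinfun_inner_right])
 from continuous_map_compose[OF this bundle_chart_continuous[OF c, of "cotangent_of A"]]
 show ?thesis unfolding cotangent_topology_def by(simp add: o_def split_beta' case_prod_unfold)
qed

lemma Hc_continuous:
 assumes c: "c : A"
 shows "continuous_on (img c \<times> UNIV \<times> UNIV) (%(y, z, r). Hc c y z r)"
proof -
 let ?S = "img c \<times> (UNIV::'e set) \<times> (UNIV::real set)"
 have "continuous_map (top_of_set ?S) (top_of_set (img c \<times> UNIV)) (%x. (fst x, fst (snd x)))"
  unfolding continuous_map_in_subtopology continuous_map_iff_continuous by(auto intro!: continuous_intros)
 from continuous_map_compose[OF this bundle_chart_inner[OF c]]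
 have 1: "continuous_map (top_of_set ?S) (cotangent_topology A)
  (%x. (cinv c (fst x), cotangent_of A c (cinv c (fst x)) (blinfun_inner_right (fst (snd x)))))"
  by(simp add: o_def)
 have 2: "continuous_map (top_of_set ?S) euclideanreal (%x. snd (snd x))"
  unfolding continuous_map_iff_continuous by(intro continuous_intros)
 have "continuous_map (top_of_set ?S) (prod_topology (cotangent_topology A) euclideanreal)
  (%x. ((cinv c (fst x), cotangent_of A c (cinv c (fst x)) (blinfun_inner_right (fst (snd x)))), snd (snd x)))"
  by(rule continuous_map_pairedI[OF 1 2])
 from continuous_map_compose[OF this H_cont]
 show ?thesis unfolding continuous_map_iff_continuous by(simp add: o_def split_beta Hc_def)
qed

lemma metric_bounds:
 obtains m M where "m > 0" "M > 0" "!!v. m * norm v <= tangent_norm g x v" "!!v. tangent_norm g x v <= M * norm v"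
proof -
 have bil: "bilinear (g x)" and pos: "!!v. v ~= 0 ==> g x v v > 0" using metric by(auto simp: riemannian_metric_def)
 obtain B where B: "!!v w. norm (g x v w) <= B * norm v * norm w" using bilinear_bounded[OF bil] by blast
 have B0: "abs B + 1 > 0" by simp
 have cont: "continuous_on UNIV (%v. g x v v)"
 proof -
  have "bounded_bilinear (g x)" using bil by(simp add: bilinear_conv_bounded_bilinear)
  from bounded_bilinear.continuous_on[OF this continuous_on_id continuous_on_id] show ?thesis .
 qed
 obtain v0 :: 'e where "v0 : sphere 0 1" using vector_choose_size[of 1] by auto
 then obtain v1 where v1: "v1 : sphere 0 1" "!!v. v : sphere 0 1 ==> g x v1 v1 <= g x v v"
  using continuous_attains_inf[OF compact_sphere[of "0::'e" 1] _ continuous_on_subset[OF cont]] by blast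
 define q where "q = g x v1 v1"
 have "v1 ~= 0" using v1(1) by force
 hence q: "q > 0" using pos[of v1] by(simp add: q_def)
 have low: "q * (norm v)\<^sup>2 <= g x v v" for v
 proof (cases "v = 0")
  case False
  define e where "e = v /\<^sub>R norm v"
  have "norm e = 1" using False by(simp add: e_def)
  hence "q <= g x e e" using v1(2)[of e] by(simp add: q_def)
  moreover have "g x v v = (norm v)\<^sup>2 * g x e e"
  proof -
  have v: "v = norm v *\<^sub>R e" using False by(simp add: e_def)
  have "g x (norm v *\<^sub>R e) (norm v *\<^sub>R e) = norm v * (norm v * g x e e)"
  using bil by(simp add: bilinear_lmul bilinear_rmul)
  thus ?thesis using v by(simp add: power2_eq_square)
  qed
  ultimately show ?thesis by(metis mult.commute mult_left_mono zero_le_power2)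
 qed (use bil in "simp add: bilinear_lzero")
 show ?thesis
 proof (rule that[of "sqrt q" "sqrt (abs B + 1)"])
  show "sqrt q > 0" "sqrt (abs B + 1) > 0" using q by auto
  show "sqrt q * norm v <= tangent_norm g x v" for v
  using real_sqrt_le_mono[OF low[of v]] by(simp add: tangent_norm_def real_sqrt_mult)
  show "tangent_norm g x v <= sqrt (abs B + 1) * norm v" for v
  proof -
  have "g x v v <= B * norm v * norm v" using B[of v v] by(simp add: abs_le_iff)
  also have "... = B * (norm v)\<^sup>2" by(simp add: power2_eq_square)
  also have "... <= (abs B + 1) * (norm v)\<^sup>2" by(intro mult_right_mono) auto
  finally show ?thesis using real_sqrt_le_mono[of "g x v v" "(abs B + 1) * (norm v)\<^sup>2"] by(simp add: tangent_norm_def real_sqrt_mult)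
  qed
 qed
qed

text \<open>Superlinearity is given in the dual Riemannian norm. Testing the covector on the vector
  with coordinates in direction \<open>z\<close> bounds that norm below by
  \<open>norm z / (M * N)\<close>, where \<open>M\<close> compares the norms and \<open>N\<close>
  bounds the change of trivialisation.\<close>

lemma Hc_superlinear:
 assumes c: "c : A" and y: "y : img c"
 shows "EX R. ALL z. norm z >= R --> Hc c y z r >= k * norm z"
proof -
 define x where "x = cinv c y"
 have x: "x : fst c" unfolding x_def by(rule chart_inv_dom[OF c y])
 obtain m M where mM: "m > 0" "M > 0" "!!v. m * norm v <= tangent_norm g x v" "!!v. tangent_norm g x v <= M * norm v"
  by(rule metric_bounds) blast
 have blT: "bounded_linear (tangent_of A c x)" unfolding tangent_of_def
  by(rule transition_has_derivative(2)[OF c chart_atD(1) x chart_atD(2)])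
 obtain N where N: "N > 0" "!!w. norm (tangent_of A c x w) <= norm w * N" using bounded_linear.pos_bounded[OF blT] by blast
 let ?p = "%z. cotangent_of A c x (blinfun_inner_right z)"
 have lower: "norm z / (M * N) <= cotangent_norm g x (?p z)" for z
 proof (cases "z = 0")
  case True
  have "blinfun_apply (?p z) 0 <= cotangent_norm g x (?p z)" unfolding cotangent_norm_def
  proof (rule cSUP_upper)
  show "0 : {v. tangent_norm g x v <= 1}" using mM(4)[of 0] by simp
  show "bdd_above (blinfun_apply (?p z) ` {v. tangent_norm g x v <= 1})"
  proof (rule bdd_aboveI2)
  fix v assume "v : {v. tangent_norm g x v <= 1}"
  hence "norm v <= 1 / m" using mM(3)[of v] mM(1) by(simp add: field_simps)
  hence "norm (?p z) * norm v <= norm (?p z) * (1 / m)" by(intro mult_left_mono) auto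
  thus "blinfun_apply (?p z) v <= norm (?p z) * (1 / m)" using norm_blinfun[of "?p z" v] by(simp add: abs_le_iff)
  qed
  qed
  thus ?thesis using True by simp
 next
  case False
  define v where "v = tangent_of A c x (z /\<^sub>R (norm z * (M * N)))"
  have nz: "norm z > 0" using False by simp
  have MN: "M * N > 0" using mM N by simp
  have "norm (z /\<^sub>R (norm z * (M * N))) = 1 / (M * N)" using nz mM(2) N(1) by(simp add: abs_mult divide_inverse)
  hence "norm v <= 1 / (M * N) * N" unfolding v_def using N(2)[of "z /\<^sub>R (norm z * (M * N))"] by simp
  also have "... = 1 / M" using N(1) by simp
  finally have "tangent_norm g x v <= M * (1 / M)" using mM(4)[of v] mM(2) by(meson mult_left_mono less_imp_le order_trans)
  hence v1: "tangent_norm g x v <= 1" using mM(2) by simp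
  have "blinfun_apply (?p z) v <= cotangent_norm g x (?p z)" unfolding cotangent_norm_def
  proof (rule cSUP_upper)
  show "v : {v. tangent_norm g x v <= 1}" using v1 by simp
  show "bdd_above (blinfun_apply (?p z) ` {v. tangent_norm g x v <= 1})"
  proof (rule bdd_aboveI2)
  fix v assume "v : {v. tangent_norm g x v <= 1}"
  hence "norm v <= 1 / m" using mM(3)[of v] mM(1) by(simp add: field_simps)
  hence "norm (?p z) * norm v <= norm (?p z) * (1 / m)" by(intro mult_left_mono) auto
  thus "blinfun_apply (?p z) v <= norm (?p z) * (1 / m)" using norm_blinfun[of "?p z" v] by(simp add: abs_le_iff)
  qed
  qed
  moreover have "blinfun_apply (?p z) v = z \<bullet> (z /\<^sub>R (norm z * (M * N)))"
  unfolding v_def pairing[OF c x] by(simp add: blinfun_inner_right.rep_eq)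
  moreover have "z \<bullet> (z /\<^sub>R (norm z * (M * N))) = norm z / (M * N)"
  using nz by(simp add: dot_square_norm power2_eq_square field_simps)
  ultimately show ?thesis by simp
 qed
 define K where "K = abs k * (M * N)"
 have MN: "M * N > 0" using mM N by simp
 have "eventually (%p. H x p r / cotangent_norm g x p >= K) (filtercomap (cotangent_norm g x) at_top)"
  using H_superlinear[of x r] by(simp add: filterlim_at_top)
 then obtain B where B: "!!p. cotangent_norm g x p >= B ==> H x p r / cotangent_norm g x p >= K"
  unfolding eventually_filtercomap_at_top_linorder by blast
 show ?thesis
 proof (intro exI[of _ "(abs B + 1) * (M * N)"] allI impI)
  fix z :: 'e assume z: "(abs B + 1) * (M * N) <= norm z"
  hence "abs B + 1 <= norm z / (M * N)" using MN by(simp add: field_simps)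
  hence cn: "cotangent_norm g x (?p z) >= abs B + 1" using lower[of z] by linarith
  hence "H x (?p z) r / cotangent_norm g x (?p z) >= K" by(intro B) linarith
  hence "H x (?p z) r >= K * cotangent_norm g x (?p z)" using cn by(simp add: pos_le_divide_eq)
  moreover have "K * cotangent_norm g x (?p z) >= K * (norm z / (M * N))" using MN lower[of z] by(intro mult_left_mono) (auto simp: K_def)
  moreover have "K * (norm z / (M * N)) = abs k * norm z" using less_imp_neq[OF MN] unfolding K_def by simp
  moreover have "abs k * norm z >= k * norm z" by(intro mult_right_mono) auto
  ultimately show "Hc c y z r >= k * norm z" unfolding Hc_def x_def[symmetric] by linarith
 qed
qed

lemma Hc_convex: "c : A ==> y : img c ==> convex_on UNIV (%z. Hc c y z r)"
proof -
 assume c: "c : A" "y : img c"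
 let ?p = "%z. cotangent_of A c (cinv c y) (blinfun_inner_right z)"
 have lin: "?p ((1 - t) *\<^sub>R z1 + t *\<^sub>R z2) = (1 - t) *\<^sub>R ?p z1 + t *\<^sub>R ?p z2" for t z1 z2
  unfolding cotangent_of_def by(rule blinfun_eqI) (simp add: blinfun_inner_right.rep_eq inner_add_left blinfun.add_left blinfun.scaleR_left)
 show "convex_on UNIV (%z. Hc c y z r)"
 proof (rule convex_onI)
  fix t :: real and z1 z2 :: 'e assume t: "0 < t" "t < 1"
  show "Hc c y ((1 - t) *\<^sub>R z1 + t *\<^sub>R z2) r <= (1 - t) * Hc c y z1 r + t * Hc c y z2 r"
  unfolding Hc_def lin by(rule convex_onD[OF H_convex]) (use t in auto)
 qed simp
qed

lemma local_ham: "c : A ==> local_hamiltonian (img c) (Hc c)"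
 by(unfold_locales) (use open_img Hc_continuous Hc_convex Hc_superlinear in auto)

lemma lagrangian_chart:
 assumes c: "c : A" and y: "y : img c"
 shows "Lc c y w r = local_hamiltonian.lag (Hc c) y w r"
proof -
 note x = chart_inv_dom[OF c y]
 have "range (%p. blinfun_apply p (Tg c y w) - H (cinv c y) p r) = range (%z. z \<bullet> w - Hc c y z r)"
 proof (intro equalityI subsetI)
  fix s assume "s : range (%p. blinfun_apply p (Tg c y w) - H (cinv c y) p r)"
  then obtain p where p: "s = blinfun_apply p (Tg c y w) - H (cinv c y) p r" by blast
  obtain z where z: "cotangent_of A c (cinv c y) (blinfun_inner_right z) = p" by(rule cotangent_of_surj[OF c x])
  have "s = z \<bullet> w - Hc c y z r" unfolding p z[symmetric] pairing[OF c x] Hc_def by(simp add: blinfun_inner_right.rep_eq)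
  thus "s : range (%z. z \<bullet> w - Hc c y z r)" by blast
 next
  fix s assume "s : range (%z. z \<bullet> w - Hc c y z r)"
  then obtain z where z: "s = z \<bullet> w - Hc c y z r" by blast
  have "s = blinfun_apply (cotangent_of A c (cinv c y) (blinfun_inner_right z)) (Tg c y w) - H (cinv c y) (cotangent_of A c (cinv c y) (blinfun_inner_right z)) r"
  unfolding pairing[OF c x] z Hc_def by(simp add: blinfun_inner_right.rep_eq)
  thus "s : range (%p. blinfun_apply p (Tg c y w) - H (cinv c y) p r)" by blast
 qed
 thus ?thesis unfolding lagrangian_def local_hamiltonian.lag_def[OF local_ham[OF c]] by simp
qed

lemma local_ham_deriv:
 assumes c: "c : A"
 shows "local_hamiltonian_deriv (img c) (Hc c) (Dc c) (%y w. dLc c y w)"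
proof -
 interpret local_hamiltonian "img c" "Hc c" by(rule local_ham[OF c])
 show ?thesis
 proof
  fix K :: "'e set" and P eps :: real assume K: "compact K" "K <= img c" and e: "eps > 0"
  let ?b = "%(y, z). (cinv c y, cotangent_of A c (cinv c y) (blinfun_inner_right z))"
  have "compactin (top_of_set (img c \<times> UNIV)) (K \<times> cball (0::'e) P)"
  unfolding compactin_subtopology using K by(auto intro: compact_Times)
  hence "compactin (cotangent_topology A) (?b ` (K \<times> cball 0 P))" by(rule image_compactin[OF _ bundle_chart_inner[OF c]])
  then obtain eta where eta: "modulus_of_continuity eta"
  "ALL (x, p):?b ` (K \<times> cball 0 P). ALL r. abs (H x p r - H x p 0 - r * deriv (H x p) 0) <= abs r * eta (abs r)" using H_modulus by meson
  have "(eta \<longlongrightarrow> 0) (at_right 0)" using eta(1) by(simp add: modulus_of_continuity_def)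
  hence "eventually (%r. eta r < eps) (at_right 0)" using e by(rule order_tendstoD(2))
  then obtain dlt where dlt: "dlt > 0" "!!r. 0 < r ==> r < dlt ==> eta r < eps"
  unfolding eventually_at_right[OF zero_less_one] by auto
  show "EX dlt>0. ALL y:K. ALL z r. norm z <= P --> abs r < dlt --> abs (Hc c y z r - Hc c y z 0 - r * Dc c y z) <= eps * abs r"
  proof (intro exI[of _ dlt] conjI ballI allI impI dlt(1))
  fix y z r assume y: "y : K" and z: "norm (z::'e) <= P" and r: "abs r < dlt"
  have "?b (y, z) : ?b ` (K \<times> cball 0 P)" using y z by(intro imageI) auto
  from eta(2)[rule_format, OF this] have "abs (Hc c y z r - Hc c y z 0 - r * Dc c y z) <= abs r * eta (abs r)"
  unfolding Hc_def Dc_def by simp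
  also have "... <= abs r * eps"
  using dlt(2)[of "abs r"] r by(cases "r = 0") (auto intro!: mult_left_mono less_imp_le)
  finally show "abs (Hc c y z r - Hc c y z 0 - r * Dc c y z) <= eps * abs r" by(simp add: mult.commute)
  qed
 next
  fix y w assume y: "y : img c"
  have "lag y w = Lc c y w" using lagrangian_chart[OF c y] by auto
  thus "(lag y w has_real_derivative dLc c y w) (at 0)"
  using L_deriv[of "cinv c y" "Tg c y w"] by(simp add: DERIV_deriv_iff_real_differentiable)
 qed
qed

text \<open>By the envelope formula the derivative is minus a value of the positive derivative of
  \<open>H\<close>.\<close>

lemma dL_neg: "dL x v < 0"
proof -
 let ?c = "chart_at A x"
 note c = chart_atD(1)[of x] chart_atD(2)[of x]
 interpret local_hamiltonian_deriv "img ?c" "Hc ?c" "Dc ?c" "%y w. dL (cinv ?c y) (Tg ?c y w)" by(rule local_ham_deriv[OF c(1)])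
 obtain w where w: "tangent_of A ?c x w = v" by(rule tangent_of_surj[OF c])
 have y: "snd ?c x : img ?c" "cinv ?c (snd ?c x) = x" using c(2) chart_inv_chart[OF c] by auto
 obtain z where z: "lag (snd ?c x) w 0 = z \<bullet> w - Hc ?c (snd ?c x) z 0" "!!z'. z' \<bullet> w - Hc ?c (snd ?c x) z' 0 <= lag (snd ?c x) w 0"
  by(rule lag_argmax[OF y(1)]) blast
 have "dL x v = - Dc ?c (snd ?c x) z" using dL_eq[OF y(1) z(1)] y(2) w by simp
 thus ?thesis using H_deriv unfolding Dc_def by simp
qed

lemma fenchel_global: "blinfun_apply p v <= L x v r + H x p r"
proof -
 let ?c = "chart_at A x"
 note c = chart_atD(1)[of x] chart_atD(2)[of x]
 interpret local_hamiltonian "img ?c" "Hc ?c" by(rule local_ham[OF c(1)])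
 obtain w where w: "tangent_of A ?c x w = v" by(rule tangent_of_surj[OF c])
 obtain z where z: "cotangent_of A ?c x (blinfun_inner_right z) = p" by(rule cotangent_of_surj[OF c])
 have y: "snd ?c x : img ?c" "cinv ?c (snd ?c x) = x" using c(2) chart_inv_chart[OF c] by auto
 have "blinfun_apply p v = z \<bullet> w" unfolding z[symmetric] w[symmetric] pairing[OF c] by(simp add: blinfun_inner_right.rep_eq)
 moreover have "Hc ?c (snd ?c x) z r = H x p r" unfolding Hc_def y(2) z ..
 moreover have "lag (snd ?c x) w r = L x v r" using lagrangian_chart[OF c(1) y(1), of w r] y(2) w by simp
 ultimately show ?thesis using fenchel[OF y(1), of z w r] by simp
qed

lemma tm_cont_L:
 assumes u: "continuous_on UNIV u" shows "tm_cont (%x v. L x v (u x))"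
 unfolding tm_cont_def
proof
 fix c assume c: "c : A"
 interpret local_hamiltonian "img c" "Hc c" by(rule local_ham[OF c])
 have uc: "continuous_on (img c) (%y. u (cinv c y))" by(rule continuous_on_compose2[OF u cont_chart_inv[OF c]]) auto
 have "continuous_on (img c \<times> UNIV) (%x. lag (fst x) (snd x) (u (cinv c (fst x))))"
  by(intro continuous_on_lag' continuous_intros continuous_on_compose2[OF uc]) auto
 thus "continuous_on (img c \<times> UNIV) (%x. L (cinv c (fst x)) (Tg c (fst x) (snd x)) (u (cinv c (fst x))))"
  by(rule continuous_on_eq) (use lagrangian_chart[OF c] in auto)
qed

lemma tm_cont_dL: "tm_cont dL"
 unfolding tm_cont_def
proof
 fix c assume c: "c : A"
 interpret local_hamiltonian_deriv "img c" "Hc c" "Dc c" "%y w. dLc c y w" by(rule local_ham_deriv[OF c])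
 show "continuous_on (img c \<times> UNIV) (%x. dL (cinv c (fst x)) (Tg c (fst x) (snd x)))"
  using continuous_on_dL by(simp add: split_beta)
qed

section \<open>Estimates uniform over the cover\<close>

text \<open>The side condition \<open>Q\<close> and the free parameter \<open>t\<close> let one
  statement yield growth bounds, two-sided bounds and, via reciprocals, thresholds and bounds away
  from 0.\<close>

lemma cover_bound:
 assumes "!!c a r. (c, a, r) : cover ==> EX B. ALL y:cball a (3 * r). ALL t. Q c y t --> F c y t <= (B::real)"
 obtains B where "B > 0" "!!c a r y t. (c, a, r) : cover ==> y : cball a (3 * r) ==> Q c y t ==> F c y t <= B"
proof -
 have "ALL i:cover. EX B. ALL y:cball (fst (snd i)) (3 * snd (snd i)). ALL t. Q (fst i) y t --> F (fst i) y t <= B" using assms by auto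
 from bchoice[OF this] obtain B where B: "ALL i:cover. ALL y:cball (fst (snd i)) (3 * snd (snd i)). ALL t. Q (fst i) y t --> F (fst i) y t <= B i" by blast
 have fin: "finite (insert 1 (B ` cover))" using finite_cover by simp
 show ?thesis
 proof (rule that[of "Max (insert 1 (B ` cover))"])
  show "0 < Max (insert 1 (B ` cover))" using Max_ge[OF fin, of 1] by simp
  fix c a r y t assume c: "(c, a, r) : cover" and y: "y : cball a (3 * r)" "Q c y t"
  show "F c y t <= Max (insert 1 (B ` cover))"
  by(rule order_trans[OF _ Max_ge[OF fin, of "B (c, a, r)"]]) (use bspec[OF bspec[OF B c], of y] y c in auto)
 qed
qed

lemma cover_cball: "(c, a, r) : cover ==> cball a (3 * r) <= img c" "(c, a, r) : cover ==> y : ball a r ==> y : cball a (3 * r)"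
proof -
 assume c: "(c, a, r) : cover"
 show "cball a (3 * r) <= img c" using coverD(2)[OF c] by(intro order_trans[OF _ coverD(3)[OF c]]) auto
 show "y : ball a r ==> y : cball a (3 * r)" using coverD(2)[OF c] by auto
qed

abbreviation L_growth :: "real => real => prop" where
"PROP L_growth k C == (!!c a r y w s. (c, a, r) : cover ==> y : cball a (3 * r) ==> abs s <= 1 ==> k * norm w - C <= Lc c y w s)"

abbreviation L_bound :: "real => real => prop" where
"PROP L_bound R B == (!!c a r y w s. (c, a, r) : cover ==> y : cball a (3 * r) ==> norm w <= R ==> abs s <= 1 ==> abs (Lc c y w s) <= B & abs (dLc c y w) <= B)"

abbreviation L_C1 :: "real => real => real => prop" where
"PROP L_C1 R d e == (!!c a r y w s. (c, a, r) : cover ==> y : cball a (3 * r) ==> norm w <= R ==> abs s < d ==> abs (Lc c y w s - Lc c y w 0 - s * dLc c y w) <= e * abs s)"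

lemma L_superlinear:
 assumes k: "k >= 0"
 obtains C where "C > 0" "PROP L_growth k C"
proof (rule cover_bound[where Q = "%c y t. abs (snd t) <= 1" and F = "%c y t. k * norm (fst t) - L (cinv c y) (Tg c y (fst t)) (snd t)"])
 fix c a r assume i: "(c, a, r) : cover"
 note c = coverD(1)[OF i]
 interpret local_hamiltonian "img c" "Hc c" by(rule local_ham[OF c])
 obtain C where C: "ALL y:cball a (3 * r). ALL w s. abs s <= 1 --> k * norm w - C <= lag y w s"
  by(rule lag_superlinear[OF compact_cball cover_cball(1)[OF i] k])
 have "k * norm w - Lc c y w s <= C" if y: "y : cball a (3 * r)" and s: "abs s <= 1" for y w s
 proof -
  have "y : img c" using y cover_cball(1)[OF i] by blast
  thus ?thesis using C[rule_format, OF y s, of w] lagrangian_chart[OF c] by simp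
 qed
 thus "EX B. ALL y:cball a (3 * r). ALL t. abs (snd t) <= 1 --> k * norm (fst t) - L (cinv c y) (Tg c y (fst t)) (snd t) <= B" by blast
next
 fix C assume C: "C > 0" "!!c a r y t. (c, a, r) : cover ==> y : cball a (3 * r) ==> abs (snd t) <= 1 ==>
  k * norm (fst t) - L (cinv c y) (Tg c y (fst t)) (snd t) <= C"
 show thesis
 proof (rule that[OF C(1)])
  show "k * norm w - C <= Lc c y w s" if "(c, a, r) : cover" "y : cball a (3 * r)" "abs s <= 1" for c a r y w s
  using C(2)[of c a r y "(w, s)"] that by simp
 qed
qed

lemma L_bounded_below: obtains B where "B > 0" "!!x v s. abs s <= 1 ==> - B <= L x v s"
proof -
 obtain C where C: "C > 0" "PROP L_growth 0 C"
  by(rule L_superlinear[of 0]) auto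
 have "- C <= L x v s" if s: "abs s <= 1" for x v s
 proof -
  obtain c a r y where c: "(c, a, r) : cover" "y : ball a r" "x = cinv c y" by(rule coverE)
  have y: "y : cball a (3 * r)" "y : img c" using cover_cball[OF c(1)] c(2) by auto
  obtain w where "tangent_of A c x w = v" using tangent_of_surj[OF coverD(1)[OF c(1)]] chart_inv_dom[OF coverD(1)[OF c(1)] y(2)] c(3) by blast
  thus ?thesis using C(2)[OF c(1) y(1) s, of w] c(3) by simp
 qed
 with C(1) show ?thesis by(rule that)
qed

lemma L_local_bounded:
 obtains B where "B > 0" "PROP L_bound R B"
proof -
 let ?F = "%c y t. max (abs (L (cinv c y) (Tg c y (fst t)) (snd t))) (abs (dL (cinv c y) (Tg c y (fst t))))"
 obtain B where B: "B > 0" "!!c a r y t. (c, a, r) : cover ==> y : cball a (3 * r) ==> norm (fst t) <= R & abs (snd t) <= 1 ==> ?F c y t <= B"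
 proof (rule cover_bound[where F = ?F and Q = "%c y t. norm (fst t) <= R & abs (snd t) <= 1"])
  fix c a r assume i: "(c, a, r) : cover"
  note c = coverD(1)[OF i]
  interpret local_hamiltonian_deriv "img c" "Hc c" "Dc c" "%y w. dLc c y w" by(rule local_ham_deriv[OF c])
  let ?K = "cball a (3 * r) \<times> cball (0::'e) R \<times> cball (0::real) 1"
  have lc: "continuous_on ?K (%x. lag (fst x) (fst (snd x)) (snd (snd x)))"
  by(intro continuous_on_lag' continuous_intros) (use cover_cball(1)[OF i] in auto)
  have sub: "(%x. (fst x, fst (snd x))) ` ?K <= img c \<times> UNIV" using cover_cball(1)[OF i] by auto
  have "continuous_on ?K (%x. case (fst x, fst (snd x)) of (y, w) => dLc c y w)"
  by(rule continuous_on_compose2[OF continuous_on_dL _ sub]) (intro continuous_intros)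
  hence dc: "continuous_on ?K (%x. dL (cinv c (fst x)) (Tg c (fst x) (fst (snd x))))" by simp
  have cK: "compact ?K" by(intro compact_Times compact_cball)
  obtain B1 where B1: "!!x. x : ?K ==> norm (lag (fst x) (fst (snd x)) (snd (snd x))) <= B1" by(rule compact_boundE[OF lc cK]) blast
  obtain B2 where B2: "!!x. x : ?K ==> norm (dL (cinv c (fst x)) (Tg c (fst x) (fst (snd x)))) <= B2" by(rule compact_boundE[OF dc cK]) blast
  have "?F c y t <= max B1 B2" if y: "y : cball a (3 * r)" and t: "norm (fst t) <= R & abs (snd t) <= 1" for y t
  proof -
  have yt: "(y, t) : ?K" using y t by(simp add: mem_Times_iff)
  have "y : img c" using y cover_cball(1)[OF i] by blast
  hence "abs (L (cinv c y) (Tg c y (fst t)) (snd t)) <= B1" using B1[OF yt] lagrangian_chart[OF c] by simp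
  moreover have "abs (dL (cinv c y) (Tg c y (fst t))) <= B2" using B2[OF yt] by simp
  ultimately show ?thesis by(rule max.mono)
  qed
  thus "EX B. ALL y:cball a (3 * r). ALL t. norm (fst t) <= R & abs (snd t) <= 1 --> ?F c y t <= B" by blast
 qed blast
 show ?thesis
 proof (rule that[OF B(1)])
  show "abs (Lc c y w s) <= B & abs (dLc c y w) <= B"
  if "(c, a, r) : cover" "y : cball a (3 * r)" "norm w <= R" "abs s <= 1" for c a r y w s
  using B(2)[of c a r y "(w, s)"] that by simp
 qed
qed

lemma L_deriv_uniform:
 assumes e: "eps > 0"
 obtains dlt where "dlt > 0" "PROP L_C1 R dlt eps"
proof -
 let ?Q = "%c y w s. abs (Lc c y w s - Lc c y w 0 - s * dLc c y w) <= eps * abs s"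
 \<comment> \<open>The threshold is encoded as a bound: every \<open>s\<close> violating the
   estimate satisfies \<open>1 / abs s \<le> B\<close>.\<close>
 obtain B where B: "B > 0" "!!c a r y t. (c, a, r) : cover ==> y : cball a (3 * r) ==> norm (fst t) <= R & ~ ?Q c y (fst t) (snd t) ==> 1 / abs (snd t) <= B"
 proof (rule cover_bound[where F = "%c y t. 1 / abs (snd t)" and Q = "%c y t. norm (fst t) <= R & ~ ?Q c y (fst t) (snd t)"])
  fix c a r assume i: "(c, a, r) : cover"
  note c = coverD(1)[OF i]
  interpret local_hamiltonian_deriv "img c" "Hc c" "Dc c" "%y w. dLc c y w" by(rule local_ham_deriv[OF c])
  obtain dlt where d: "dlt > 0" "ALL y:cball a (3 * r). ALL w s. norm w <= R --> abs s < dlt --> abs (lag y w s - lag y w 0 - s * dLc c y w) <= eps * abs s"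
  using lag_deriv_uniform[OF compact_cball cover_cball(1)[OF i] e] by blast
  have "1 / abs (snd t) <= 1 / dlt" if y: "y : cball a (3 * r)" and t: "norm (fst t) <= R & ~ ?Q c y (fst t) (snd t)" for y t
  proof -
  have "y : img c" using y cover_cball(1)[OF i] by blast
  hence "~ abs (snd t) < dlt" using d(2) y t lagrangian_chart[OF c] by fastforce
  thus ?thesis using d(1) by(intro divide_left_mono mult_pos_pos) auto
  qed
  thus "EX B. ALL y:cball a (3 * r). ALL t. norm (fst t) <= R & ~ ?Q c y (fst t) (snd t) --> 1 / abs (snd t) <= B" by blast
 qed blast
 show ?thesis
 proof (rule that[of "1 / B"])
  show "1 / B > 0" using B(1) by simp
  fix c a r y w s assume cy: "(c, a, r) : cover" "y : cball a (3 * r)" "norm (w::'e) <= R" "abs s < 1 / B"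
  show "?Q c y w s"
  proof (rule ccontr)
  assume n: "~ ?Q c y w s"
  hence "s ~= 0" by auto
  moreover have "1 / abs s <= B" using B(2)[OF cy(1,2), of "(w, s)"] cy(3) n by simp
  ultimately show False using cy(4) B(1) by(simp add: field_simps)
  qed
 qed
qed

section \<open>Subsolutions in charts: Lipschitz bounds and smoothing\<close>

text \<open>The dependence on the unknown is frozen: \<open>l * u\<close> enters as a given function
  \<open>f\<close> and \<open>l * V\<close> moves into the right-hand side \<open>k\<close>. All
  estimates then concern one equation, with constants depending only on bounds for \<open>f\<close>
  and \<open>k\<close>.\<close>

definition frozen_sub :: "('m => real) => ('m => real) => ('m => real) => bool" where
 "frozen_sub f k u \<longleftrightarrow> (ALL c:A. ALL phi G y r. r > 0 --> ball y r <= img c --> C1_grad (ball y r) phi G -->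
  (ALL z:ball y r. u (cinv c z) - phi z <= u (cinv c y) - phi y) -->
  Hc c y (G y) (f (cinv c y)) <= k (cinv c y))"

definition frozen_super :: "('m => real) => ('m => real) => ('m => real) => bool" where
 "frozen_super f k u \<longleftrightarrow> (ALL c:A. ALL phi G y r. r > 0 --> ball y r <= img c --> C1_grad (ball y r) phi G -->
  (ALL z:ball y r. u (cinv c z) - phi z >= u (cinv c y) - phi y) -->
  Hc c y (G y) (f (cinv c y)) >= k (cinv c y))"

lemma chart_nhds:
 assumes c: "c : A" and r: "r > 0" "ball y r <= img c" and P: "!!z. z : ball y r ==> P (cinv c z)"
 shows "eventually P (nhds (cinv c y))"
 unfolding eventually_nhds
 by(rule exI[of _ "cinv c ` ball y r"]) (use open_chart_inv_image[OF c open_ball r(2)] r(1) P in auto)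

lemma viscosity_frozen:
 assumes "viscosity_solution A (%x p r. H x p (l * r) + l * V x) k u"
 shows "frozen_sub (%x. l * u x) (%x. k - l * V x) u" "frozen_super (%x. l * u x) (%x. k - l * V x) u"
proof -
 have sub: "viscosity_subsolution A (%x p r. H x p (l * r) + l * V x) k u"
  and super: "viscosity_supersolution A (%x p r. H x p (l * r) + l * V x) k u"
  using assms by(auto simp: viscosity_solution_def)
 have test: "EX phi'. C1_fun A phi' & differential A phi' (cinv c y) = cotangent_of A c (cinv c y) (blinfun_inner_right (G y)) &
  (ALL z:ball y (r/4). phi' (cinv c z) = phi z)"
  if "c : A" "r > 0" "ball y r <= img c" "C1_grad (ball y r) phi G" for c phi G y r
  by(rule local_test_function[OF that]) blast
 have sm: "r/4 > 0" "ball y (r/4) <= ball y r" if "r > 0" for r :: real and y :: 'e using that by auto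
 show "frozen_sub (%x. l * u x) (%x. k - l * V x) u"
  unfolding frozen_sub_def
 proof (intro ballI allI impI)
  fix c phi G y r assume c: "c : A" and r: "r > 0" "ball y r <= img c" and G: "C1_grad (ball y r) phi G"
  and mx: "ALL z:ball y r. u (cinv c z) - phi z <= u (cinv c y) - phi y"
  obtain phi' where p: "C1_fun A phi'" "differential A phi' (cinv c y) = cotangent_of A c (cinv c y) (blinfun_inner_right (G y))"
  "ALL z:ball y (r/4). phi' (cinv c z) = phi z" using test[OF c r G] by blast
  have "\<forall>\<^sub>F x in nhds (cinv c y). u x - phi' x <= u (cinv c y) - phi' (cinv c y)"
  proof (rule chart_nhds[OF c sm(1)[OF r(1)] order_trans[OF sm(2)[OF r(1)] r(2)]])
  fix z assume z: "z : ball y (r/4)"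
  have "y : ball y (r/4)" using r by simp
  moreover have "z : ball y r" using z sm(2)[OF r(1)] by blast
  ultimately show "u (cinv c z) - phi' (cinv c z) <= u (cinv c y) - phi' (cinv c y)" using p(3) z mx by simp
  qed
  hence "H (cinv c y) (differential A phi' (cinv c y)) (l * u (cinv c y)) + l * V (cinv c y) <= k"
  using sub p(1) by(simp add: viscosity_subsolution_def)
  thus "Hc c y (G y) (l * u (cinv c y)) <= k - l * V (cinv c y)" unfolding Hc_def p(2) by simp
 qed
 show "frozen_super (%x. l * u x) (%x. k - l * V x) u"
  unfolding frozen_super_def
 proof (intro ballI allI impI)
  fix c phi G y r assume c: "c : A" and r: "r > 0" "ball y r <= img c" and G: "C1_grad (ball y r) phi G"
  and mx: "ALL z:ball y r. u (cinv c z) - phi z >= u (cinv c y) - phi y"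
  obtain phi' where p: "C1_fun A phi'" "differential A phi' (cinv c y) = cotangent_of A c (cinv c y) (blinfun_inner_right (G y))"
  "ALL z:ball y (r/4). phi' (cinv c z) = phi z" using test[OF c r G] by blast
  have "\<forall>\<^sub>F x in nhds (cinv c y). u x - phi' x >= u (cinv c y) - phi' (cinv c y)"
  proof (rule chart_nhds[OF c sm(1)[OF r(1)] order_trans[OF sm(2)[OF r(1)] r(2)]])
  fix z assume z: "z : ball y (r/4)"
  have "y : ball y (r/4)" using r by simp
  moreover have "z : ball y r" using z sm(2)[OF r(1)] by blast
  ultimately show "u (cinv c z) - phi' (cinv c z) >= u (cinv c y) - phi' (cinv c y)" using p(3) z mx by simp
  qed
  hence "H (cinv c y) (differential A phi' (cinv c y)) (l * u (cinv c y)) + l * V (cinv c y) >= k"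
  using super p(1) by(simp add: viscosity_supersolution_def)
  thus "Hc c y (G y) (l * u (cinv c y)) >= k - l * V (cinv c y)" unfolding Hc_def p(2) by simp
 qed
qed

text \<open>At a touching point Fenchel's inequality converts the bound on the Hamiltonian into a
  bound on the gradient in the single direction \<open>v\<close>, which
  \<open>viscosity_direction_bound\<close> integrates along the segment.\<close>

lemma frozen_sub_segment:
 assumes sub: "frozen_sub f k u" and u: "continuous_on UNIV u" and c: "c : A"
  and W: "open W" "W <= img c" "closed_segment y (y + t *\<^sub>R v) <= W" and t: "t > 0" and v: "v ~= 0"
  and k: "!!z. z : W ==> Lc c z v (f (cinv c z)) + k (cinv c z) <= kp"
 shows "u (cinv c (y + t *\<^sub>R v)) - u (cinv c y) <= kp * t"
proof -
 interpret local_hamiltonian "img c" "Hc c" by(rule local_ham[OF c])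
 have cu: "continuous_on W (%y. u (cinv c y))"
  by(rule continuous_on_compose2[OF u continuous_on_subset[OF cont_chart_inv[OF c] W(2)]]) auto
 have "(%y. u (cinv c y)) (y + t *\<^sub>R v) - (%y. u (cinv c y)) y <= kp * t"
 proof (rule viscosity_direction_bound[OF W(1) cu W(3)])
  show "t *\<^sub>R v ~= 0" using t v by simp
  fix phi G z r assume r: "r > 0" "ball z r <= W" and G: "ALL z:ball z r. (phi has_derivative (%h. G z \<bullet> h)) (at z)"
  "continuous_on (ball z r) G" and mx: "ALL z':ball z r. u (cinv c z') - phi z' <= u (cinv c z) - phi z"
  have zW: "z : W" using r by auto
  have zi: "z : img c" using zW W(2) by blast
  have g: "C1_grad (ball z r) phi G" using G by(simp add: C1_grad_def)
  have "Hc c z (G z) (f (cinv c z)) <= k (cinv c z)"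
  using sub[unfolded frozen_sub_def, rule_format, OF c r(1) order_trans[OF r(2) W(2)] g] mx by blast
  moreover have "G z \<bullet> v <= lag z v (f (cinv c z)) + Hc c z (G z) (f (cinv c z))" by(rule fenchel[OF zi])
  ultimately have "G z \<bullet> v <= kp" using k[OF zW] lagrangian_chart[OF c zi] by simp
  hence "t * (G z \<bullet> v) <= t * kp" using t by simp
  thus "G z \<bullet> (t *\<^sub>R v) <= kp * t" by(simp add: mult.commute)
 qed
 thus ?thesis by simp
qed

abbreviation Lip_bound :: "real => real => prop" where
"PROP Lip_bound Kb K == (!!f k u c a r y y'. frozen_sub f k u ==> continuous_on UNIV u ==> (!!x. abs (f x) <= 1) ==> (!!x. k x <= Kb) ==> (c, a, r) : cover ==> y : ball a (3 * r) ==> y' : ball a (3 * r) ==> abs (u (cinv c y') - u (cinv c y)) <= K * dist y' y)"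

text \<open>Along unit-speed segments the Lagrangian is bounded. The constant depends only on
  \<open>Kb\<close>, hence can be fixed before the discount.\<close>

lemma frozen_sub_Lipschitz:
 obtains K where "K > 0" "PROP Lip_bound Kb K"
proof -
 obtain B where B: "B > 0" "PROP L_bound 1 B"
  by(rule L_local_bounded[of 1]) blast
 show ?thesis
 proof (rule that[of "B + abs Kb"])
  show "B + abs Kb > 0" using B(1) by simp
  fix f k u c a r y y' assume sub: "frozen_sub f k u" and u: "continuous_on UNIV u" and f: "!!x. abs (f x) <= 1" and k: "!!x. k x <= Kb"
  and i: "(c, a, r) : cover" and y: "y : ball a (3 * r)" and y': "y' : ball a (3 * r)"
  have one: "u (cinv c y') - u (cinv c y) <= (B + abs Kb) * dist y' y" if y: "y : ball a (3 * r)" and y': "y' : ball a (3 * r)" for y y'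
  proof (cases "y' = y")
  case False
  define t where "t = norm (y' - y)"
  define e where "e = (y' - y) /\<^sub>R t"
  have t: "t > 0" using False by(simp add: t_def)
  have e: "norm e = 1" "y + t *\<^sub>R e = y'" using t by(auto simp: e_def t_def)
  have "u (cinv c (y + t *\<^sub>R e)) - u (cinv c y) <= (B + abs Kb) * t"
  proof (rule frozen_sub_segment[OF sub u coverD(1)[OF i] open_ball _ _ t])
  show "ball a (3 * r) <= img c" using cover_cball(1)[OF i] ball_subset_cball by blast
  show "closed_segment y (y + t *\<^sub>R e) <= ball a (3 * r)" unfolding e(2) by(rule closed_segment_subset[OF y y' convex_ball])
  show "e ~= 0" using e(1) by force
  fix z assume "z : ball a (3 * r)"
  hence "z : cball a (3 * r)" by auto
  hence "abs (Lc c z e (f (cinv c z))) <= B" using B(2)[OF i _ _ f, of z e] e(1) by simp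
  thus "Lc c z e (f (cinv c z)) + k (cinv c z) <= B + abs Kb" using k[of "cinv c z"] by linarith
  qed
  thus ?thesis using e(2) by(simp add: t_def dist_norm)
  qed simp
  show "abs (u (cinv c y') - u (cinv c y)) <= (B + abs Kb) * dist y' y"
  using one[OF y y'] one[OF y' y] by(simp add: abs_le_iff dist_commute)
 qed
qed

text \<open>Mollification in one chart. Large velocities are harmless because the gradient is bounded.\<close>

lemma mollify_in_chart:
 assumes sub: "frozen_sub f k u" and u: "continuous_on UNIV u" and fc: "continuous_on UNIV f" and kc: "continuous_on UNIV k"
  and f1: "!!x. abs (f x) <= 1" and i: "(c, a, r) : cover" and e: "eps > 0"
 obtains w where "C1_fun A w" "!!y. y : ball a (2 * r) ==> abs (w (cinv c y) - u (cinv c y)) <= eps"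
  "!!y v. y : ball a (2 * r) ==> df w (cinv c y) v
  <= L (cinv c y) v (f (cinv c y)) + k (cinv c y) + eps"
proof -
 note c = coverD(1)[OF i] and r = coverD(2)[OF i]
 interpret local_hamiltonian "img c" "Hc c" by(rule local_ham[OF c])
 have cb: "cball a (3 * r) <= img c" by(rule cover_cball(1)[OF i])
 obtain Kb where Kb: "!!x. abs (k x) <= Kb" by(rule compact_boundE[OF kc compactM]) auto
 obtain K where K: "K > 0" "PROP Lip_bound Kb K" by(rule frozen_sub_Lipschitz[of Kb]) blast
 have kKb: "k x <= Kb" for x using Kb[of x] by linarith
 have lip: "abs (u (cinv c y') - u (cinv c y)) <= K * dist y' y" if "y : ball a (3 * r)" "y' : ball a (3 * r)" for y y'
  using K(2)[OF sub u f1 kKb i that] .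
 obtain C where C: "C > 0" "PROP L_growth (K + 1) C"
  by(rule L_superlinear[of "K + 1"]) (use K(1) in auto)
 \<comment> \<open>Beyond speed \<open>R\<close> the growth \<open>(K + 1) * norm v - C\<close>
   dominates the gradient bound \<open>K * norm v\<close> by at least \<open>Kb\<close>, so uniform
   continuity is needed only for speeds up to \<open>R\<close>.\<close>
 define R where "R = C + Kb"
 define S where "S y w = lag y w (f (cinv c y)) + k (cinv c y)" for y w
 have comp: "continuous_on (img c) (%y. h (cinv c y))" if "continuous_on UNIV h" for h :: "'m => real"
  by(rule continuous_on_compose2[OF that cont_chart_inv[OF c]]) auto
 have cS: "continuous_on (img c \<times> UNIV) (%x. S (fst x) (snd x))" unfolding S_def
  by(intro continuous_intros continuous_on_lag' continuous_on_compose2[OF comp[OF fc]] continuous_on_compose2[OF comp[OF kc]]) auto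
 let ?Q = "cball a (3 * r) \<times> cball (0::'e) R"
 have "continuous_on ?Q (%x. S (fst x) (snd x))" by(rule continuous_on_subset[OF cS]) (use cb in auto)
 from compact_uniformly_continuous[OF this compact_Times[OF compact_cball compact_cball]] e
 obtain d where d: "d > 0" "ALL x:?Q. ALL x':?Q. dist x' x < d --> dist (S (fst x') (snd x')) (S (fst x) (snd x)) < eps"
  unfolding uniformly_continuous_on_def by blast
 define mu where "mu = min (min (r/4) (d/4)) (eps / K)"
 have mu: "mu > 0" "mu <= r/4" "mu <= d/4" "K * mu <= eps"
 proof -
  show "mu > 0" using r d(1) e K(1) by(auto simp: mu_def)
  show "mu <= r/4" "mu <= d/4" unfolding mu_def by linarith+
  have "K * mu <= K * (eps / K)" using K(1) by(intro mult_left_mono) (auto simp: mu_def)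
  thus "K * mu <= eps" using K(1) by simp
 qed
 \<comment> \<open>Composition with the nearest-point projection extends \<open>u\<close> in
   coordinates continuously to the whole space, as mollification requires.\<close>
 define uu where "uu y = u (cinv c (closest_point (cball a (3 * r)) y))" for y
 have cne: "cball a (3 * r) ~= {}" using r by simp
 have cuu: "continuous_on UNIV uu"
 proof -
  have "continuous_on UNIV (closest_point (cball a (3 * r)))"
  by(rule continuous_on_closest_point[OF convex_cball closed_cball cne])
  thus ?thesis unfolding uu_def
  by(rule continuous_on_compose2[OF comp[OF u]]) (use closest_point_in_set[OF closed_cball cne] cb in blast)
 qed
 have uu: "uu y = u (cinv c y)" if "y : ball a (3 * r)" for y
  using that closest_point_self[of y "cball a (3 * r)"] by(simp add: uu_def less_imp_le)
 define Rb where "Rb = norm a + 8 * r"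
 have Rb: "ball a (8 * r) <= ball 0 Rb"
 proof
  fix y assume "y : ball a (8 * r)"
  hence "dist a y < 8 * r" by simp
  moreover have "norm y <= norm a + dist a y" by(metis dist_0_norm dist_commute dist_triangle)
  ultimately show "y : ball 0 Rb" by(simp add: Rb_def)
 qed
 obtain w G where w: "!!y. y : ball 0 Rb ==> (w has_derivative (%h. G y \<bullet> h)) (at y)" "continuous_on (ball 0 Rb) G"
  and w1: "!!y b kp. (!!z. z : cball y mu ==> abs (uu z - b) <= kp) ==> abs (w y - b) <= kp"
  and w2: "!!y v kp t0. y : ball 0 Rb ==> t0 > 0 ==>
  (!!t z. 0 < t ==> t < t0 ==> z : cball y mu ==> uu (z + t *\<^sub>R v) - uu z <= kp * t) ==> G y \<bullet> v <= kp"
  by(rule mollification[OF cuu mu(1), of Rb]) blast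
 have wg: "C1_grad (ball a (8 * r)) w G" unfolding C1_grad_def
  using w Rb continuous_on_subset[OF w(2) Rb] by blast
 have r8: "8 * r > 0" using r by simp
 obtain G' where G': "C1_grad UNIV (%y. cutoff a (8 * r / 4) y * w y) G'" "!!y. y : ball a (8 * r / 4) ==> G' y = G y"
  by(rule C1_grad_cutoff_mult[OF r8 wg]) blast
 have eq8: "8 * r / 4 = 2 * r" by simp
 define W where "W x = (if x : fst c then cutoff a (2 * r) (snd c x) * w (snd c x) else 0)" for x
 have r2: "2 * r > 0" using r by simp
 have C1W: "C1_fun A W" unfolding W_def
 proof (rule C1_fun_extend[OF c compact_cball coverD(3)[OF i] G'(1)[unfolded eq8]])
  fix y assume "y ~: cball a (4 * r)"
  hence "cutoff a (2 * r) y = 0" by(intro cutoff_0[OF r2]) auto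
  thus "cutoff a (2 * r) y * w y = 0" by simp
 qed
 have sub3: "y : ball a (3 * r)" "y : img c" "y : ball 0 Rb" if "y : ball a (2 * r)" for y
 proof -
  show 3: "y : ball a (3 * r)" using that r by auto
  thus "y : img c" using cb ball_subset_cball by blast
  show "y : ball 0 Rb" using that r by(intro subsetD[OF Rb]) auto
 qed
 have Weq: "W (cinv c y) = w y" if y: "y : ball a (2 * r)" for y
  using chart_inv_dom[OF c sub3(2)[OF y]] chart_chart_inv[OF c sub3(2)[OF y]] cutoff_1[OF r2, of y a] y by(simp add: W_def)
 have bnd: "abs (w y - u (cinv c y)) <= eps" if y: "y : ball a (2 * r)" for y
 proof (rule w1)
  fix z assume z: "z : cball y mu"
  have "dist a z <= dist a y + dist y z" by(rule dist_triangle)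
  hence z3: "z : ball a (3 * r)" using z y mu(2) r by(auto intro: le_less_trans)
  have "abs (u (cinv c z) - u (cinv c y)) <= K * dist z y" by(rule lip[OF sub3(1)[OF y] z3])
  also have "... <= K * mu" using z K(1) by(intro mult_left_mono) (auto simp: dist_commute)
  also have "... <= eps" by(rule mu(4))
  finally show "abs (uu z - u (cinv c y)) <= eps" using uu[OF z3] by simp
 qed
 have z3: "z : ball a (3 * r)" "z + t *\<^sub>R v : ball a (3 * r)" "z : ball y (2 * mu)" "z + t *\<^sub>R v : ball y (2 * mu)"
  if y: "y : ball a (2 * r)" and z: "z : cball y mu" and t: "0 < t" "t < mu / (norm v + 1)" for y z t and v :: 'e
 proof -
  have nv: "norm v + 1 > 0" using norm_ge_zero[of v] by linarith
  have "t * norm v <= t * (norm v + 1)" using t by(intro mult_left_mono) auto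
  also have "... < mu" using t(2) nv by(simp add: field_simps)
  finally have tv: "dist z (z + t *\<^sub>R v) < mu" using t by(simp add: dist_norm)
  have dz: "dist y z <= mu" using z by simp
  have d1: "dist y (z + t *\<^sub>R v) < 2 * mu" using dist_triangle[of y "z + t *\<^sub>R v" z] dz tv by linarith
  have dy: "dist a y < 2 * r" using y by simp
  show "z : ball a (3 * r)" using dist_triangle[of a z y] dz dy mu(2) r by simp
  show "z + t *\<^sub>R v : ball a (3 * r)" using dist_triangle[of a "z + t *\<^sub>R v" y] d1 dy mu(2) r by simp
  show "z : ball y (2 * mu)" using dz mu(1) by simp
  show "z + t *\<^sub>R v : ball y (2 * mu)" using d1 by simp
 qed
 have tpos: "mu / (norm v + 1) > 0" for v :: 'e using mu(1) norm_ge_zero[of v] by(intro divide_pos_pos) linarith+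
 have Gb: "G y \<bullet> v <= K * norm v" if y: "y : ball a (2 * r)" for y v
 proof (rule w2[OF sub3(3)[OF y] tpos])
  fix t z assume t: "0 < t" "t < mu / (norm v + 1)" and z: "z : cball y mu"
  note zz = z3[OF y z t]
  have "u (cinv c (z + t *\<^sub>R v)) - u (cinv c z) <= K * dist (z + t *\<^sub>R v) z" using lip[OF zz(1,2)] by linarith
  also have "dist (z + t *\<^sub>R v) z = t * norm v" using t by(simp add: dist_norm)
  finally show "uu (z + t *\<^sub>R v) - uu z <= K * norm v * t" using uu[OF zz(1)] uu[OF zz(2)] by(simp add: algebra_simps)
 qed
 have Gs: "G y \<bullet> v <= S y v + eps" if y: "y : ball a (2 * r)" and v: "v ~= 0" "norm v <= R" for y v
 proof (rule w2[OF sub3(3)[OF y] tpos])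
  fix t z assume t: "0 < t" "t < mu / (norm v + 1)" and z: "z : cball y mu"
  note zz = z3[OF y z t]
  have WW: "ball y (2 * mu) <= ball a (3 * r)"
  proof
  fix x assume "x : ball y (2 * mu)"
  thus "x : ball a (3 * r)" using dist_triangle[of a x y] y mu(2) r by simp
  qed
  have WI: "ball y (2 * mu) <= img c" using WW cb ball_subset_cball by blast
  have "u (cinv c (z + t *\<^sub>R v)) - u (cinv c z) <= (S y v + eps) * t"
  proof (rule frozen_sub_segment[OF sub u c open_ball WI closed_segment_subset[OF zz(3,4) convex_ball] t(1) v(1)])
  fix x assume x: "x : ball y (2 * mu)"
  have "x : cball a (3 * r)" "y : cball a (3 * r)" using x WW sub3(1)[OF y] ball_subset_cball by blast+
  hence "(x, v) : ?Q" "(y, v) : ?Q" using v by auto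
  moreover have "dist (x, v) (y, v) < d" using x mu(3) d(1) by(simp add: dist_Pair_Pair dist_commute)
  ultimately have "dist (S x v) (S y v) < eps" using d(2) by(metis fst_conv snd_conv)
  thus "Lc c x v (f (cinv c x)) + k (cinv c x) <= S y v + eps"
  using lagrangian_chart[OF c] x WI by(auto simp: S_def dist_real_def)
  qed
  thus "uu (z + t *\<^sub>R v) - uu z <= (S y v + eps) * t" using uu[OF zz(1)] uu[OF zz(2)] by simp
 qed
 have Gall: "G y \<bullet> v <= S y v + eps" if y: "y : ball a (2 * r)" for y v
 proof -
  consider "v = 0" | "v ~= 0" "norm v <= R" | "norm v > R" by linarith
  thus ?thesis
  proof cases
  case 1
  \<comment> \<open>The segment estimate excludes \<open>v = 0\<close>; this case is the limit of
    the estimate along multiples of a unit vector tending to 0.\<close>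
  obtain b :: 'e where b: "norm b = 1" using vector_choose_size[of 1] by auto
  have R0: "R >= 0 | R < 0" by linarith
  have key: "G y \<bullet> v' <= S y v' + eps" if "v' ~= 0" for v'
  proof (cases "norm v' <= R")
  case True thus ?thesis by(rule Gs[OF y that])
  next
  case False
  have "y : cball a (3 * r)" using sub3(1)[OF y] by auto
  from C(2)[OF i this f1, of v'] have "(K + 1) * norm v' - C <= lag y v' (f (cinv c y))"
  using lagrangian_chart[OF c sub3(2)[OF y]] by simp
  thus ?thesis using Gb[OF y, of v'] False Kb[of "cinv c y"] e unfolding S_def R_def by(simp add: algebra_simps abs_le_iff)
  qed
  have lim: "(%n. inverse (real (Suc n)) *\<^sub>R b) ----> 0 *\<^sub>R b" by(intro tendsto_intros LIMSEQ_inverse_real_of_nat)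
  have "G y \<bullet> 0 <= S y 0 + eps"
  proof (rule LIMSEQ_le)
  show "(%n. G y \<bullet> (inverse (real (Suc n)) *\<^sub>R b)) ----> G y \<bullet> 0" using lim by(intro tendsto_intros) simp
  show "(%n. S y (inverse (real (Suc n)) *\<^sub>R b) + eps) ----> S y 0 + eps" unfolding S_def
  using lim by(intro tendsto_intros lag_tendsto sub3(2)[OF y]) auto
  have "inverse (real (Suc n)) *\<^sub>R b ~= 0" for n using b by force
  thus "EX N. ALL n>=N. G y \<bullet> (inverse (real (Suc n)) *\<^sub>R b) <= S y (inverse (real (Suc n)) *\<^sub>R b) + eps" using key by blast
  qed
  thus ?thesis using 1 by simp
  next
  case 2 thus ?thesis by(rule Gs[OF y])
  next
  case 3
  have "y : cball a (3 * r)" using sub3(1)[OF y] by auto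
  from C(2)[OF i this f1, of v] have "(K + 1) * norm v - C <= lag y v (f (cinv c y))"
  using lagrangian_chart[OF c sub3(2)[OF y]] by simp
  thus ?thesis using Gb[OF y, of v] 3 Kb[of "cinv c y"] e unfolding S_def R_def by(simp add: algebra_simps abs_le_iff)
  qed
 qed
 show ?thesis
 proof (rule that[OF C1W])
  show "abs (W (cinv c y) - u (cinv c y)) <= eps" if "y : ball a (2 * r)" for y using Weq[OF that] bnd[OF that] by simp
  fix y v assume y: "y : ball a (2 * r)"
  obtain v' where v': "Tg c y v' = v" by(rule tangent_of_surj[OF c chart_inv_dom[OF c sub3(2)[OF y]]])
  have "((W o cinv c) has_derivative (%h. G y \<bullet> h)) (at y)"
  by(rule has_derivative_transform_within_open[OF w(1)[OF sub3(3)[OF y]] open_ball y]) (use Weq in auto)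
  hence "((W o cinv c) has_derivative (%h. G y \<bullet> h)) (at (snd c (cinv c y)))"
  using chart_chart_inv[OF c sub3(2)[OF y]] by simp
  from differential_chart(2)[OF c chart_inv_dom[OF c sub3(2)[OF y]] this, of v']
  show "df W (cinv c y) v <= L (cinv c y) v (f (cinv c y)) + k (cinv c y) + eps"
  using Gall[OF y, of v'] v' lagrangian_chart[OF c sub3(2)[OF y], of v'] by(simp add: S_def)
 qed
qed

end

section \<open>Algebra of continuously differentiable functions and gluing\<close>

context riem_manifold
begin

lemma differential_chart_at:
 assumes "C1_grad (img (chart_at A x)) (f o cinv (chart_at A x)) G"
 shows "df f x v = G (snd (chart_at A x) x) \<bullet> v"
proof -
 let ?d = "chart_at A x"
 note d = chart_atD(1)[of x] chart_atD(2)[of x]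
 have "snd ?d x : img ?d" using d(2) by blast
 from differential_chart(2)[OF d C1_gradD(1)[OF assms this], of v]
 show ?thesis using transition_self[OF d] by(simp add: tangent_of_def)
qed

lemma differential_eq_grad:
 "C1_fun A f ==> df f x v = grad (chart_at A x) f (snd (chart_at A x) x) \<bullet> v"
 by(rule differential_chart_at[OF C1_fun_grad[OF _ chart_atD(1)]])

lemma chart_at_inv: "cinv (chart_at A x) (snd (chart_at A x) x) = x" "snd (chart_at A x) x : img (chart_at A x)"
 using chart_inv_chart[OF chart_atD] chart_atD(2) by auto

lemma C1_fun_mult:
 assumes f: "C1_fun A f" and h: "C1_fun A h"
 shows "C1_fun A (%x. f x * h x)"
  and "df (%x. f x * h x) x v = f x * df h x v + h x * df f x v"
proof -
 have m: "C1_grad (img c) ((%x. f x * h x) o cinv c) (%y. (f o cinv c) y *\<^sub>R grad c h y + (h o cinv c) y *\<^sub>R grad c f y)" if "c : A" for c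
  using C1_grad_mult[OF C1_fun_grad[OF f that] C1_fun_grad[OF h that]] by(simp add: o_def)
 thus "C1_fun A (%x. f x * h x)" unfolding C1_fun_iff by blast
 show "df (%x. f x * h x) x v = f x * df h x v + h x * df f x v"
  unfolding differential_chart_at[OF m[OF chart_atD(1)]] differential_eq_grad[OF f] differential_eq_grad[OF h]
  by(simp add: inner_add_left chart_at_inv)
qed

lemma C1_fun_add:
 assumes f: "C1_fun A f" and h: "C1_fun A h"
 shows "C1_fun A (%x. f x + h x)"
  and "df (%x. f x + h x) x v = df f x v + df h x v"
proof -
 have m: "C1_grad (img c) ((%x. f x + h x) o cinv c) (%y. grad c f y + grad c h y)" if "c : A" for c
  using C1_grad_add[OF C1_fun_grad[OF f that] C1_fun_grad[OF h that]] by(simp add: o_def)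
 thus "C1_fun A (%x. f x + h x)" unfolding C1_fun_iff by blast
 show "df (%x. f x + h x) x v = df f x v + df h x v"
  unfolding differential_chart_at[OF m[OF chart_atD(1)]] differential_eq_grad[OF f] differential_eq_grad[OF h]
  by(simp add: inner_add_left)
qed

lemma C1_fun_const: "C1_fun A (%x. k)" "df (%x. k) x v = 0"
proof -
 have m: "C1_grad (img c) ((%x. k) o cinv c) (%y. 0)" for c :: "('m, 'e) chart"
  by(auto simp: C1_grad_def o_def)
 thus "C1_fun A (%x. k)" unfolding C1_fun_iff by blast
 show "df (%x. k) x v = 0" unfolding differential_chart_at[OF m] by simp
qed

lemma C1_fun_cmult:
 assumes "C1_fun A f"
 shows "C1_fun A (%x. k * f x)" "df (%x. k * f x) x v = k * df f x v"
 using C1_fun_mult[OF C1_fun_const(1)[of k] assms] by(auto simp: C1_fun_const)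

lemma C1_fun_sum:
 assumes "finite I" "!!i. i : I ==> C1_fun A (f i)"
 shows "C1_fun A (%x. SUM i:I. f i x) & (ALL x v. df (%x. SUM i:I. f i x) x v = (SUM i:I. df (f i) x v))"
 using assms
proof (induction I rule: finite_induct)
 case empty
 thus ?case by(simp add: C1_fun_const)
next
 case (insert i I)
 hence "C1_fun A (f i)" "C1_fun A (%x. SUM i:I. f i x)" by auto
 from C1_fun_add[OF this] show ?case using insert by simp
qed

lemma C1_fun_inverse:
 assumes f: "C1_fun A f" and nz: "!!x. f x ~= 0"
 shows "C1_fun A (%x. inverse (f x))"
  and "df (%x. inverse (f x)) x v = - (inverse (f x))\<^sup>2 * df f x v"
proof -
 have m: "C1_grad (img c) ((%x. inverse (f x)) o cinv c) (%y. (- inverse ((f o cinv c) y * (f o cinv c) y)) *\<^sub>R grad c f y)" if "c : A" for c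
  using C1_grad_inverse[OF C1_fun_grad[OF f that]] nz by(simp add: o_def)
 thus "C1_fun A (%x. inverse (f x))" unfolding C1_fun_iff by blast
 show "df (%x. inverse (f x)) x v = - (inverse (f x))\<^sup>2 * df f x v"
  unfolding differential_chart_at[OF m[OF chart_atD(1)]] differential_eq_grad[OF f]
  by(simp add: chart_at_inv power2_eq_square)
qed

lemma differential_zero_of_nonneg:
 assumes f: "C1_fun A f" and nn: "!!x. f x >= 0" and x: "f x = 0"
 shows "df f x v = 0"
proof -
 let ?d = "chart_at A x"
 note d = chart_atD(1)[of x] chart_atD(2)[of x]
 have "(%h. grad ?d f (snd ?d x) \<bullet> h) = (%v. 0)"
  by(rule differential_zero_maxmin[OF chart_at_inv(2) open_img[OF d(1)] C1_gradD(1)[OF C1_fun_grad[OF f d(1)] chart_at_inv(2)]])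
  (use nn x in "simp add: chart_at_inv")
 thus ?thesis unfolding differential_eq_grad[OF f] by metis
qed

end

context hamiltonian
begin

lemma H_differential_bounded:
 assumes f: "C1_fun A f"
 obtains B where "B > 0" "!!x t s. abs t <= 2 ==> abs s <= 1 ==> abs (H x (t *\<^sub>R differential A f x) s) <= B"
proof -
 let ?F = "%c y t. abs (H (cinv c y) (fst t *\<^sub>R differential A f (cinv c y)) (snd t))"
 obtain B where B: "B > 0" "!!c a r y t. (c, a, r) : cover ==> y : cball a (3 * r) ==> abs (fst t) <= 2 & abs (snd t) <= 1 ==> ?F c y t <= B"
 proof (rule cover_bound[where F = ?F and Q = "%c y t. abs (fst t) <= 2 & abs (snd t) <= 1"])
  fix c a r assume i: "(c, a, r) : cover"
  note c = coverD(1)[OF i]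
  interpret local_hamiltonian "img c" "Hc c" by(rule local_ham[OF c])
  obtain G where G: "!!y. y : cball a (3 * r) ==> norm (grad c f y) <= G"
  by(rule compact_boundE[OF continuous_on_subset[OF C1_gradD(2)[OF C1_fun_grad[OF f c]] cover_cball(1)[OF i]] compact_cball]) blast
  obtain B where B: "ALL y:cball a (3 * r). ALL z r. norm z <= 2 * G --> abs r <= 1 --> abs (Hc c y z r) <= B"
  by(rule h_bounded[OF compact_cball cover_cball(1)[OF i]])
  show "EX B. ALL y:cball a (3 * r). ALL t. abs (fst t) <= 2 & abs (snd t) <= 1 --> ?F c y t <= B"
  proof (intro exI[of _ B] ballI allI impI, elim conjE)
  fix y and t :: "real \<times> real" assume y: "y : cball a (3 * r)" and t: "abs (fst t) <= 2" and s: "abs (snd t) <= 1"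
  have yi: "y : img c" using y cover_cball(1)[OF i] by blast
  have "fst t *\<^sub>R differential A f (cinv c y) = cotangent_of A c (cinv c y) (blinfun_inner_right (fst t *\<^sub>R grad c f y))"
  unfolding differential_grad(2)[OF f c yi] cotangent_of_def
  by(rule blinfun_eqI) (simp add: blinfun_inner_right.rep_eq blinfun.scaleR_left)
  hence "?F c y t = abs (Hc c y (fst t *\<^sub>R grad c f y) (snd t))" by(simp add: Hc_def)
  moreover have "norm (fst t *\<^sub>R grad c f y) <= 2 * G" using mult_mono[OF t G[OF y]] by simp
  ultimately show "?F c y t <= B" using B y s by simp
  qed
 qed blast
 show ?thesis
 proof (rule that[OF B(1)])
  fix x t s assume ts: "abs t <= (2::real)" "abs s <= (1::real)"
  obtain c a r y where c: "(c, a, r) : cover" "y : ball a r" "x = cinv c y" by(rule coverE)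
  show "abs (H x (t *\<^sub>R differential A f x) s) <= B" using B(2)[OF c(1) cover_cball(2)[OF c(1,2)], of "(t, s)"] ts c(3) by simp
 qed
qed

text \<open>Fenchel's inequality at multiples of the differential, whose Hamiltonian is bounded by
  compactness. It expresses superlinearity of \<open>L\<close> without a norm on the fibres.\<close>

lemma differential_le_L:
 assumes f: "C1_fun A f"
 obtains B where "B > 0" "!!x v s. abs s <= 1 ==> abs (df f x v) <= L x v s + B"
  "!!x v s. abs s <= 1 ==> 2 * df f x v <= L x v s + B"
proof -
 obtain B where B: "B > 0" "!!x t s. abs t <= 2 ==> abs s <= 1 ==> abs (H x (t *\<^sub>R differential A f x) s) <= B"
  by(rule H_differential_bounded[OF f]) blast
 have le: "t * df f x v <= L x v s + B" if "abs t <= 2" "abs s <= 1" for x v t s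
  using fenchel_global[of "t *\<^sub>R differential A f x" v x s] B(2)[OF that, of x] by(simp add: blinfun.scaleR_left abs_le_iff)
 show ?thesis
 proof (rule that[OF B(1)])
  show "abs (df f x v) <= L x v s + B" if "abs s <= 1" for x v s
  using le[of 1 s x v] le[of "-1" s x v] that by(simp add: abs_le_iff)
  show "2 * df f x v <= L x v s + B" if "abs s <= 1" for x v s
  using le[of 2 s x v] that by simp
 qed
qed

definition bump :: "('m, 'e) chart \<times> 'e \<times> real => 'm => real" where
 "bump i x = (if x : fst (fst i) then cutoff (fst (snd i)) (snd (snd i)) (snd (fst i) x) else 0)"

lemma bump:
 assumes "i : cover"
 shows bump_C1: "C1_fun A (bump i)" and bump_nonneg: "bump i x >= 0"
  and bump_supp: "bump i x ~= 0 ==> EX y:ball (fst (snd i)) (2 * snd (snd i)). x = cinv (fst i) y"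
proof -
 obtain c a r where car: "i = (c, a, r)" by(cases i)
 note i = assms[unfolded car]
 note c = coverD(1)[OF i] and r = coverD(2)[OF i]
 obtain G where G: "!!y. (cutoff a r has_derivative (%h. G y \<bullet> h)) (at y)" "continuous_on UNIV G" by(rule cutoff_C1[of a r]) blast
 have GG: "C1_grad UNIV (cutoff a r) G" using G by(simp add: C1_grad_def)
 show "C1_fun A (bump i)"
  unfolding bump_def[abs_def] car fst_conv snd_conv
 proof (rule C1_fun_extend[OF c compact_cball cover_cball(1)[OF i] GG])
  fix y assume "y ~: cball a (3 * r)"
  thus "cutoff a r y = 0" using r by(intro cutoff_0[OF r]) auto
 qed
 show "bump i x >= 0" by(simp add: bump_def car cutoff_nonneg[OF r])
 show "EX y:ball (fst (snd i)) (2 * snd (snd i)). x = cinv (fst i) y" if b: "bump i x ~= 0"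
 proof (rule bexI)
  have x: "x : fst c" "cutoff a r (snd c x) ~= 0" using b by(auto simp: bump_def car split: if_splits)
  show "snd c x : ball (fst (snd i)) (2 * snd (snd i))" using cutoff_0[OF r, of "snd c x" a] x(2) unfolding car by auto
  show "x = cinv (fst i) (snd c x)" using chart_inv_chart[OF c x(1)] car by simp
 qed
qed

lemma bump_sum_ge_1: "(SUM i:cover. bump i x) >= 1"
proof -
 obtain c a r y where c: "(c, a, r) : cover" "y : ball a r" "x = cinv c y" by(rule coverE)
 have y: "y : img c" using cover_cball[OF c(1)] c(2) by auto
 have "bump (c, a, r) x = 1"
  using chart_inv_dom[OF coverD(1)[OF c(1)] y] chart_chart_inv[OF coverD(1)[OF c(1)] y] c cutoff_1[OF coverD(2)[OF c(1)], of y a]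
  by(simp add: bump_def)
 moreover have "bump (c, a, r) x <= (SUM i:cover. bump i x)" by(rule member_le_sum[OF c(1)]) (use bump_nonneg finite_cover in auto)
 ultimately show ?thesis by simp
qed

text \<open>Gluing with a partition of unity: the error involves the differentials of the bump functions, which
 Fenchel's inequality bounds by the Lagrangian itself, so that a slight contraction absorbs it.\<close>

lemma smooth_subsolution:
 assumes sub: "frozen_sub f k u" and u: "continuous_on UNIV u" and fc: "continuous_on UNIV f" and kc: "continuous_on UNIV k"
  and f1: "!!x. abs (f x) <= 1" and e: "eps > 0"
 obtains phi where "C1_fun A phi" "!!x. abs (phi x - u x) <= eps"
  "!!x v. df phi x v <= L x v (f x) + k x + eps"
proof -
 obtain Kb where Kb: "!!x. abs (k x) <= Kb" by(rule compact_boundE[OF kc compactM]) auto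
 obtain U where U: "!!x. abs (u x) <= U" by(rule compact_boundE[OF u compactM]) auto
 have "ALL i:cover. EX B. ALL x v s. abs s <= 1 --> abs (df (bump i) x v) <= L x v s + B"
 proof
  fix i assume i: "i : cover"
  show "EX B. ALL x v s. abs s <= 1 --> abs (df (bump i) x v) <= L x v s + B"
  by(rule differential_le_L[OF bump_C1[OF i]]) blast
 qed
 from bchoice[OF this] obtain Bi where Bi: "ALL i:cover. ALL x v s. abs s <= 1 --> abs (df (bump i) x v) <= L x v s + Bi i" by blast
 define B where "B = (SUM i:cover. abs (Bi i))"
 have B: "abs (df (bump i) x v) <= L x v (f x) + B" if "i : cover" for i x v
 proof -
  have "abs (Bi i) <= B" unfolding B_def by(rule member_le_sum[OF that]) (use finite_cover in auto)
  moreover have "abs (df (bump i) x v) <= L x v (f x) + Bi i" using Bi that f1[of x] by blast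
  ultimately show ?thesis by linarith
 qed
 define n where "n = real (card cover)"
 define Z where "Z = 1 + 2 * n * (U + 1 + Kb + B)"
 have nn: "n >= 0" "U >= 0" "Kb >= 0" "B >= 0" using U[of undefined] Kb[of undefined] by(auto simp: n_def B_def sum_nonneg)
 have Z: "Z >= 1" using nn by(simp add: Z_def)
 define e' where "e' = min 1 (eps / Z)"
 have e': "e' > 0" "e' <= 1" "e' * Z <= eps"
 proof -
  show "e' > 0" "e' <= 1" using e Z by(auto simp: e'_def)
  have "e' * Z <= eps / Z * Z" using Z by(intro mult_right_mono) (auto simp: e'_def)
  thus "e' * Z <= eps" using Z by simp
 qed
 define eta where "eta = 2 * e' * n"
 have eta: "eta >= 0" using nn e' by(simp add: eta_def)
 have Zs: "e' + eta * (U + 1 + Kb + B) <= eps" using e'(3) unfolding Z_def eta_def by(simp add: algebra_simps)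
 have Zs1: "e' + eta * (U + 1) <= eps" and Zs2: "e' + eta * Kb + eta * B <= eps"
 proof -
  have "eta * (U + 1 + Kb + B) = eta * (U + 1) + eta * Kb + eta * B" by(simp add: algebra_simps)
  moreover have "eta * (U + 1) >= 0" "eta * Kb >= 0" "eta * B >= 0" using eta nn by auto
  ultimately show "e' + eta * (U + 1) <= eps" "e' + eta * Kb + eta * B <= eps" using Zs by linarith+
 qed
 have "ALL i:cover. EX w. C1_fun A w & (ALL y:ball (fst (snd i)) (2 * snd (snd i)). abs (w (cinv (fst i) y) - u (cinv (fst i) y)) <= e' &
  (ALL v. df w (cinv (fst i) y) v
  <= L (cinv (fst i) y) v (f (cinv (fst i) y)) + k (cinv (fst i) y) + e'))" (is "ALL i:cover. EX w. ?Q i w")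
 proof
  fix i assume i: "i : cover"
  obtain c a r where car: "i = (c, a, r)" by(cases i)
  show "EX w. ?Q i w"
  by(rule mollify_in_chart[OF sub u fc kc f1 i[unfolded car] e'(1)]) (unfold car fst_conv snd_conv, blast)
 qed
 from bchoice[OF this] obtain w where w: "ALL i:cover. ?Q i (w i)" by blast
 have wC: "C1_fun A (w i)" if "i : cover" for i using w that by blast
 have wu: "abs (w i x - u x) <= e'" "df (w i) x v <= L x v (f x) + k x + e'" if i: "i : cover" and b: "bump i x ~= 0" for i x v
  using bump_supp[OF i b] w i by blast+
 define S where "S x = (SUM i:cover. bump i x)" for x
 define W where "W x = (SUM i:cover. bump i x * w i x)" for x
 have S: "S x >= 1" for x using bump_sum_ge_1 by(simp add: S_def)
 have S0: "S x ~= 0" for x using S[of x] by linarith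
 have SC: "C1_fun A S" and Sd: "df S x v = (SUM i:cover. df (bump i) x v)" for x v
  using C1_fun_sum[where f = bump, OF finite_cover bump_C1] unfolding S_def[abs_def] by blast+
 have WC: "C1_fun A W" and Wd: "df W x v =
  (SUM i:cover. bump i x * df (w i) x v + w i x * df (bump i) x v)" for x v
 proof -
  have s: "C1_fun A (%x. SUM i:cover. bump i x * w i x) & (ALL x v. df (%x. SUM i:cover. bump i x * w i x) x v =
  (SUM i:cover. df (%x. bump i x * w i x) x v))"
  by(rule C1_fun_sum[OF finite_cover]) (rule C1_fun_mult(1)[OF bump_C1 wC])
  thus "C1_fun A W" unfolding W_def[abs_def] by blast
  show "df W x v =
  (SUM i:cover. bump i x * df (w i) x v + w i x * df (bump i) x v)"
  unfolding W_def[abs_def] s[THEN conjunct2, rule_format] by(rule sum.cong[OF refl]) (rule C1_fun_mult(2)[OF bump_C1 wC])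
 qed
 define phi0 where "phi0 x = W x * inverse (S x)" for x
 have phi0C: "C1_fun A phi0" unfolding phi0_def[abs_def] by(rule C1_fun_mult(1)[OF WC C1_fun_inverse(1)[OF SC S0]])
 \<comment> \<open>The quotient rule pairs the differential of each bump with
   \<open>w i - phi0\<close>, which is at most \<open>2 * e'\<close> wherever that bump is
   positive.\<close>
 have phi0d: "S x * df phi0 x v =
  (SUM i:cover. bump i x * df (w i) x v + (w i x - phi0 x) * df (bump i) x v)" for x v
 proof -
  have "df phi0 x v = W x * (- (inverse (S x))\<^sup>2 * df S x v) + inverse (S x) * df W x v"
  unfolding phi0_def[abs_def] C1_fun_mult(2)[OF WC C1_fun_inverse(1)[OF SC S0]] C1_fun_inverse(2)[OF SC S0] ..
  hence "S x * df phi0 x v = df W x v - phi0 x * df S x v"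
  using S0[of x] by(simp add: phi0_def field_simps power2_eq_square)
  also have "... = (SUM i:cover. bump i x * df (w i) x v + w i x * df (bump i) x v
  - phi0 x * df (bump i) x v)"
  unfolding Wd Sd by(simp add: sum_distrib_left sum_subtractf)
  finally show ?thesis by(simp add: algebra_simps)
 qed
 have phi0u: "abs (phi0 x - u x) <= e'" for x
 proof -
  have "abs (W x - S x * u x) = abs (SUM i:cover. bump i x * (w i x - u x))"
  by(simp add: W_def S_def sum_distrib_right sum_subtractf right_diff_distrib)
  also have "... <= (SUM i:cover. bump i x * e')"
  proof (rule order_trans[OF sum_abs], rule sum_mono)
  fix i assume i: "i : cover"
  show "abs (bump i x * (w i x - u x)) <= bump i x * e'"
  using wu(1)[OF i, of x] bump_nonneg[OF i, of x] by(cases "bump i x = 0") (auto simp: abs_mult intro!: mult_left_mono)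
  qed
  also have "... = S x * e'" by(simp add: S_def sum_distrib_right)
  finally have "abs (W x - S x * u x) <= S x * e'" .
  moreover have "S x * (phi0 x - u x) = W x - S x * u x" using S0[of x] by(simp add: phi0_def right_diff_distrib)
  ultimately have "abs (S x * (phi0 x - u x)) <= S x * e'" by simp
  thus ?thesis using S[of x] by(simp add: abs_mult)
 qed
 have main: "df phi0 x v <= L x v (f x) + k x + e' + eta * (L x v (f x) + B)" for x v
 proof -
  let ?Lam = "L x v (f x) + k x + e'" and ?M = "L x v (f x) + B"
  have M: "?M >= 0"
  proof -
  obtain i where "i : cover" using bump_sum_ge_1[of x] by(metis all_not_in_conv not_one_le_zero sum.empty)
  thus ?thesis using B[of i x v] by linarith
  qed
  have "S x * df phi0 x v <= (SUM i:cover. bump i x * ?Lam + 2 * e' * ?M)"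
  unfolding phi0d
  proof (rule sum_mono)
  fix i assume i: "i : cover"
  show "bump i x * df (w i) x v + (w i x - phi0 x) * df (bump i) x v <= bump i x * ?Lam + 2 * e' * ?M"
  proof (cases "bump i x = 0")
  case True
  \<comment> \<open>Where the bump vanishes \<open>w i\<close> need not be near \<open>u\<close>;
    but there the bump is minimal and its differential is 0.\<close>
  thus ?thesis using differential_zero_of_nonneg[OF bump_C1[OF i] bump_nonneg[OF i] True] M e'(1) by simp
  next
  case False
  have "bump i x * df (w i) x v <= bump i x * ?Lam"
  by(rule mult_left_mono[OF wu(2)[OF i False] bump_nonneg[OF i]])
  moreover have "abs (w i x - phi0 x) <= 2 * e'" using wu(1)[OF i False] phi0u[of x] by linarith
  hence "abs (w i x - phi0 x) * abs (df (bump i) x v) <= 2 * e' * ?M"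
  by(rule mult_mono[OF _ B[OF i]]) (use e' in auto)
  hence "(w i x - phi0 x) * df (bump i) x v <= 2 * e' * ?M" by(simp add: abs_mult[symmetric] abs_le_iff)
  ultimately show ?thesis by linarith
  qed
  qed
  also have "... = S x * ?Lam + eta * ?M" by(simp add: sum.distrib S_def sum_distrib_right eta_def n_def)
  also have "... <= S x * ?Lam + S x * (eta * ?M)"
  using mult_right_mono[OF S[of x], of "eta * ?M"] M eta by simp
  finally have "S x * df phi0 x v <= S x * (?Lam + eta * ?M)" by(simp only: distrib_left)
  thus ?thesis using S[of x] by(simp add: mult_le_cancel_left_pos)
 qed
 \<comment> \<open>In \<open>main\<close> the Lagrangian has coefficient \<open>1 + eta\<close>;
   multiplication by \<open>q\<close> restores the coefficient 1 and changes values and constants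
   only by terms of order \<open>eta\<close>.\<close>
 define q where "q = inverse (1 + eta)"
 have q: "q > 0" "q <= 1" "q * (1 + eta) = 1" using eta by(auto simp: q_def field_simps)
 show ?thesis
 proof (rule that[of "%x. q * phi0 x"])
  show "C1_fun A (%x. q * phi0 x)" by(rule C1_fun_cmult(1)[OF phi0C])
  have q1: "1 - q = q * eta" using q(3) by(simp add: algebra_simps)
  have qeta: "q * eta <= eta" "q * eta >= 0" using mult_right_mono[OF q(2) eta] q(1) eta by auto
  show "abs (q * phi0 x - u x) <= eps" for x
  proof -
  have "q * phi0 x - u x = q * (phi0 x - u x) - (1 - q) * u x" by(simp add: algebra_simps)
  hence "abs (q * phi0 x - u x) <= abs (q * (phi0 x - u x)) + abs ((1 - q) * u x)" by linarith
  also have "abs (q * (phi0 x - u x)) <= 1 * e'" unfolding abs_mult by(rule mult_mono) (use q phi0u in auto)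
  also have "abs ((1 - q) * u x) <= eta * U" unfolding abs_mult q1 by(rule mult_mono) (use qeta U eta in auto)
  finally show ?thesis using Zs1 eta by(simp add: algebra_simps)
  qed
  fix x v
  have "q * df phi0 x v <= q * (L x v (f x) + k x + e' + eta * (L x v (f x) + B))"
  by(rule mult_left_mono[OF main]) (use q in simp)
  also have "... = (q * (1 + eta)) * L x v (f x) + q * k x + q * e' + q * eta * B" by(simp add: algebra_simps)
  finally have "q * df phi0 x v <= L x v (f x) + q * k x + q * e' + q * eta * B" using q(3) by simp
  moreover have "q * k x = k x - (1 - q) * k x" by(simp add: algebra_simps)
  moreover have "abs ((1 - q) * k x) <= eta * Kb" unfolding abs_mult q1 by(rule mult_mono) (use qeta Kb eta in auto)
  moreover have "q * e' <= e'" using mult_right_mono[OF q(2), of e'] e' by simp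
  moreover have "q * eta * B <= eta * B" using mult_right_mono[OF qeta(1) nn(4)] .
  ultimately show "df (%x. q * phi0 x) x v <= L x v (f x) + k x + eps"
  unfolding C1_fun_cmult(2)[OF phi0C] using Zs2 by linarith
 qed
qed

section \<open>Bounded velocities and Mather measures\<close>

abbreviation c0 :: real where "c0 == critical_value A (%x p. H x p 0)"

text \<open>Velocities are bounded in coordinates of the cover rather than in the metric, since that
  is where the uniform estimates on \<open>L\<close> are available.\<close>

definition tame :: "real => 'm => 'e => bool" where
 "tame R x v \<longleftrightarrow> (EX c a r y w. (c, a, r) : cover & y : ball a r & x = cinv c y & v = Tg c y w & norm w <= R)"

lemma tangent_repr:
 obtains c a r y w where "(c, a, r) : cover" "y : ball a r" "x = cinv c y" "v = Tg c y w" "y : cball a (3 * r)" "y : img c"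
proof -
 obtain c a r y where c: "(c, a, r) : cover" "y : ball a r" "x = cinv c y" by(rule coverE)
 have y: "y : cball a (3 * r)" "y : img c" using cover_cball[OF c(1)] c(2) by auto
 obtain w where "Tg c y w = v" by(rule tangent_of_surj[OF coverD(1)[OF c(1)] chart_inv_dom[OF coverD(1)[OF c(1)] y(2)]])
 with c y show ?thesis using that by blast
qed

lemma tame_of_L_le: obtains R where "!!x v. L x v 0 <= C ==> tame R x v"
proof -
 obtain C' where C': "C' > 0" "PROP L_growth 1 C'"
  by(rule L_superlinear[of 1]) auto
 show ?thesis
 proof (rule that[of "C + C'"])
  fix x v assume le: "L x v 0 <= C"
  obtain c a r y w where c: "(c, a, r) : cover" "y : ball a r" "x = cinv c y" "v = Tg c y w" "y : cball a (3 * r)"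
  by(rule tangent_repr[of x v])
  have "norm w <= C + C'" using C'(2)[OF c(1,5), of 0 w] le c(3,4) by simp
  thus "tame (C + C') x v" unfolding tame_def using c by blast
 qed
qed

lemma tame_bounded:
 obtains B where "B > 0" "!!x v s. tame R x v ==> abs s <= 1 ==> abs (L x v s) <= B" "!!x v. tame R x v ==> abs (dL x v) <= B"
proof -
 obtain B where B: "B > 0" "PROP L_bound R B"
  by(rule L_local_bounded[of R]) blast
 have *: "abs (L x v s) <= B & abs (dL x v) <= B" if "tame R x v" "abs s <= 1" for x v s
  using that B(2)[OF _ cover_cball(2)] unfolding tame_def by blast
 show ?thesis by(rule that[OF B(1)]) (use * *[of _ _ 0] in auto)
qed

abbreviation tame_C1 :: "real => real => real => prop" where
"PROP tame_C1 R dlt e == (!!x v s. tame R x v ==> abs s < dlt ==> abs (L x v s - L x v 0 - s * dL x v) <= e * abs s)"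

lemma tame_deriv:
 assumes e: "eps > 0"
 obtains dlt where "dlt > 0" "PROP tame_C1 R dlt eps"
proof -
 obtain dlt where d: "dlt > 0" "PROP L_C1 R dlt eps"
  by(rule L_deriv_uniform[OF e, of R]) blast
 show ?thesis by(rule that[OF d(1)]) (unfold tame_def, use d(2)[OF _ cover_cball(2)] in blast)
qed

lemma tm_measurable:
 assumes "tm_cont F" "sets m = sets TM"
 shows "(%p. F (fst p) (snd p)) : borel_measurable m"
 using tm_cont_measurable[OF assms] by(simp add: split_beta')

lemma matherD:
 assumes "m : mather_measures A g H"
 shows "prob_space m" "sets m = sets TM" "!!phi. C1_fun A phi ==> (\<integral>p. df phi (fst p) (snd p) \<partial>m) = 0"
  "integrable m (%p. L (fst p) (snd p) 0)" "(\<integral>p. L (fst p) (snd p) 0 \<partial>m) = - c0"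
 using assms by(auto simp: mather_measures_def closed_measure_def split_beta' has_bochner_integral_iff)

lemma differential_integrable:
 assumes "prob_space m" "sets m = sets TM" "integrable m (%p. L (fst p) (snd p) 0)" and f: "C1_fun A f"
 shows "integrable m (%p. df f (fst p) (snd p))"
proof -
 interpret prob_space m by fact
 obtain B where B: "!!x v s. abs s <= 1 ==> abs (df f x v) <= L x v s + B" by(rule differential_le_L[OF f]) blast
 show ?thesis
 proof (rule Bochner_Integration.integrable_bound)
  show "integrable m (%p. L (fst p) (snd p) 0 + B)" using assms(3) by simp
  show "(%p. df f (fst p) (snd p)) : borel_measurable m"
  by(rule tm_measurable[OF tm_cont_differential[OF f] assms(2)])
  have "abs (df f x v) <= abs (L x v 0 + B)" for x v using B[of 0 x v] by simp
  thus "AE p in m. norm (df f (fst p) (snd p)) <= norm (L (fst p) (snd p) 0 + B)" by simp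
 qed
qed

lemma tame_integrable:
 assumes "prob_space m" "sets m = sets TM" "AE p in m. tame R (fst p) (snd p)" "tm_cont F" "!!x v. tame R x v ==> abs (F x v) <= B"
 shows "integrable m (%p. F (fst p) (snd p))"
proof -
 interpret prob_space m by fact
 show ?thesis
  by(rule integrable_const_bound[where B = B]) (use assms(3,5) tm_measurable[OF assms(4,2)] in auto)
qed

end

section \<open>Properties of the limit function: domination and the constraint on Mather
  measures\<close>

locale vanishing_discount = hamiltonian A g H
 for A :: "('m::t2_space, 'e::euclidean_space) chart set" and g :: "'m => 'e => 'e => real"
  and H :: "'m => ('e \<Rightarrow>\<^sub>L real) => real => real" +
 fixes V :: "'m => real => real" and u :: "real => 'm => real" and u0 :: "'m => real" and l0 :: real
 assumes V_cont: "!!l. l > 0 ==> continuous_on UNIV (%x. V x l)"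
  and V_lim: "uniform_limit UNIV (%l x. V x l) (%x. V x 0) (at_right 0)"
  and l0_pos: "l0 > 0"
  and u_sol: "!!l. l : {0<..l0} ==> viscosity_solution A (%x p r. H x p (l * r) + l * V x l) (critical_value A (%x p. H x p 0)) (u l)"
  and u_lim: "uniform_limit UNIV u u0 (at_right 0)"
begin

lemma u_cont: "l : {0<..l0} ==> continuous_on UNIV (u l)"
 using u_sol by(auto simp: viscosity_solution_def viscosity_subsolution_def)

lemma u0_cont: "continuous_on UNIV u0"
proof (rule uniform_limit_theorem[OF _ u_lim])
 show "\<forall>\<^sub>F l in at_right 0. continuous_on UNIV (u l)"
  by(rule eventually_mono[OF eventually_at_right_real[OF l0_pos]]) (use u_cont in auto)
qed simp

lemma V0_cont: "continuous_on UNIV (%x. V x 0)"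
 by(rule uniform_limit_theorem[OF _ V_lim])
  (use eventually_at_right_less[of 0] V_cont in "auto elim!: eventually_mono")

lemma close_to_limit:
 assumes e: "eps > 0"
 obtains l1 where "l1 > 0" "l1 <= l0" "!!l x. 0 < l ==> l < l1 ==> abs (u l x - u0 x) < eps" "!!l x. 0 < l ==> l < l1 ==> abs (V x l - V x 0) < eps"
proof -
 have "\<forall>\<^sub>F l in at_right 0. ALL x:UNIV. dist (u l x) (u0 x) < eps" "\<forall>\<^sub>F l in at_right 0. ALL x:UNIV. dist (V x l) (V x 0) < eps"
  using u_lim V_lim e unfolding uniform_limit_iff by blast+
 hence "\<forall>\<^sub>F l in at_right 0. ALL x. dist (u l x) (u0 x) < eps & dist (V x l) (V x 0) < eps" by eventually_elim auto
 then obtain b where b: "b > 0" "ALL l>0. l < b --> (ALL x. dist (u l x) (u0 x) < eps & dist (V x l) (V x 0) < eps)"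
  unfolding eventually_at_right[OF zero_less_one] by blast
 show ?thesis by(rule that[of "min b l0"]) (use b l0_pos in "auto simp: dist_real_def")
qed

text \<open>The condition \<open>l1 * U \<le> 1\<close> keeps \<open>l * u l x\<close> in
  \<open>[-1, 1]\<close>, the range of the last argument in all uniform bounds on
  \<open>L\<close>.\<close>

lemma uniform_bounds:
 obtains U l1 where "U >= 1" "l1 > 0" "l1 <= l0" "l1 * U <= 1" "l1 <= 1" "!!l x. 0 < l ==> l < l1 ==> abs (u l x) <= U"
  "!!l x. 0 < l ==> l < l1 ==> abs (V x l) <= U" "!!x. abs (u0 x) <= U" "!!x. abs (V x 0) <= U"
proof -
 obtain a where a: "!!x. abs (u0 x) <= a" by(rule compact_boundE[OF u0_cont compactM]) auto
 obtain b where b: "!!x. abs (V x 0) <= b" by(rule compact_boundE[OF V0_cont compactM]) auto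
 note ab = a b
 define U where "U = 1 + abs a + abs b"
 obtain l1 where l1: "l1 > 0" "l1 <= l0" "!!l x. 0 < l ==> l < l1 ==> abs (u l x - u0 x) < 1" "!!l x. 0 < l ==> l < l1 ==> abs (V x l - V x 0) < 1"
  by(rule close_to_limit[of 1]) auto
 have U: "U >= 1" by(simp add: U_def)
 have m: "min l1 (1/U) * U <= 1/U * U" using U by(intro mult_right_mono) auto
 show ?thesis
 proof (rule that[of U "min l1 (1/U)"])
  show "U >= 1" "min l1 (1/U) > 0" "min l1 (1/U) <= l0" "min l1 (1/U) <= 1" using U l1 by(auto simp: min_le_iff_disj)
  show "min l1 (1/U) * U <= 1" using m U by simp
  show "abs (u l x) <= U" if "0 < l" "l < min l1 (1/U)" for l x using l1(3)[of l x] that ab(1)[of x] unfolding U_def by linarith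
  show "abs (V x l) <= U" if "0 < l" "l < min l1 (1/U)" for l x using l1(4)[of l x] that ab(2)[of x] unfolding U_def by linarith
  show "abs (u0 x) <= U" for x using ab(1)[of x] unfolding U_def by linarith
  show "abs (V x 0) <= U" for x using ab(2)[of x] unfolding U_def by linarith
 qed
qed

lemma u_frozen:
 assumes "l : {0<..l0}"
 shows "frozen_sub (%x. l * u l x) (%x. c0 - l * V x l) (u l)" "frozen_super (%x. l * u l x) (%x. c0 - l * V x l) (u l)"
 using viscosity_frozen[of l "%x. V x l" c0 "u l"] u_sol[OF assms] by auto

lemma smooth_u:
 assumes l: "0 < l" "l <= l0" and s: "!!x. abs (l * u l x) <= 1" and e: "eps > 0"
 obtains phi where "C1_fun A phi" "!!x. abs (phi x - u l x) <= eps"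
  "!!x v. df phi x v <= L x v (l * u l x) + c0 - l * V x l + eps"
proof -
 have l': "l : {0<..l0}" using l by simp
 obtain phi where "C1_fun A phi" "!!x. abs (phi x - u l x) <= eps"
  "!!x v. df phi x v <= L x v (l * u l x) + (c0 - l * V x l) + eps"
  by(rule smooth_subsolution[OF u_frozen(1)[OF l'] u_cont[OF l'] _ _ s e])
  (use u_cont[OF l'] V_cont[OF l(1)] in "auto intro!: continuous_intros")
 thus ?thesis using that by(simp add: algebra_simps)
qed

text \<open>The second bound on the differential is uniform in \<open>\<epsilon>\<close>, because \<open>\<phi>\<close> has a gradient bound independent of \<open>\<epsilon>\<close>.\<close>

abbreviation smooth_approx :: "real => prop" where
"PROP smooth_approx C == (!!eps. eps > 0 ==> EX phi. C1_fun A phi & (ALL x. abs (phi x - u0 x) <= eps) & (ALL x v. df phi x v <= L x v 0 + c0 + eps) & (ALL x v. 2 * df phi x v <= L x v 0 + C))"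

lemma smooth_critical_subsolution:
 obtains C where "PROP smooth_approx C"
proof -
 obtain U l1 where U: "U >= 1" "l1 > 0" "l1 <= l0" "l1 * U <= 1" "l1 <= 1" "!!l x. 0 < l ==> l < l1 ==> abs (u l x) <= U"
  "!!l x. 0 < l ==> l < l1 ==> abs (V x l) <= U" by(rule uniform_bounds) blast
 obtain B1 where B1: "B1 > 0" "PROP L_bound 1 B1" by(rule L_local_bounded[of 1]) blast
 define K where "K = B1 + abs c0 + 2"
 have K: "K > 0" using B1 by(simp add: K_def)
 obtain C where C: "C > 0" "PROP L_growth (2 * K) C"
  by(rule L_superlinear[of "2 * K"]) (use K in auto)
 \<comment> \<open>For \<open>norm w > R\<close> the growth of \<open>L\<close> with slope
   \<open>2 * K\<close> already makes \<open>L + c0\<close> larger than the gradient bound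
   \<open>K * norm w\<close>; smaller velocities allow the expansion in the last argument.\<close>
 define R where "R = (C + abs c0) / K"
 obtain B2 where B2: "B2 > 0" "PROP L_bound R B2" by(rule L_local_bounded[of R]) blast
 obtain dlt where d: "dlt > 0" "PROP L_C1 R dlt 1"
  by(rule L_deriv_uniform[of 1 R]) auto
 show ?thesis
 proof (rule that[of C])
  fix eps :: real assume e: "eps > 0"
  define e' where "e' = min 1 eps / 3"
  have e': "e' > 0" "e' <= 1" "3 * e' <= eps" using e unfolding e'_def by auto
  obtain l2 where l2: "l2 > 0" "l2 <= l0" "!!l x. 0 < l ==> l < l2 ==> abs (u l x - u0 x) < e'"
  by(rule close_to_limit[OF e'(1)]) blast
  \<comment> \<open>\<open>l * M\<close> is the total cost of replacing \<open>l * u l x\<close> by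
    0 inside \<open>L\<close> and of dropping \<open>l * V x l\<close>.\<close>
  define M where "M = U * (B2 + 2)"
  have M: "M > 0" using U B2 by(simp add: M_def)
  define q where "q = min (min l1 l2) (min (dlt / U) (e' / M))"
  define l where "l = q / 2"
  have mm: "0 < q" "q <= l1" "q <= l2" "q <= dlt / U" "q <= e' / M" using U(1,2) l2(1) d(1) e'(1) M by(auto simp: q_def min_le_iff_disj)
  have l: "0 < l" "l < l1" "l < l2" "l < dlt / U" "l < e' / M" using mm unfolding l_def by linarith+
  have ll: "l * U < dlt" "l * M < e'" "l <= l0" "l * U <= 1"
  proof -
  show "l * U < dlt" using l(4) U(1) by(simp add: pos_less_divide_eq)
  show "l * M < e'" using l(5) M by(simp add: pos_less_divide_eq)
  show "l <= l0" using l U by linarith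
  have "l * U <= l1 * U" using l U by(intro mult_right_mono) auto
  thus "l * U <= 1" using U by linarith
  qed
  have su: "abs (l * u l x) <= l * U" for x using U(6)[OF l(1,2), of x] l(1) by(simp add: abs_mult)
  have sV: "abs (l * V x l) <= l * U" for x using U(7)[OF l(1,2), of x] l(1) by(simp add: abs_mult)
  have su1: "abs (l * u l x) <= 1" for x using su[of x] ll(4) by linarith
  obtain phi where phi: "C1_fun A phi" "!!x. abs (phi x - u l x) <= e'"
  "!!x v. df phi x v <= L x v (l * u l x) + c0 - l * V x l + e'"
  by(rule smooth_u[OF l(1) ll(3) su1 e'(1)]) blast
  have gradb: "df phi (cinv c y) (Tg c y w) <= K * norm w" if c: "(c, a, r) : cover" "y : cball a (3 * r)" for c a r y w
  proof (cases "w = 0")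
  case False
  have yi: "y : img c" using that cover_cball(1)[OF c(1)] by blast
  note dg = differential_grad(1)[OF phi(1) coverD(1)[OF c(1)] yi]
  define e where "e = w /\<^sub>R norm w"
  have ne: "norm e = 1" "w = norm w *\<^sub>R e" using False by(auto simp: e_def)
  have "df phi (cinv c y) (Tg c y e) <= Lc c y e (l * u l (cinv c y)) + c0 - l * V (cinv c y) l + e'" by(rule phi(3))
  moreover have "abs (Lc c y e (l * u l (cinv c y))) <= B1" using B1(2)[OF c _ su1] ne(1) by simp
  ultimately have "grad c phi y \<bullet> e <= K" unfolding dg K_def using sV[of "cinv c y"] ll(4) e'(2) by linarith
  hence "norm w * (grad c phi y \<bullet> e) <= norm w * K" by(intro mult_left_mono) auto
  moreover have "grad c phi y \<bullet> w = norm w * (grad c phi y \<bullet> e)" using ne(2) by(metis inner_scaleR_right)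
  ultimately show ?thesis unfolding dg by(simp add: mult.commute)
  next
  case True
  have yi: "y : img c" using that cover_cball(1)[OF c(1)] by blast
  show ?thesis unfolding differential_grad(1)[OF phi(1) coverD(1)[OF c(1)] yi] using True by simp
  qed
  have two: "2 * df phi x v <= L x v 0 + C" for x v
  proof -
  obtain c a r y w where c: "(c, a, r) : cover" "y : ball a r" "x = cinv c y" "v = Tg c y w" "y : cball a (3 * r)" by(rule tangent_repr[of x v])
  show ?thesis using gradb[OF c(1,5), of w] C(2)[OF c(1,5), of 0 w] unfolding c(3,4) by simp
  qed
  have one: "df phi x v <= L x v 0 + c0 + eps" for x v
  proof -
  obtain c a r y w where c: "(c, a, r) : cover" "y : ball a r" "x = cinv c y" "v = Tg c y w" "y : cball a (3 * r)" by(rule tangent_repr[of x v])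
  show ?thesis
  proof (cases "norm w <= R")
  case True
  let ?s = "l * u l x"
  have "abs ?s < dlt" using su[of x] ll(1) by linarith
  from d(2)[OF c(1,5) True this] have 1: "L x v ?s <= L x v 0 + ?s * dL x v + abs ?s" unfolding c(3,4) by(simp add: abs_le_iff)
  have dB: "abs (dL x v) <= B2" using B2(2)[OF c(1,5) True, of 0] unfolding c(3,4) by simp
  have "?s * dL x v <= abs ?s * abs (dL x v)" by(metis abs_ge_self abs_mult)
  also have "... <= (l * U) * B2" by(rule mult_mono[OF su dB]) (use l U in auto)
  finally have "L x v ?s <= L x v 0 + l * U * B2 + l * U" using 1 su[of x] by linarith
  moreover have "l * U * B2 + l * U + l * U = l * M" by(simp add: M_def algebra_simps)
  ultimately show ?thesis using phi(3)[of x v] sV[of x] ll(2) e'(1,3) by linarith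
  next
  case False
  hence "K * norm w > C + abs c0" using K by(simp add: R_def pos_divide_less_eq mult.commute not_le)
  moreover have "2 * K * norm w - C <= L x v 0" using C(2)[OF c(1,5), of 0 w] unfolding c(3,4) by simp
  ultimately show ?thesis using gradb[OF c(1,5), of w] e unfolding c(3,4) by simp
  qed
  qed
  have "abs (phi x - u0 x) <= eps" for x using phi(2)[of x] l2(3)[OF l(1,3), of x] e' by linarith
  with phi(1) one two show "EX phi. C1_fun A phi & (ALL x. abs (phi x - u0 x) <= eps) &
  (ALL x v. df phi x v <= L x v 0 + c0 + eps) & (ALL x v. 2 * df phi x v <= L x v 0 + C)" by blast
 qed
qed

lemma ex_smooth_critical_subsolution:
 assumes "eps > 0"
 shows "EX phi. C1_fun A phi & (ALL x. abs (phi x - u0 x) <= eps) & (ALL x v. df phi x v <= L x v 0 + c0 + eps)"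
proof -
 obtain C where "PROP smooth_approx C"
  by(rule smooth_critical_subsolution) blast
 from this[OF assms] show ?thesis by blast
qed

lemma u0_dominated:
 assumes t: "t >= 0" and a: "minimal_action A (%x v. L x v 0) t y x < ereal a"
 shows "u0 x - u0 y <= a + c0 * t"
proof -
 obtain gm I where gm: "abs_cont_curve A t gm" "gm 0 = y" "gm t = x"
  "((%s. L (gm s) (velocity A gm s) 0) has_integral I) {0..t}" "I < a" by(rule minimal_action_lessE[OF a])
 have "u0 x - u0 y <= I + c0 * t + e" if e: "e > 0" for e
 proof -
  define e' where "e' = e / (t + 2)"
  have e': "e' > 0" "e' * (t + 2) = e" using e t by(auto simp: e'_def)
  obtain phi where phi: "C1_fun A phi" "!!x. abs (phi x - u0 x) <= e'" "!!x v. df phi x v <= L x v 0 + c0 + e'"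
  using ex_smooth_critical_subsolution[OF e'(1)] by blast
  have "((%s. L (gm s) (velocity A gm s) 0 + (c0 + e')) has_integral (I + (t - 0) *\<^sub>R (c0 + e'))) {0..t}"
  using has_integral_add[OF gm(4) has_integral_const_real[of "c0 + e'" 0 t]] t by simp
  from C1_increment_le[OF phi(1) gm(1) t this] phi(3)
  have "phi x - phi y <= I + t * (c0 + e')" using gm(2,3) by(simp add: add.assoc)
  thus ?thesis using phi(2)[of x] phi(2)[of y] e'(2) by(simp add: algebra_simps abs_le_iff)
 qed
 hence "u0 x - u0 y <= I + c0 * t" by(rule field_le_epsilon)
 thus ?thesis using gm(5) by linarith
qed

text \<open>Integrating smooth approximate subsolutions against a closed measure kills their
  differentials. This later shows that a weak limit whose action is at most \<open>- c0\<close> is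
  minimising.\<close>

lemma closed_action_ge:
 assumes m: "prob_space m" "sets m = sets TM" "!!phi. C1_fun A phi ==> (\<integral>p. df phi (fst p) (snd p) \<partial>m) = 0"
  "integrable m (%p. L (fst p) (snd p) 0)"
 shows "(\<integral>p. L (fst p) (snd p) 0 \<partial>m) >= - c0"
proof -
 interpret prob_space m by fact
 have "- c0 <= (\<integral>p. L (fst p) (snd p) 0 \<partial>m) + e" if e: "e > 0" for e
 proof -
  obtain phi where phi: "C1_fun A phi" "!!x v. df phi x v <= L x v 0 + c0 + e"
  using ex_smooth_critical_subsolution[OF e] by blast
  have "(\<integral>p. df phi (fst p) (snd p) \<partial>m) <= (\<integral>p. L (fst p) (snd p) 0 + c0 + e \<partial>m)"
  by(rule integral_mono[OF differential_integrable[OF m(1,2,4) phi(1)]]) (use m(4) phi(2) in auto)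
  thus ?thesis using m(3)[OF phi(1)] m(4) by(simp add: prob_space)
 qed
 thus ?thesis by(rule field_le_epsilon)
qed

text \<open>The slack \<open>L + c0 + e - df phi\<close> is nonnegative and, for a Mather measure,
  has integral \<open>e\<close>. Since \<open>2 * df phi \<le> L + C\<close>, it is at least
  \<open>(L + 2 * c0 - C) / 2\<close>, a quantity independent of \<open>phi\<close>; letting
  \<open>e\<close> tend to 0 forces its positive part to vanish almost everywhere. One
  \<open>R\<close> serves for all Mather measures.\<close>

lemma mather_tame: obtains R where "!!m. m : mather_measures A g H ==> AE p in m. tame R (fst p) (snd p)"
proof -
 obtain C where C: "PROP smooth_approx C"
  by(rule smooth_critical_subsolution) blast
 obtain R where R: "!!x v. L x v 0 <= C - 2 * c0 ==> tame R x v" by(rule tame_of_L_le[of "C - 2 * c0"]) blast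
 show ?thesis
 proof (rule that[of R])
  fix m assume mm: "m : mather_measures A g H"
  note m = matherD[OF mm]
  interpret prob_space m by(rule m(1))
  define G where "G p = max 0 ((L (fst p) (snd p) 0 + 2 * c0 - C) / 2)" for p
  have Gi: "integrable m G" unfolding G_def[abs_def] using m(4) by(intro integrable_max) auto
  have "(\<integral>p. G p \<partial>m) <= e" if e: "e > 0" for e
  proof -
  obtain phi where phi: "C1_fun A phi" "!!x v. df phi x v <= L x v 0 + c0 + e" "!!x v. 2 * df phi x v <= L x v 0 + C"
  using C[OF e] by blast
  note di = differential_integrable[OF m(1,2,4) phi(1)]
  have "(\<integral>p. G p \<partial>m) <= (\<integral>p. L (fst p) (snd p) 0 + c0 + e - df phi (fst p) (snd p) \<partial>m)"
  proof (rule integral_mono[OF Gi])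
  show "integrable m (%p. L (fst p) (snd p) 0 + c0 + e - df phi (fst p) (snd p))" using di m(4) by simp
  show "G p <= L (fst p) (snd p) 0 + c0 + e - df phi (fst p) (snd p)" for p
  using phi(2)[of "fst p" "snd p"] phi(3)[of "fst p" "snd p"] e unfolding G_def by(auto simp: max_def field_simps)
  qed
  also have "... = e" using di m(3)[OF phi(1)] m(4,5) by(simp add: prob_space)
  finally show ?thesis .
  qed
  hence "(\<integral>p. G p \<partial>m) <= 0" by(rule field_le_epsilon) simp
  moreover have G0: "G p >= 0" for p by(simp add: G_def)
  ultimately have "(\<integral>p. G p \<partial>m) = 0" using Bochner_Integration.integral_nonneg[of m G] by fastforce
  hence "AE p in m. G p = 0" using integral_nonneg_eq_0_iff_AE[OF Gi] G0 by simp
  thus "AE p in m. tame R (fst p) (snd p)"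
  proof eventually_elim
  case (elim p)
  hence "(L (fst p) (snd p) 0 + 2 * c0 - C) / 2 <= 0" unfolding G_def by(metis max.cobounded2)
  thus ?case by(intro R) simp
  qed
 qed
qed

lemma mather_constraint:
 assumes mm: "m : mather_measures A g H"
 shows "(\<integral>p. V (fst p) 0 \<partial>m) <= (\<integral>p. u0 (fst p) * dL (fst p) (snd p) \<partial>m)"
proof -
 note m = matherD[OF mm]
 interpret prob_space m by(rule m(1))
 obtain R where "!!m. m : mather_measures A g H ==> AE p in m. tame R (fst p) (snd p)" by(rule mather_tame) blast
 hence R: "AE p in m. tame R (fst p) (snd p)" using mm by blast
 obtain U l1 where U: "U >= 1" "l1 > 0" "l1 <= l0" "l1 * U <= 1" "l1 <= 1" "!!l x. 0 < l ==> l < l1 ==> abs (u l x) <= U"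
  "!!l x. 0 < l ==> l < l1 ==> abs (V x l) <= U" "!!x. abs (u0 x) <= U" "!!x. abs (V x 0) <= U" by(rule uniform_bounds) blast
 obtain B where B: "B > 0" "!!x v s. tame R x v ==> abs s <= 1 ==> abs (L x v s) <= B" "!!x v. tame R x v ==> abs (dL x v) <= B" by(rule tame_bounded[of R]) blast
 have iV: "integrable m (%p. V (fst p) 0)" by(rule tame_integrable[OF m(1,2) R tm_cont_base[OF V0_cont]]) (use U(9) in blast)
 have iu: "integrable m (%p. u0 (fst p) * dL (fst p) (snd p))"
 proof (rule tame_integrable[OF m(1,2) R tm_cont_mult[OF tm_cont_base[OF u0_cont] tm_cont_dL]])
  show "abs (u0 x * dL x v) <= U * B" if "tame R x v" for x v unfolding abs_mult by(rule mult_mono) (use U B that in auto)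
 qed
 have "(\<integral>p. V (fst p) 0 \<partial>m) <= (\<integral>p. u0 (fst p) * dL (fst p) (snd p) \<partial>m) + e" if e: "e > 0" for e
 proof -
  define e' where "e' = e / (U + B + 2)"
  have e': "e' > 0" "e' * (U + B + 2) = e" using e U B by(auto simp: e'_def)
  obtain dlt where d: "dlt > 0" "PROP tame_C1 R dlt e'" by(rule tame_deriv[OF e'(1), of R]) blast
  obtain l2 where l2: "l2 > 0" "l2 <= l0" "!!l x. 0 < l ==> l < l2 ==> abs (u l x - u0 x) < e'" "!!l x. 0 < l ==> l < l2 ==> abs (V x l - V x 0) < e'"
  by(rule close_to_limit[OF e'(1)]) blast
  define q where "q = min (min l1 l2) (dlt / U)"
  define l where "l = q / 2"
  have mm: "0 < q" "q <= l1" "q <= l2" "q <= dlt / U" using U(1,2) l2(1) d(1) by(auto simp: q_def min_le_iff_disj)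
  have l: "0 < l" "l < l1" "l < l2" "l < dlt / U" using mm unfolding l_def by linarith+
  have ll: "l * U < dlt" "l <= l0" "l * U <= 1"
  proof -
  show "l * U < dlt" using l(4) U(1) by(simp add: pos_less_divide_eq)
  show "l <= l0" using l U by linarith
  have "l * U <= l1 * U" using l U by(intro mult_right_mono) auto
  thus "l * U <= 1" using U by linarith
  qed
  have su: "abs (l * u l x) <= l * U" for x using U(6)[OF l(1,2), of x] l(1) by(simp add: abs_mult)
  have su1: "abs (l * u l x) <= 1" for x using su[of x] ll(3) by linarith
  \<comment> \<open>The integrated inequality is divided by \<open>l\<close> at the end, so the
    smoothing error has to be small relative to \<open>l\<close>.\<close>
  have le: "l * e' > 0" using l e' by simp
  obtain phi where phi: "C1_fun A phi" "!!x v. df phi x v <= L x v (l * u l x) + c0 - l * V x l + l * e'"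
  by(rule smooth_u[OF l(1) ll(2) su1 le]) blast
  note di = differential_integrable[OF m(1,2,4) phi(1)]
  let ?F = "%p. L (fst p) (snd p) 0 + c0 + l * (u0 (fst p) * dL (fst p) (snd p) - V (fst p) 0 + e)"
  have "(\<integral>p. df phi (fst p) (snd p) \<partial>m) <= (\<integral>p. ?F p \<partial>m)"
  proof (rule integral_mono_AE[OF di])
  show "integrable m ?F" using m(4) iV iu by simp
  show "AE p in m. df phi (fst p) (snd p) <= ?F p"
  using R
  proof eventually_elim
  case (elim p)
  obtain x v where p: "p = (x, v)" by(cases p)
  have t: "tame R x v" using elim p by simp
  let ?s = "l * u l x"
  have "abs ?s < dlt" using su[of x] ll(1) by linarith
  from d(2)[OF t this] have 1: "L x v ?s <= L x v 0 + ?s * dL x v + e' * abs ?s" by linarith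
  have 2: "e' * abs ?s <= e' * (l * U)" by(rule mult_left_mono[OF su]) (use e' in simp)
  have 3: "(u l x - u0 x) * dL x v <= e' * B"
  proof -
  have "abs ((u l x - u0 x) * dL x v) <= e' * B" unfolding abs_mult by(rule mult_mono) (use l2(3)[OF l(1,3), of x] B(3)[OF t] e' in auto)
  thus ?thesis by linarith
  qed
  have 4: "l * ((u l x - u0 x) * dL x v) <= l * (e' * B)" by(rule mult_left_mono[OF 3]) (use l in simp)
  have "V x 0 - V x l <= e'" using l2(4)[OF l(1,3), of x] by linarith
  hence 5: "l * (V x 0 - V x l) <= l * e'" by(rule mult_left_mono) (use l in simp)
  have "df phi x v <= L x v 0 + c0 + l * (u0 x * dL x v - V x 0) + (e' * (l * U) + l * (e' * B) + l * e' + l * e')"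
  using phi(2)[of x v] 1 2 4 5 by(simp add: algebra_simps)
  also have "e' * (l * U) + l * (e' * B) + l * e' + l * e' = l * (e' * (U + B + 2))" by(simp add: algebra_simps)
  finally show ?case unfolding p e'(2) by(simp add: algebra_simps)
  qed
  qed
  also have "(\<integral>p. ?F p \<partial>m) = l * ((\<integral>p. u0 (fst p) * dL (fst p) (snd p) \<partial>m) - (\<integral>p. V (fst p) 0 \<partial>m) + e)"
  using m(4,5) iV iu by(simp add: prob_space)
  finally have "0 <= l * ((\<integral>p. u0 (fst p) * dL (fst p) (snd p) \<partial>m) - (\<integral>p. V (fst p) 0 \<partial>m) + e)" using m(3)[OF phi(1)] by simp
  thus ?thesis using l(1) by(simp add: zero_le_mult_iff)
 qed
 thus ?thesis by(rule field_le_epsilon)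
qed

end

section \<open>Hopf-Lax steps and chains on the manifold\<close>

text \<open>A function touching a Lipschitz function from below satisfies the last hypothesis. The
  bound confines the momenta in the supersolution test to a ball on which \<open>H\<close> is
  uniformly continuous.\<close>

lemma gradient_le_of_touching:
 fixes phi :: "'e::euclidean_space => real"
 assumes d: "(phi has_derivative (%h. G \<bullet> h)) (at y)" and r: "r > 0" and K: "K >= 0"
  and le: "!!z. z : ball y r ==> phi z - phi y <= K * dist z y"
 shows "norm G <= K"
proof (cases "G = 0")
 case False
 define e where "e = G /\<^sub>R norm G"
 have e: "norm e = 1" "G \<bullet> e = norm G" using False by(auto simp: e_def dot_square_norm power2_eq_square)
 have "((%t. y + t *\<^sub>R e) has_derivative (%t. t *\<^sub>R e)) (at 0)" by(auto intro!: derivative_eq_intros)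
 hence "((%t. phi (y + t *\<^sub>R e)) has_derivative (%t. G \<bullet> (t *\<^sub>R e))) (at 0)"
  by(rule has_derivative_compose) (use d in simp)
 hence "((%t. phi (y + t *\<^sub>R e)) has_real_derivative norm G) (at 0)"
  unfolding has_field_derivative_def by(rule has_derivative_eq_rhs) (use e(2) in "auto simp: fun_eq_iff")
 hence "((%t. (phi (y + t *\<^sub>R e) - phi y) / t) \<longlongrightarrow> norm G) (at 0)" by(simp add: DERIV_def)
 hence lim: "((%t. (phi (y + t *\<^sub>R e) - phi y) / t) \<longlongrightarrow> norm G) (at_right 0)" by(rule filterlim_mono) (auto simp: at_le)
 have "eventually (%t. (phi (y + t *\<^sub>R e) - phi y) / t <= K) (at_right 0)"
 proof (rule eventually_mono[OF eventually_at_right_real[OF r]])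
  fix t assume t: "t : {0<..<r}"
  hence "phi (y + t *\<^sub>R e) - phi y <= K * t" using le[of "y + t *\<^sub>R e"] e(1) by(simp add: dist_norm)
  thus "(phi (y + t *\<^sub>R e) - phi y) / t <= K" using t by(simp add: pos_divide_le_eq)
 qed
 from tendsto_upperbound[OF lim this] show ?thesis by simp
qed (use K in simp)

context hamiltonian
begin

lemma segment_action:
 assumes c: "c : A" and t: "t >= 0" and seg: "!!s. s : {0..t} ==> y + s *\<^sub>R w : img c"
  and M: "!!s. s : {0..t} ==> Lc c (y + s *\<^sub>R w) w 0 <= M" and a: "t * M < a"
 shows "minimal_action A (%x v. L x v 0) t (cinv c y) (cinv c (y + t *\<^sub>R w)) < ereal a"
proof -
 let ?gm = "%s. cinv c (y + s *\<^sub>R w)" and ?l = "%s. Lc c (y + s *\<^sub>R w) w 0"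
 obtain B where B: "!!x v s. abs s <= 1 ==> - B <= L x v s" by(rule L_bounded_below) blast
 have B0: "- B <= L x v 0" for x v using B[of 0] by simp
 have "continuous_on (img c \<times> UNIV) (%x. L (cinv c (fst x)) (Tg c (fst x) (snd x)) 0)"
  using tm_cont_L[of "%_. 0"] c by(simp add: tm_cont_def)
 moreover have "continuous_on {0..t} (%s. (y + s *\<^sub>R w, w))" by(intro continuous_intros)
 moreover have "(%s. (y + s *\<^sub>R w, w)) ` {0..t} <= img c \<times> UNIV" using seg by auto
 ultimately have "continuous_on {0..t} (%s. (%x. L (cinv c (fst x)) (Tg c (fst x) (snd x)) 0) (y + s *\<^sub>R w, w))" by(rule continuous_on_compose2)
 hence cl: "continuous_on {0..t} ?l" by simp
 have vel: "velocity A ?gm s = Tg c (y + s *\<^sub>R w) w" if "s : {0..t}" for s using segment_curve(2)[OF c seg that] .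
 have io: "(?l has_integral integral {0..t} ?l) {0..t}" by(rule integrable_integral[OF integrable_continuous_real[OF cl]])
 have int: "((%s. L (?gm s) (velocity A ?gm s) 0) has_integral integral {0..t} ?l) {0..t}"
  by(rule has_integral_eq[OF _ io]) (use vel in auto)
 have "integral {0..t} ?l <= (t - 0) *\<^sub>R M"
 proof (rule has_integral_le[OF io])
  show "((%s. M) has_integral (t - 0) *\<^sub>R M) {0..t}" using has_integral_const_real[of M 0 t] t by simp
 qed (use M in auto)
 hence "integral {0..t} ?l < a" using a by simp
 from minimal_action_lessI[OF B0 segment_curve(1)[OF c seg] _ _ int this]
 show ?thesis by simp
qed

lemma hopf_lax_constants:
 obtains C0 C where "!!c a r y z s. (c, a, r) : cover ==> y : cball a (3 * r) ==> abs s <= 1 ==> - C0 <= Hc c y z s"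
  "!!c a r y z s. (c, a, r) : cover ==> y : cball a (3 * r) ==> abs s <= 1 ==> norm z <= K ==> Hc c y z s <= C"
proof -
 let ?F = "%c y t. max (- Hc c y (fst t) (snd t)) (if norm (fst t) <= K then Hc c y (fst t) (snd t) else 0)"
 obtain B where B: "B > 0" "!!c a r y t. (c, a, r) : cover ==> y : cball a (3 * r) ==> abs (snd t) <= 1 ==> ?F c y t <= B"
 proof (rule cover_bound[where F = ?F and Q = "%c y t. abs (snd t) <= 1"])
  fix c a r assume i: "(c, a, r) : cover"
  interpret local_hamiltonian "img c" "Hc c" by(rule local_ham[OF coverD(1)[OF i]])
  obtain B1 where B1: "ALL y:cball a (3 * r). ALL z r. abs r <= 1 --> 0 * norm z - B1 <= Hc c y z r" by(rule uniform_superlinear[OF compact_cball cover_cball(1)[OF i]])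
  obtain B2 where B2: "ALL y:cball a (3 * r). ALL z r. norm z <= K --> abs r <= 1 --> abs (Hc c y z r) <= B2" by(rule h_bounded[OF compact_cball cover_cball(1)[OF i]])
  have "?F c y t <= max (max B1 B2) 0" if "y : cball a (3 * r)" "abs (snd t) <= 1" for y t
  using B1[rule_format, OF that, of "fst t"] B2[rule_format, OF that(1) _ that(2), of "fst t"] by auto
  thus "EX B. ALL y:cball a (3 * r). ALL t. abs (snd t) <= 1 --> ?F c y t <= B" by blast
 qed blast
 show ?thesis
 proof (rule that[of B B])
  fix c a r y z s assume "(c, a, r) : cover" "y : cball a (3 * r)" "abs s <= (1::real)"
  from B(2)[of c a r y "(z, s)"] this show "- B <= Hc c y z s" "norm z <= K ==> Hc c y z s <= B" by auto
 qed
qed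

text \<open>One step runs backwards in time from \<open>y\<close> to
  \<open>y - tau *\<^sub>R w\<close>. The Lagrangian is evaluated at the starting point
  \<open>y\<close> alone; the last conjunct compares it with the minimal action over the step. The
  segment stays in the ball of radius \<open>3 * r\<close>, where first-order expansions are
  uniform.\<close>

definition hl_step :: "real => ('m => real) => ('m => real) => ('m => real) => real => real => ('m, 'e) chart \<times> 'e \<times> real => 'e => 'e => bool" where
 "hl_step R f k u eps tau = (%(c, a, r) y w. (c, a, r) : cover & y : ball a r & norm w <= R & closed_segment y (y - tau *\<^sub>R w) <= cball a (3 * r) &
  u (cinv c (y - tau *\<^sub>R w)) + tau * (Lc c y w (f (cinv c y)) + k (cinv c y) - eps) <= u (cinv c y) &
  minimal_action A (%x v. L x v 0) tau (cinv c (y - tau *\<^sub>R w)) (cinv c y) < ereal (tau * (Lc c y w 0 + eps)))"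

abbreviation "hl_steps R f k u eps == (EX tau0>0. ALL tau x. 0 < tau --> tau < tau0 --> (EX i y w. hl_step R f k u eps tau i y w & x = cinv (fst i) y))"

text \<open>Near each point the coefficients are frozen at that point, which reduces the claim to
  \<open>hopf_lax_step\<close> with an error controlled by uniform continuity. The velocity bound
  \<open>R\<close> depends only on \<open>Kb\<close>; the admissible step length may depend on all
  the data.\<close>

lemma hopf_lax_manifold:
 obtains R where "R > 0" "!!f k u eps. frozen_sub f k u ==> frozen_super f k u ==> continuous_on UNIV u ==> continuous_on UNIV f ==>
  continuous_on UNIV k ==> (!!x. abs (f x) <= 1) ==> (!!x. abs (k x) <= Kb) ==> eps > 0 ==>
  hl_steps R f k u eps"
proof -
 obtain K where K: "K > 0" "PROP Lip_bound Kb K" by(rule frozen_sub_Lipschitz[of Kb]) blast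
 obtain C0 C1 where CC: "!!c a r y z s. (c, a, r) : cover ==> y : cball a (3 * r) ==> abs s <= 1 ==> - C0 <= Hc c y z s"
  "!!c a r y z s. (c, a, r) : cover ==> y : cball a (3 * r) ==> abs s <= 1 ==> norm z <= K + 1 ==> Hc c y z s <= C1"
  by(rule hopf_lax_constants[of "K + 1"]) blast
 define C where "C = C1 + (K + 1)\<^sup>2 / 2"
 define R where "R = abs (C + C0) + 1"
 have R: "R > 0" "C + C0 <= R" by(auto simp: R_def)
 show ?thesis
 proof (rule that[OF R(1)])
  fix f k u and eps :: real
  assume sub: "frozen_sub f k u" and super: "frozen_super f k u" and u: "continuous_on UNIV u" and fc: "continuous_on UNIV f"
  and kc: "continuous_on UNIV k" and f1: "!!x. abs (f x) <= 1" and kb: "!!x. abs (k x) <= Kb" and e: "eps > 0"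
  have kb': "k x <= Kb" for x using kb[of x] by linarith
  \<comment> \<open>Three quarters of \<open>eps\<close> are spent by \<open>hopf_lax_step\<close>,
    the last one on the quadratic regularisation.\<close>
  define e1 where "e1 = eps / 4"
  have e1: "e1 > 0" using e by(simp add: e1_def)
  have loc: "EX tau0>0. ALL y0:ball (fst (snd i)) (snd (snd i)). ALL tau. 0 < tau --> tau < tau0 --> (EX w. hl_step R f k u eps tau i y0 w)" if ii: "i : cover" for i
  proof -
  obtain c a r where car: "i = (c, a, r)" by(cases i)
  note i = ii[unfolded car]
  note c = coverD(1)[OF i] and r = coverD(2)[OF i]
  have cb: "cball a (3 * r) <= img c" by(rule cover_cball(1)[OF i])
  interpret local_hamiltonian "img c" "Hc c" by(rule local_ham[OF c])
  have lip: "abs (u (cinv c y') - u (cinv c y)) <= K * dist y' y" if "y : ball a (3 * r)" "y' : ball a (3 * r)" for y y'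
  using K(2)[OF sub u f1 kb' i that] .
  obtain P where P: "ALL y:cball a (3 * r). ALL w s z. norm w <= R --> abs s <= 1 --> lag y w s = z \<bullet> w - Hc c y z s --> norm z <= P"
  by(rule argmax_bound[OF compact_cball cb])
  \<comment> \<open>The bound 1 lets \<open>C\<close>, and hence \<open>R\<close>, be chosen before
    \<open>dlt\<close>; the other bound makes the quadratic term cost at most \<open>e1\<close> at a
    maximising momentum.\<close>
  define dlt where "dlt = min 1 (2 * e1 / (P\<^sup>2 + 1))"
  have P1: "P\<^sup>2 + 1 > 0" by(simp add: add_nonneg_pos)
  have dlt: "dlt > 0" "dlt <= 1" "dlt / 2 * P\<^sup>2 <= e1"
  proof -
  show "dlt > 0" "dlt <= 1" using e1 P1 by(auto simp: dlt_def)
  have "dlt <= 2 * e1 / (P\<^sup>2 + 1)" by(simp add: dlt_def)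
  hence "dlt * (P\<^sup>2 + 1) <= 2 * e1" using P1 by(simp add: pos_le_divide_eq)
  thus "dlt / 2 * P\<^sup>2 <= e1" using \<open>dlt > 0\<close> by(simp add: algebra_simps)
  qed
  have comp: "continuous_on (img c) (%y. h (cinv c y))" if "continuous_on UNIV h" for h :: "'m => real"
  by(rule continuous_on_compose2[OF that cont_chart_inv[OF c]]) auto
  define S where "S x = Hc c (fst x) (snd x) (f (cinv c (fst x))) - k (cinv c (fst x))" for x
  have "continuous_on (cball a (3 * r) \<times> cball 0 K) S" unfolding S_def[abs_def]
  by(intro continuous_intros continuous_on_h continuous_on_compose2[OF comp[OF fc]] continuous_on_compose2[OF comp[OF kc]]) (use cb in auto)
  from compact_uniformly_continuous[OF this compact_Times[OF compact_cball compact_cball]] e1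
  obtain d1 where d1: "d1 > 0" "ALL x:cball a (3 * r) \<times> cball 0 K. ALL x':cball a (3 * r) \<times> cball 0 K. dist x' x < d1 --> dist (S x') (S x) < e1"
  unfolding uniformly_continuous_on_def by blast
  define T where "T x = lag (fst x) (snd x) 0" for x
  have "continuous_on (cball a (3 * r) \<times> cball 0 R) T" unfolding T_def[abs_def]
  by(intro continuous_on_lag' continuous_intros) (use cb in auto)
  from compact_uniformly_continuous[OF this compact_Times[OF compact_cball compact_cball]] e1
  obtain d2 where d2: "d2 > 0" "ALL x:cball a (3 * r) \<times> cball 0 R. ALL x':cball a (3 * r) \<times> cball 0 R. dist x' x < d2 --> dist (T x') (T x) < e1"
  unfolding uniformly_continuous_on_def by blast
  define rho where "rho = min (min r d1) d2 / 2"
  have rho: "rho > 0" "rho < r" "rho < d1" "rho < d2" using r d1(1) d2(1) by(auto simp: rho_def min_def)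
  show ?thesis
  proof (intro exI[of _ "rho / R"] conjI ballI allI impI)
  show "rho / R > 0" using rho R by simp
  fix y0 tau assume y0i: "y0 : ball (fst (snd i)) (snd (snd i))" and tau: "0 < tau" "tau < rho / R"
  have y0: "y0 : ball a r" using y0i by(simp add: car)
  have tauR: "R * tau < rho" using tau(2) R(1) by(simp add: field_simps)
  have near: "y : ball a (3 * r)" "y : cball a (3 * r)" "y : img c" if "y : cball y0 rho" for y
  proof -
  show 1: "y : ball a (3 * r)" using that y0 rho(2) r dist_triangle[of a y y0] by simp
  thus 2: "y : cball a (3 * r)" by simp
  thus "y : img c" using cb by blast
  qed
  have y0n: "y0 : cball y0 rho" using rho by simp
  note y0' = near[OF y0n]
  let ?s = "f (cinv c y0)"
  let ?f = "%z. Hc c y0 z ?s"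
  let ?u = "%y. u (cinv c y)"
  have small: "(C + C0) * tau < rho" using mult_right_mono[OF R(2), of tau] tau tauR by linarith
  obtain y where y: "norm (y0 - y) <= (C + C0) * tau"
  "!!z. ?u y + z \<bullet> (y0 - y) - tau * (?f z + dlt/2 * (z \<bullet> z)) + (k (cinv c y0) - 3 * e1) * tau <= ?u y0"
  proof (rule hopf_lax_step[where f = ?f and u = ?u and kp = K and C = C and rho = rho and C0 = C0 and dlt = dlt and eps = e1 and tau = tau and ?y0.0 = y0 and c = "k (cinv c y0)"])
  show "convex_on UNIV ?f" by(rule Hc_convex[OF c y0'(3)])
  show "continuous_on UNIV ?f" by(rule continuous_on_h) (use y0'(3) in "auto intro!: continuous_intros")
  fix q :: real
  obtain Q where "ALL y:{y0}. ALL z r. abs r <= 1 --> q * norm z - Q <= Hc c y z r" by(rule uniform_superlinear[of "{y0}" 1 q]) (use y0'(3) in auto)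
  thus "EX C. ALL z. ?f z >= q * norm z - C" using f1 by blast
  next
  show "continuous_on (cball y0 rho) ?u" by(rule continuous_on_subset[OF comp[OF u]]) (use near in blast)
  show "?u y0 - K * dist y y0 <= ?u y" if "y : cball y0 rho" for y using lip[OF y0'(1) near(1)[OF that]] by linarith
  show "?f z + dlt/2 * (z \<bullet> z) <= C" if z: "norm z <= K + 1" for z
  proof -
  have "z \<bullet> z <= (K + 1)\<^sup>2" unfolding dot_square_norm using z by(intro power_mono) auto
  hence "dlt/2 * (z \<bullet> z) <= 1/2 * (K + 1)\<^sup>2" using dlt by(intro mult_mono) auto
  thus ?thesis using CC(2)[OF i y0'(2) f1 z, of "cinv c y0"] by(simp add: C_def)
  qed
  show "- C0 <= ?f z" for z by(rule CC(1)[OF i y0'(2) f1])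
  next
  fix phi G y q assume q: "q > 0" "ball y q <= ball y0 rho" and G: "ALL z:ball y q. (phi has_derivative (%h. G z \<bullet> h)) (at z)" "continuous_on (ball y q) G"
  and mn: "ALL z:ball y q. ?u z - phi z >= ?u y - phi y"
  have yq: "y : ball y q" using q by simp
  have sub': "z : cball y0 rho" if "z : ball y q" for z using that q(2) ball_subset_cball by blast
  have y': "y : cball y0 rho" using sub'[OF yq] .
  have "norm (G y) <= K"
  proof (rule gradient_le_of_touching[OF _ q(1)])
  show "(phi has_derivative (%h. G y \<bullet> h)) (at y)" using G(1) yq by blast
  fix z assume z: "z : ball y q"
  have "phi z - phi y <= ?u z - ?u y" using mn z by(simp add: algebra_simps)
  thus "phi z - phi y <= K * dist z y" using lip[OF near(1)[OF y'] near(1)[OF sub'[OF z]]] by linarith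
  qed (use K in simp)
  hence mem: "(y, G y) : cball a (3 * r) \<times> cball 0 K" "(y0, G y) : cball a (3 * r) \<times> cball 0 K" using near(2)[OF y'] y0'(2) by auto
  have "dist (y, G y) (y0, G y) < d1" using y' rho(3) by(simp add: dist_Pair_Pair dist_commute)
  hence "dist (S (y, G y)) (S (y0, G y)) < e1" using d1(2) mem by blast
  moreover have "ball y q <= img c" using sub' near(3) by blast
  hence "S (y, G y) >= 0" unfolding S_def fst_conv snd_conv
  using super[unfolded frozen_super_def, rule_format, OF c q(1), of y phi G] G mn by(simp add: C1_grad_def)
  ultimately have "S (y0, G y) >= - e1" by(simp add: dist_real_def)
  thus "k (cinv c y0) - e1 <= Hc c y0 (G y) ?s" unfolding S_def by simp
  qed (use dlt(1) e1 tau(1) K(1) small in auto)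
  define w where "w = (y0 - y) /\<^sub>R tau"
  have wy: "y0 - tau *\<^sub>R w = y" "y0 - y = tau *\<^sub>R w" using tau by(auto simp: w_def)
  have nw: "norm w <= R"
  proof -
  have "tau * norm w <= (C + C0) * tau" using y(1) tau unfolding wy(2) by simp
  hence "norm w <= C + C0" using tau by(simp add: mult.commute)
  thus ?thesis using R by linarith
  qed
  have seg: "y + s *\<^sub>R w : cball y0 rho" if s: "s : {0..tau}" for s
  proof -
  have "dist y0 (y + s *\<^sub>R w) = norm ((tau - s) *\<^sub>R w)" unfolding dist_norm wy(1)[symmetric] by(simp add: algebra_simps)
  also have "... <= tau * R" unfolding norm_scaleR by(rule mult_mono) (use s nw tau in auto)
  finally show ?thesis using tauR by(simp add: mult.commute)
  qed
  obtain z where z: "lag y0 w ?s = z \<bullet> w - Hc c y0 z ?s" by(rule lag_argmax[OF y0'(3)])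
  have "norm z <= P" using P y0'(2) nw f1 z by blast
  hence "z \<bullet> z <= P\<^sup>2" unfolding dot_square_norm by(intro power_mono) auto
  hence zz: "dlt/2 * (z \<bullet> z) <= e1" using dlt(3) mult_left_mono[of "z \<bullet> z" "P\<^sup>2" "dlt/2"] dlt(1) by linarith
  have 1: "?u y + tau * (Lc c y0 w ?s + k (cinv c y0) - eps) <= ?u y0"
  proof -
  have "?u y + tau * (z \<bullet> w - (?f z + dlt/2 * (z \<bullet> z)) + (k (cinv c y0) - 3 * e1)) <= ?u y0"
  using y(2)[of z] unfolding wy(2) by(simp add: algebra_simps)
  moreover have "tau * (lag y0 w ?s + k (cinv c y0) - eps) <= tau * (z \<bullet> w - (?f z + dlt/2 * (z \<bullet> z)) + (k (cinv c y0) - 3 * e1))"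
  using tau zz z by(intro mult_left_mono) (auto simp: e1_def)
  ultimately show ?thesis unfolding lagrangian_chart[OF c y0'(3)] by linarith
  qed
  have 2: "minimal_action A (%x v. L x v 0) tau (cinv c y) (cinv c (y + tau *\<^sub>R w)) < ereal (tau * (Lc c y0 w 0 + eps))"
  proof (rule segment_action[OF c, where M = "Lc c y0 w 0 + e1"])
  fix s assume s: "s : {0..tau}"
  show yi: "y + s *\<^sub>R w : img c" by(rule near(3)[OF seg[OF s]])
  have mem: "(y + s *\<^sub>R w, w) : cball a (3 * r) \<times> cball 0 R" "(y0, w) : cball a (3 * r) \<times> cball 0 R" using near(2)[OF seg[OF s]] y0'(2) nw by auto
  have "dist (y + s *\<^sub>R w, w) (y0, w) < d2" using seg[OF s] rho(4) by(simp add: dist_Pair_Pair dist_commute)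
  hence "dist (T (y + s *\<^sub>R w, w)) (T (y0, w)) < e1" using d2(2) mem by blast
  thus "Lc c (y + s *\<^sub>R w) w 0 <= Lc c y0 w 0 + e1"
  unfolding lagrangian_chart[OF c yi] lagrangian_chart[OF c y0'(3)] by(simp add: T_def dist_real_def)
  qed (use tau e in "auto simp: e1_def")
  have 3: "closed_segment y0 (y0 - tau *\<^sub>R w) <= cball a (3 * r)"
  proof (rule closed_segment_subset[OF _ _ convex_cball])
  show "y0 : cball a (3 * r)" by(rule y0'(2))
  show "y0 - tau *\<^sub>R w : cball a (3 * r)" unfolding wy(1) using near(2)[OF seg[of 0]] tau by simp
  qed
  have "y + tau *\<^sub>R w = y0" using wy by(simp add: algebra_simps)
  hence "hl_step R f k u eps tau i y0 w" unfolding car hl_step_def prod.case wy(1) using i y0 nw 1 2 3[unfolded wy(1)] by simp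
  thus "EX w. hl_step R f k u eps tau i y0 w" by blast
  qed
  qed
  have "ALL i:cover. EX tau0>0. ALL y0:ball (fst (snd i)) (snd (snd i)). ALL tau. 0 < tau --> tau < tau0 --> (EX w. hl_step R f k u eps tau i y0 w)" using loc by blast
  from bchoice[OF this] obtain t where t: "ALL i:cover. t i > 0 & (ALL y0:ball (fst (snd i)) (snd (snd i)). ALL tau. 0 < tau --> tau < t i --> (EX w. hl_step R f k u eps tau i y0 w))" by blast
  define t0 where "t0 = Min (insert 1 (t ` cover))"
  have fin: "finite (insert 1 (t ` cover))" using finite_cover by simp
  show "hl_steps R f k u eps"
  proof (intro exI[of _ t0] conjI allI impI)
  show "t0 > 0" unfolding t0_def using fin t by(subst Min_gr_iff) auto
  fix tau x assume tau: "0 < tau" "tau < t0"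
  obtain c a r y where c: "(c, a, r) : cover" "y : ball a r" "x = cinv c y" by(rule coverE)
  have "t0 <= t (c, a, r)" unfolding t0_def using fin c(1) by(intro Min_le) auto
  hence "EX w. hl_step R f k u eps tau (c, a, r) y w" using t[rule_format, OF c(1)] c(2) tau by simp
  thus "EX i y w. hl_step R f k u eps tau i y w & x = cinv (fst i) y" using c(3) by(metis fst_conv)
  qed
 qed
qed

abbreviation ma :: "real => 'm => 'm => ereal" where "ma == minimal_action A (%x v. L x v 0)"

lemma ma_triangle:
 assumes "0 <= s" "0 <= t" "ma s x y < ereal a" "ma t y z < ereal b"
 shows "ma (s + t) x z < ereal (a + b)"
proof -
 obtain B where B: "!!x v s. abs s <= 1 ==> - B <= L x v s" by(rule L_bounded_below) blast
 have "- B <= L x v 0" for x v using B[of 0] by simp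
 from minimal_action_triangle[OF this assms] show ?thesis .
qed

abbreviation seg_bound :: "real => prop" where
"PROP seg_bound B == (!!c a r y1 y2 b. (c, a, r) : cover ==> y1 : ball a r ==> y2 : ball a r ==> B * dist y1 y2 < b ==> ma (dist y1 y2) (cinv c y1) (cinv c y2) < ereal b)"

lemma short_segment:
 obtains B where "B > 0" "PROP seg_bound B"
proof -
 obtain B where B: "B > 0" "PROP L_bound 1 B"
  by(rule L_local_bounded[of 1]) blast
 show ?thesis
 proof (rule that[OF B(1)])
  fix c a r y1 y2 b assume i: "(c, a, r) : cover" and y: "y1 : ball a r" "y2 : ball a r" and b: "B * dist y1 y2 < b"
  define t where "t = dist y1 y2"
  define w where "w = (y2 - y1) /\<^sub>R t"
  have t: "t >= 0" by(simp add: t_def)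
  have w: "norm w <= 1" "y1 + t *\<^sub>R w = y2"
  by(cases "t = 0"; simp add: w_def t_def dist_norm norm_minus_commute)+
  have seg: "y1 + s *\<^sub>R w : ball a r" if s: "s : {0..t}" for s
  proof (cases "t = 0")
  case False
  have "y1 + s *\<^sub>R w = (1 - s/t) *\<^sub>R y1 + (s/t) *\<^sub>R y2" using False by(simp add: w_def algebra_simps divide_inverse)
  moreover have "0 <= s/t" "s/t <= 1" using s t False by(auto simp: field_simps)
  ultimately have "y1 + s *\<^sub>R w : closed_segment y1 y2" by(auto simp: in_segment)
  thus ?thesis using closed_segment_subset[OF y convex_ball] by blast
  qed (use s y in auto)
  have c3: "y1 + s *\<^sub>R w : cball a (3 * r)" if "s : {0..t}" for s by(rule cover_cball(2)[OF i seg[OF that]])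
  have "ma t (cinv c y1) (cinv c (y1 + t *\<^sub>R w)) < ereal b"
  proof (rule segment_action[OF coverD(1)[OF i] t, where M = B])
  show "y1 + s *\<^sub>R w : img c" if "s : {0..t}" for s using c3[OF that] cover_cball(1)[OF i] by blast
  show "Lc c (y1 + s *\<^sub>R w) w 0 <= B" if "s : {0..t}" for s
  using B(2)[OF i c3[OF that] w(1), of 0] by auto
  show "t * B < b" using b by(simp add: t_def mult.commute)
  qed
  thus "ma (dist y1 y2) (cinv c y1) (cinv c y2) < ereal b" unfolding w(2) by(simp add: t_def)
 qed
qed

lemma ma_refl: assumes "b > 0" shows "ma 0 x x < ereal b"
proof -
 obtain B where B: "PROP seg_bound B" by(rule short_segment) blast
 obtain c a r y where c: "(c, a, r) : cover" "y : ball a r" "x = cinv c y" by(rule coverE)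
 show ?thesis using B[OF c(1,2,2), of b] assms c(3) by simp
qed

text \<open>Being joined by a curve of finite action is transitive and holds locally in both
  directions, so its classes are open and connectedness leaves only one. Time and action become
  uniform by travelling through the centres of the finitely many cover balls.\<close>

lemma connecting_curves:
 obtains S D where "!!y z. EX s. 0 <= s & s <= S & ma s y z < ereal D"
proof -
 obtain B where B: "B > 0" "PROP seg_bound B" by(rule short_segment) blast
 define conn where "conn y z \<longleftrightarrow> (EX s>=0. EX D. ma s y z < ereal D)" for y z
 have refl: "conn y y" for y unfolding conn_def using ma_refl[of 1 y] by(intro exI[of _ 0] conjI exI[of _ 1]) auto
 have trans: "conn x z" if xy: "conn x y" and yz: "conn y z" for x y z
 proof -
  obtain s D where 1: "s >= 0" "ma s x y < ereal D" using xy unfolding conn_def by blast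
  obtain t E where 2: "t >= 0" "ma t y z < ereal E" using yz unfolding conn_def by blast
  have "ma (s + t) x z < ereal (D + E)" by(rule ma_triangle[OF 1(1) 2(1) 1(2) 2(2)])
  thus ?thesis unfolding conn_def using 1 2 by(intro exI[of _ "s + t"] conjI exI[of _ "D + E"]) auto
 qed
 have loc: "conn (cinv c y1) (cinv c y2)" if "(c, a, r) : cover" "y1 : ball a r" "y2 : ball a r" for c a r y1 y2
  unfolding conn_def using B(2)[OF that, of "B * dist y1 y2 + 1"] by(intro exI[of _ "dist y1 y2"] conjI exI) auto
 have nb: "EX N. open N & z : N & (ALL z':N. conn z z' & conn z' z)" for z
 proof -
  obtain c a r y where c: "(c, a, r) : cover" "y : ball a r" "z = cinv c y" by(rule coverE)
  have "ball a r <= img c" using cover_cball[OF c(1)] by blast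
  hence "open (cinv c ` ball a r)" by(rule open_chart_inv_image[OF coverD(1)[OF c(1)] open_ball])
  thus ?thesis using loc[OF c(1)] c(2,3) by(intro exI[of _ "cinv c ` ball a r"]) auto
 qed
 have all: "conn y z" for y z
 proof -
  let ?S = "{z. conn y z}"
  have "open ?S"
  proof (rule Topological_Spaces.openI)
  fix z assume z: "z : ?S"
  obtain N where N: "open N" "z : N" "ALL z':N. conn z z' & conn z' z" using nb by blast
  have "N <= ?S" using N(3) trans[of y z] z by auto
  with N show "EX T. open T & z : T & T <= ?S" by blast
  qed
  moreover have "open (- ?S)"
  proof (rule Topological_Spaces.openI)
  fix z assume z: "z : - ?S"
  obtain N where N: "open N" "z : N" "ALL z':N. conn z z' & conn z' z" using nb by blast
  have "N <= - ?S" using N(3) trans[of y _ z] z by auto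
  with N show "EX T. open T & z : T & T <= - ?S" by blast
  qed
  ultimately have "closed ?S" "open ?S" by(auto simp: closed_def)
  moreover have "ALL T::'m set. open T & closed T --> T = {} | T = UNIV" using connectedM unfolding connected_clopen by simp
  ultimately have "?S = {} | ?S = UNIV" by blast
  thus ?thesis using refl[of y] by blast
 qed
 define ctr where "ctr i = cinv (fst i) (fst (snd i))" for i :: "('m, 'e) chart \<times> 'e \<times> real"
 have "ALL p:cover \<times> cover. EX q. fst q >= 0 & ma (fst q) (ctr (fst p)) (ctr (snd p)) < ereal (snd q)"
 proof
  fix p assume "p : cover \<times> cover"
  obtain s D where "s >= 0" "ma s (ctr (fst p)) (ctr (snd p)) < ereal D" using all unfolding conn_def by blast
  thus "EX q. fst q >= 0 & ma (fst q) (ctr (fst p)) (ctr (snd p)) < ereal (snd q)" by(intro exI[of _ "(s, D)"]) simp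
 qed
 from bchoice[OF this] obtain q where q: "ALL p:cover \<times> cover. fst (q p) >= 0 & ma (fst (q p)) (ctr (fst p)) (ctr (snd p)) < ereal (snd (q p))" by blast
 define rr where "rr = (SUM i:cover. snd (snd i))"
 define S where "S = 2 * rr + (SUM p:cover \<times> cover. abs (fst (q p)))"
 define D where "D = 2 * (B * rr + 1) + (SUM p:cover \<times> cover. abs (snd (q p)))"
 have finp: "finite (cover \<times> cover)" using finite_cover by simp
 have rr: "r <= rr" if "(c, a, r) : cover" for c a r
 proof -
  have "snd (snd (c, a, r)) <= rr" unfolding rr_def
  by(rule member_le_sum[OF that]) (use coverD(2) finite_cover in "auto intro: less_imp_le")
  thus ?thesis by simp
 qed
 show ?thesis
 proof (rule that[of S D])
  fix y z
  obtain c1 a1 r1 y1 where c1: "(c1, a1, r1) : cover" "y1 : ball a1 r1" "y = cinv c1 y1" by(rule coverE)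
  obtain c2 a2 r2 y2 where c2: "(c2, a2, r2) : cover" "y2 : ball a2 r2" "z = cinv c2 y2" by(rule coverE)
  let ?p = "((c1, a1, r1), (c2, a2, r2))"
  have p: "?p : cover \<times> cover" using c1 c2 by simp
  have a1: "a1 : ball a1 r1" "a2 : ball a2 r2" using coverD(2)[OF c1(1)] coverD(2)[OF c2(1)] by auto
  have d1: "dist y1 a1 <= rr" "dist a2 y2 <= rr" using c1(2) c2(2) rr[OF c1(1)] rr[OF c2(1)] by(auto simp: dist_commute)
  have Bd: "B * dist y1 a1 < B * rr + 1" "B * dist a2 y2 < B * rr + 1"
  proof -
  have "B * dist y1 a1 <= B * rr" "B * dist a2 y2 <= B * rr" using d1 B(1) by simp_all
  thus "B * dist y1 a1 < B * rr + 1" "B * dist a2 y2 < B * rr + 1" by linarith+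
  qed
  have m1: "ma (dist y1 a1) y (ctr (c1, a1, r1)) < ereal (B * rr + 1)" unfolding c1(3) ctr_def fst_conv snd_conv by(rule B(2)[OF c1(1,2) a1(1) Bd(1)])
  have m3: "ma (dist a2 y2) (ctr (c2, a2, r2)) z < ereal (B * rr + 1)" unfolding c2(3) ctr_def fst_conv snd_conv by(rule B(2)[OF c2(1) a1(2) c2(2) Bd(2)])
  have m2: "fst (q ?p) >= 0" "ma (fst (q ?p)) (ctr (c1, a1, r1)) (ctr (c2, a2, r2)) < ereal (snd (q ?p))" using q p by force+
  have "ma (dist y1 a1 + (fst (q ?p) + dist a2 y2)) y z < ereal ((B * rr + 1) + (snd (q ?p) + (B * rr + 1)))"
  by(rule ma_triangle[OF _ _ m1 ma_triangle[OF m2(1) _ m2(2) m3]]) (use m2(1) in auto)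
  also have "... <= ereal D"
  proof -
  have "abs (snd (q ?p)) <= (SUM p:cover \<times> cover. abs (snd (q p)))" by(rule member_le_sum[OF p]) (use finp in auto)
  thus ?thesis by(simp add: D_def)
  qed
  finally have "ma (dist y1 a1 + (fst (q ?p) + dist a2 y2)) y z < ereal D" .
  moreover have "abs (fst (q ?p)) <= (SUM p:cover \<times> cover. abs (fst (q p)))" by(rule member_le_sum[OF p]) (use finp in auto)
  hence "dist y1 a1 + (fst (q ?p) + dist a2 y2) <= S" using d1 by(simp add: S_def)
  moreover have "0 <= dist y1 a1 + (fst (q ?p) + dist a2 y2)" using m2(1) by simp
  ultimately show "EX s. 0 <= s & s <= S & ma s y z < ereal D" by blast
 qed
qed

lemma hl_step_tame:
 assumes "hl_step R f k u eps tau i y w"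
 shows "tame R (cinv (fst i) y) (Tg (fst i) y w)"
  "u (cinv (fst i) (y - tau *\<^sub>R w)) + tau * (L (cinv (fst i) y) (Tg (fst i) y w) (f (cinv (fst i) y)) + k (cinv (fst i) y) - eps) <= u (cinv (fst i) y)"
proof -
 obtain c a r where i: "i = (c, a, r)" by(cases i)
 have 1: "(c, a, r) : cover" "y : ball a r" "norm w <= R" and 2: "u (cinv c (y - tau *\<^sub>R w)) + tau * (Lc c y w (f (cinv c y)) + k (cinv c y) - eps) <= u (cinv c y)"
  using assms unfolding hl_step_def i prod.case by blast+
 show "tame R (cinv (fst i) y) (Tg (fst i) y w)" unfolding tame_def i fst_conv using 1 by blast
 show "u (cinv (fst i) (y - tau *\<^sub>R w)) + tau * (L (cinv (fst i) y) (Tg (fst i) y w) (f (cinv (fst i) y)) + k (cinv (fst i) y) - eps) <= u (cinv (fst i) y)"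
  unfolding i fst_conv by(rule 2)
qed

text \<open>A step is selected once for every point and then iterated. As steps run backwards,
  concatenation gives curves from \<open>X j\<close> to the initial point \<open>x\<close>. The
  slack \<open>b\<close> stems from the strict inequality for the constant curve of duration
  0.\<close>

lemma hl_chain:
 assumes ex: "!!x. EX i y w. hl_step R f k u eps tau i y w & x = cinv (fst i) y" and tau: "tau > 0"
 obtains X I Y W where "X 0 = x" "!!j. hl_step R f k u eps tau (I j) (Y j) (W j)" "!!j. X j = cinv (fst (I j)) (Y j)"
  "!!j. X (Suc j) = cinv (fst (I j)) (Y j - tau *\<^sub>R W j)"
  "!!j b. b > 0 ==> ma (real j * tau) (X j) x < ereal (b + (SUM n<j. tau * (L (X n) (Tg (fst (I n)) (Y n) (W n)) 0 + eps)))"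
proof -
 have "ALL x. EX q. hl_step R f k u eps tau (fst q) (fst (snd q)) (snd (snd q)) & x = cinv (fst (fst q)) (fst (snd q))"
 proof
  fix x
  obtain i y w where "hl_step R f k u eps tau i y w & x = cinv (fst i) y" using ex by blast
  thus "EX q. hl_step R f k u eps tau (fst q) (fst (snd q)) (snd (snd q)) & x = cinv (fst (fst q)) (fst (snd q))" by(intro exI[of _ "(i, y, w)"]) simp
 qed
 from choice[OF this] obtain q where "ALL x. hl_step R f k u eps tau (fst (q x)) (fst (snd (q x))) (snd (snd (q x))) & x = cinv (fst (fst (q x))) (fst (snd (q x)))" by blast
 hence q: "hl_step R f k u eps tau (fst (q x)) (fst (snd (q x))) (snd (snd (q x)))" "x = cinv (fst (fst (q x))) (fst (snd (q x)))" for x by blast+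
 define X where "X = rec_nat x (%_ z. cinv (fst (fst (q z))) (fst (snd (q z)) - tau *\<^sub>R snd (snd (q z))))"
 have X0: "X 0 = x" and XS: "X (Suc j) = cinv (fst (fst (q (X j)))) (fst (snd (q (X j))) - tau *\<^sub>R snd (snd (q (X j))))" for j by(simp_all add: X_def)
 define I where "I j = fst (q (X j))" for j
 define Y where "Y j = fst (snd (q (X j)))" for j
 define W where "W j = snd (snd (q (X j)))" for j
 have st: "hl_step R f k u eps tau (I j) (Y j) (W j)" "X j = cinv (fst (I j)) (Y j)" for j unfolding I_def Y_def W_def by(rule q)+
 have XS': "X (Suc j) = cinv (fst (I j)) (Y j - tau *\<^sub>R W j)" for j unfolding XS I_def Y_def W_def ..
 have "ma (real j * tau) (X j) x < ereal (b + (SUM n<j. tau * (L (X n) (Tg (fst (I n)) (Y n) (W n)) 0 + eps)))" if b: "b > 0" for j b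
 proof (induction j)
  case 0
  thus ?case using ma_refl[OF b, of x] by(simp add: X0)
 next
  case (Suc j)
  obtain c a r where car: "I j = (c, a, r)" by(cases "I j")
  have "ma tau (X (Suc j)) (X j) < ereal (tau * (L (X j) (Tg (fst (I j)) (Y j) (W j)) 0 + eps))"
  using st(1)[of j] unfolding XS' st(2)[of j] hl_step_def car by simp
  from ma_triangle[OF _ _ this Suc] tau show ?case by(simp add: algebra_simps)
 qed
 with X0 st XS' show ?thesis by(rule that)
qed

end

section \<open>Finiteness, continuity and uniformity of the Peierls barrier\<close>

context vanishing_discount
begin

text \<open>The real-valued form of \<open>h_t(y, x) + c0 * t < a\<close>. Statements about the
  lower limit as \<open>t\<close> grows become statements about arbitrarily large or all large
  \<open>t\<close>.\<close>

definition reach :: "'m => real => 'm => real => bool" where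
 "reach x t y a \<longleftrightarrow> t >= 0 & ma t y x < ereal (a - c0 * t)"

lemma reach_concat:
 assumes "reach x t y a" "s >= 0" "ma s z y < ereal b"
 shows "reach x (s + t) z (a + b + c0 * s)"
 using ma_triangle[OF assms(2) _ assms(3), of t x "a - c0 * t"] assms(1,2) unfolding reach_def by(simp add: algebra_simps)

lemma reach_mono: "reach x t y a ==> a <= a' ==> reach x t y a'"
 unfolding reach_def by(auto elim: order.strict_trans2)

lemma reach_lower: "reach x t y a ==> u0 x - u0 y <= a"
 using u0_dominated[of t y x "a - c0 * t"] unfolding reach_def by simp

abbreviation "dstep R l == hl_step R (%x. l * u l x) (%x. c0 - l * V x l) (u l)"

abbreviation "dsteps R l eps == (EX tau0>0. ALL tau x. 0 < tau --> tau < tau0 --> (EX i y w. dstep R l eps tau i y w & x = cinv (fst i) y))"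

lemma discounted_step:
 obtains R l1 where "R > 0" "l1 > 0" "l1 <= l0" "!!l eps. 0 < l ==> l < l1 ==> eps > 0 ==>
  dsteps R l eps"
proof -
 obtain U l1 where U: "U >= 1" "l1 > 0" "l1 <= l0" "l1 * U <= 1" "l1 <= 1" "!!l x. 0 < l ==> l < l1 ==> abs (u l x) <= U"
  "!!l x. 0 < l ==> l < l1 ==> abs (V x l) <= U" by(rule uniform_bounds) blast
 obtain R where R: "R > 0" "!!f k u eps. frozen_sub f k u ==> frozen_super f k u ==> continuous_on UNIV u ==> continuous_on UNIV f ==>
  continuous_on UNIV k ==> (!!x. abs (f x) <= 1) ==> (!!x. abs (k x) <= abs c0 + 1) ==> eps > 0 ==>
  hl_steps R f k u eps"
  by(rule hopf_lax_manifold[of "abs c0 + 1"]) blast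
 show ?thesis
 proof (rule that[OF R(1) U(2,3)])
  fix l eps :: real assume l: "0 < l" "l < l1" and e: "eps > 0"
  have l': "l : {0<..l0}" using l U by auto
  have lU: "l * U <= 1" using mult_right_mono[of l l1 U] l U by linarith
  have su: "abs (l * u l x) <= 1" and sV: "abs (l * V x l) <= 1" for x
  proof -
  have "l * abs (u l x) <= l * U" "l * abs (V x l) <= l * U" using U(6)[OF l, of x] U(7)[OF l, of x] l by simp_all
  hence "l * abs (u l x) <= 1" "l * abs (V x l) <= 1" using lU by linarith+
  thus "abs (l * u l x) <= 1" "abs (l * V x l) <= 1" using l by(simp_all add: abs_mult)
  qed
  have sk: "abs (c0 - l * V x l) <= abs c0 + 1" for x using sV[of x] by linarith
  show "dsteps R l eps"
  by(rule R(2)[OF u_frozen[OF l'] u_cont[OF l'] _ _ su sk e]) (use u_cont[OF l'] V_cont[OF l(1)] in "auto intro!: continuous_intros")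
 qed
qed

text \<open>Needed to bound the barrier from above. For each duration a discount small relative to
  it is chosen; the discounted chain then has normalised action bounded by the oscillation of
  \<open>u l\<close> plus a constant independent of the duration.\<close>

lemma long_curves:
 obtains M where "!!T. EX t>=T. EX y. reach x t y M"
proof -
 obtain U l1 where U: "U >= 1" "l1 > 0" "l1 <= l0" "l1 * U <= 1" "l1 <= 1" "!!l x. 0 < l ==> l < l1 ==> abs (u l x) <= U"
  "!!l x. 0 < l ==> l < l1 ==> abs (V x l) <= U" by(rule uniform_bounds) blast
 obtain R l2 where R: "R > 0" "l2 > 0" "l2 <= l0" "!!l eps. 0 < l ==> l < l2 ==> eps > 0 ==>
  dsteps R l eps"
  by(rule discounted_step) blast
 obtain B where B: "B > 0" "!!x v s. tame R x v ==> abs s <= 1 ==> abs (L x v s) <= B" "!!x v. tame R x v ==> abs (dL x v) <= B" by(rule tame_bounded[of R]) blast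
 obtain dlt where d: "dlt > 0" "PROP tame_C1 R dlt 1" by(rule tame_deriv[of 1 R]) auto
 show ?thesis
 proof (rule that[of "2 * U + 3"])
  fix T :: real
  define T' where "T' = abs T + 1"
  have T': "T' >= 1" by(simp add: T'_def)
  \<comment> \<open>\<open>l * Z < 1\<close> and \<open>2 * e * T' = 1\<close> keep the discount and
    the step errors, accumulated over the whole duration, below 2. With \<open>2 * U\<close> from
    the values of \<open>u l\<close> and 1 from strictness this gives
    \<open>2 * U + 3\<close>.\<close>
  define Z where "Z = U * (B + 2) * T'"
  have Z: "Z > 0" using U B T' by(simp add: Z_def)
  define q where "q = min (min l1 l2) (min (dlt / U) (1 / Z))"
  have q: "0 < q" "q <= l1" "q <= l2" "q <= dlt / U" "q <= 1 / Z" using U(1,2) R(2) d(1) Z by(auto simp: q_def min_le_iff_disj)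
  define l where "l = q / 2"
  have l: "0 < l" "l < l1" "l < l2" "l < dlt / U" "l < 1 / Z" using q unfolding l_def by linarith+
  have lU: "l * U < dlt" "l * Z < 1" using l(4,5) U(1) Z by(auto simp: pos_less_divide_eq)
  define e where "e = 1 / (2 * T')"
  have e: "e > 0" "2 * e * T' = 1" using T' by(auto simp: e_def)
  obtain tau0 where tau0: "tau0 > 0" "ALL tau x. 0 < tau --> tau < tau0 --> (EX i y w. dstep R l e tau i y w & x = cinv (fst i) y)"
  using R(4)[OF l(1,3) e(1)] by blast
  define tau where "tau = min 1 tau0 / 2"
  have tau: "0 < tau" "tau < 1" "tau < tau0" using tau0(1) by(auto simp: tau_def min_def)
  have step: "EX i y w. dstep R l e tau i y w & z = cinv (fst i) y" for z
  using tau0(2) tau by blast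
  obtain X I Y W where X: "X 0 = x" "!!j. dstep R l e tau (I j) (Y j) (W j)" "!!j. X j = cinv (fst (I j)) (Y j)"
  "!!j. X (Suc j) = cinv (fst (I j)) (Y j - tau *\<^sub>R W j)"
  "!!j b. b > 0 ==> ma (real j * tau) (X j) x < ereal (b + (SUM n<j. tau * (L (X n) (Tg (fst (I n)) (Y n) (W n)) 0 + e)))"
  by(rule hl_chain[OF step tau(1), of x]) blast
  define v where "v j = Tg (fst (I j)) (Y j) (W j)" for j
  have tm: "tame R (X j) (v j)" for j unfolding X(3) v_def by(rule hl_step_tame(1)[OF X(2)])
  have one: "tau * (L (X j) (v j) 0 + e) <= u l (X j) - u l (X (Suc j)) + tau * (l * U * (B + 2) + 2 * e - c0)" for j
  proof -
  let ?s = "l * u l (X j)"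
  have s: "abs ?s <= l * U" using mult_left_mono[OF U(6)[OF l(1,2), of "X j"], of l] l by(simp add: abs_mult)
  have 1: "u l (X (Suc j)) + tau * (L (X j) (v j) ?s + (c0 - l * V (X j) l) - e) <= u l (X j)"
  using hl_step_tame(2)[OF X(2)[of j]] unfolding X(4)[symmetric] X(3)[symmetric] v_def by simp
  have "abs (L (X j) (v j) ?s - L (X j) (v j) 0 - ?s * dL (X j) (v j)) <= 1 * abs ?s" by(rule d(2)[OF tm]) (use s lU in linarith)
  moreover have "abs (?s * dL (X j) (v j)) <= (l * U) * B" unfolding abs_mult[of ?s] by(rule mult_mono[OF s B(3)[OF tm]]) (use l U in auto)
  ultimately have "L (X j) (v j) 0 <= L (X j) (v j) ?s + l * U * B + l * U" using s by linarith
  moreover have "l * V (X j) l <= l * U" using mult_left_mono[OF U(7)[OF l(1,2), of "X j"], of l] l by(simp add: abs_mult abs_le_iff)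
  ultimately have "L (X j) (v j) 0 + e <= (L (X j) (v j) ?s + (c0 - l * V (X j) l) - e) + (l * U * (B + 2) + 2 * e - c0)" by(simp add: algebra_simps)
  hence "tau * (L (X j) (v j) 0 + e) <= tau * ((L (X j) (v j) ?s + (c0 - l * V (X j) l) - e) + (l * U * (B + 2) + 2 * e - c0))" using tau by(intro mult_left_mono) auto
  thus ?thesis using 1 unfolding distrib_left[of tau _ "_ - c0"] by linarith
  qed
  have sum: "(SUM n<j. tau * (L (X n) (v n) 0 + e)) <= u l (X 0) - u l (X j) + real j * tau * (l * U * (B + 2) + 2 * e - c0)" for j
  proof (induction j)
  case (Suc j)
  thus ?case using one[of j] by(simp add: algebra_simps)
  qed simp
  \<comment> \<open>Then \<open>j * tau\<close> lies between \<open>T' - tau\<close> and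
    \<open>T'\<close>; the first is at least \<open>T\<close> because \<open>tau < 1\<close> and
    \<open>T' = abs T + 1\<close>.\<close>
  define j where "j = nat (\<lceil>T' / tau\<rceil> - 1)"
  have "T' / tau > 1" using T' tau by(simp add: pos_less_divide_eq)
  hence "\<lceil>T' / tau\<rceil> >= 2" by linarith
  hence "real j = real_of_int \<lceil>T' / tau\<rceil> - 1" unfolding j_def by simp
  hence "real j <= T' / tau" "T' / tau - 1 <= real j" by linarith+
  hence jt: "real j * tau <= T'" "T' - tau <= real j * tau" using tau(1) by(auto simp: field_simps)
  have "real j * tau * (l * U * (B + 2) + 2 * e) <= T' * (l * U * (B + 2) + 2 * e)"
  by(rule mult_right_mono[OF jt(1)]) (use l U B e in auto)
  also have "... = l * Z + 2 * e * T'" by(simp add: Z_def algebra_simps)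
  also have "... <= 2" using lU(2) e(2) by linarith
  finally have "real j * tau * (l * U * (B + 2) + 2 * e) <= 2" .
  moreover have "abs (u l (X 0)) <= U" "abs (u l (X j)) <= U" using U(6)[OF l(1,2)] by auto
  ultimately have "1 + (SUM n<j. tau * (L (X n) (v n) 0 + e)) <= 2 * U + 3 - c0 * (real j * tau)" using sum[of j] by(simp add: algebra_simps abs_le_iff)
  moreover have "ma (real j * tau) (X j) x < ereal (1 + (SUM n<j. tau * (L (X n) (v n) 0 + e)))" unfolding v_def by(rule X(5)) simp
  ultimately have "ma (real j * tau) (X j) x < ereal (2 * U + 3 - c0 * (real j * tau))" by(meson ereal_less_eq(3) order.strict_trans2)
  hence "reach x (real j * tau) (X j) (2 * U + 3)" unfolding reach_def using tau by simp
  moreover have "T <= real j * tau" using jt(2) tau(2) unfolding T'_def by linarith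
  ultimately show "EX t>=T. EX y. reach x t y (2 * U + 3)" by blast
 qed
qed

lemma reach_frequently:
 obtains M where "!!y T. EX t>=T. reach x t y M"
proof -
 obtain M where M: "!!T. EX t>=T. EX y. reach x t y M" by(rule long_curves[of x]) blast
 obtain S D where SD: "!!y z. EX s. 0 <= s & s <= S & ma s y z < ereal D" by(rule connecting_curves) blast
 show ?thesis
 proof (rule that[of "M + D + abs c0 * S"])
  fix y T
  obtain t z where t: "t >= T" "reach x t z M" using M[of T] by blast
  obtain s where s: "0 <= s" "s <= S" "ma s y z < ereal D" using SD by blast
  have le: "c0 * s <= abs c0 * S" using s by(intro mult_mono) auto
  have "reach x (s + t) y (M + D + abs c0 * S)" by(rule reach_mono[OF reach_concat[OF t(2) s(1,3)]]) (use le in simp)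
  moreover have "s + t >= T" using s t by linarith
  ultimately show "EX t>=T. reach x t y (M + D + abs c0 * S)" by blast
 qed
qed

abbreviation h :: "'m => 'm => real" where "h == peierls_barrier A H"

text \<open>The barrier is the real part of an extended lower limit, so finiteness has to come
  first: curves of bounded normalised action at arbitrarily large times bound it above, domination
  by \<open>u0\<close> bounds it below.\<close>

lemma peierls_props:
 shows peierls_frequently: "a > h y x ==> EX t>=T. reach x t y a"
  and peierls_eventually: "a < h y x ==> EX T. ALL t>=T. ~ reach x t y a"
  and peierls_ge: "u0 x - u0 y <= h y x"
proof -
 let ?F = "%t. ma t y x + ereal (c0 * t)"
 have iff: "?F t < ereal a \<longleftrightarrow> reach x t y a" if "t >= 0" for t a
  unfolding reach_def using that by(cases "ma t y x") auto
 obtain M where M: "!!y T. EX t>=T. reach x t y M" by(rule reach_frequently[of x]) blast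
 have up: "Liminf at_top ?F <= ereal M"
 proof (rule ccontr)
  assume "~ ?thesis"
  hence "ereal M < Liminf at_top ?F" by simp
  hence "eventually (%t. ereal M < ?F t) at_top" using le_Liminf_iff[of "Liminf at_top ?F" at_top ?F] by blast
  then obtain T where T: "!!t. t >= T ==> ereal M < ?F t" unfolding eventually_at_top_linorder by blast
  obtain t where t: "t >= T" "reach x t y M" using M by blast
  hence "?F t < ereal M" using iff[of t M] by(simp add: reach_def)
  thus False using T[OF t(1)] by(metis less_asym)
 qed
 have lo: "ereal (u0 x - u0 y) <= Liminf at_top ?F"
 proof (rule Liminf_bounded)
  have "ereal (u0 x - u0 y) <= ?F t" if t: "t >= 0" for t
  proof (rule ccontr)
  assume "~ ?thesis"
  hence "?F t < ereal (u0 x - u0 y)" by simp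
  from ereal_dense2[OF this] obtain a where a: "?F t < ereal a" "ereal a < ereal (u0 x - u0 y)" by blast
  thus False using iff[OF t, of a] reach_lower[of x t y a] by simp
  qed
  thus "eventually (%t. ereal (u0 x - u0 y) <= ?F t) at_top" using eventually_ge_at_top[of 0] by(rule eventually_mono[rotated]) blast
 qed
 have "abs (Liminf at_top ?F) ~= \<infinity>" using up lo by(cases "Liminf at_top ?F") auto
 hence eq: "Liminf at_top ?F = ereal (h y x)" unfolding peierls_barrier_def by(simp add: ereal_real)
 show "u0 x - u0 y <= h y x" using lo unfolding eq by simp
 show "EX t>=T. reach x t y a" if a: "a > h y x"
 proof (rule ccontr)
  assume no: "~ ?thesis"
  have "eventually (%t. ereal a <= ?F t) at_top"
  proof (rule eventually_mono[OF eventually_ge_at_top[of "max T 0"]])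
  fix t assume "max T 0 <= t"
  thus "ereal a <= ?F t" using no iff[of t a] by(auto simp: not_less)
  qed
  hence "ereal a <= ereal (h y x)" unfolding eq[symmetric] by(rule Liminf_bounded)
  thus False using a by simp
 qed
 show "EX T. ALL t>=T. ~ reach x t y a" if a: "a < h y x"
 proof -
  have "ereal a < Liminf at_top ?F" unfolding eq using a by simp
  hence "eventually (%t. ereal a < ?F t) at_top" using le_Liminf_iff[of "Liminf at_top ?F" at_top ?F] by blast
  then obtain T where T: "!!t. t >= T ==> ereal a < ?F t" unfolding eventually_at_top_linorder by blast
  have "~ reach x t y a" if "t >= T" for t
  proof
  assume r: "reach x t y a"
  hence "?F t < ereal a" using iff[of t a] by(simp add: reach_def)
  thus False using T[OF that] by(metis less_asym)
  qed
  thus ?thesis by blast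
 qed
qed

text \<open>Prepending the unit-speed segment from \<open>y1\<close> to \<open>y2\<close> costs a
  multiple of its length. The change of duration is invisible to a lower limit at infinity.\<close>

lemma peierls_local_Lipschitz:
 obtains K where "K > 0" "!!c a r y1 y2 x b t. (c, a, r) : cover ==> y1 : ball a r ==> y2 : ball a r ==> reach x t (cinv c y2) b ==> e > 0
  ==> reach x (dist y1 y2 + t) (cinv c y1) (b + K * dist y1 y2 + e)"
  "!!c a r y1 y2 x. (c, a, r) : cover ==> y1 : ball a r ==> y2 : ball a r ==> abs (h (cinv c y1) x - h (cinv c y2) x) <= K * dist y1 y2"
proof -
 obtain B where B: "B > 0" "PROP seg_bound B" by(rule short_segment) blast
 define K where "K = B + abs c0"
 have r: "reach x (dist y1 y2 + t) (cinv c y1) (b + K * dist y1 y2 + e)"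
  if i: "(c, a, r) : cover" "y1 : ball a r" "y2 : ball a r" and re: "reach x t (cinv c y2) b" and e: "e > 0" for c a r y1 y2 x b t e
 proof -
  have "ma (dist y1 y2) (cinv c y1) (cinv c y2) < ereal (B * dist y1 y2 + e)" by(rule B(2)[OF i]) (use e in simp)
  from reach_concat[OF re zero_le_dist this]
  have "reach x (dist y1 y2 + t) (cinv c y1) (b + (B * dist y1 y2 + e) + c0 * dist y1 y2)" .
  moreover have "c0 * dist y1 y2 <= abs c0 * dist y1 y2" by(intro mult_right_mono) auto
  ultimately show ?thesis by(elim reach_mono) (simp add: K_def algebra_simps)
 qed
 have one: "h (cinv c y1) x <= h (cinv c y2) x + K * dist y1 y2" if i: "(c, a, r) : cover" "y1 : ball a r" "y2 : ball a r" for c a r y1 y2 x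
 proof (rule field_le_epsilon)
  fix e :: real assume e: "e > 0"
  show "h (cinv c y1) x <= h (cinv c y2) x + K * dist y1 y2 + e"
  proof (rule ccontr)
  assume "~ ?thesis"
  hence "h (cinv c y2) x + K * dist y1 y2 + e < h (cinv c y1) x" by simp
  then obtain T where T: "!!t. t >= T ==> ~ reach x t (cinv c y1) (h (cinv c y2) x + K * dist y1 y2 + e)" using peierls_eventually by blast
  obtain t where t: "t >= T" "reach x t (cinv c y2) (h (cinv c y2) x + e/2)" using peierls_frequently[of "cinv c y2" x "h (cinv c y2) x + e/2" T] e by auto
  have "reach x (dist y1 y2 + t) (cinv c y1) (h (cinv c y2) x + e/2 + K * dist y1 y2 + e/2)" by(rule r[OF i t(2)]) (use e in simp)
  moreover have "dist y1 y2 + t >= T" using t(1) zero_le_dist[of y1 y2] by linarith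
  ultimately show False using T[of "dist y1 y2 + t"] by(simp add: algebra_simps)
  qed
 qed
 show ?thesis
 proof (rule that[of K])
  show "K > 0" using B by(simp add: K_def)
  show "abs (h (cinv c y1) x - h (cinv c y2) x) <= K * dist y1 y2" if "(c, a, r) : cover" "y1 : ball a r" "y2 : ball a r" for c a r y1 y2 x
  using one[OF that, of x] one[OF that(1,3,2), of x] unfolding dist_commute[of y2 y1] by linarith
 qed (rule r)
qed

text \<open>The time \<open>T\<close> found at \<open>z\<close> serves all nearby points: a cheap
  long curve from such a point, preceded by a short segment from \<open>z\<close>, would be a cheap
  long curve from \<open>z\<close>.\<close>

lemma peierls_neighbourhood:
 assumes e: "eps > 0"
 shows "EX N. open N & z : N & (EX T. ALL y:N. abs (h y x - h z x) <= eps & (ALL t>=T. ~ reach x t y (h y x - eps)))"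
proof -
 obtain K where K: "K > 0" "!!c a r y1 y2 x b t. (c, a, r) : cover ==> y1 : ball a r ==> y2 : ball a r ==> reach x t (cinv c y2) b ==> eps/4 > 0
  ==> reach x (dist y1 y2 + t) (cinv c y1) (b + K * dist y1 y2 + eps/4)"
  "!!c a r y1 y2 x. (c, a, r) : cover ==> y1 : ball a r ==> y2 : ball a r ==> abs (h (cinv c y1) x - h (cinv c y2) x) <= K * dist y1 y2"
  by(rule peierls_local_Lipschitz[of "eps/4"]) blast
 have e4: "eps/4 > 0" using e by simp
 obtain c a r y where c: "(c, a, r) : cover" "y : ball a r" "z = cinv c y" by(rule coverE)
 obtain T where T: "ALL t>=T. ~ reach x t z (h z x - eps/4)" using peierls_eventually[of "h z x - eps/4" z x] e by auto
 define S where "S = ball a r Int ball y (eps / (4 * K))"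
 have S: "open S" "S <= img c" "y : S" using cover_cball[OF c(1)] c(2) e K(1) by(auto simp: S_def)
 have "open (cinv c ` S)" by(rule open_chart_inv_image[OF coverD(1)[OF c(1)] S(1,2)])
 moreover have loc: "abs (h (cinv c y') x - h z x) <= eps & (ALL t>=T. ~ reach x t (cinv c y') (h (cinv c y') x - eps))" if y': "y' : S" for y'
 proof -
  have y'b: "y' : ball a r" "dist y y' < eps / (4 * K)" using y' by(auto simp: S_def)
  hence d: "K * dist y y' <= eps/4" using K(1) by(simp add: field_simps)
  have 1: "abs (h (cinv c y') x - h z x) <= eps/4" using K(3)[OF c(1) y'b(1) c(2), of x] d unfolding c(3) by(simp add: dist_commute)
  moreover have "~ reach x t (cinv c y') (h (cinv c y') x - eps)" if t: "t >= T" for t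
  proof
  assume "reach x t (cinv c y') (h (cinv c y') x - eps)"
  from K(2)[OF c(1,2) y'b(1) this e4] have "reach x (dist y y' + t) z (h (cinv c y') x - eps + K * dist y y' + eps/4)" unfolding c(3) .
  hence "reach x (dist y y' + t) z (h z x - eps/4)" by(rule reach_mono) (use 1 d in linarith)
  moreover have "dist y y' + t >= T" using t zero_le_dist[of y y'] by linarith
  ultimately show False using T by blast
  qed
  moreover have "abs (h (cinv c y') x - h z x) <= eps" using 1 e by linarith
  ultimately show ?thesis by blast
 qed
 moreover have "z : cinv c ` S" using S(3) c(3) by blast
 ultimately show ?thesis by(intro exI[of _ "cinv c ` S"] conjI exI[of _ T]) blast+
qed

lemma peierls_continuous: "continuous_on UNIV (%y. h y x)"
proof -
 have "isCont (%y. h y x) z" for z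
  unfolding continuous_at tendsto_iff
 proof (intro allI impI)
  fix e :: real assume "e > 0"
  hence e2: "e/2 > 0" by simp
  obtain N where "open N" "z : N" "ALL y:N. abs (h y x - h z x) <= e/2" using peierls_neighbourhood[OF e2, of z x] by blast
  hence "eventually (%y. abs (h y x - h z x) <= e/2) (nhds z)" unfolding eventually_nhds by blast
  hence "eventually (%y. dist (h y x) (h z x) < e) (nhds z)" by eventually_elim (use \<open>e > 0\<close> in "simp add: dist_real_def")
  thus "eventually (%y. dist (h y x) (h z x) < e) (at z)" unfolding eventually_at_filter by eventually_elim simp
 qed
 thus ?thesis by(simp add: continuous_on_eq_continuous_at)
qed

text \<open>The points visited by a chain are not under control, so the time after which the action
  exceeds \<open>h - eps\<close> must be uniform in the starting point; compactness provides
  this.\<close>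

lemma peierls_uniform_liminf:
 assumes e: "eps > 0"
 obtains T where "!!t y a. t >= T ==> reach x t y a ==> h y x - eps < a"
proof -
 have "ALL z. EX q. open (fst q) & z : fst q & (ALL y:fst q. ALL t>=snd q. ~ reach x t y (h y x - eps))"
 proof
  fix z
  obtain N T where "open N" "z : N" "ALL y:N. ALL t>=T. ~ reach x t y (h y x - eps)" using peierls_neighbourhood[OF e, of z x] by blast
  thus "EX q. open (fst q) & z : fst q & (ALL y:fst q. ALL t>=snd q. ~ reach x t y (h y x - eps))" by(intro exI[of _ "(N, T)"]) simp
 qed
 from choice[OF this] obtain q where q: "ALL z. open (fst (q z)) & z : fst (q z) & (ALL y:fst (q z). ALL t>=snd (q z). ~ reach x t y (h y x - eps))" by blast
 obtain Z where Z: "finite Z" "UNIV <= (UN z:Z. fst (q z))"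
  by(rule compactE_image[OF compactM, of UNIV "%z. fst (q z)"]) (use q in auto)
 define T where "T = (SUM z:Z. abs (snd (q z)))"
 show ?thesis
 proof (rule that[of T], rule ccontr)
  fix t y a assume t: "t >= T" and r: "reach x t y a" and no: "~ h y x - eps < a"
  obtain z where z: "z : Z" "y : fst (q z)" using Z(2) by blast
  have "abs (snd (q z)) <= T" unfolding T_def by(rule member_le_sum[OF z(1)]) (use Z in auto)
  hence "~ reach x t y (h y x - eps)" using q z(2) t by fastforce
  thus False using reach_mono[OF r] no by simp
 qed
qed

end

section \<open>Discounted weights and approximate Mather measures\<close>

text \<open>Summation by parts moves the differences onto the decreasing weights, whose total
  variation is at most 1. The bound is independent of the number of steps and of the
  discount.\<close>

lemma abel_bound:
 fixes E f :: "nat => real"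
 assumes E: "!!j. E (Suc j) <= E j" "!!j. E j >= 0" "E 0 = 1" and f: "!!j. abs (f j) <= F"
 shows "abs (SUM j<N. E (Suc j) * (f j - f (Suc j))) <= 2 * F"
proof -
 have eq: "(SUM j<N. E (Suc j) * (f j - f (Suc j))) = f 0 - E N * f N - (SUM j<N. (E j - E (Suc j)) * f j)"
  by(induction N) (auto simp: E(3) algebra_simps)
 have "abs (SUM j<N. (E j - E (Suc j)) * f j) <= (SUM j<N. (E j - E (Suc j)) * F)"
 proof (rule order_trans[OF sum_abs], rule sum_mono)
  fix j
  show "abs ((E j - E (Suc j)) * f j) <= (E j - E (Suc j)) * F" unfolding abs_mult using E(1)[of j] f[of j] by(simp add: mult_left_mono)
 qed
 also have "... = (1 - E N) * F" by(induction N) (auto simp: E(3) algebra_simps)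
 finally have 1: "abs (SUM j<N. (E j - E (Suc j)) * f j) <= (1 - E N) * F" .
 have 2: "abs (E N * f N) <= E N * F" unfolding abs_mult using E(2)[of N] f[of N] by(simp add: mult_left_mono)
 show ?thesis unfolding eq using 1 2 f[of 0] by(simp add: algebra_simps)
qed

text \<open>\<open>E\<close> is the discrete counterpart of the exponential of minus the integral of
  \<open>tht * a\<close>. The lower bound \<open>alp\<close> forces geometric decay, so a finite
  chain exhausts almost all the mass.\<close>

lemma discount_weights:
 fixes a :: "nat => real"
 assumes a: "!!j. alp <= a j" and alp: "alp > 0" and tht: "tht > 0" and e: "e > 0"
 obtains E N where "E 0 = 1" "!!j. E j > 0" "!!j. E (Suc j) * (1 + tht * a j) = E j" "!!j. E (Suc j) <= E j" "E N < e"
proof -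
 define E where "E = rec_nat 1 (%j z. z / (1 + tht * a j))"
 have E0: "E 0 = 1" and ES: "E (Suc j) = E j / (1 + tht * a j)" for j by(simp_all add: E_def)
 have ge: "1 + tht * alp <= 1 + tht * a j" for j using a[of j] tht by simp
 have g1: "1 + tht * alp > 1" using alp tht by simp
 have pos: "E j > 0" for j
 proof (induction j)
  case (Suc j)
  thus ?case unfolding ES using ge[of j] g1 by simp
 qed (simp add: E0)
 have mul: "E (Suc j) * (1 + tht * a j) = E j" for j unfolding ES using ge[of j] g1 by simp
 have geom: "E j <= (1 / (1 + tht * alp)) ^ j" for j
 proof (induction j)
  case (Suc j)
  have "E (Suc j) <= E j / (1 + tht * alp)" unfolding ES using ge[of j] g1 pos[of j] by(intro divide_left_mono) auto
  also have "... <= (1 / (1 + tht * alp)) ^ j / (1 + tht * alp)" using Suc g1 by(intro divide_right_mono) auto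
  finally show ?case by(simp add: field_simps)
 qed (simp add: E0)
 have "(%n. (1 / (1 + tht * alp)) ^ n) ----> 0" using g1 by(intro LIMSEQ_power_zero) simp
 hence "eventually (%n. (1 / (1 + tht * alp)) ^ n < e) sequentially" using e by(rule order_tendstoD(2))
 then obtain N where N: "(1 / (1 + tht * alp)) ^ N < e" unfolding eventually_sequentially by blast
 show ?thesis
 proof (rule that[OF E0 pos mul])
  show "E (Suc j) <= E j" for j using mul[of j] pos[of "Suc j"] ge[of j] g1 mult_left_mono[of 1 "1 + tht * a j" "E (Suc j)"] by simp
  show "E N < e" using geom[of N] N by linarith
 qed
qed

lemma early_sum_le:
 fixes c tau T :: real
 assumes tau: "tau > 0" and T: "T >= 0" and c: "c >= 0"
 shows "(SUM j<N. if real j * tau < T then c else 0) <= c * (T / tau + 1)"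
proof -
 have sub: "{j : {..<N}. real j * tau < T} <= {..<nat \<lceil>T / tau\<rceil>}"
 proof
  fix j assume "j : {j : {..<N}. real j * tau < T}"
  hence "real j < T / tau" using tau by(simp add: pos_less_divide_eq)
  thus "j : {..<nat \<lceil>T / tau\<rceil>}" by(simp add: less_ceiling_iff zless_nat_eq_int_zless)
 qed
 have "(SUM j<N. if real j * tau < T then c else 0) = c * real (card {j : {..<N}. real j * tau < T})"
  by(simp add: sum.If_cases Int_def)
 also have "... <= c * real (nat \<lceil>T / tau\<rceil>)"
  using card_mono[OF _ sub] c by(intro mult_left_mono) auto
 also have "real (nat \<lceil>T / tau\<rceil>) = real_of_int \<lceil>T / tau\<rceil>" using T tau by(simp add: of_nat_nat)
 also have "c * real_of_int \<lceil>T / tau\<rceil> <= c * (T / tau + 1)" using c by(intro mult_left_mono) linarith+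
 finally show ?thesis .
qed

context hamiltonian
begin

abbreviation first_order :: "real => ('m => real) => real => real => bool" where
"first_order R phi tau om == (ALL i y w. i : cover --> y : ball (fst (snd i)) (snd (snd i)) --> norm w <= R --> closed_segment y (y - tau *\<^sub>R w) <= cball (fst (snd i)) (3 * snd (snd i)) --> abs (phi (cinv (fst i) y) - phi (cinv (fst i) (y - tau *\<^sub>R w)) - tau * df phi (cinv (fst i) y) (Tg (fst i) y w)) <= tau * om)"

lemma tame_dL_neg:
 obtains alp where "alp > 0" "!!x v. tame R x v ==> alp <= - dL x v"
proof -
 \<comment> \<open>Bounding \<open>- 1 / dL\<close> above by compactness is bounding
   \<open>- dL\<close> away from 0.\<close>
 obtain B where B: "B > 0" "!!c a r y w. (c, a, r) : cover ==> y : cball a (3 * r) ==> norm w <= R ==> - 1 / dLc c y w <= B"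
 proof (rule cover_bound[where Q = "%c y w. norm w <= R" and F = "%c y w. - 1 / dLc c y w"])
  fix c a r assume i: "(c, a, r) : cover"
  let ?Q = "cball a (3 * r) \<times> cball (0::'e) R"
  let ?f = "%x. dL (cinv c (fst x)) (Tg c (fst x) (snd x))"
  have cf: "continuous_on ?Q ?f"
  by(rule continuous_on_subset[OF tm_cont_dL[unfolded tm_cont_def, rule_format, OF coverD(1)[OF i]]]) (use cover_cball(1)[OF i] in auto)
  have "continuous_on ?Q (%x. - 1 / ?f x)" by(intro continuous_intros cf) (use dL_neg in "simp add: less_imp_neq")
  then obtain B where B: "!!x. x : ?Q ==> norm (- 1 / ?f x) <= B" by(rule compact_boundE[OF _ compact_Times[OF compact_cball compact_cball]]) blast
  have "- 1 / dLc c y w <= B" if "y : cball a (3 * r)" "norm w <= R" for y w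
  proof -
  have "norm (- 1 / dLc c y w) <= B" using B[of "(y, w)"] that by simp
  thus ?thesis unfolding real_norm_def by(rule order_trans[OF abs_ge_self])
  qed
  thus "EX B. ALL y:cball a (3 * r). ALL w. norm w <= R --> - 1 / dLc c y w <= B" by blast
 qed blast
 show ?thesis
 proof (rule that[of "1 / B"])
  show "1 / B > 0" using B by simp
  fix x v assume "tame R x v"
  then obtain c a r y w where c: "(c, a, r) : cover" "y : ball a r" "x = cinv c y" "v = Tg c y w" "norm w <= R" unfolding tame_def by blast
  have "- 1 / dL x v <= B" using B(2)[OF c(1) cover_cball(2)[OF c(1,2)] c(5)] unfolding c(3,4) .
  thus "1 / B <= - dL x v" using B(1) dL_neg[of x v] by(simp add: field_simps)
 qed
qed

lemma hl_stepD:
 assumes "hl_step R f k u eps tau i y w"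
 shows "i : cover" "y : ball (fst (snd i)) (snd (snd i))" "norm w <= R" "closed_segment y (y - tau *\<^sub>R w) <= cball (fst (snd i)) (3 * snd (snd i))"
 using assms unfolding hl_step_def by(cases i, simp)+

end

context vanishing_discount
begin

text \<open>A finitely supported approximate Mather measure: closed up to
  \<open>K * e * Phi + om\<close>, where \<open>om\<close> is the first-order remainder of the test
  function over one step; of action at most \<open>- c0 + K * e\<close>; and satisfying up to
  \<open>K * e\<close> the inequality that the limit measure has to attain.\<close>

definition good_weights :: "'m => real => real => real => nat => (nat => real) => (nat => ('m, 'e) chart \<times> 'e \<times> real) => (nat => 'e) => (nat => 'e) => real => bool" where
 "good_weights x R K e N p I Y W tau \<longleftrightarrow> 0 < tau & tau <= e &
  (ALL k<N. p k >= 0 & I k : cover & Y k : ball (fst (snd (I k))) (snd (snd (I k))) & norm (W k) <= R) & (SUM k<N. p k) = 1 &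
  (ALL phi Phi om. (ALL x. abs (phi x) <= Phi) -->
  (first_order R phi tau om) -->
  abs (SUM k<N. p k * df phi (cinv (fst (I k)) (Y k)) (Tg (fst (I k)) (Y k) (W k))) <= K * e * Phi + om) &
  (SUM k<N. p k * (L (cinv (fst (I k)) (Y k)) (Tg (fst (I k)) (Y k) (W k)) 0 + c0)) <= K * e &
  (SUM k<N. p k * (h (cinv (fst (I k)) (Y k)) x * - dL (cinv (fst (I k)) (Y k)) (Tg (fst (I k)) (Y k) (W k)) - V (cinv (fst (I k)) (Y k)) 0))
  <= u0 x * (SUM k<N. p k * - dL (cinv (fst (I k)) (Y k)) (Tg (fst (I k)) (Y k) (W k))) + K * e"

text \<open>With \<open>a j = - dL\<close>, the estimate \<open>s1\<close> multiplies
  \<open>uu j\<close> by \<open>1 + tau * l * a j\<close>, and \<open>E (Suc j)\<close> is its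
  integrating factor. As \<open>pw j * a j = E j - E (Suc j)\<close>, summation by parts replaces
  the running cost by the accumulated action \<open>AA j\<close> with weight
  \<open>pw j * a j\<close>; and \<open>AA j\<close> is at least \<open>h - e\<close> after time
  \<open>T\<close>.\<close>

lemma discrete_approx:
 obtains R K where "R > 0" "!!e. 0 < e ==> e <= 1/2 ==> EX N p I Y W tau. good_weights x R K e N p I Y W tau"
proof -
 obtain U l1 where U: "U >= 1" "l1 > 0" "l1 <= l0" "l1 * U <= 1" "l1 <= 1" "!!l x. 0 < l ==> l < l1 ==> abs (u l x) <= U"
  "!!l x. 0 < l ==> l < l1 ==> abs (V x l) <= U" "!!x. abs (u0 x) <= U" "!!x. abs (V x 0) <= U" by(rule uniform_bounds) blast
 obtain R l2 where R: "R > 0" "l2 > 0" "l2 <= l0" "!!l eps. 0 < l ==> l < l2 ==> eps > 0 ==>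
  dsteps R l eps"
  by(rule discounted_step) blast
 obtain B where B: "B > 0" "!!x v s. tame R x v ==> abs s <= 1 ==> abs (L x v s) <= B" "!!x v. tame R x v ==> abs (dL x v) <= B" by(rule tame_bounded[of R]) blast
 obtain alp where alp: "alp > 0" "!!x v. tame R x v ==> alp <= - dL x v" by(rule tame_dL_neg[of R]) blast
 obtain Mh where Mh: "!!y. abs (h y x) <= Mh" by(rule compact_boundE[OF peierls_continuous[of x] compactM]) auto
 define C where "C = 2 * U + Mh"
 have C: "C >= 0" using U Mh[of x] by(simp add: C_def)
 define C' where "C' = B * U + 2 * U + 3"
 \<comment> \<open>The summands serve the inequality with the barrier, the action and the closedness
   estimate: the bounds in \<open>K\<close> correspond to \<open>pc\<close>, \<open>pb\<close> and
   \<open>pa\<close>.\<close>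
 define K where "K = 2 * B * (3 + 4 * U + C * B) + (U + 3) + (4 * B * U + C') + 4 * B"
 have C'0: "C' >= 0" using B U by(simp add: C'_def)
 have K: "4 * B <= K" "4 * B * U + C' <= K" "2 * B * (3 + 4 * U + C * B) + (U + 3) <= K"
 proof -
  have "0 <= 2 * B * (3 + 4 * U + C * B)" "0 <= 4 * B * U" using B U C by auto
  thus "4 * B <= K" "4 * B * U + C' <= K" "2 * B * (3 + 4 * U + C * B) + (U + 3) <= K" using C'0 U B unfolding K_def by linarith+
 qed
 show ?thesis
 proof (rule that[OF R(1), of K])
  fix e :: real assume e: "0 < e" "e <= 1/2"
  obtain dlt where d: "dlt > 0" "PROP tame_C1 R dlt e" by(rule tame_deriv[OF e(1), of R]) blast
  obtain l3 where l3: "l3 > 0" "l3 <= l0" "!!l x. 0 < l ==> l < l3 ==> abs (u l x - u0 x) < e" "!!l x. 0 < l ==> l < l3 ==> abs (V x l - V x 0) < e"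
  by(rule close_to_limit[OF e(1)]) blast
  obtain T' where T': "!!t y a. t >= T' ==> reach x t y a ==> h y x - e < a" by(rule peierls_uniform_liminf[OF e(1), of x]) blast
  define T where "T = max T' 0"
  have T: "T >= 0" "!!t y a. t >= T ==> reach x t y a ==> h y x - e < a" using T' by(auto simp: T_def)
  \<comment> \<open>\<open>dlt / U\<close> makes the expansion of \<open>L\<close> applicable to
    \<open>l * u l x\<close>; \<open>e / (T + 1)\<close> makes the steps before time
    \<open>T\<close> carry weight of order \<open>e\<close> only.\<close>
  define q where "q = min (min (min l1 l2) l3) (min (dlt / U) (e / (T + 1)))"
  have q: "0 < q" "q <= l1" "q <= l2" "q <= l3" "q <= dlt / U" "q <= e / (T + 1)"
  using U(1,2) R(2) d(1) l3(1) e T(1) by(auto simp: q_def min_le_iff_disj)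
  define l where "l = q / 2"
  have l: "0 < l" "l < l1" "l < l2" "l < l3" "l < dlt / U" "l < e / (T + 1)" using q unfolding l_def by linarith+
  have lU: "l * U < dlt" "l * (T + 1) < e" using l(5,6) U(1) T(1) by(auto simp: pos_less_divide_eq)
  have le: "l <= e"
  proof -
  have "l * 1 <= l * (T + 1)" using l T by(intro mult_left_mono) auto
  thus ?thesis using lU by linarith
  qed
  \<comment> \<open>The step errors \<open>tau * eps\<close> are weighted by a sum of order
    \<open>1 / (tau * l)\<close>, so \<open>eps\<close> must be small relative to
    \<open>l\<close>.\<close>
  define eps where "eps = e * l"
  have eps: "eps > 0" using e l by(simp add: eps_def)
  obtain tau0 where tau0: "tau0 > 0" "ALL tau x. 0 < tau --> tau < tau0 --> (EX i y w. dstep R l eps tau i y w & x = cinv (fst i) y)"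
  using R(4)[OF l(1,3) eps] by blast
  define tau where "tau = min e tau0 / 2"
  have tau: "0 < tau" "tau <= e" "tau < tau0" using tau0(1) e by(auto simp: tau_def min_def)
  have tau1: "tau <= 1" using tau(2) e by linarith
  have step: "EX i y w. dstep R l eps tau i y w & z = cinv (fst i) y" for z
  using tau0(2) tau by blast
  obtain X I Y W where X: "X 0 = x" "!!j. dstep R l eps tau (I j) (Y j) (W j)" "!!j. X j = cinv (fst (I j)) (Y j)"
  "!!j. X (Suc j) = cinv (fst (I j)) (Y j - tau *\<^sub>R W j)"
  "!!j b. b > 0 ==> ma (real j * tau) (X j) x < ereal (b + (SUM n<j. tau * (L (X n) (Tg (fst (I n)) (Y n) (W n)) 0 + eps)))"
  by(rule hl_chain[OF step tau(1), of x]) blast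
  define v where "v j = Tg (fst (I j)) (Y j) (W j)" for j
  define a where "a j = - dL (X j) (v j)" for j
  define Lo where "Lo j = L (X j) (v j) 0" for j
  define uu where "uu j = u l (X j)" for j
  have tm: "tame R (X j) (v j)" for j unfolding X(3) v_def by(rule hl_step_tame(1)[OF X(2)])
  have aB: "alp <= a j" "a j <= B" "0 < a j" for j using alp(2)[OF tm, of j] B(3)[OF tm, of j] alp(1) unfolding a_def by(auto simp: abs_le_iff)
  have uU: "abs (uu j) <= U" for j unfolding uu_def by(rule U(6)[OF l(1,2)])
  have s1: "uu (Suc j) + tau * (Lo j + c0 + eps) <= uu j + tau * (l * (a j * uu j + V (X j) 0 + e * (U + 3)))" for j
  proof -
  let ?s = "l * uu j"
  have s: "abs ?s <= l * U" using mult_left_mono[OF uU[of j], of l] l by(simp add: abs_mult)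
  have 1: "uu (Suc j) + tau * (L (X j) (v j) ?s + (c0 - l * V (X j) l) - eps) <= uu j"
  using hl_step_tame(2)[OF X(2)[of j]] unfolding X(4)[symmetric] X(3)[symmetric] v_def uu_def by simp
  have "abs (L (X j) (v j) ?s - L (X j) (v j) 0 - ?s * dL (X j) (v j)) <= e * abs ?s" by(rule d(2)[OF tm]) (use s lU in linarith)
  moreover have "e * abs ?s <= e * (l * U)" by(rule mult_left_mono[OF s]) (use e in simp)
  moreover have "?s * dL (X j) (v j) = - (l * (a j * uu j))" by(simp add: a_def)
  ultimately have 2: "Lo j <= L (X j) (v j) ?s + l * (a j * uu j) + e * (l * U)" unfolding Lo_def by linarith
  have "V (X j) l <= V (X j) 0 + e" using l3(4)[OF l(1,4), of "X j"] by linarith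
  hence "l * V (X j) l <= l * (V (X j) 0 + e)" using l by(intro mult_left_mono) auto
  hence "Lo j + c0 + eps <= (L (X j) (v j) ?s + (c0 - l * V (X j) l) - eps) + l * (a j * uu j + V (X j) 0 + e * (U + 3))"
  using 2 by(simp add: eps_def algebra_simps)
  hence "tau * (Lo j + c0 + eps) <= tau * ((L (X j) (v j) ?s + (c0 - l * V (X j) l) - eps) + l * (a j * uu j + V (X j) 0 + e * (U + 3)))" using tau by(intro mult_left_mono) auto
  thus ?thesis using 1 unfolding distrib_left[of tau "_ - eps"] by linarith
  qed
  have tht: "tau * l > 0" using tau l by simp
  obtain E N where E: "E 0 = 1" "!!j. E j > 0" "!!j. E (Suc j) * (1 + (tau * l) * a j) = E j" "!!j. E (Suc j) <= E j" "E N < e"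
  by(rule discount_weights[where a = a, OF aB(1) alp(1) tht e(1)]) blast
  have E0: "E j >= 0" for j using E(2)[of j] by simp
  have E1: "E j <= 1" for j
  proof (induction j)
  case (Suc j)
  thus ?case using E(4)[of j] by linarith
  qed (simp add: E(1))
  define pw where "pw j = tau * l * E (Suc j)" for j
  have pw0: "pw j > 0" for j using tht E(2) by(simp add: pw_def)
  have pwle: "pw j <= tau * l" for j using mult_left_mono[OF E1[of "Suc j"], of "tau * l"] tht by(simp add: pw_def)
  have pwE: "pw j * a j = E j - E (Suc j)" for j using E(3)[of j] by(simp add: pw_def algebra_simps)
  define Q where "Q = (SUM j<N. pw j)"
  have Sa: "(SUM j<N. pw j * a j) = 1 - E N" unfolding pwE by(induction N) (auto simp: E(1))
  \<comment> \<open>\<open>E N < 1/2\<close> and \<open>a j \<le> B\<close> keep the total mass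
    \<open>Q\<close> away from 0; normalisation then multiplies errors by at most
    \<open>2 * B\<close>.\<close>
  have QB: "1 <= 2 * B * Q"
  proof -
  have "(SUM j<N. pw j * a j) <= (SUM j<N. pw j * B)" by(intro sum_mono mult_left_mono) (use aB pw0 in "auto intro: less_imp_le")
  hence "1 - E N <= Q * B" unfolding Sa by(simp add: Q_def sum_distrib_right)
  thus ?thesis using E(5) e by(simp add: algebra_simps)
  qed
  have Q: "Q > 0"
  proof (rule ccontr)
  assume "~ Q > 0"
  hence "2 * B * Q <= 0" using B(1) by(intro mult_nonneg_nonpos) auto
  thus False using QB by linarith
  qed
  have Qd: "z / Q <= 2 * B * z" if "z >= 0" for z using mult_right_mono[OF QB that] Q by(simp add: field_simps)
  define p where "p j = pw j / Q" for j
  have psum: "(SUM k<N. p k * F k) = (SUM k<N. pw k * F k) / Q" for F by(simp add: p_def sum_divide_distrib)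
  have p1: "(SUM k<N. p k) = 1" unfolding p_def sum_divide_distrib[symmetric] Q_def[symmetric] using Q by simp
  have Abel: "abs (SUM j<N. E (Suc j) * (f j - f (Suc j))) <= 2 * F" if "!!j. abs (f j) <= F" for f F by(rule abel_bound[OF E(4) E0 E(1) that])
  have pa: "abs (SUM k<N. p k * df phi (X k) (v k)) <= K * e * Phi + om"
  if Phi: "ALL x. abs (phi x) <= Phi" and om: "first_order R phi tau om" for phi Phi om
  proof -
  let ?D = "%k. df phi (X k) (v k)"
  have st: "abs (phi (X j) - phi (X (Suc j)) - tau * ?D j) <= tau * om" for j
  unfolding X(3)[of j] X(4) v_def using om hl_stepD[OF X(2)[of j]] by blast
  have "abs ((SUM k<N. pw k * ?D k) - l * (SUM j<N. E (Suc j) * (phi (X j) - phi (X (Suc j))))) = abs (SUM k<N. l * E (Suc k) * (tau * ?D k - (phi (X k) - phi (X (Suc k)))))"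
  by(simp add: sum_subtractf[symmetric] sum_distrib_left pw_def algebra_simps)
  also have "... <= (SUM k<N. pw k * om)"
  proof (rule order_trans[OF sum_abs], rule sum_mono)
  fix k
  have "abs (l * E (Suc k) * (tau * ?D k - (phi (X k) - phi (X (Suc k))))) = l * E (Suc k) * abs (phi (X k) - phi (X (Suc k)) - tau * ?D k)"
  using l E0[of "Suc k"] by(simp add: abs_mult abs_minus_commute)
  also have "... <= l * E (Suc k) * (tau * om)" using l E0[of "Suc k"] st[of k] by(intro mult_left_mono) auto
  finally show "abs (l * E (Suc k) * (tau * ?D k - (phi (X k) - phi (X (Suc k))))) <= pw k * om" by(simp add: pw_def algebra_simps)
  qed
  also have "... = Q * om" by(simp add: Q_def sum_distrib_right)
  finally have "abs ((SUM k<N. pw k * ?D k)) <= abs (l * (SUM j<N. E (Suc j) * (phi (X j) - phi (X (Suc j))))) + Q * om" by linarith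
  also have "abs (l * (SUM j<N. E (Suc j) * (phi (X j) - phi (X (Suc j))))) <= e * (2 * Phi)"
  unfolding abs_mult using l le Abel[of "%j. phi (X j)" Phi] Phi e by(intro mult_mono) auto
  finally have "abs ((SUM k<N. pw k * ?D k)) <= e * (2 * Phi) + Q * om" by linarith
  hence "abs ((SUM k<N. pw k * ?D k)) / Q <= (e * (2 * Phi) + Q * om) / Q" using Q by(intro divide_right_mono) auto
  also have "... = e * (2 * Phi) / Q + om" using Q by(simp add: add_divide_distrib)
  also have "... <= 2 * B * (e * (2 * Phi)) + om" using Qd[of "e * (2 * Phi)"] e Phi[rule_format, of x] by simp
  also have "2 * B * (e * (2 * Phi)) = (4 * B) * (e * Phi)" by simp
  also have "... <= K * (e * Phi)" using K(1) e Phi[rule_format, of x] by(intro mult_right_mono) auto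
  finally show ?thesis unfolding psum using Q by(simp add: abs_divide mult.assoc)
  qed
  have pb: "(SUM k<N. p k * (Lo k + c0)) <= K * e"
  proof -
  have "pw j * (Lo j + c0) <= l * (E (Suc j) * (uu j - uu (Suc j))) + pw j * (l * C')" for j
  proof -
  have "a j * uu j <= B * U"
  proof -
  have "abs (a j * uu j) <= B * U" unfolding abs_mult using aB[of j] uU[of j] B by(intro mult_mono) auto
  thus ?thesis by linarith
  qed
  moreover have "e * (U + 3) <= U + 3" using mult_right_mono[of e 1 "U + 3"] e U by simp
  ultimately have "a j * uu j + V (X j) 0 + e * (U + 3) <= C'" using U(9)[of "X j"] unfolding C'_def by linarith
  hence "l * (a j * uu j + V (X j) 0 + e * (U + 3)) <= l * C'" using l by(intro mult_left_mono) auto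
  hence "tau * (l * (a j * uu j + V (X j) 0 + e * (U + 3))) <= tau * (l * C')" by(rule mult_left_mono) (use tau in simp)
  moreover have "tau * (Lo j + c0) <= tau * (Lo j + c0 + eps)" using tau eps by(intro mult_left_mono) auto
  ultimately have "tau * (Lo j + c0) <= (uu j - uu (Suc j)) + tau * (l * C')" using s1[of j] by linarith
  hence "l * E (Suc j) * (tau * (Lo j + c0)) <= l * E (Suc j) * ((uu j - uu (Suc j)) + tau * (l * C'))" using l E0[of "Suc j"] by(intro mult_left_mono) auto
  thus ?thesis by(simp add: pw_def algebra_simps)
  qed
  hence "(SUM j<N. pw j * (Lo j + c0)) <= (SUM j<N. l * (E (Suc j) * (uu j - uu (Suc j))) + pw j * (l * C'))" by(intro sum_mono)
  also have "... = l * (SUM j<N. E (Suc j) * (uu j - uu (Suc j))) + Q * (l * C')" by(simp add: sum.distrib sum_distrib_left[symmetric] sum_distrib_right[symmetric] Q_def)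
  also have "... <= l * (2 * U) + Q * (l * C')"
  proof -
  have "(SUM j<N. E (Suc j) * (uu j - uu (Suc j))) <= 2 * U" using Abel[of uu U, OF uU] by linarith
  thus ?thesis using l by simp
  qed
  finally have "(SUM j<N. pw j * (Lo j + c0)) / Q <= (l * (2 * U) + Q * (l * C')) / Q" using Q by(intro divide_right_mono) auto
  also have "... = l * (2 * U) / Q + l * C'" using Q by(simp add: add_divide_distrib)
  also have "... <= 2 * B * (l * (2 * U)) + l * C'" using Qd[of "l * (2 * U)"] l U by simp
  also have "... = l * (4 * B * U + C')" by(simp add: algebra_simps)
  also have "... <= e * K" using le K(2) B U C'0 e by(intro mult_mono) auto
  finally show ?thesis unfolding psum by(simp add: mult.commute)
  qed
  have pc: "(SUM k<N. p k * (h (X k) x * a k - V (X k) 0)) <= u0 x * (SUM k<N. p k * a k) + K * e"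
  proof -
  \<comment> \<open>\<open>AA j\<close> bounds the normalised action from \<open>X j\<close> to
    \<open>x\<close>; its initial value \<open>e\<close> is the slack in the strict inequality for
    the trivial curve.\<close>
  define AA where "AA j = e + (SUM n<j. tau * (Lo n + c0 + eps))" for j
  have AS: "AA (Suc j) = AA j + tau * (Lo j + c0 + eps)" for j by(simp add: AA_def)
  have re: "reach x (real j * tau) (X j) (AA j)" for j
  proof -
  have "AA j - c0 * (real j * tau) = e + (SUM n<j. tau * (Lo n + eps))"
  by(simp add: AA_def algebra_simps sum.distrib sum_distrib_left[symmetric])
  thus ?thesis unfolding reach_def using X(5)[OF e(1), of j] tau by(simp add: Lo_def v_def)
  qed
  have Alow: "AA j >= - 2 * U" for j using reach_lower[OF re[of j]] U(8)[of x] U(8)[of "X j"] by linarith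
  let ?dlt = "e * (U + 3)"
  \<comment> \<open>Adding \<open>AA\<close> to \<open>uu\<close> absorbs the running cost of
    \<open>s1\<close>, and \<open>E (Suc n) * (1 + tau * l * a n) = E n\<close> makes the discounted
    sum telescope, leaving \<open>a j * AA j\<close> as the weighted quantity.\<close>
  have tel: "E n * (uu n + AA n) + (SUM j<n. pw j * (a j * AA j - V (X j) 0 - ?dlt)) <= uu 0 + e" for n
  proof (induction n)
  case 0
  thus ?case by(simp add: E(1) AA_def)
  next
  case (Suc n)
  have "uu (Suc n) + AA (Suc n) <= uu n * (1 + tau * l * a n) + AA n + tau * l * (V (X n) 0 + ?dlt)"
  using s1[of n] unfolding AS by(simp add: algebra_simps)
  hence "E (Suc n) * (uu (Suc n) + AA (Suc n)) <= E (Suc n) * (uu n * (1 + tau * l * a n) + AA n + tau * l * (V (X n) 0 + ?dlt))"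
  using E0 by(intro mult_left_mono) auto
  also have "... = uu n * (E (Suc n) * (1 + tau * l * a n)) + AA n * (E (Suc n) * (1 + tau * l * a n)) - pw n * (a n * AA n - V (X n) 0 - ?dlt)"
  by(simp add: pw_def algebra_simps)
  also have "... = E n * (uu n + AA n) - pw n * (a n * AA n - V (X n) 0 - ?dlt)" unfolding E(3) by(simp add: algebra_simps)
  finally show ?case using Suc by simp
  qed
  have G: "- E N * (uu N + AA N) <= 3 * U * e"
  proof -
  have "- (uu N + AA N) <= 3 * U" using Alow[of N] uU[of N] by linarith
  hence "E N * - (uu N + AA N) <= E N * (3 * U)" using E0 by(intro mult_left_mono) auto
  also have "... <= e * (3 * U)" using E(5) U by(intro mult_right_mono) auto
  finally show ?thesis by(simp add: algebra_simps)
  qed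
  \<comment> \<open>After time \<open>T\<close> the barrier exceeds \<open>AA j\<close> by at most
    \<open>e\<close>; before it, by at most \<open>C\<close>, which is paid for by the last
    summand.\<close>
  have diff: "pw j * (h (X j) x * a j - V (X j) 0) <= pw j * (a j * AA j - V (X j) 0 - ?dlt) + pw j * ?dlt + e * (pw j * a j) + (if real j * tau < T then tau * l * B * C else 0)" for j
  proof -
  have pwa: "0 <= pw j * a j" using pw0[of j] aB(3)[of j] by simp
  have "pw j * a j * (h (X j) x - AA j) <= e * (pw j * a j) + (if real j * tau < T then tau * l * B * C else 0)"
  proof (cases "real j * tau < T")
  case True
  have "h (X j) x - AA j <= C" using Alow[of j] Mh[of "X j"] unfolding C_def by linarith
  hence "pw j * a j * (h (X j) x - AA j) <= pw j * a j * C" using pwa by(intro mult_left_mono) auto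
  also have "... <= tau * l * B * C" using pwle[of j] pw0[of j] aB[of j] C tht B by(intro mult_mono) auto
  finally show ?thesis using True pwa e by(simp add: add_increasing)
  next
  case False
  hence "h (X j) x - e < AA j" using T(2)[OF _ re[of j]] by simp
  hence "pw j * a j * (h (X j) x - AA j) <= pw j * a j * e" using pwa by(intro mult_left_mono) auto
  thus ?thesis using False by(simp add: mult.commute)
  qed
  thus ?thesis by(simp add: algebra_simps)
  qed
  have "(SUM j<N. pw j * (h (X j) x * a j - V (X j) 0)) <= (SUM j<N. pw j * (a j * AA j - V (X j) 0 - ?dlt) + pw j * ?dlt + e * (pw j * a j) + (if real j * tau < T then tau * l * B * C else 0))"
  by(rule sum_mono) (rule diff)
  also have "... = (SUM j<N. pw j * (a j * AA j - V (X j) 0 - ?dlt)) + Q * ?dlt + e * (1 - E N) + (SUM j<N. if real j * tau < T then tau * l * B * C else 0)"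
  unfolding sum.distrib Sa[symmetric] by(simp only: sum_distrib_left sum_distrib_right Q_def)
  also have "... <= (uu 0 + e + 3 * U * e) + Q * ?dlt + e + C * B * e"
  proof -
  have "(SUM j<N. if real j * tau < T then tau * l * B * C else 0) <= tau * l * B * C * (T / tau + 1)"
  by(rule early_sum_le[OF tau(1) T(1)]) (use tht B C in auto)
  also have "... = B * C * (l * (T + tau))" using tau(1) by(simp add: field_simps)
  also have "... <= B * C * e"
  proof (rule mult_left_mono)
  have "l * (T + tau) <= l * (T + 1)" using l tau1 by(intro mult_left_mono) auto
  thus "l * (T + tau) <= e" using lU(2) by linarith
  qed (use B C in auto)
  finally have 1: "(SUM j<N. if real j * tau < T then tau * l * B * C else 0) <= C * B * e" by(simp add: mult_ac)
  have "e * (1 - E N) <= e * 1" using e E0[of N] by(intro mult_left_mono) auto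
  thus ?thesis using 1 tel[of N] G by(simp add: algebra_simps)
  qed
  also have "uu 0 <= u0 x * (1 - E N) + e + U * e"
  proof -
  have "uu 0 - u0 x <= e" using l3(3)[OF l(1,4), of x] unfolding uu_def X(1) by linarith
  moreover have "u0 x * E N <= U * e"
  proof -
  have "abs (u0 x * E N) <= U * e" unfolding abs_mult using U(8)[of x] E(5) E0[of N] U by(intro mult_mono) auto
  thus ?thesis by linarith
  qed
  ultimately show ?thesis by(simp add: algebra_simps)
  qed
  finally have "(SUM j<N. pw j * (h (X j) x * a j - V (X j) 0)) <= u0 x * (1 - E N) + e * (3 + 4 * U + C * B) + Q * ?dlt"
  by(simp add: algebra_simps)
  hence "(SUM j<N. pw j * (h (X j) x * a j - V (X j) 0)) / Q <= (u0 x * (1 - E N) + e * (3 + 4 * U + C * B) + Q * ?dlt) / Q" using Q by(intro divide_right_mono) auto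
  also have "... = u0 x * (1 - E N) / Q + e * (3 + 4 * U + C * B) / Q + ?dlt" using Q by(simp add: add_divide_distrib)
  also have "... <= u0 x * (1 - E N) / Q + 2 * B * (e * (3 + 4 * U + C * B)) + ?dlt"
  proof -
  have "0 <= e * (3 + 4 * U + C * B)" using e U C B by auto
  from Qd[OF this] show ?thesis by simp
  qed
  finally have "(SUM j<N. pw j * (h (X j) x * a j - V (X j) 0)) / Q <= u0 x * (1 - E N) / Q + 2 * B * (e * (3 + 4 * U + C * B)) + ?dlt" .
  moreover have "2 * B * (e * (3 + 4 * U + C * B)) + ?dlt = e * (2 * B * (3 + 4 * U + C * B) + (U + 3))" by(simp add: algebra_simps)
  moreover have "e * (2 * B * (3 + 4 * U + C * B) + (U + 3)) <= e * K" using K(3) e by(intro mult_left_mono) auto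
  ultimately have "(SUM j<N. pw j * (h (X j) x * a j - V (X j) 0)) / Q <= u0 x * (1 - E N) / Q + e * K" by linarith
  thus ?thesis unfolding psum Sa by(simp add: mult.commute[of K])
  qed
  have Xv: "cinv (fst (I k)) (Y k) = X k" "tangent_of A (fst (I k)) (X k) (W k) = v k" for k by(simp_all add: X(3) v_def)
  have "good_weights x R K e N p I Y W tau"
  unfolding good_weights_def Xv
  proof (intro conjI)
  show "0 < tau" "tau <= e" "(SUM k<N. p k) = 1" using tau p1 by auto
  show "ALL k<N. p k >= 0 & I k : cover & Y k : ball (fst (snd (I k))) (snd (snd (I k))) & norm (W k) <= R"
  using hl_stepD(1-3)[OF X(2)] pw0 Q by(auto simp: p_def intro!: divide_nonneg_pos less_imp_le)
  show "(SUM k<N. p k * (L (X k) (v k) 0 + c0)) <= K * e" using pb unfolding Lo_def .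
  show "(SUM k<N. p k * (h (X k) x * - dL (X k) (v k) - V (X k) 0)) <= u0 x * (SUM k<N. p k * - dL (X k) (v k)) + K * e" using pc unfolding a_def .
  qed (use pa in blast)
  thus "EX N p I Y W tau. good_weights x R K e N p I Y W tau" by blast
 qed
qed

end

section \<open>The limit measure and the representation formula\<close>

context hamiltonian
begin

text \<open>Gradients are uniformly continuous on the finitely many compact balls, so one step
  length makes the remainder at most \<open>tau * om\<close> for all points and all velocities up to
  \<open>R\<close>.\<close>

lemma C1_one_step:
 assumes f: "C1_fun A phi" and om: "om > 0" and R: "R > 0"
 shows "EX tau1>0. ALL tau. 0 < tau --> tau < tau1 --> (first_order R phi tau om)"
proof -
 define kp where "kp = om / R"
 have kp: "kp > 0" "kp * R = om" using om R by(auto simp: kp_def)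
 have "ALL i:cover. EX d>0. ALL y:cball (fst (snd i)) (3 * snd (snd i)). ALL y':cball (fst (snd i)) (3 * snd (snd i)). dist y' y < d --> dist (grad (fst i) phi y') (grad (fst i) phi y) < kp"
 proof
  fix i assume ii: "i : cover"
  obtain c a r where car: "i = (c, a, r)" by(cases i)
  note i = ii[unfolded car]
  have "continuous_on (cball a (3 * r)) (grad c phi)"
  by(rule continuous_on_subset[OF C1_gradD(2)[OF C1_fun_grad[OF f coverD(1)[OF i]]] cover_cball(1)[OF i]])
  from compact_uniformly_continuous[OF this compact_cball] kp(1)
  show "EX d>0. ALL y:cball (fst (snd i)) (3 * snd (snd i)). ALL y':cball (fst (snd i)) (3 * snd (snd i)). dist y' y < d --> dist (grad (fst i) phi y') (grad (fst i) phi y) < kp"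
  unfolding uniformly_continuous_on_def car by simp
 qed
 from bchoice[OF this] obtain d where d: "ALL i:cover. d i > 0 & (ALL y:cball (fst (snd i)) (3 * snd (snd i)). ALL y':cball (fst (snd i)) (3 * snd (snd i)).
  dist y' y < d i --> dist (grad (fst i) phi y') (grad (fst i) phi y) < kp)" by blast
 define d0 where "d0 = Min (insert 1 (d ` cover))"
 have fin: "finite (insert 1 (d ` cover))" using finite_cover by simp
 have d0: "d0 > 0" unfolding d0_def using fin d by(subst Min_gr_iff) auto
 show ?thesis
 proof (intro exI[of _ "d0 / R"] conjI allI impI)
  show "d0 / R > 0" using d0 R by simp
  fix tau i y w assume tau: "0 < tau" "tau < d0 / R" and ii: "i : cover" and yi: "y : ball (fst (snd i)) (snd (snd i))" and w: "norm w <= R"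
  and sgi: "closed_segment y (y - tau *\<^sub>R w) <= cball (fst (snd i)) (3 * snd (snd i))"
  obtain c a r where car: "i = (c, a, r)" by(cases i)
  note i = ii[unfolded car]
  have y: "y : ball a r" and sg: "closed_segment y (y - tau *\<^sub>R w) <= cball a (3 * r)" using yi sgi unfolding car by simp_all
  have "d0 <= d i" unfolding d0_def using fin ii by(intro Min_le) auto
  moreover have "tau * R < d0" using tau(2) R by(simp add: pos_less_divide_eq)
  ultimately have tauR: "tau * R < d i" by linarith
  note c = coverD(1)[OF i]
  have cb: "cball a (3 * r) <= img c" by(rule cover_cball(1)[OF i])
  let ?f = "phi o cinv c" and ?S = "closed_segment y (y - tau *\<^sub>R w)"
  define q where "q z = ?f z - grad c phi y \<bullet> z" for z
  have yS: "y : ?S" "y - tau *\<^sub>R w : ?S" by auto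
  have "norm (q y - q (y - tau *\<^sub>R w)) <= kp * norm (y - (y - tau *\<^sub>R w))"
  proof (rule differentiable_bound[OF convex_closed_segment _ _ yS])
  fix z assume z: "z : ?S"
  have zc: "z : cball a (3 * r)" using z sg by blast
  hence zi: "z : img c" using cb by blast
  have "(q has_derivative (%h. grad c phi z \<bullet> h - grad c phi y \<bullet> h)) (at z)"
  unfolding q_def[abs_def] by(intro has_derivative_diff C1_gradD(1)[OF C1_fun_grad[OF f c] zi] has_derivative_inner_right has_derivative_ident)
  hence "(q has_derivative (%h. (grad c phi z - grad c phi y) \<bullet> h)) (at z)" by(simp add: inner_diff_left)
  thus "(q has_derivative (%h. (grad c phi z - grad c phi y) \<bullet> h)) (at z within ?S)" by(rule has_derivative_at_withinI)
  have "dist z y <= dist y (y - tau *\<^sub>R w)" using segment_bound(1)[OF z] by(simp add: dist_norm norm_minus_commute)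
  also have "... <= tau * R" using w tau(1) by(simp add: dist_norm)
  finally have "dist z y < d i" using tauR by linarith
  moreover have "y : cball a (3 * r)" using yS(1) sg by blast
  ultimately have "dist (grad c phi z) (grad c phi y) < kp" using d[rule_format, OF ii] zc unfolding car by simp
  hence n: "norm (grad c phi z - grad c phi y) <= kp" by(simp add: dist_norm)
  show "onorm (%h. (grad c phi z - grad c phi y) \<bullet> h) <= kp"
  proof (rule onorm_le)
  fix h
  have "norm ((grad c phi z - grad c phi y) \<bullet> h) <= norm (grad c phi z - grad c phi y) * norm h" by(simp add: Cauchy_Schwarz_ineq2)
  also have "... <= kp * norm h" by(rule mult_right_mono[OF n]) simp
  finally show "norm ((grad c phi z - grad c phi y) \<bullet> h) <= kp * norm h" .
  qed
  qed
  also have "... = kp * (tau * norm w)" using tau by simp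
  also have "... <= kp * (tau * R)" using kp tau w by(intro mult_left_mono) auto
  also have "... = tau * om" using kp(2) by(simp add: mult_ac)
  finally have le: "abs (q y - q (y - tau *\<^sub>R w)) <= tau * om" by simp
  have "y : img c" using yS(1) sg cb by blast
  from differential_grad(1)[OF f c this, of w]
  show "abs (phi (cinv (fst i) y) - phi (cinv (fst i) (y - tau *\<^sub>R w)) - tau * df phi (cinv (fst i) y) (Tg (fst i) y w)) <= tau * om"
  using le unfolding car q_def by(simp add: inner_diff_right algebra_simps)
 qed
qed

text \<open>The finitely many charts of the cover are encoded as the first coordinate of a compact set in a Euclidean space.\<close>

lemma weak_limit_on_TM:
 fixes N :: "nat => nat" and p :: "nat => nat => real" and I :: "nat => nat => ('m, 'e) chart \<times> 'e \<times> real" and Y W :: "nat => nat => 'e"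
 assumes data: "!!n k. k < N n ==> p n k >= 0 & I n k : cover & Y n k : ball (fst (snd (I n k))) (snd (snd (I n k))) & norm (W n k) <= R"
  and p1: "!!n. (SUM k<N n. p n k) = 1"
 obtains r m where "strict_mono (r :: nat => nat)" "prob_space m" "sets m = sets TM" "!!F. tm_cont F ==> integrable m (%p. F (fst p) (snd p))"
  "!!F. tm_cont F ==> (%j. SUM k<N (r j). p (r j) k * F (cinv (fst (I (r j) k)) (Y (r j) k)) (Tg (fst (I (r j) k)) (Y (r j) k) (W (r j) k)))
  ----> (\<integral>p. F (fst p) (snd p) \<partial>m)"
proof -
 obtain code0 :: "('m, 'e) chart \<times> 'e \<times> real => nat" and n0 where code0: "inj_on code0 cover" using finite_imp_inj_to_nat_seg[OF finite_cover] by blast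
 define code where "code i = real (code0 i)" for i
 have inj: "inj_on code cover" using code0 unfolding code_def inj_on_def by simp
 define dec where "dec s = inv_into cover code s" for s
 have dec: "dec (code i) = i" if "i : cover" for i unfolding dec_def using inv_into_f_f[OF inj that] .
 define P where "P i = {code i} \<times> (cball (fst (snd i)) (snd (snd i)) \<times> cball (0::'e) R)" for i :: "('m, 'e) chart \<times> 'e \<times> real"
 define K where "K = (UN i:cover. P i)"
 have cP: "compact (P i)" for i unfolding P_def by(intro compact_Times compact_cball) auto
 have cK: "compact K" unfolding K_def by(rule compact_UN[OF finite_cover cP])
 define Psi0 where "Psi0 i z = (cinv (fst i) (fst z), Tg (fst i) (fst z) (snd z))" for i :: "('m, 'e) chart \<times> 'e \<times> real" and z :: "'e \<times> 'e"
 \<comment> \<open>A fixed value off \<open>K\<close> keeps \<open>Psi\<close> measurable; the limit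
   measure does not charge that set.\<close>
 define pt :: "'m \<times> 'e" where "pt = (undefined, 0)"
 define Psi where "Psi z = (if z : K then Psi0 (dec (fst z)) (snd z) else pt)" for z :: "real \<times> 'e \<times> 'e"
 have PsiP: "Psi z = Psi0 i (snd z)" if i: "i : cover" and z: "z : P i" for i z
 proof -
  have "fst z = code i" "z : K" using z i unfolding P_def K_def by auto
  thus ?thesis unfolding Psi_def using dec[OF i] by simp
 qed
 have sub: "cball (fst (snd i)) (snd (snd i)) <= img (fst i)" if ii: "i : cover" for i
 proof -
  obtain c a r where car: "i = (c, a, r)" by(cases i)
  note i = ii[unfolded car]
  have "cball a r <= cball a (3 * r)" using coverD(2)[OF i] by auto
  thus ?thesis using cover_cball(1)[OF i] unfolding car by auto
 qed
 have contF: "continuous_on K (%z. F (fst (Psi z)) (snd (Psi z)))" if F: "tm_cont F" for F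
  unfolding K_def
 proof (rule continuous_on_closed_Union[OF finite_cover])
  fix i assume i: "i : cover"
  show "closed (P i)" by(rule compact_imp_closed[OF cP])
  obtain c a r where car: "i = (c, a, r)" by(cases i)
  have c: "fst i : A" using coverD(1)[OF i[unfolded car]] car by simp
  have "continuous_on (P i) (%z. (%x. F (cinv (fst i) (fst x)) (Tg (fst i) (fst x) (snd x))) (snd z))"
  by(rule continuous_on_compose2[OF F[unfolded tm_cont_def, rule_format, OF c]]) (use sub[OF i] in "auto simp: P_def intro!: continuous_intros")
  thus "continuous_on (P i) (%z. F (fst (Psi z)) (snd (Psi z)))"
  by(rule continuous_on_eq) (simp add: PsiP[OF i] Psi0_def)
 qed
 have XK: "(code (I n k), Y n k, W n k) : P (I n k)" "(code (I n k), Y n k, W n k) : K" if "k < N n" for n k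
  using data[OF that] unfolding P_def K_def by auto
 obtain r M where rM: "strict_mono (r :: nat => nat)" "prob_space M" "sets M = sets borel" "AE x in M. x : K"
  "!!f :: real \<times> 'e \<times> 'e => real. continuous_on K f ==>
  (%j. SUM k<N (r j). p (r j) k * f (code (I (r j) k), Y (r j) k, W (r j) k)) ----> (\<integral>x. (if x : K then f x else 0) \<partial>M)"
  by(rule weak_limit_of_discrete_measures[OF cK, of N "%n k. (code (I n k), Y n k, W n k)" p]) (use XK(2) data p1 in blast)+
 interpret M: prob_space M by(rule rM(2))
 have spM: "space M = UNIV" using sets_eq_imp_space_eq[OF rM(3)] by simp
 have mPsi: "Psi : measurable M TM"
 proof (rule measurable_measure_of)
  fix B assume "B : {W. openin (tangent_topology A) W}"
  hence B: "openin (tangent_topology A) B" by simp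
  have piece: "P i Int {z. Psi0 i (snd z) : B} : sets borel" if i: "i : cover" for i
  proof -
  obtain c a r where car: "i = (c, a, r)" by(cases i)
  have c: "fst i : A" using coverD(1)[OF i[unfolded car]] car by simp
  let ?O = "{(y, w). y : img (fst i) & (cinv (fst i) y, tangent_of A (fst i) (cinv (fst i) y) w) : B}"
  have "open ?O" using B c unfolding tangent_topology_def openin_bundle_topology by blast
  hence "open ((snd :: real \<times> 'e \<times> 'e => _) -` ?O)" by(rule open_vimage) (intro continuous_intros)
  hence "P i Int snd -` ?O : sets borel" using compact_imp_closed[OF cP[of i]] by(intro sets.Int) auto
  moreover have "P i Int snd -` ?O = P i Int {z. Psi0 i (snd z) : B}" using sub[OF i] by(auto simp: P_def Psi0_def)
  ultimately show ?thesis by simp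
  qed
  have "Psi -` B = (UN i:cover. P i Int {z. Psi0 i (snd z) : B}) Un (if pt : B then - K else {})"
  proof (intro set_eqI iffI)
  fix z assume z: "z : Psi -` B"
  show "z : (UN i:cover. P i Int {z. Psi0 i (snd z) : B}) Un (if pt : B then - K else {})"
  proof (cases "z : K")
  case True
  then obtain i where i: "i : cover" "z : P i" unfolding K_def by blast
  thus ?thesis using z PsiP[OF i] by auto
  next
  case False
  thus ?thesis using z by(simp add: Psi_def)
  qed
  next
  fix z assume z: "z : (UN i:cover. P i Int {z. Psi0 i (snd z) : B}) Un (if pt : B then - K else {})"
  thus "z : Psi -` B"
  proof
  assume "z : (UN i:cover. P i Int {z. Psi0 i (snd z) : B})"
  then obtain i where i: "i : cover" "z : P i" "Psi0 i (snd z) : B" by blast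
  thus ?thesis using PsiP[OF i(1,2)] by simp
  next
  assume "z : (if pt : B then - K else {})"
  thus ?thesis by(auto simp: Psi_def split: if_splits)
  qed
  qed
  moreover have "(UN i:cover. P i Int {z. Psi0 i (snd z) : B}) : sets borel" using piece finite_cover by(intro sets.finite_UN) auto
  moreover have "- K : sets borel" using compact_imp_closed[OF cK] by(intro borel_comp) auto
  ultimately show "Psi -` B Int space M : sets M" unfolding spM rM(3) by(auto intro!: sets.Un)
 qed auto
 define m where "m = distr M TM Psi"
 have sm: "sets m = sets TM" by(simp add: m_def)
 have pm: "prob_space m" unfolding m_def by(rule M.prob_space_distr[OF mPsi])
 have FM: "(%p. F (fst p) (snd p)) : borel_measurable TM" if "tm_cont F" for F by(rule tm_measurable[OF that refl])
 have comp: "(%z. F (fst (Psi z)) (snd (Psi z))) : borel_measurable M" if "tm_cont F" for F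
  using measurable_compose[OF mPsi FM[OF that]] by simp
 have int: "integrable M (%z. F (fst (Psi z)) (snd (Psi z)))" if F: "tm_cont F" for F
 proof -
  obtain B where B: "!!z. z : K ==> norm (F (fst (Psi z)) (snd (Psi z))) <= B" by(rule compact_boundE[OF contF[OF F] cK]) blast
  show ?thesis by(rule M.integrable_const_bound[where B = B, OF _ comp[OF F]]) (use rM(4) B in "auto elim: eventually_mono")
 qed
 show ?thesis
 proof (rule that[OF rM(1) pm sm])
  fix F assume F: "tm_cont F"
  show "integrable m (%p. F (fst p) (snd p))" unfolding m_def integrable_distr_eq[OF mPsi FM[OF F]] by(rule int[OF F])
  let ?f = "%z. F (fst (Psi z)) (snd (Psi z))"
  have "(\<integral>p. F (fst p) (snd p) \<partial>m) = (\<integral>z. ?f z \<partial>M)" unfolding m_def integral_distr[OF mPsi FM[OF F]] ..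
  also have "... = (\<integral>z. (if z : K then ?f z else 0) \<partial>M)"
  proof (rule integral_cong_AE)
  show "?f : borel_measurable M" by(rule comp[OF F])
  have "{z : space M. z : K} : sets M" using compact_imp_closed[OF cK] unfolding spM rM(3) by simp
  thus "(%z. if z : K then ?f z else 0) : borel_measurable M" by(intro measurable_If comp[OF F]) auto
  show "AE z in M. ?f z = (if z : K then ?f z else 0)" using rM(4) by(rule eventually_mono) simp
  qed
  finally have "(%j. SUM k<N (r j). p (r j) k * ?f (code (I (r j) k), Y (r j) k, W (r j) k)) ----> (\<integral>p. F (fst p) (snd p) \<partial>m)"
  using rM(5)[OF contF[OF F]] by simp
  moreover have "?f (code (I n k), Y n k, W n k) = F (cinv (fst (I n k)) (Y n k)) (Tg (fst (I n k)) (Y n k) (W n k))" if "k < N n" for n k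
  using PsiP[OF _ XK(1)[OF that]] data[OF that] by(simp add: Psi0_def)
  hence "(SUM k<N n. p n k * ?f (code (I n k), Y n k, W n k)) = (SUM k<N n. p n k * F (cinv (fst (I n k)) (Y n k)) (Tg (fst (I n k)) (Y n k) (W n k)))" for n
  by(intro sum.cong) auto
  ultimately show "(%j. SUM k<N (r j). p (r j) k * F (cinv (fst (I (r j) k)) (Y (r j) k)) (Tg (fst (I (r j) k)) (Y (r j) k) (W (r j) k)))
  ----> (\<integral>p. F (fst p) (snd p) \<partial>m)" by simp
 qed
qed

end

context vanishing_discount
begin

lemma attaining_mather_measure:
 obtains m where "m : mather_measures A g H"
  "u0 x * (\<integral>p. dL (fst p) (snd p) \<partial>m) <= (\<integral>p. h (fst p) x * dL (fst p) (snd p) \<partial>m) + (\<integral>p. V (fst p) 0 \<partial>m)"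
proof -
 obtain R K where R: "R > 0" and K: "!!e. 0 < e ==> e <= 1/2 ==> EX N p I Y W tau. good_weights x R K e N p I Y W tau"
  by(rule discrete_approx[of x]) blast
 define e where "e n = inverse (real (Suc (Suc n)))" for n
 have e: "0 < e n" "e n <= 1/2" for n by(auto simp: e_def field_simps)
 have e0: "e ----> 0" unfolding e_def using LIMSEQ_Suc[OF LIMSEQ_inverse_real_of_nat] by simp
 have "ALL n. EX q. good_weights x R K (e n) (fst q) (fst (snd q)) (fst (snd (snd q))) (fst (snd (snd (snd q)))) (fst (snd (snd (snd (snd q))))) (snd (snd (snd (snd (snd q)))))"
 proof
  fix n
  obtain N p I Y W tau where "good_weights x R K (e n) N p I Y W tau" using K[OF e] by blast
  thus "EX q. good_weights x R K (e n) (fst q) (fst (snd q)) (fst (snd (snd q))) (fst (snd (snd (snd q)))) (fst (snd (snd (snd (snd q))))) (snd (snd (snd (snd (snd q)))))"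
  by(intro exI[of _ "(N, p, I, Y, W, tau)"]) simp
 qed
 from choice[OF this] obtain q where q: "ALL n. good_weights x R K (e n) (fst (q n)) (fst (snd (q n))) (fst (snd (snd (q n)))) (fst (snd (snd (snd (q n)))))
  (fst (snd (snd (snd (snd (q n)))))) (snd (snd (snd (snd (snd (q n))))))" by blast
 define N where "N n = fst (q n)" for n
 define p where "p n = fst (snd (q n))" for n
 define I where "I n = fst (snd (snd (q n)))" for n
 define Y where "Y n = fst (snd (snd (snd (q n))))" for n
 define W where "W n = fst (snd (snd (snd (snd (q n)))))" for n
 define tau where "tau n = snd (snd (snd (snd (snd (q n)))))" for n
 have gw: "good_weights x R K (e n) (N n) (p n) (I n) (Y n) (W n) (tau n)" for n using q unfolding N_def p_def I_def Y_def W_def tau_def by blast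
 define X where "X n k = cinv (fst (I n k)) (Y n k)" for n k
 define v where "v n k = Tg (fst (I n k)) (Y n k) (W n k)" for n k
 have g1: "0 < tau n" "tau n <= e n" for n using gw[of n] unfolding good_weights_def by blast+
 have g2: "p n k >= 0 & I n k : cover & Y n k : ball (fst (snd (I n k))) (snd (snd (I n k))) & norm (W n k) <= R" if "k < N n" for n k
  using gw[of n] that unfolding good_weights_def by blast
 have g3: "(SUM k<N n. p n k) = 1" for n using gw[of n] unfolding good_weights_def by blast
 have g4: "abs (SUM k<N n. p n k * df phi (X n k) (v n k)) <= K * e n * Phi + om" if "ALL x. abs (phi x) <= Phi"
  "first_order R phi (tau n) om" for n phi Phi om
  using gw[of n] that unfolding good_weights_def X_def v_def by blast
 have g5: "(SUM k<N n. p n k * (L (X n k) (v n k) 0 + c0)) <= K * e n" for n using gw[of n] unfolding good_weights_def X_def v_def by blast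
 have g6: "(SUM k<N n. p n k * (h (X n k) x * - dL (X n k) (v n k) - V (X n k) 0)) <= u0 x * (SUM k<N n. p n k * - dL (X n k) (v n k)) + K * e n" for n
  using gw[of n] unfolding good_weights_def X_def v_def by blast
 obtain r m where r: "strict_mono (r :: nat => nat)" and m: "prob_space m" "sets m = sets TM" "!!F. tm_cont F ==> integrable m (%p. F (fst p) (snd p))"
  and lim': "!!F. tm_cont F ==> (%j. SUM k<N (r j). p (r j) k * F (cinv (fst (I (r j) k)) (Y (r j) k)) (Tg (fst (I (r j) k)) (Y (r j) k) (W (r j) k)))
  ----> (\<integral>p. F (fst p) (snd p) \<partial>m)"
  by(rule weak_limit_on_TM[of N p I Y W R]) (use g2 g3 in blast)+
 have lim: "(%j. SUM k<N (r j). p (r j) k * F (X (r j) k) (v (r j) k)) ----> (\<integral>p. F (fst p) (snd p) \<partial>m)" if "tm_cont F" for F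
  using lim'[OF that] unfolding X_def v_def .
 have er: "(%j. e (r j)) ----> 0" using LIMSEQ_subseq_LIMSEQ[OF e0 r] by(simp add: o_def)
 interpret prob_space m by(rule m(1))
 have cl: "(\<integral>p. df phi (fst p) (snd p) \<partial>m) = 0" if phi: "C1_fun A phi" for phi
 proof -
  obtain Phi where Phi: "ALL x. abs (phi x) <= Phi" by(rule compact_boundE[OF C1_fun_continuous[OF phi] compactM]) auto
  \<comment> \<open>The accuracy \<open>om\<close> is fixed first; since
    \<open>tau n \<le> e n\<close>, the steps eventually become short enough for it, and only then
    does \<open>om\<close> tend to 0.\<close>
  have le: "abs (\<integral>p. df phi (fst p) (snd p) \<partial>m) <= 0 + om" if om: "om > 0" for om
  proof -
  obtain tau1 where tau1: "tau1 > 0" "ALL tau. 0 < tau --> tau < tau1 --> (first_order R phi tau om)"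
  using C1_one_step[OF phi om R] by blast
  have "eventually (%j. e (r j) < tau1) sequentially" using er tau1(1) by(rule order_tendstoD(2))
  hence ev: "eventually (%j. abs (SUM k<N (r j). p (r j) k * df phi (X (r j) k) (v (r j) k)) <= K * e (r j) * Phi + om) sequentially"
  proof (rule eventually_mono)
  fix j assume "e (r j) < tau1"
  hence "tau (r j) < tau1" using g1(2)[of "r j"] by linarith
  thus "abs (SUM k<N (r j). p (r j) k * df phi (X (r j) k) (v (r j) k)) <= K * e (r j) * Phi + om"
  using tau1(2) g1(1)[of "r j"] by(intro g4[OF Phi]) blast
  qed
  have l1: "(%j. K * e (r j) * Phi + om) ----> K * 0 * Phi + om" by(intro tendsto_intros er)
  have l2: "(%j. abs (SUM k<N (r j). p (r j) k * df phi (X (r j) k) (v (r j) k))) ----> abs (\<integral>p. df phi (fst p) (snd p) \<partial>m)"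
  by(intro tendsto_rabs lim[OF tm_cont_differential[OF phi]])
  from tendsto_le[OF sequentially_bot l1 l2 ev] show ?thesis by simp
  qed
  have "abs (\<integral>p. df phi (fst p) (snd p) \<partial>m) <= 0" by(rule field_le_epsilon[OF le])
  thus ?thesis by simp
 qed
 have tL: "tm_cont (%x v. L x v 0)" using tm_cont_L[of "%_. 0"] by simp
 have L0: "(\<integral>p. L (fst p) (snd p) 0 \<partial>m) = - c0"
 proof (rule antisym)
  show "- c0 <= (\<integral>p. L (fst p) (snd p) 0 \<partial>m)" by(rule closed_action_ge[OF m(1,2) cl m(3)[OF tL]])
  have "(\<integral>p. L (fst p) (snd p) 0 \<partial>m) <= K * 0 - c0"
  proof (rule LIMSEQ_le[OF lim[OF tL]])
  show "(%j. K * e (r j) - c0) ----> K * 0 - c0" by(intro tendsto_intros er)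
  have "(SUM k<N n. p n k * L (X n k) (v n k) 0) <= K * e n - c0" for n
  using g5[of n] g3[of n] by(simp add: distrib_left sum.distrib sum_distrib_right[symmetric])
  thus "EX M. ALL n>=M. (SUM k<N (r n). p (r n) k * L (X (r n) k) (v (r n) k) 0) <= K * e (r n) - c0" by blast
  qed
  thus "(\<integral>p. L (fst p) (snd p) 0 \<partial>m) <= - c0" by simp
 qed
 have "closed_measure A g m" unfolding closed_measure_def
  using m(1,2) m(3)[OF tm_cont_metric] cl by(simp add: split_beta')
 moreover have "has_bochner_integral m (%(x, v). L x v 0) (- c0)" using m(3)[OF tL] L0 by(simp add: has_bochner_integral_iff split_beta')
 ultimately have "m : mather_measures A g H" unfolding mather_measures_def by simp
 moreover have "u0 x * (\<integral>p. dL (fst p) (snd p) \<partial>m) <= (\<integral>p. h (fst p) x * dL (fst p) (snd p) \<partial>m) + (\<integral>p. V (fst p) 0 \<partial>m)"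
 proof -
  have th: "tm_cont (%y v. h y x * dL y v)" by(rule tm_cont_mult[OF tm_cont_base[OF peierls_continuous] tm_cont_dL])
  have tV: "tm_cont (%y v. V y 0)" by(rule tm_cont_base[OF V0_cont])
  have "u0 x * (\<integral>p. dL (fst p) (snd p) \<partial>m) <= (\<integral>p. h (fst p) x * dL (fst p) (snd p) \<partial>m) + (\<integral>p. V (fst p) 0 \<partial>m) + K * 0"
  proof (rule LIMSEQ_le)
  show "(%j. u0 x * (SUM k<N (r j). p (r j) k * dL (X (r j) k) (v (r j) k))) ----> u0 x * (\<integral>p. dL (fst p) (snd p) \<partial>m)"
  by(rule tendsto_mult_left[OF lim[OF tm_cont_dL]])
  show "(%j. (SUM k<N (r j). p (r j) k * (h (X (r j) k) x * dL (X (r j) k) (v (r j) k))) + (SUM k<N (r j). p (r j) k * V (X (r j) k) 0) + K * e (r j))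
  ----> (\<integral>p. h (fst p) x * dL (fst p) (snd p) \<partial>m) + (\<integral>p. V (fst p) 0 \<partial>m) + K * 0"
  by(intro tendsto_add tendsto_mult_left er lim[OF th] lim[OF tV])
  have "u0 x * (SUM k<N n. p n k * dL (X n k) (v n k)) <= (SUM k<N n. p n k * (h (X n k) x * dL (X n k) (v n k))) + (SUM k<N n. p n k * V (X n k) 0) + K * e n" for n
  using g6[of n] by(simp add: right_diff_distrib sum_subtractf sum_negf)
  thus "EX M. ALL n>=M. u0 x * (SUM k<N (r n). p (r n) k * dL (X (r n) k) (v (r n) k))
  <= (SUM k<N (r n). p (r n) k * (h (X (r n) k) x * dL (X (r n) k) (v (r n) k))) + (SUM k<N (r n). p (r n) k * V (X (r n) k) 0) + K * e (r n)" by blast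
  qed
  thus ?thesis by simp
 qed
 ultimately show ?thesis by(rule that)
qed

text \<open>As \<open>dL < 0\<close>, multiplying \<open>u0 x - u0 y \<le> h y x\<close> by
  \<open>dL\<close> reverses it; integrating and adding the constraint gives
  \<open>I1 + I2 \<le> u0 x * I3\<close>, and division by the negative \<open>I3\<close> makes every
  quotient at least \<open>u0 x\<close>. The measure from \<open>attaining_mather_measure\<close>
  gives equality, so the infimum is a minimum.\<close>

lemma limit_formula:
 "u0 x = (INF m\<in>mather_measures A g H.
  ((\<integral>(y, v). h y x * dL y v \<partial>m) + (\<integral>y. V y 0 \<partial>(distr m borel fst))) / (\<integral>(y, v). dL y v \<partial>m))"
proof -
 obtain R where R: "!!m. m : mather_measures A g H ==> AE p in m. tame R (fst p) (snd p)" by(rule mather_tame) blast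
 obtain B where B: "B > 0" "!!x v s. tame R x v ==> abs s <= 1 ==> abs (L x v s) <= B" "!!x v. tame R x v ==> abs (dL x v) <= B" by(rule tame_bounded[of R]) blast
 obtain alp where alp: "alp > 0" "!!x v. tame R x v ==> alp <= - dL x v" by(rule tame_dL_neg[of R]) blast
 obtain U where U: "!!x. abs (u0 x) <= U" by(rule uniform_bounds) blast
 obtain Mh where Mh: "!!y. abs (h y x) <= Mh" by(rule compact_boundE[OF peierls_continuous[of x] compactM]) auto
 define I1 where "I1 m = (\<integral>p. h (fst p) x * dL (fst p) (snd p) \<partial>m)" for m :: "('m \<times> 'e) measure"
 define I2 where "I2 m = (\<integral>p. V (fst p) 0 \<partial>m)" for m :: "('m \<times> 'e) measure"
 define I3 where "I3 m = (\<integral>p. dL (fst p) (snd p) \<partial>m)" for m :: "('m \<times> 'e) measure"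
 have I3: "I3 m < 0" and low: "I1 m + I2 m <= u0 x * I3 m" if mm: "m : mather_measures A g H" for m
 proof -
  note m = matherD[OF mm]
  interpret prob_space m by(rule m(1))
  have iL: "integrable m (%p. dL (fst p) (snd p))" by(rule tame_integrable[OF m(1,2) R[OF mm] tm_cont_dL B(3)])
  have bound: "abs (f y * dL y v) <= C * B" if "tame R y v" "!!y. abs (f y) <= C" for f C y v
  proof -
  have "0 <= C" using that(2)[of y] by linarith
  thus ?thesis unfolding abs_mult using that(2)[of y] B(3)[OF that(1)] by(intro mult_mono) auto
  qed
  have iu: "integrable m (%p. u0 (fst p) * dL (fst p) (snd p))"
  by(rule tame_integrable[OF m(1,2) R[OF mm] tm_cont_mult[OF tm_cont_base[OF u0_cont] tm_cont_dL]]) (rule bound[OF _ U])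
  have ih: "integrable m (%p. h (fst p) x * dL (fst p) (snd p))"
  by(rule tame_integrable[OF m(1,2) R[OF mm] tm_cont_mult[OF tm_cont_base[OF peierls_continuous] tm_cont_dL]]) (rule bound[OF _ Mh])
  have "(\<integral>p. dL (fst p) (snd p) \<partial>m) <= (\<integral>p. - alp \<partial>m)"
  proof (rule integral_mono_AE[OF iL])
  show "AE p in m. dL (fst p) (snd p) <= - alp" using R[OF mm]
  proof eventually_elim
  case (elim p)
  thus ?case using alp(2) by fastforce
  qed
  qed simp
  thus "I3 m < 0" using alp(1) unfolding I3_def by(simp add: prob_space)
  have "I1 m <= (\<integral>p. u0 x * dL (fst p) (snd p) - u0 (fst p) * dL (fst p) (snd p) \<partial>m)"
  unfolding I1_def
  proof (rule integral_mono[OF ih])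
  show "integrable m (%p. u0 x * dL (fst p) (snd p) - u0 (fst p) * dL (fst p) (snd p))" using iL iu by simp
  fix p
  have "dL (fst p) (snd p) * h (fst p) x <= dL (fst p) (snd p) * (u0 x - u0 (fst p))"
  by(rule mult_left_mono_neg[OF peierls_ge]) (use dL_neg[of "fst p" "snd p"] in simp)
  thus "h (fst p) x * dL (fst p) (snd p) <= u0 x * dL (fst p) (snd p) - u0 (fst p) * dL (fst p) (snd p)" by(simp add: algebra_simps)
  qed
  also have "... = u0 x * I3 m - (\<integral>p. u0 (fst p) * dL (fst p) (snd p) \<partial>m)" unfolding I3_def using iL iu by simp
  finally show "I1 m + I2 m <= u0 x * I3 m" using mather_constraint[OF mm] unfolding I2_def by linarith
 qed
 have conv: "((\<integral>(y, v). h y x * dL y v \<partial>m) + (\<integral>y. V y 0 \<partial>(distr m borel fst))) / (\<integral>(y, v). dL y v \<partial>m) = (I1 m + I2 m) / I3 m"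
  if mm: "m : mather_measures A g H" for m
 proof -
  have "(\<integral>y. V y 0 \<partial>(distr m borel fst)) = I2 m" unfolding I2_def
  by(rule integral_distr[OF fst_measurable[OF matherD(2)[OF mm]] borel_measurable_continuous_onI[OF V0_cont]])
  thus ?thesis unfolding I1_def I3_def by(simp add: split_beta')
 qed
 obtain m0 where m0: "m0 : mather_measures A g H" "u0 x * I3 m0 <= I1 m0 + I2 m0"
  unfolding I1_def I2_def I3_def by(rule attaining_mather_measure[of x]) blast
 have "(INF m\<in>mather_measures A g H. ((\<integral>(y, v). h y x * dL y v \<partial>m) + (\<integral>y. V y 0 \<partial>(distr m borel fst))) / (\<integral>(y, v). dL y v \<partial>m))
  = (INF m\<in>mather_measures A g H. (I1 m + I2 m) / I3 m)"
  by(rule INF_cong[OF refl conv])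
 also have "... = u0 x"
 proof (rule cInf_eq_minimum)
  have "(I1 m0 + I2 m0) / I3 m0 = u0 x" using I3[OF m0(1)] low[OF m0(1)] m0(2) by(simp add: field_simps)
  thus "u0 x : (%m. (I1 m + I2 m) / I3 m) ` mather_measures A g H" by(intro image_eqI[OF _ m0(1)]) simp
  fix z assume "z : (%m. (I1 m + I2 m) / I3 m) ` mather_measures A g H"
  then obtain m where m: "m : mather_measures A g H" "z = (I1 m + I2 m) / I3 m" by blast
  show "u0 x <= z" unfolding m(2) using I3[OF m(1)] low[OF m(1)] by(simp add: neg_le_divide_eq)
 qed
 finally show ?thesis by simp
qed

end

theorem theorem2:
  fixes A :: "('m::t2_space, 'e::euclidean_space) chart set"
    and g :: "'m \<Rightarrow> 'e \<Rightarrow> 'e \<Rightarrow> real"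
    and H :: "'m \<Rightarrow> ('e \<Rightarrow>\<^sub>L real) \<Rightarrow> real \<Rightarrow> real"
    and V :: "'m \<Rightarrow> real \<Rightarrow> real"
    and u :: "real \<Rightarrow> 'm \<Rightarrow> real"
    and u0 :: "'m \<Rightarrow> real"
    and l0 :: real
  assumes manifold: "closed_connected_riemannian_manifold A g"
    and H_cont: "continuous_map (prod_topology (cotangent_topology A) euclideanreal) euclideanreal
                   (\<lambda>((x, p), r). H x p r)"
    and H_convex: "\<And>x r. convex_on UNIV (\<lambda>p. H x p r)"
    and H_superlinear: "\<And>x r. filterlim (\<lambda>p. H x p r / cotangent_norm g x p) at_top
                                  (filtercomap (cotangent_norm g x) at_top)"
    and H_increasing: "\<And>x p. strict_mono (H x p)"
    and H_deriv: "\<And>x p. H x p differentiable (at 0) \<and> deriv (H x p) 0 > 0"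
    and H_modulus: "\<And>S. compactin (cotangent_topology A) S \<Longrightarrow>
          \<exists>\<eta>. modulus_of_continuity \<eta> \<and>
              (\<forall>(x, p)\<in>S. \<forall>r. \<bar>H x p r - H x p 0 - r * deriv (H x p) 0\<bar> \<le> \<bar>r\<bar> * \<eta> \<bar>r\<bar>)"
    and L_deriv: "\<And>x v. lagrangian H x v differentiable (at 0)"
    and V_cont: "\<And>l. l > 0 \<Longrightarrow> continuous_on UNIV (\<lambda>x. V x l)"
    and V_lim: "uniform_limit UNIV (\<lambda>l x. V x l) (\<lambda>x. V x 0) (at_right 0)"
    and l0_pos: "l0 > 0"
    and u_sol: "\<And>l. l \<in> {0<..l0} \<Longrightarrow>
          viscosity_solution A (\<lambda>x p r. H x p (l * r) + l * V x l)
            (critical_value A (\<lambda>x p. H x p 0)) (u l)"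
    and u_unique: "\<And>l w. l \<in> {0<..l0} \<Longrightarrow>
          viscosity_solution A (\<lambda>x p r. H x p (l * r) + l * V x l)
            (critical_value A (\<lambda>x p. H x p 0)) w \<Longrightarrow> w = u l"
    and u_lim: "uniform_limit UNIV u u0 (at_right 0)"
  shows "\<forall>x. u0 x = (INF m\<in>mather_measures A g H.
           ((\<integral>(y, v). peierls_barrier A H y x * deriv (lagrangian H y v) 0 \<partial>m)
             + (\<integral>y. V y 0 \<partial>(distr m borel fst)))
           / (\<integral>(y, v). deriv (lagrangian H y v) 0 \<partial>m))"
proof -
  interpret vanishing_discount A g H V u u0 l0
    using manifold H_cont H_convex H_superlinear H_deriv H_modulus L_deriv V_cont V_lim l0_pos u_sol u_lim
    by unfold_locales auto
  show ?thesis using limit_formula by blast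
qed

end
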